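(* Let $R$ be a standard graded polynomial ring in $n\ge 2$ variables over a field $k$, with maximal graded ideal $\mathfrak m$. Let $M$ be a finitely generated graded $R$-module of dimension $d\ge 1$. Let $l_1,\dots,l_d$ be a filter regular sequence of linear forms on $M$ and, for $0\le j\le d$, set $M_j:=M/(l_1,\dots,l_j)M$, $\overline{M_j}:=M_j/H^0_{\mathfrak m}(M_j)$ and $\bar r_j:=\operatorname{reg}(\overline{M_j})$. Then for every $i$ with $0<i\le d$, $$\operatorname{indeg}(\operatorname{Ext}^{n-i}_R(M,R))\ge -\bar r_{i-1}-n+1,$$ and for every integer $\mu$, $$\dim_k\operatorname{Ext}^{n-i}_R(M,R)_\mu\le \binom{\mu+\bar r_{i-1}+n-1}{i-1}\,\Delta^{i-1}P_M(\bar r_i-1),$$ where $P_M$ is the Hilbert polynomial of $M$.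
   Context: $\operatorname{indeg}(N)=\min\{t: N_t\neq 0\}$, with $\operatorname{indeg}(0)=+\infty$; $\operatorname{reg}(N)=\max\{i+t : H^i_{\mathfrak m}(N)_t\neq 0\}$ is the Castelnuovo-Mumford regularity, with $\operatorname{reg}(0)=-\infty$. A sequence $l_1,\dots,l_d$ of linear forms is filter regular on $M$ if for each $j=1,\dots,d$ the kernel of multiplication by $l_j$ on $M/(l_1,\dots,l_{j-1})M$ has finite length. For a polynomial $P$, $\Delta^0P=P$, $\Delta P(t):=P(t)-P(t-1)$, $\Delta^iP:=\Delta(\Delta^{i-1}P)$. Binomial coefficients $\binom{a}{b}$ are $0$ if $a<b$. When $i=d$, $\overline{M_d}=0$ so $\bar r_d=-\infty$, but $\Delta^{d-1}P_M$ is the constant polynomial $\deg(M)$, so $\Delta^{d-1}P_M(\bar r_d-1)$ is understood to be this constant. *)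

theory Defs
  imports
    "HOL-Library.Poly_Mapping"
    "HOL-Library.Extended"
    "HOL-Library.Cardinality"
    "HOL-Computational_Algebra.Polynomial"
    "HOL-Algebra.Ideal_Product"
    "Jordan_Normal_Form.VS_Connect"
begin

hide_const (open) Polynomial.smult

section \<open>The standard graded polynomial ring\<close>

text \<open>
  The ring \<open>R = k[x\<^sub>i | i \<in> 'n]\<close> in \<open>n = CARD('n)\<close> variables is the type below; as an object of
  HOL-Algebra it is \<open>class_ring\<close> at that type, with carrier \<open>UNIV\<close>.
\<close>

type_synonym ('n, 'k) mpolynomial = "('n \<Rightarrow>\<^sub>0 nat) \<Rightarrow>\<^sub>0 'k"

definition mono_degree :: "('n::finite \<Rightarrow>\<^sub>0 nat) \<Rightarrow> nat" where
  "mono_degree m = (\<Sum>i\<in>UNIV. Poly_Mapping.lookup m i)"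

definition homogeneous_part :: "int \<Rightarrow> ('n::finite, 'k::field) mpolynomial set" where
  "homogeneous_part e = {p. \<forall>m\<in>Poly_Mapping.keys p. int (mono_degree m) = e}"

definition pvar :: "'n \<Rightarrow> ('n, 'k::field) mpolynomial" where
  "pvar i = Poly_Mapping.single (Poly_Mapping.single i 1) 1"

definition pconst :: "'k \<Rightarrow> ('n, 'k::field) mpolynomial" where
  "pconst c = Poly_Mapping.single 0 c"

definition irrelevant_ideal :: "('n, 'k::field) mpolynomial set" where
  "irrelevant_ideal = Idl\<^bsub>class_ring\<^esub> (range pvar)"

definition irrelevant_power :: "nat \<Rightarrow> ('n, 'k::field) mpolynomial set" where
  "irrelevant_power s = (ideal_prod class_ring irrelevant_ideal ^^ s) UNIV"


section \<open>Graded modules\<close>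

text \<open>
  HOL-Algebra's modules extend the ring record; the fields \<^verbatim>\<open>mult\<close> and \<^verbatim>\<open>one\<close> play no role for modules
  and are left undefined in the constructions below.
\<close>

record ('a, 'm) gmodule = "('a, 'm) module" +
  component :: "int \<Rightarrow> 'm set"

locale graded_module =
  Module.module class_ring M
  for M :: "(('n::finite, 'k::field) mpolynomial, 'm) gmodule" +
  assumes component_subgroup: "subgroup (component M t) (add_monoid M)"
    and component_smult:
      "\<lbrakk>r \<in> homogeneous_part e; x \<in> component M t\<rbrakk> \<Longrightarrow> r \<odot>\<^bsub>M\<^esub> x \<in> component M (e + t)"
    and component_direct_sum:
      "x \<in> carrier M \<Longrightarrow>
        \<exists>!f. (\<forall>t. f t \<in> component M t) \<and> finite {t. f t \<noteq> \<zero>\<^bsub>M\<^esub>} \<and>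
          x = (\<Oplus>\<^bsub>M\<^esub>t\<in>{t. f t \<noteq> \<zero>\<^bsub>M\<^esub>}. f t)"

definition finitely_generated :: "('a::comm_ring_1, 'm) gmodule \<Rightarrow> bool" where
  "finitely_generated M \<longleftrightarrow>
    (\<exists>A. finite A \<and> A \<subseteq> carrier M \<and> LinearCombinations.module.span class_ring M A = carrier M)"

definition component_space ::
  "(('n, 'k::field) mpolynomial, 'm) gmodule \<Rightarrow> int \<Rightarrow> ('k, 'm) module" where
  "component_space M t =
    \<lparr>carrier = component M t, mult = undefined, one = undefined,
     zero = \<zero>\<^bsub>M\<^esub>, add = (\<oplus>\<^bsub>M\<^esub>), smult = (\<lambda>c x. pconst c \<odot>\<^bsub>M\<^esub> x)\<rparr>"

definition sub_gmodule :: "('a, 'm) gmodule \<Rightarrow> 'm set \<Rightarrow> ('a, 'm) gmodule" where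
  "sub_gmodule M A = M\<lparr>carrier := A, component := (\<lambda>t. component M t \<inter> A)\<rparr>"

definition quot_gmodule :: "('a, 'm) gmodule \<Rightarrow> 'm set \<Rightarrow> ('a, 'm set) gmodule" where
  "quot_gmodule M B =
    \<lparr>carrier = a_rcosets\<^bsub>M\<^esub> B, mult = undefined, one = undefined,
     zero = B, add = set_add M, smult = (\<lambda>r X. \<Union>x\<in>X. B +>\<^bsub>M\<^esub> (r \<odot>\<^bsub>M\<^esub> x)),
     component = (\<lambda>t. {B +>\<^bsub>M\<^esub> x | x. x \<in> component M t})\<rparr>"

definition ring_gmodule ::
  "(('n::finite, 'k::field) mpolynomial, ('n, 'k) mpolynomial) gmodule" where
  "ring_gmodule =
    \<lparr>carrier = UNIV, mult = undefined, one = undefined, zero = 0, add = (+), smult = (*),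
     component = homogeneous_part\<rparr>"

text \<open>\<open>C\<^sup>0 \<rightarrow> C\<^sup>1 \<rightarrow> \<dots>\<close> with differentials \<open>D p : C\<^sup>p \<rightarrow> C\<^sup>p\<^sup>+\<^sup>1\<close>.\<close>

definition cohomology ::
  "(nat \<Rightarrow> ('a, 'm) gmodule) \<Rightarrow> (nat \<Rightarrow> 'm \<Rightarrow> 'm) \<Rightarrow> nat \<Rightarrow> ('a, 'm set) gmodule" where
  "cohomology C D p =
    quot_gmodule
      (sub_gmodule (C p) {x \<in> carrier (C p). D p x = \<zero>\<^bsub>C (Suc p)\<^esub>})
      (case p of 0 \<Rightarrow> {\<zero>\<^bsub>C 0\<^esub>} | Suc q \<Rightarrow> D q ` carrier (C q))"


section \<open>Values in the extended integers\<close>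

definition ext_Sup :: "int set \<Rightarrow> int extended" where
  "ext_Sup A = (if A = {} then Minf else if bdd_above A then Fin (Sup A) else Pinf)"

definition ext_Inf :: "int set \<Rightarrow> int extended" where
  "ext_Inf A = (if A = {} then Pinf else if bdd_below A then Fin (Inf A) else Minf)"

definition indeg :: "('a, 'm) gmodule \<Rightarrow> int extended" where
  "indeg N = ext_Inf {t. component N t \<noteq> {\<zero>\<^bsub>N\<^esub>}}"

text \<open>\<open>Pinf\<close> is a dummy case: it does not occur as a regularity of a finitely generated module.\<close>

definition ext_binomial :: "int extended \<Rightarrow> nat \<Rightarrow> nat" where
  "ext_binomial a b =
    (case a of Fin c \<Rightarrow> if c < int b then 0 else nat c choose b | Pinf \<Rightarrow> 0 | Minf \<Rightarrow> 0)"

text \<open>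
  At an infinite argument only constant polynomials are meant to be evaluated; the value is then
  that constant, i.e. the constant coefficient.
\<close>

definition ext_poly :: "rat poly \<Rightarrow> int extended \<Rightarrow> rat" where
  "ext_poly P a =
    (case a of Fin t \<Rightarrow> poly P (of_int t) | Pinf \<Rightarrow> Polynomial.coeff P 0 | Minf \<Rightarrow> Polynomial.coeff P 0)"


section \<open>Krull dimension and length\<close>

definition annihilator :: "('a, 'm) gmodule \<Rightarrow> 'a set" where
  "annihilator M = {r. \<forall>x\<in>carrier M. r \<odot>\<^bsub>M\<^esub> x = \<zero>\<^bsub>M\<^esub>}"

definition krull_dim :: "('a::comm_ring_1, 'm) gmodule \<Rightarrow> int extended" where
  "krull_dim M = ext_Sup {int r | r. \<exists>P.
     (\<forall>i\<le>r. primeideal (P i) class_ring \<and> annihilator M \<subseteq> P i) \<and> (\<forall>i<r. P i \<subset> P (Suc i))}"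

definition module_length :: "('a::comm_ring_1, 'm) gmodule \<Rightarrow> int extended" where
  "module_length N = ext_Sup {int r | r. \<exists>L.
     (\<forall>i\<le>r. Module.submodule (L i) (class_ring :: 'a ring) N) \<and> (\<forall>i<r. L i \<subset> L (Suc i))}"

definition finite_length :: "('a::comm_ring_1, 'm) gmodule \<Rightarrow> bool" where
  "finite_length N \<longleftrightarrow> module_length N < Pinf"


section \<open>The modules \<open>M\<^sub>j\<close> and their quotients by \<open>H\<^sup>0\<close>; filter regular sequences\<close>

text \<open>\<open>M/(l\<^sub>1,\<dots>,l\<^sub>j)M\<close>; the sequence is indexed from \<open>1\<close>.\<close>

definition quot_by_seq :: "('a, 'm) gmodule \<Rightarrow> (nat \<Rightarrow> 'a) \<Rightarrow> nat \<Rightarrow> ('a, 'm set) gmodule" where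
  "quot_by_seq M l j =
    quot_gmodule M {\<Oplus>\<^bsub>M\<^esub>s\<in>{1..j}. l s \<odot>\<^bsub>M\<^esub> m s | m. m \<in> {1..j} \<rightarrow> carrier M}"

definition torsion :: "(('n, 'k::field) mpolynomial, 'm) gmodule \<Rightarrow> 'm set" where
  "torsion N = {x \<in> carrier N. \<exists>s. \<forall>r\<in>irrelevant_power s. r \<odot>\<^bsub>N\<^esub> x = \<zero>\<^bsub>N\<^esub>}"

definition mod_torsion ::
  "(('n, 'k::field) mpolynomial, 'm) gmodule \<Rightarrow> (('n, 'k) mpolynomial, 'm set) gmodule" where
  "mod_torsion N = quot_gmodule N (torsion N)"

definition filter_regular ::
  "('a::comm_ring_1, 'm) gmodule \<Rightarrow> (nat \<Rightarrow> 'a) \<Rightarrow> nat \<Rightarrow> bool" where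
  "filter_regular M l d \<longleftrightarrow>
    (\<forall>j\<in>{1..d}. let N = quot_by_seq M l (j - 1) in
       finite_length (sub_gmodule N {x \<in> carrier N. l j \<odot>\<^bsub>N\<^esub> x = \<zero>\<^bsub>N\<^esub>}))"


section \<open>Local cohomology and regularity\<close>

text \<open>
  Local cohomology with support in the maximal graded ideal is the cohomology of the Cech
  complex on the variables.  \<open>loc_frac N f x a\<close> is the fraction \<open>x/f\<^sup>a\<close>.
\<close>

definition loc_rel ::
  "('a::comm_ring_1, 'm) gmodule \<Rightarrow> 'a \<Rightarrow> (('m \<times> nat) \<times> ('m \<times> nat)) set" where
  "loc_rel N f = {((x, a), (y, b)) | x a y b. x \<in> carrier N \<and> y \<in> carrier N \<and>
     (\<exists>c. f ^ (c + b) \<odot>\<^bsub>N\<^esub> x = f ^ (c + a) \<odot>\<^bsub>N\<^esub> y)}"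

definition loc_frac ::
  "('a::comm_ring_1, 'm) gmodule \<Rightarrow> 'a \<Rightarrow> 'm \<Rightarrow> nat \<Rightarrow> ('m \<times> nat) set" where
  "loc_frac N f x a = loc_rel N f `` {(x, a)}"

text \<open>Localization of \<open>N\<close> at the powers of \<open>f\<close>, homogeneous of degree \<open>e\<close>.\<close>

definition localization ::
  "('a::comm_ring_1, 'm) gmodule \<Rightarrow> 'a \<Rightarrow> nat \<Rightarrow> ('a, ('m \<times> nat) set) gmodule" where
  "localization N f e =
    \<lparr>carrier = {loc_frac N f x a | x a. x \<in> carrier N}, mult = undefined, one = undefined,
     zero = loc_frac N f \<zero>\<^bsub>N\<^esub> 0,
     add = (\<lambda>X Y. \<Union>(x, a)\<in>X. \<Union>(y, b)\<in>Y.
       loc_frac N f (f ^ b \<odot>\<^bsub>N\<^esub> x \<oplus>\<^bsub>N\<^esub> f ^ a \<odot>\<^bsub>N\<^esub> y) (a + b)),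
     smult = (\<lambda>r X. \<Union>(x, a)\<in>X. loc_frac N f (r \<odot>\<^bsub>N\<^esub> x) a),
     component = (\<lambda>t. {loc_frac N f x a | x a. x \<in> component N (t + int (a * e))})\<rparr>"

definition var_prod :: "'n set \<Rightarrow> ('n, 'k::field) mpolynomial" where
  "var_prod S = (\<Prod>i\<in>S. pvar i)"

definition var_localization ::
  "(('n, 'k::field) mpolynomial, 'm) gmodule \<Rightarrow> 'n set
    \<Rightarrow> (('n, 'k) mpolynomial, ('m \<times> nat) set) gmodule" where
  "var_localization N S = localization N (var_prod S) (card S)"

text \<open>
  The canonical map from the localization at \<open>var_prod (S - {i})\<close> to the one at \<open>var_prod S\<close>,
  for \<open>i \<in> S\<close>: \<open>x/f\<^sup>a = x\<^sub>i\<^sup>a x/(x\<^sub>i f)\<^sup>a\<close>.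
\<close>

definition loc_map ::
  "(('n, 'k::field) mpolynomial, 'm) gmodule \<Rightarrow> 'n set \<Rightarrow> 'n
    \<Rightarrow> ('m \<times> nat) set \<Rightarrow> ('m \<times> nat) set" where
  "loc_map N S i X = (\<Union>(x, a)\<in>X. loc_frac N (var_prod S) (pvar i ^ a \<odot>\<^bsub>N\<^esub> x) a)"

definition cech_module ::
  "(('n::finite, 'k::field) mpolynomial, 'm) gmodule \<Rightarrow> nat
    \<Rightarrow> (('n, 'k) mpolynomial, 'n set \<Rightarrow> ('m \<times> nat) set) gmodule" where
  "cech_module N p =
    \<lparr>carrier = (\<Pi>\<^sub>E S\<in>{S. card S = p}. carrier (var_localization N S)),
     mult = undefined, one = undefined,
     zero = (\<lambda>S\<in>{S. card S = p}. \<zero>\<^bsub>var_localization N S\<^esub>),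
     add = (\<lambda>b c. \<lambda>S\<in>{S. card S = p}. b S \<oplus>\<^bsub>var_localization N S\<^esub> c S),
     smult = (\<lambda>r c. \<lambda>S\<in>{S. card S = p}. r \<odot>\<^bsub>var_localization N S\<^esub> c S),
     component = (\<lambda>t. \<Pi>\<^sub>E S\<in>{S. card S = p}. component (var_localization N S) t)\<rparr>"

definition cech_diff ::
  "(('n::{finite,linorder}, 'k::field) mpolynomial, 'm) gmodule \<Rightarrow> nat
    \<Rightarrow> ('n set \<Rightarrow> ('m \<times> nat) set) \<Rightarrow> ('n set \<Rightarrow> ('m \<times> nat) set)" where
  "cech_diff N p c =
    (\<lambda>S\<in>{S. card S = Suc p}. \<Oplus>\<^bsub>var_localization N S\<^esub>i\<in>S.
       (- 1) ^ card {j \<in> S. j < i} \<odot>\<^bsub>var_localization N S\<^esub> loc_map N S i (c (S - {i})))"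

definition local_cohomology ::
  "(('n::{finite,linorder}, 'k::field) mpolynomial, 'm) gmodule \<Rightarrow> nat
    \<Rightarrow> (('n, 'k) mpolynomial, ('n set \<Rightarrow> ('m \<times> nat) set) set) gmodule" where
  "local_cohomology N = cohomology (cech_module N) (cech_diff N)"

definition regularity ::
  "(('n::{finite,linorder}, 'k::field) mpolynomial, 'm) gmodule \<Rightarrow> int extended" where
  "regularity N =
    ext_Sup {int i + t | i t. component (local_cohomology N i) t \<noteq> {\<zero>\<^bsub>local_cohomology N i\<^esub>}}"


section \<open>Graded free resolutions and Ext\<close>

text \<open>\<open>\<Oplus>\<^sub>j R(-a\<^sub>j)\<close> for a list of shifts \<open>a\<close>: the \<open>j\<close>-th basis vector has degree \<open>a ! j\<close>.\<close>

definition free_gmodule ::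
  "int list \<Rightarrow> (('n::finite, 'k::field) mpolynomial, nat \<Rightarrow> ('n, 'k) mpolynomial) gmodule" where
  "free_gmodule a =
    \<lparr>carrier = {v. \<forall>j\<ge>length a. v j = 0}, mult = undefined, one = undefined,
     zero = (\<lambda>_. 0), add = (\<lambda>v w j. v j + w j), smult = (\<lambda>r v j. r * v j),
     component = (\<lambda>t. {v. (\<forall>j\<ge>length a. v j = 0) \<and>
       (\<forall>j<length a. v j \<in> homogeneous_part (t - a ! j))})\<rparr>"

definition graded_hom :: "('a::comm_ring_1, 'm) gmodule \<Rightarrow> ('a, 'q) gmodule \<Rightarrow> ('m \<Rightarrow> 'q) set" where
  "graded_hom M N =
    {h \<in> LinearCombinations.module_hom class_ring M N. \<forall>t. h ` component M t \<subseteq> component N t}"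

text \<open>
  \<open>\<dots> \<rightarrow> F\<^sub>1 \<rightarrow> F\<^sub>0 \<rightarrow> M \<rightarrow> 0\<close> with \<open>F\<^sub>p = free_gmodule (a p)\<close>, differentials
  \<open>\<delta> p : F\<^sub>p\<^sub>+\<^sub>1 \<rightarrow> F\<^sub>p\<close> and augmentation \<open>\<epsilon> : F\<^sub>0 \<rightarrow> M\<close>.
\<close>

definition graded_free_resolution ::
  "(('n::finite, 'k::field) mpolynomial, 'm) gmodule \<Rightarrow> (nat \<Rightarrow> int list)
    \<Rightarrow> (nat \<Rightarrow> (nat \<Rightarrow> ('n, 'k) mpolynomial) \<Rightarrow> (nat \<Rightarrow> ('n, 'k) mpolynomial))
    \<Rightarrow> ((nat \<Rightarrow> ('n, 'k) mpolynomial) \<Rightarrow> 'm) \<Rightarrow> bool" where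
  "graded_free_resolution M a \<delta> \<epsilon> \<longleftrightarrow>
    \<epsilon> \<in> graded_hom (free_gmodule (a 0)) M \<and>
    (\<forall>p. \<delta> p \<in> graded_hom (free_gmodule (a (Suc p))) (free_gmodule (a p))) \<and>
    \<epsilon> ` carrier (free_gmodule (a 0)) = carrier M \<and>
    \<delta> 0 ` carrier (free_gmodule (a 1)) = {v \<in> carrier (free_gmodule (a 0)). \<epsilon> v = \<zero>\<^bsub>M\<^esub>} \<and>
    (\<forall>p. \<delta> (Suc p) ` carrier (free_gmodule (a (Suc (Suc p)))) =
       {v \<in> carrier (free_gmodule (a (Suc p))). \<delta> p v = (\<lambda>_. 0)})"

text \<open>\<open>Hom\<^sub>R(M,N)\<close> for finitely generated \<open>M\<close>, graded by the degree of homomorphisms.\<close>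

definition Hom_gmodule ::
  "('a::comm_ring_1, 'm) gmodule \<Rightarrow> ('a, 'q) gmodule \<Rightarrow> ('a, 'm \<Rightarrow> 'q) gmodule" where
  "Hom_gmodule M N =
    \<lparr>carrier = LinearCombinations.module_hom class_ring M N \<inter> extensional (carrier M),
     mult = undefined, one = undefined,
     zero = (\<lambda>x\<in>carrier M. \<zero>\<^bsub>N\<^esub>),
     add = (\<lambda>g h. \<lambda>x\<in>carrier M. g x \<oplus>\<^bsub>N\<^esub> h x),
     smult = (\<lambda>r h. \<lambda>x\<in>carrier M. r \<odot>\<^bsub>N\<^esub> h x),
     component = (\<lambda>\<mu>. {h \<in> LinearCombinations.module_hom class_ring M N \<inter> extensional (carrier M).
       \<forall>t. h ` component M t \<subseteq> component N (t + \<mu>)})\<rparr>"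

text \<open>Ext is computed from a chosen graded free resolution of the first argument.\<close>

definition Ext ::
  "nat \<Rightarrow> (('n::finite, 'k::field) mpolynomial, 'm) gmodule \<Rightarrow> (('n, 'k) mpolynomial, 'q) gmodule
    \<Rightarrow> (('n, 'k) mpolynomial, ((nat \<Rightarrow> ('n, 'k) mpolynomial) \<Rightarrow> 'q) set) gmodule" where
  "Ext i M N =
    (let (a, \<delta>) = (SOME (a, \<delta>). \<exists>\<epsilon>. graded_free_resolution M a \<delta> \<epsilon>) in
     cohomology (\<lambda>p. Hom_gmodule (free_gmodule (a p)) N)
       (\<lambda>p h. \<lambda>v\<in>carrier (free_gmodule (a (Suc p))). h (\<delta> p v)) i)"


section \<open>Hilbert polynomial\<close>

definition hilbert_poly :: "(('n, 'k::field) mpolynomial, 'm) gmodule \<Rightarrow> rat poly" where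
  "hilbert_poly M = (THE P. \<exists>t0. \<forall>t\<ge>t0.
     poly P (of_int t) = of_nat (vectorspace.dim class_ring (component_space M t)))"

definition Delta :: "rat poly \<Rightarrow> rat poly" where
  "Delta P = P - pcompose P [:- 1, 1:]"

end

theory Submission
  imports Defs "HOL-Library.Function_Algebras" "HOL-Library.Extended_Nat" "HOL-Library.Fun_Lexorder"
begin

text \<open>
  A graded module with a finite presentation is a quotient \<open>F/U\<close> of a free module, and everything takes place in
  finitely supported functions on pairs (basis index, exponent in \<open>\<int>\<^sup>n\<close>), on which the variables act by
  invertible shifts; a localization is then a union of inverse shifts of \<open>F\<close> and \<open>U\<close>.
  The bound is first proved for local cohomology. For a filter regular linear form \<open>l\<close> the long exact sequence of
  \<open>0 \<rightarrow> M'(-1) \<rightarrow> M' \<rightarrow> M'/lM' \<rightarrow> 0\<close>, where \<open>M' = M/H\<^sup>0(M)\<close>, bounds \<open>dim H\<^sup>i(M)\<^sub>t\<close> by the sum of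
  \<open>dim H\<^sup>i\<^sup>-\<^sup>1(M/lM)\<^sub>s\<close> over \<open>s > t\<close>; the sum is cut off by the regularity, and induction on \<open>i\<close> produces the
  binomial coefficient. For \<open>i = 1\<close> one uses that \<open>dim M'\<^sub>t + dim H\<^sup>1(M')\<^sub>t\<close> is nondecreasing in \<open>t\<close> up to
  \<open>r - 1\<close>, where \<open>r\<close> is the regularity of \<open>M/lM\<close> modulo torsion, and takes the value \<open>P(r - 1)\<close> there.
  The pairing of \<open>H\<^sup>n(F)\<close> with the dual free module and dimension shifting along a free resolution give
  \<open>dim Ext\<^sup>n\<^sup>-\<^sup>i(M,R)\<^sub>\<mu> \<le> dim H\<^sup>i(M)\<^sub>-\<^sub>\<mu>\<^sub>-\<^sub>n\<close>, which is all of local duality that is needed.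
  The dimension enters only through \<open>d \<le> n\<close>, which follows by comparing the growth of \<open>dim R\<^sub>\<le>\<^sub>s/P\<close> along a chain of primes.
\<close>

text \<open>Modules occur as pairs \<open>U <= V\<close> of families of subspaces of one function
  space, so sub- and quotient modules never change the ambient type, and the long exact sequence
  becomes an identity between dimensions of subquotients. The Hilbert polynomial enters through
  Serre's identity P(t) = dim M_t - sum (-1)^p dim H^p(M)_t, valid for every t. It explains the
  value P(r - 1): H^0(M') = 0, and the regularity r of the hyperplane section forces H^p(M')_t = 0
  for p >= 2 and t >= r - 1, so that P(t) = dim M'_t + dim H^1(M')_t there. If the regularity is
  minus infinity, this holds in all degrees and P turns out to be constant, in agreement with the
  convention for \<open>ext_poly\<close>. \<open>Ext\<close> is computed from an arbitrarily chosen
  resolution, possibly infinite and not minimal. The duality argument therefore has to work for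
  every graded free resolution, and one has to be shown to exist before the choice means anything.
  The inequality d <= n turns \<open>n - i\<close> into a true difference, so that Ext of index n -
  i is paired with H^i.\<close>

section \<open>Linear algebra in spaces of field-valued functions\<close>

definition scl :: "'k::field => ('i => 'k) => 'i => 'k" where
  "scl c f = (%i. c * f i)"

lemma scl_apply [simp]: "scl c f i = c * f i" by (simp add: scl_def)

interpretation fs: vector_space "scl :: 'k::field => ('i => 'k) => 'i => 'k"
  by unfold_locales (auto simp: fun_eq_iff algebra_simps)

text \<open>Linear maps are total on the function space; the domain of interest is always given by a
  separate subspace, so restrictions need no type of their own.\<close>

definition flin :: "(('i => 'k::field) => ('j => 'k)) => bool" where
  "flin f \<longleftrightarrow> (\<forall>x y. f (x + y) = f x + f y) & (\<forall>c x. f (scl c x) = scl c (f x))"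

lemma flinI:
  assumes "!!x y. f (x + y) = f x + f y" "!!c x. f (scl c x) = scl c (f x)"
  shows "flin f" using assms by (simp add: flin_def)

lemma flin_add: "flin f ==> f (x + y) = f x + f y"
  and flin_scl: "flin f ==> f (scl c x) = scl c (f x)" by (simp_all add: flin_def)

lemma scl_minus_one: "scl (- 1) x = - x" by (simp add: fun_eq_iff)

lemma flin_0: "flin f ==> f 0 = 0" using flin_add[of f 0 0] by (simp only: add_0_left add_cancel_right_right)

lemma flin_uminus: "flin f ==> f (- x) = - f x" using flin_scl[of f "- 1" x] by (simp only: scl_minus_one)

lemma flin_diff: "flin f ==> f (x - y) = f x - f y"
  using flin_add[of f x "- y"] flin_uminus[of f y] by (simp only: diff_conv_add_uminus)

lemma flin_sum:
  assumes "flin f"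
  shows "f (sum g A) = (\<Sum>i\<in>A. f (g i))" by (induction A rule: infinite_finite_induct)
    (simp_all only: flin_0[OF assms] flin_add[OF assms] sum.infinite sum.empty sum.insert not_False_eq_True)

lemma flin_id: "flin (%x. x)" by (simp add: flin_def)

lemma flin_comp: "flin f ==> flin g ==> flin (%x. f (g x))" by (simp add: flin_def)

definition sadd :: "('i => 'k::field) set => ('i => 'k) set => ('i => 'k) set" where
  "sadd A B = {a + b | a b. a : A & b : B}"

lemma saddI: "a : A ==> b : B ==> a + b : sadd A B" by (auto simp: sadd_def)

lemma saddE: "x : sadd A B ==> (!!a b. a : A ==> b : B ==> x = a + b ==> P) ==> P" by (auto simp: sadd_def)

lemma subspace_sadd:
  assumes "fs.subspace A" "fs.subspace B"
  shows "fs.subspace (sadd A B)"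
proof (rule fs.subspaceI)
  show "0 : sadd A B" using saddI[of 0 A 0 B] assms by (simp add: fs.subspace_0)
next
  fix x y assume "x : sadd A B" "y : sadd A B"
  then obtain a b a' b' where "x = a + b" "y = a' + b'" "a : A" "b : B" "a' : A" "b' : B" by (auto elim!: saddE)
  moreover from this have "x + y = (a + a') + (b + b')" by (simp add: algebra_simps)
  ultimately show "x + y : sadd A B" using saddI[of "a + a'" A "b + b'" B] assms by (metis fs.subspace_add)
next
  fix c x assume "x : sadd A B"
  then obtain a b where "x = a + b" "a : A" "b : B" by (auto elim!: saddE)
  moreover from this have "scl c x = scl c a + scl c b" by (simp add: fs.scale_right_distrib)
  ultimately show "scl c x : sadd A B" using saddI[of "scl c a" A "scl c b" B] assms by (metis fs.subspace_scale)
qed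

lemma sadd_left: "fs.subspace B ==> a : A ==> a : sadd A B" using saddI[of a A 0 B] by (simp add: fs.subspace_0)

lemma sadd_right: "fs.subspace A ==> b : B ==> b : sadd A B" using saddI[of 0 A b B] by (simp add: fs.subspace_0)

lemma sadd_least: "fs.subspace C ==> A <= C ==> B <= C ==> sadd A B <= C" by (auto elim!: saddE intro: fs.subspace_add)

lemma sadd_mono: "A <= A' ==> B <= B' ==> sadd A B <= sadd A' B'" by (auto simp: sadd_def)

lemma subspace_image:
  assumes f: "flin f" and A: "fs.subspace A"
  shows "fs.subspace (f ` A)"
proof (rule fs.subspaceI)
  show "0 : f ` A" using flin_0[OF f] fs.subspace_0[OF A] by (metis image_eqI)
  show "x + y : f ` A" if "x : f ` A" "y : f ` A" for x y
    using that fs.subspace_add[OF A] by (auto simp: flin_add[OF f, symmetric] intro!: imageI)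
  show "scl c x : f ` A" if "x : f ` A" for c x
    using that fs.subspace_scale[OF A] by (auto simp: flin_scl[OF f, symmetric] intro!: imageI)
qed

lemma subspace_vimage:
  assumes f: "flin f" and A: "fs.subspace A" and B: "fs.subspace B"
  shows "fs.subspace {x \<in> A. f x : B}" by (rule fs.subspaceI)
    (auto simp: flin_0[OF f] flin_add[OF f] flin_scl[OF f] fs.subspace_0[OF A] fs.subspace_0[OF B]
      intro!: fs.subspace_add[OF A] fs.subspace_add[OF B] fs.subspace_scale[OF A] fs.subspace_scale[OF B])

lemma flin_span_image:
  assumes f: "flin f" and x: "x : fs.span S"
  shows "f x : fs.span (f ` S)"
proof -
  have "fs.span S <= {x \<in> UNIV. f x : fs.span (f ` S)}"
    by (rule fs.span_minimal[OF _ subspace_vimage[OF f fs.subspace_UNIV fs.subspace_span]])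
      (auto intro: fs.span_base)
  then show ?thesis using x by auto
qed

lemma subspace_zero: "fs.subspace {0 :: 'i => 'k::field}" by (rule fs.subspaceI) auto

lemma span_Un_subspace:
  assumes "fs.subspace B"
  shows "fs.span (T Un B) = sadd (fs.span T) B"
  unfolding fs.span_Un sadd_def using assms by (simp add: fs.span_eq_iff[THEN iffD2])

subsection \<open>Dimension of subquotients\<close>

text \<open>Linear independence in the quotient by the span of \<open>B\<close>, without forming the
  quotient. Distinct elements of \<open>T\<close> automatically have distinct classes.\<close>

definition ind_mod :: "('i => 'k::field) set => ('i => 'k) set => bool" where
  "ind_mod B T \<longleftrightarrow> (\<forall>v\<in>T. v ~: fs.span ((T - {v}) Un B))"

text \<open>The dimension of \<open>Z\<close> modulo \<open>B\<close>. As a supremum in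
  \<open>enat\<close> it is monotone by definition, and additivity holds in the infinite case as
  well.\<close>

definition qdim :: "('i => 'k::field) set => ('i => 'k) set => enat" where
  "qdim Z B = (SUP T\<in>{T. finite T & T <= Z & ind_mod B T}. enat (card T))"

text \<open>Exchange: if an old vector \<open>v\<close> became dependent only through
  \<open>s\<close>, then \<open>s\<close> would lie in the span of \<open>T\<close> and
  \<open>B\<close>.\<close>

lemma ind_mod_insert:
  assumes "ind_mod B T" "s ~: fs.span (T Un B)"
  shows "ind_mod B (insert s T)" unfolding ind_mod_def
proof
  fix v assume v: "v : insert s T"
  show "v ~: fs.span ((insert s T - {v}) Un B)"
  proof (cases "v = s")
    case True
    have "(insert s T - {v}) Un B <= T Un B" using True by auto
    then show ?thesis using assms(2) fs.span_mono[of "(insert s T - {v}) Un B" "T Un B"] True by auto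
  next
    case False
    then have vT: "v : T" using v by auto
    then have nv: "v ~: fs.span ((T - {v}) Un B)" using assms(1) by (auto simp: ind_mod_def)
    show ?thesis
    proof
      assume "v : fs.span ((insert s T - {v}) Un B)"
      moreover have "(insert s T - {v}) Un B = insert s ((T - {v}) Un B)" using False by auto
      ultimately have "s : fs.span (insert v ((T - {v}) Un B))" using fs.in_span_insert[of v s "(T - {v}) Un B"] nv by simp
      moreover have "insert v ((T - {v}) Un B) = T Un B" using vT by auto
      ultimately show False using assms(2) by simp
    qed
  qed
qed

lemma ind_mod_anti:
  assumes "ind_mod Y T" "T' <= T" "B <= Y"
  shows "ind_mod B T'" unfolding ind_mod_def
proof
  fix v assume v: "v : T'"
  have "(T' - {v}) Un B <= (T - {v}) Un Y" using assms by auto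
  then have "fs.span ((T' - {v}) Un B) <= fs.span ((T - {v}) Un Y)" by (rule fs.span_mono)
  moreover have "v ~: fs.span ((T - {v}) Un Y)" using assms v by (auto simp: ind_mod_def)
  ultimately show "v ~: fs.span ((T' - {v}) Un B)" by auto
qed

text \<open>Steinitz exchange modulo \<open>B\<close>: an element of \<open>T\<close> outside
  \<open>S\<close> is replaced by one of \<open>S\<close>, which keeps the cardinality and shrinks
  \<open>T - S\<close>.\<close>

lemma ind_mod_card_le:
  assumes "finite S" "finite T" "ind_mod B T" "T <= fs.span (S Un B)"
  shows "card T <= card S" using assms(2-)
proof (induction "card (T - S)" arbitrary: T rule: less_induct)
  case (less T)
  show ?case
  proof (cases "T <= S")
    case True
    then show ?thesis using assms(1) by (simp add: card_mono)
  next
    case False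
    then obtain x where x: "x : T" "x ~: S" by auto
    have nx: "x ~: fs.span ((T - {x}) Un B)" using less.prems x by (auto simp: ind_mod_def)
    \<comment> \<open>Otherwise the span of \<open>S\<close> and \<open>B\<close>, which contains
      \<open>x\<close>, would lie in the span of the vectors other than \<open>x\<close>.\<close>
    have "\<not> S <= fs.span ((T - {x}) Un B)"
    proof
      assume "S <= fs.span ((T - {x}) Un B)"
      then have "S Un B <= fs.span ((T - {x}) Un B)" by (auto intro: fs.span_base)
      then have "fs.span (S Un B) <= fs.span ((T - {x}) Un B)" by (rule fs.span_minimal[OF _ fs.subspace_span])
      then show False using nx x less.prems by auto
    qed
    then obtain s where s: "s : S" "s ~: fs.span ((T - {x}) Un B)" by auto
    let ?T = "insert s (T - {x})"
    have sT: "s ~: T - {x}" using s fs.span_base[of s "T - {x} Un B"] by auto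
    have c: "card ?T = card T" using sT x less.prems(1) card_Suc_Diff1[of T x] by (simp del: card_Diff_insert)
    have "card (?T - S) < card (T - S)"
    proof (rule psubset_card_mono)
      show "finite (T - S)" using less.prems(1) by simp
      show "?T - S \<subset> T - S" using x s by auto
    qed
    moreover have "ind_mod B ?T" using ind_mod_insert[OF ind_mod_anti[OF less.prems(2) Diff_subset order_refl] s(2)] .
    moreover have "?T <= fs.span (S Un B)" using less.prems s by (auto intro: fs.span_base)
    ultimately have "card ?T <= card S" using less by simp
    then show ?thesis using c by simp
  qed
qed

lemma qdim_ge: "finite T ==> T <= Z ==> ind_mod B T ==> enat (card T) <= qdim Z B" unfolding qdim_def by (rule SUP_upper) auto

lemma qdim_leI: "(!!T. finite T ==> T <= Z ==> ind_mod B T ==> enat (card T) <= q) ==> qdim Z B <= q"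
  unfolding qdim_def by (rule SUP_least) auto

lemma qdim_le_card:
  assumes "finite S" "Z <= fs.span (S Un B)"
  shows "qdim Z B <= enat (card S)"
proof (rule qdim_leI)
  fix T assume "finite T" "T <= Z" "ind_mod B T"
  then have "card T <= card S" using assms by (intro ind_mod_card_le[of S T B]) auto
  then show "enat (card T) <= enat (card S)" by simp
qed

lemma qdim_eq_card:
  assumes "finite T" "T <= Z" "ind_mod B T" "Z <= fs.span (T Un B)"
  shows "qdim Z B = enat (card T)" by (intro antisym qdim_le_card[OF assms(1,4)] qdim_ge[OF assms(1-3)])

text \<open>A finite independent set of largest cardinality spans, since any vector outside its span
  could be adjoined by \<open>ind_mod_insert\<close>.\<close>

lemma qdim_basis:
  assumes "qdim Z B = enat m"
  obtains T where "finite T" "T <= Z" "ind_mod B T" "card T = m" "Z <= fs.span (T Un B)"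
proof -
  let ?P = "%T. finite T & T <= Z & ind_mod B T"
  have "?P {}" by (simp add: ind_mod_def)
  moreover have bd: "!!T. ?P T ==> card T <= m" using assms qdim_ge[of _ Z B] by (metis enat_ord_simps(1))
  ultimately obtain T where T: "?P T" and max: "!!T'. ?P T' ==> card T' <= card T"
    using ex_has_greatest_nat[of ?P "{}" card "Suc m"] by (metis le_imp_less_Suc)
  have sp: "Z <= fs.span (T Un B)"
  proof
    fix z assume z: "z : Z"
    show "z : fs.span (T Un B)"
    proof (rule ccontr)
      assume n: "z ~: fs.span (T Un B)"
      then have "?P (insert z T)" using T z ind_mod_insert by auto
      moreover have "z ~: T" using n fs.span_base[of z "T Un B"] by auto
      ultimately show False using max[of "insert z T"] T by simp
    qed
  qed
  then have "qdim Z B = enat (card T)" using T by (intro qdim_eq_card) auto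
  then show thesis using that[of T] T sp assms by simp
qed

lemma qdim_mono: "Z <= Z' ==> B' <= B ==> qdim Z B <= qdim Z' B'" by (rule qdim_leI, rule qdim_ge) (auto intro: ind_mod_anti)

lemma qdim_eq_0_iff:
  assumes "fs.subspace B"
  shows "qdim Z B = 0 \<longleftrightarrow> Z <= B"
proof
  assume "qdim Z B = 0"
  then obtain T where "finite T" "card T = 0" "Z <= fs.span (T Un B)" using qdim_basis[of Z B 0] by (metis zero_enat_def)
  then show "Z <= B" using assms by (simp add: fs.span_eq_iff[THEN iffD2])
next
  assume "Z <= B"
  then have "Z <= fs.span ({} Un B)" using assms by (simp add: fs.span_eq_iff[THEN iffD2])
  then have "qdim Z B <= enat 0" using qdim_le_card[of "{}" Z B] by simp
  then show "qdim Z B = 0" by (metis le_zero_eq zero_enat_def)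
qed

text \<open>In a relation modulo \<open>B\<close> the part coming from \<open>T'\<close> lies in
  \<open>Y\<close> and vanishes by independence modulo \<open>Y\<close>; what remains is a relation
  in \<open>T\<close> alone.\<close>

lemma ind_mod_Un:
  assumes "fs.subspace Y" "B <= Y" "T <= Y" "ind_mod B T" "ind_mod Y T'"
  shows "ind_mod B (T Un T')" "T Int T' = {}"
proof -
  show dis: "T Int T' = {}"
  proof (rule equals0I)
    fix t assume t: "t : T Int T'"
    then have "t : fs.span ((T' - {t}) Un Y)" using assms(3) by (intro fs.span_base) auto
    then show False using t assms(5) by (auto simp: ind_mod_def)
  qed
  show "ind_mod B (T Un T')" unfolding ind_mod_def
  proof
    fix v assume v: "v : T Un T'"
    show "v ~: fs.span ((T Un T' - {v}) Un B)"
    proof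
      assume a: "v : fs.span ((T Un T' - {v}) Un B)"
      show False
      proof (cases "v : T'")
        case True
        have "(T Un T' - {v}) Un B <= (T' - {v}) Un Y" using assms by auto
        then have "v : fs.span ((T' - {v}) Un Y)" using a by (meson fs.span_mono subsetD)
        then show False using True assms(5) by (auto simp: ind_mod_def)
      next
        case False
        then have vT: "v : T" using v by auto
        have eq: "(T Un T' - {v}) Un B = T' Un ((T - {v}) Un B)" using False by auto
        obtain p q where pq: "v = p + q" "p : fs.span T'" "q : fs.span ((T - {v}) Un B)"
          using a unfolding eq fs.span_Un[of T'] by auto
        have qY: "q : Y"
        proof -
          have "fs.span ((T - {v}) Un B) <= Y" using assms by (intro fs.span_minimal) auto
          then show ?thesis using pq by auto
        qed
        \<comment> \<open>A nonzero \<open>p\<close> would be a combination of elements of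
          \<open>T'\<close> lying in \<open>Y\<close>, and any \<open>w\<close> with nonzero
          coefficient would depend on the others modulo \<open>Y\<close>.\<close>
        have "p : Y" using fs.subspace_diff[OF assms(1), of v q] pq(1) qY vT assms(3) by auto
        have "p = 0"
        proof (rule ccontr)
          assume "p ~= 0"
          obtain F r where Fr: "finite F" "F <= T'" "p = (\<Sum>a\<in>F. scl (r a) a)"
            using pq(2) by (auto simp: fs.span_explicit)
          with \<open>p ~= 0\<close> obtain w where w: "w : F" "r w ~= 0"
            using sum.neutral[of F "%a. scl (r a) a"] fs.scale_zero_left by metis
          have "scl (r w) w = p - (\<Sum>a\<in>F - {w}. scl (r a) a)" using Fr w by (simp add: sum.remove)
          also have "\<dots> : fs.span ((T' - {w}) Un Y)" using Fr \<open>p : Y\<close>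
            by (intro fs.span_diff fs.span_sum fs.span_scale) (auto intro: fs.span_base)
          finally have "scl (1 / r w) (scl (r w) w) : fs.span ((T' - {w}) Un Y)" by (rule fs.span_scale)
          then have "w : fs.span ((T' - {w}) Un Y)" using w by simp
          then show False using assms(5) w Fr by (auto simp: ind_mod_def)
        qed
        then show False using pq vT assms(4) by (auto simp: ind_mod_def)
      qed
    qed
  qed
qed

text \<open>If a summand is infinite, monotonicity suffices; otherwise a basis of \<open>Y\<close>
  modulo \<open>B\<close> and one of \<open>Z\<close> modulo \<open>Y\<close> are joined.\<close>

lemma qdim_add:
  assumes "fs.subspace B" "fs.subspace Y" "B <= Y" "Y <= Z"
  shows "qdim Z B = qdim Z Y + qdim Y B"
proof (cases "qdim Z Y = \<infinity> | qdim Y B = \<infinity>")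
  case True
  moreover have "qdim Z Y <= qdim Z B" "qdim Y B <= qdim Z B" using assms by (auto intro: qdim_mono)
  ultimately show ?thesis by auto
next
  case False
  then obtain m k where mk: "qdim Z Y = enat m" "qdim Y B = enat k" by auto
  obtain S where S: "finite S" "S <= Z" "ind_mod Y S" "card S = m" "Z <= fs.span (S Un Y)" using qdim_basis mk by metis
  obtain T where T: "finite T" "T <= Y" "ind_mod B T" "card T = k" "Y <= fs.span (T Un B)" using qdim_basis mk by metis
  have u: "ind_mod B (T Un S)" "T Int S = {}" using ind_mod_Un[OF assms(2,3) T(2,3) S(3)] .
  have "S Un Y <= fs.span ((T Un S) Un B)" using T(5) fs.span_mono[of "T Un B" "(T Un S) Un B"] by (auto intro: fs.span_base)
  then have "Z <= fs.span ((T Un S) Un B)"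
    using S(5) fs.span_minimal[OF _ fs.subspace_span, of "S Un Y" "(T Un S) Un B"] by (rule_tac order_trans)
  then have "qdim Z B = enat (card (T Un S))" using u S T assms by (intro qdim_eq_card) auto
  then show ?thesis using u S T mk by (simp add: card_Un_disjoint)
qed

text \<open>The last assumption makes the induced map of quotients injective, so independent sets
  are carried to independent sets of the same size.\<close>

lemma qdim_inj:
  assumes f: "flin f" and "fs.subspace Z" "fs.subspace B'"
    and "!!z. z : Z ==> f z : Z'" and "!!z. z : Z ==> f z : B' ==> z : B"
  shows "qdim Z B <= qdim Z' B'"
proof (rule qdim_leI)
  fix T assume T: "finite T" "T <= Z" "ind_mod B T"
  have key: "f v ~: fs.span (f ` (T - {v}) Un B')" if v: "v : T" for v
  proof
    assume "f v : fs.span (f ` (T - {v}) Un B')"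
    then obtain p q where pq: "f v = p + q" "p : fs.span (f ` (T - {v}))" "q : B'"
      using assms by (auto simp: span_Un_subspace elim!: saddE)
    obtain w where w: "w : fs.span (T - {v})" "p = f w"
    proof -
      have "fs.span (f ` (T - {v})) <= f ` fs.span (T - {v})"
        by (rule fs.span_minimal) (auto intro: subspace_image[OF f] fs.subspace_span fs.span_base)
      then show thesis using pq that by auto
    qed
    have "w : Z" using w T fs.span_minimal[of "T - {v}" Z] assms by auto
    then have "v - w : Z" using v T fs.subspace_diff[OF assms(2), of v w] by auto
    moreover have "f (v - w) : B'" using pq w by (simp add: flin_diff[OF f])
    ultimately have "v - w : B" by (rule assms(5))
    then have "w + (v - w) : fs.span ((T - {v}) Un B)" using w fs.span_mono[of "T - {v}" "T - {v} Un B"]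
      by (intro fs.span_add fs.span_base[of "v - w"]) auto
    then show False using T v by (auto simp: ind_mod_def)
  qed
  have inj: "inj_on f T"
  proof (rule inj_onI, rule ccontr)
    fix x y assume "x : T" "y : T" "f x = f y" "x ~= y"
    then have "f x : f ` (T - {x})" by auto
    then show False using key[OF \<open>x : T\<close>] by (auto intro: fs.span_base)
  qed
  have "ind_mod B' (f ` T)" unfolding ind_mod_def
  proof
    fix u assume "u : f ` T"
    then obtain v where v: "v : T" "u = f v" by auto
    have "f ` T - {u} <= f ` (T - {v})" using v by auto
    then have "f ` T - {u} Un B' <= f ` (T - {v}) Un B'" by auto
    then show "u ~: fs.span (f ` T - {u} Un B')" using key[OF v(1)] v(2) by (meson fs.span_mono subsetD)
  qed
  then have "enat (card (f ` T)) <= qdim Z' B'" using T assms by (intro qdim_ge) auto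
  then show "enat (card T) <= qdim Z' B'" using inj by (simp add: card_image)
qed

text \<open>Preimages modulo \<open>B'\<close> of an independent set are independent modulo
  \<open>B\<close>, because a relation among them would be mapped to a relation in
  \<open>T\<close>.\<close>

lemma qdim_surj:
  assumes f: "flin f" and "fs.subspace B'"
    and "!!b. b : B ==> f b : B'" and "!!z'. z' : Z' ==> \<exists>z\<in>Z. f z - z' : B'"
  shows "qdim Z' B' <= qdim Z B"
proof (rule qdim_leI)
  fix T assume T: "finite T" "T <= Z'" "ind_mod B' T"
  obtain g where g: "!!t. t : T ==> g t : Z & f (g t) - t : B'"
  proof -
    have "\<forall>t\<in>T. \<exists>z. z : Z & f z - t : B'" using assms(4) T(2) by blast
    then show thesis using that by (metis bchoice)
  qed
  have key: "g t ~: fs.span (g ` (T - {t}) Un B)" if t: "t : T" for t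
  proof
    assume "g t : fs.span (g ` (T - {t}) Un B)"
    then have "f (g t) : fs.span (f ` (g ` (T - {t}) Un B))" by (rule flin_span_image[OF f])
    moreover have "f ` (g ` (T - {t}) Un B) <= fs.span ((T - {t}) Un B')"
    proof -
      have "f (g s) : fs.span ((T - {t}) Un B')" if "s : T - {t}" for s
      proof -
        have "s + (f (g s) - s) : fs.span ((T - {t}) Un B')" using that g[of s] by (intro fs.span_add) (auto intro: fs.span_base)
        then show ?thesis by simp
      qed
      moreover have "f b : fs.span ((T - {t}) Un B')" if "b : B" for b using that assms(3) by (auto intro: fs.span_base)
      ultimately show ?thesis by auto
    qed
    ultimately have "f (g t) : fs.span ((T - {t}) Un B')"
      using fs.span_minimal[OF _ fs.subspace_span, of "f ` (g ` (T - {t}) Un B)" "(T - {t}) Un B'"] by auto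
    moreover have "f (g t) - t : fs.span ((T - {t}) Un B')" using g[OF t] by (auto intro: fs.span_base)
    ultimately have "f (g t) - (f (g t) - t) : fs.span ((T - {t}) Un B')" by (rule fs.span_diff)
    then show False using T t by (auto simp: ind_mod_def)
  qed
  have inj: "inj_on g T"
  proof (rule inj_onI, rule ccontr)
    fix x y assume "x : T" "y : T" "g x = g y" "x ~= y"
    then have "g x : g ` (T - {x})" by auto
    then show False using key[OF \<open>x : T\<close>] by (auto intro: fs.span_base)
  qed
  have "ind_mod B (g ` T)" unfolding ind_mod_def
  proof
    fix u assume "u : g ` T"
    then obtain v where v: "v : T" "u = g v" by auto
    have "g ` T - {u} Un B <= g ` (T - {v}) Un B" using v by auto
    then show "u ~: fs.span (g ` T - {u} Un B)" using key[OF v(1)] v(2) by (meson fs.span_mono subsetD)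
  qed
  then have "enat (card (g ` T)) <= qdim Z B" using T g by (intro qdim_ge) auto
  then show "enat (card T) <= qdim Z B" using inj by (simp add: card_image)
qed

lemma qdim_iso:
  assumes "flin f" "fs.subspace Z" "fs.subspace B'"
    and "!!z. z : Z ==> f z : Z'" and "!!z. z : Z ==> f z : B' \<longleftrightarrow> z : B" and "B <= Z"
    and "!!z'. z' : Z' ==> \<exists>z\<in>Z. f z - z' : B'"
  shows "qdim Z B = qdim Z' B'"
proof (rule antisym)
  show "qdim Z B <= qdim Z' B'" by (rule qdim_inj[OF assms(1-4)]) (simp_all only: assms(5))
  show "qdim Z' B' <= qdim Z B"
  proof (rule qdim_surj[OF assms(1,3) _ assms(7)])
    fix b assume "b : B"
    then show "f b : B'" using assms(5)[of b] assms(6) by (metis subsetD)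
  qed
qed

lemma qdim_second_iso:
  assumes "fs.subspace A" "fs.subspace B"
  shows "qdim (sadd A B) B = qdim A (A Int B)"
proof (rule sym, rule qdim_iso[where f = "%x. x"])
  fix z' assume "z' : sadd A B"
  then obtain a b where "z' = a + b" "a : A" "b : B" by (auto elim!: saddE)
  then show "\<exists>z\<in>A. z - z' : B" using assms by (intro bexI[of _ a]) (auto intro: fs.subspace_neg)
qed (use assms in \<open>auto simp: flin_id intro: sadd_left\<close>)

section \<open>Coordinate subspaces, pairings and functionals\<close>

definition funs_on :: "'i set => ('i => 'k::field) set" where
  "funs_on I = {f. \<forall>x. f x ~= 0 --> x : I}"

definition dirac :: "'i => 'i => 'k::field" where
  "dirac x = (%y. if y = x then 1 else 0)"

lemma subspace_funs_on: "fs.subspace (funs_on I :: ('i => 'k::field) set)"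
proof (rule fs.subspaceI)
  fix f g :: "'i => 'k" assume fg: "f : funs_on I" "g : funs_on I"
  have "(f + g) x = 0" if "x ~: I" for x
  proof -
    have "f x = 0" "g x = 0" using fg that by (auto simp: funs_on_def)
    then show ?thesis by simp
  qed
  then show "f + g : funs_on I" unfolding funs_on_def by blast
qed (auto simp: funs_on_def)

lemma fun_sum_apply: "(\<Sum>x\<in>I. F x) y = (\<Sum>x\<in>I. F x y)" by (induction I rule: infinite_finite_induct) auto

lemma fun_eq_sum_dirac:
  assumes "finite I" "f : funs_on I"
  shows "f = (\<Sum>x\<in>I. scl (f x) (dirac x))"
proof
  fix y
  have "(\<Sum>x\<in>I. scl (f x) (dirac x)) y = (\<Sum>x\<in>I. if y = x then f x else 0)"
    by (simp add: fun_sum_apply dirac_def if_distrib cong: if_cong)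
  also have "\<dots> = f y" using assms by (auto simp: funs_on_def sum.delta)
  finally show "f y = (\<Sum>x\<in>I. scl (f x) (dirac x)) y" by simp
qed

lemma qdim_funs_on_le:
  assumes "finite I"
  shows "qdim (funs_on I :: ('i => 'k::field) set) B <= enat (card I)"
proof -
  have "(funs_on I :: ('i => 'k) set) <= fs.span (dirac ` I Un B)"
  proof
    fix f :: "'i => 'k" assume "f : funs_on I"
    then have "f = (\<Sum>x\<in>I. scl (f x) (dirac x))" using assms by (rule fun_eq_sum_dirac[rotated])
    also have "\<dots> : fs.span (dirac ` I Un B)" by (intro fs.span_sum fs.span_scale fs.span_base) auto
    finally show "f : fs.span (dirac ` I Un B)" .
  qed
  then have "qdim (funs_on I :: ('i => 'k) set) B <= enat (card (dirac ` I :: ('i => 'k) set))"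
    using assms by (intro qdim_le_card) auto
  also have "\<dots> <= enat (card I)" using assms by (simp add: card_image_le)
  finally show ?thesis .
qed

text \<open>A pairing without left kernel embeds \<open>Z/B\<close> into the dual of
  \<open>Z'/B'\<close>. It suffices to evaluate at a finite set \<open>T\<close> spanning
  \<open>Z'\<close> modulo \<open>B'\<close>: what is orthogonal to \<open>T\<close> and
  \<open>B'\<close> is orthogonal to all of \<open>Z'\<close>.\<close>

lemma qdim_pairing_le:
  fixes P :: "('i => 'k::field) => ('j => 'k) => 'k"
  assumes Z: "fs.subspace Z"
    and add: "!!x y w. P (x + y) w = P x w + P y w" and scale: "!!c x w. P (scl c x) w = c * P x w"
    and add2: "!!x w w'. w : Z' ==> w' : Z' ==> P x (w + w') = P x w + P x w'"
    and scale2: "!!c x w. w : Z' ==> P x (scl c w) = c * P x w"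
    and Z': "fs.subspace Z'" and B': "B' <= Z'"
    and van: "!!z b. z : Z ==> b : B' ==> P z b = 0"
    and nondeg: "!!z. z : Z ==> (!!w. w : Z' ==> P z w = 0) ==> z : B"
  shows "qdim Z B <= qdim Z' B'"
proof (cases "qdim Z' B'")
  case (enat m)
  obtain T where T: "finite T" "T <= Z'" "card T = m" "Z' <= fs.span (T Un B')" using qdim_basis[OF enat] by metis
  define F where "F z = (%w. if w : T then P z w else 0)" for z
  have F: "flin F" by (rule flinI) (auto simp: F_def fun_eq_iff add scale)
  have "qdim Z B <= qdim (funs_on T :: (('j => 'k) => 'k) set) {0}"
  proof (rule qdim_inj[OF F Z subspace_zero])
    show "F z : funs_on T" for z by (auto simp: F_def funs_on_def)
    fix z assume z: "z : Z" and "F z : {0}"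
    then have F0: "F z = 0" by simp
    have PT: "P z w = 0" if "w : T" for w using fun_cong[OF F0, of w] that by (simp add: F_def)
    have sub: "fs.subspace {w \<in> Z'. P z w = 0}"
    proof (rule fs.subspaceI)
      have "P z (scl 0 0) = 0 * P z 0" by (rule scale2[OF fs.subspace_0[OF Z']])
      then have "P z 0 = 0" by (simp only: fs.scale_zero_left mult_zero_left)
      then show "0 : {w \<in> Z'. P z w = 0}" using fs.subspace_0[OF Z'] by blast
    next
      fix x y assume xy: "x : {w \<in> Z'. P z w = 0}" "y : {w \<in> Z'. P z w = 0}"
      then have "P z (x + y) = P z x + P z y" by (intro add2) auto
      then have "P z (x + y) = 0" using xy by (simp only: mem_Collect_eq add_0_left)
      then show "x + y : {w \<in> Z'. P z w = 0}" using xy fs.subspace_add[OF Z'] by blast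
    next
      fix c x assume x: "x : {w \<in> Z'. P z w = 0}"
      then have "P z (scl c x) = c * P z x" by (intro scale2) auto
      then have "P z (scl c x) = 0" using x by (simp only: mem_Collect_eq mult_zero_right)
      then show "scl c x : {w \<in> Z'. P z w = 0}" using x fs.subspace_scale[OF Z'] by blast
    qed
    have "fs.span (T Un B') <= {w \<in> Z'. P z w = 0}" by (rule fs.span_minimal[OF _ sub]) (use PT van[OF z] T B' in auto)
    then show "z : B" using T(4) by (intro nondeg[OF z]) auto
  qed
  also have "\<dots> <= enat (card T)" by (rule qdim_funs_on_le[OF T(1)])
  finally show ?thesis using T enat by simp
qed simp

text \<open>A basis of \<open>B\<close> stays independent when \<open>g\<close> is added, so a
  functional may be prescribed as 1 at \<open>g\<close> and 0 on that basis.\<close>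

lemma separating_functional:
  fixes g :: "'i => 'k::field"
  assumes B: "fs.subspace B" and g: "g ~: B"
  obtains fv :: "('i => 'k) => 'k" where "!!x y. fv (x + y) = fv x + fv y" "!!c x. fv (scl c x) = c * fv x"
    "fv g ~= 0" "!!b. b : B ==> fv b = 0"
proof -
  interpret one: vector_space "(*) :: 'k => 'k => 'k" by unfold_locales (simp_all add: distrib_left distrib_right mult.assoc)
  interpret vp: vector_space_pair "scl :: 'k => ('i => 'k) => 'i => 'k" "(*) :: 'k => 'k => 'k" ..
  obtain Bb where Bb: "Bb <= B" "fs.independent Bb" "B <= fs.span Bb" by (rule fs.maximal_independent_subset)
  have spB: "fs.span Bb = B" using Bb B by (simp add: antisym fs.span_minimal)
  then have ind: "fs.independent (insert g Bb)" using Bb g by (simp add: fs.independent_insert)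
  obtain fv where fv: "Vector_Spaces.linear scl (*) fv"
    "\<forall>x\<in>insert g Bb. fv x = (if x = g then 1 else 0 :: 'k)"
    using vp.linear_independent_extend[OF ind, of "%x. if x = g then 1 else 0"] by auto
  interpret l: Vector_Spaces.linear scl "(*)" fv by fact
  have gB: "g ~: Bb" using Bb g by auto
  have fvB: "fv b = 0" if "b : B" for b
  proof (rule vp.linear_eq_0_on_span[OF fv(1), of Bb])
    show "b : fs.span Bb" using that spB by simp
    show "fv x = 0" if "x : Bb" for x using that fv(2) gB by auto
  qed
  have fvg: "fv g ~= 0" using fv(2) by simp
  show thesis by (rule that[of fv, OF l.add l.scale fvg fvB])
qed

section \<open>Graded families, monomial shifts and localizations\<close>

type_synonym ('n, 'k) lvec = "nat \<times> ('n => int) => 'k"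
type_synonym ('n, 'k) fam = "int => ('n, 'k) lvec set"

text \<open>Multiplication by the Laurent monomial with exponent \<open>bv\<close>; it is invertible
  for every \<open>bv\<close>.\<close>

definition sh :: "('n => int) => ('n, 'k) lvec => ('n, 'k) lvec" where
  "sh bv f = (%(j, av). f (j, av - bv))"

lemma sh_apply [simp]: "sh bv f (j, av) = f (j, av - bv)" by (simp add: sh_def)

lemma sh_sh: "sh bv (sh gv f) = sh (bv + gv) f" by (auto simp: sh_def fun_eq_iff diff_diff_eq)

lemma sh_0 [simp]: "sh 0 f = f" by (auto simp: sh_def)

lemma sh_minus [simp]: "sh (- bv) (sh bv f) = f" "sh bv (sh (- bv) f) = f" by (simp_all add: sh_sh)

lemma flin_sh: "flin (sh bv)" by (rule flinI) (auto simp: fun_eq_iff)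

lemmas sh_add = flin_add[OF flin_sh] and sh_scl = flin_scl[OF flin_sh]
  and sh_zero [simp] = flin_0[OF flin_sh] and sh_diff = flin_diff[OF flin_sh]
  and sh_sum = flin_sum[OF flin_sh]

definition edeg :: "('n::finite => int) => int" where
  "edeg av = (\<Sum>i\<in>UNIV. av i)"

lemma edeg_add [simp]: "edeg (av + bv) = edeg av + edeg bv" by (simp add: edeg_def sum.distrib)

lemma edeg_0 [simp]: "edeg 0 = 0" by (simp add: edeg_def)

lemma edeg_uminus [simp]: "edeg (- av) = - edeg av" by (simp add: edeg_def sum_negf)

lemma edeg_diff [simp]: "edeg (av - bv) = edeg av - edeg bv" by (simp add: edeg_def sum_subtractf)

lemma edeg_nonneg: "0 <= bv ==> 0 <= edeg bv" unfolding edeg_def by (rule sum_nonneg) (auto simp: le_fun_def)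

text \<open>Graded submodules: for families of subspaces, stability under monomials amounts to
  stability under the polynomial ring.\<close>

definition gsub :: "('n::finite, 'k::field) fam => bool" where
  "gsub V \<longleftrightarrow> (\<forall>t. fs.subspace (V t)) & (\<forall>t bv v. 0 <= bv --> v : V t --> sh bv v : V (t + edeg bv))"

lemma gsub_subspace: "gsub V ==> fs.subspace (V t)" by (simp add: gsub_def)

lemma gsub_sh: "gsub V ==> 0 <= bv ==> v : V t ==> sh bv v : V (t + edeg bv)" by (simp add: gsub_def)

text \<open>The localization at the variables in \<open>S\<close>. As shifts are invertible it
  remains inside the same function space, and by exactness the localization of \<open>V/U\<close> is
  \<open>loc V S\<close> modulo \<open>loc U S\<close>.\<close>

definition loc :: "('n::finite, 'k::field) fam => 'n set => ('n, 'k) fam" where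
  "loc V S t = {v. \<exists>bv. 0 <= bv & (\<forall>i. i ~: S --> bv i = 0) & sh bv v : V (t + edeg bv)}"

lemma locI: "0 <= bv ==> (!!i. i ~: S ==> bv i = 0) ==> sh bv v : V (t + edeg bv) ==> v : loc V S t" unfolding loc_def by blast

lemma locE:
  assumes "v : loc V S t"
  obtains bv where "0 <= bv" "!!i. i ~: S ==> bv i = 0" "sh bv v : V (t + edeg bv)" using assms unfolding loc_def by blast

lemma loc_mono: "(!!t. V t <= W t) ==> loc V S t <= loc W S t" unfolding loc_def by blast

lemma loc_mono_set: "S <= S' ==> loc V S t <= loc V S' t" unfolding loc_def by blast

lemma loc_base: "v : V t ==> v : loc V S t" by (rule locI[of 0]) auto

lemma loc_empty: "loc V {} t = V t"
proof
  show "loc V {} t <= V t"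
  proof
    fix v assume "v : loc V {} t"
    then obtain bv where b: "0 <= bv" "!!i. i ~: {} ==> bv i = 0" "sh bv v : V (t + edeg bv)" by (metis locE)
    then have "bv = 0" by (auto simp: fun_eq_iff)
    then show "v : V t" using b by simp
  qed
qed (auto intro: loc_base)

lemma loc_shift_more:
  assumes "gsub V" "0 <= gv" "sh bv v : V (t + edeg bv)"
  shows "sh (gv + bv) v : V (t + edeg (gv + bv))" using gsub_sh[OF assms(1,2,3)] by (simp add: sh_sh algebra_simps)

lemma subspace_loc:
  assumes V: "gsub V"
  shows "fs.subspace (loc V S t)"
proof (rule fs.subspaceI)
  show "0 : loc V S t" by (rule loc_base) (rule fs.subspace_0[OF gsub_subspace[OF V]])
next
  fix x y assume "x : loc V S t" "y : loc V S t"
  then obtain bv gv where b: "0 <= bv" "!!i. i ~: S ==> bv i = 0" "sh bv x : V (t + edeg bv)"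
    and g: "0 <= gv" "!!i. i ~: S ==> gv i = 0" "sh gv y : V (t + edeg gv)" by (metis locE)
  have "sh (gv + bv) x : V (t + edeg (gv + bv))" by (rule loc_shift_more[OF V g(1) b(3)])
  moreover have "sh (gv + bv) y : V (t + edeg (gv + bv))" using loc_shift_more[OF V b(1) g(3)] by (simp add: add.commute)
  ultimately have "sh (gv + bv) (x + y) : V (t + edeg (gv + bv))"
    unfolding sh_add by (rule fs.subspace_add[OF gsub_subspace[OF V]])
  then show "x + y : loc V S t" by (intro locI[OF add_nonneg_nonneg[OF g(1) b(1)]]) (simp_all add: b(2) g(2))
next
  fix c x assume "x : loc V S t"
  then obtain bv where b: "0 <= bv" "!!i. i ~: S ==> bv i = 0" "sh bv x : V (t + edeg bv)" by (metis locE)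
  then have "sh bv (scl c x) : V (t + edeg bv)" unfolding sh_scl by (intro fs.subspace_scale[OF gsub_subspace[OF V]])
  then show "scl c x : loc V S t" by (intro locI[OF b(1,2)])
qed

section \<open>Cech cochains and cohomology of a pair of families\<close>

type_synonym ('n, 'k) lcoch = "'n set \<times> nat \<times> ('n => int) => 'k"

definition sl :: "('n, 'k) lcoch => 'n set => ('n, 'k) lvec" where
  "sl c S = (%x. c (S, x))"

definition unsl :: "('n set => ('n, 'k) lvec) => ('n, 'k) lcoch" where
  "unsl f = (%(S, x). f S x)"

lemma sl_unsl [simp]: "sl (unsl f) S = f S" by (simp add: sl_def unsl_def)

lemma sl_eqI: "(!!S. sl c S = sl d S) ==> c = d" by (auto simp: sl_def fun_eq_iff)

lemma flin_sl: "flin (%c. sl c S)" by (rule flinI) (auto simp: sl_def fun_eq_iff)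

lemmas sl_add = flin_add[OF flin_sl] and sl_scl = flin_scl[OF flin_sl]
  and sl_0 [simp] = flin_0[OF flin_sl] and sl_diff = flin_diff[OF flin_sl]

text \<open>The degree \<open>p\<close> is an integer so that \<open>Cc (p - 1)\<close> is the zero
  space at \<open>p = 0\<close>, and boundary cases need no separate treatment.\<close>

definition Cc :: "int => ('n::finite, 'k::field) fam => int => ('n, 'k) lcoch set" where
  "Cc p V t = {c. \<forall>S. (int (card S) = p --> sl c S : loc V S t) & (int (card S) ~= p --> sl c S = 0)}"

lemma CcI:
  "(!!S. int (card S) = p ==> sl c S : loc V S t) ==> (!!S. int (card S) ~= p ==> sl c S = 0)
    ==> c : Cc p V t" by (simp add: Cc_def)

lemma Cc_loc: "c : Cc p V t ==> int (card S) = p ==> sl c S : loc V S t"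
  and Cc_zero: "c : Cc p V t ==> int (card S) ~= p ==> sl c S = 0" by (simp_all add: Cc_def)

lemma subspace_Cc:
  assumes V: "gsub V"
  shows "fs.subspace (Cc p V t)"
proof (rule fs.subspaceI)
  show "0 : Cc p V t" by (rule CcI) (simp_all add: fs.subspace_0[OF subspace_loc[OF V]])
  fix x y assume "x : Cc p V t" "y : Cc p V t"
  then show "x + y : Cc p V t" by (intro CcI) (simp_all add: sl_add Cc_loc Cc_zero fs.subspace_add[OF subspace_loc[OF V]])
next
  fix c x assume "x : Cc p V t"
  then show "scl c x : Cc p V t" by (intro CcI) (simp_all add: sl_scl Cc_loc Cc_zero fs.subspace_scale[OF subspace_loc[OF V]])
qed

lemma Cc_mono: "(!!t. V t <= W t) ==> Cc p V t <= Cc p W t" using loc_mono[of V W] unfolding Cc_def by blast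

definition sg :: "'n::linorder set => 'n => 'k::field" where
  "sg S v = (- 1) ^ card {w \<in> S. w < v}"

definition dd :: "('n::{finite,linorder}, 'k::field) lcoch => ('n, 'k) lcoch" where
  "dd c = (%(S, x). \<Sum>v\<in>S. sg S v * c (S - {v}, x))"

lemma sl_dd: "sl (dd c) S = (\<Sum>v\<in>S. scl (sg S v) (sl c (S - {v})))" by (auto simp: sl_def dd_def fun_eq_iff fun_sum_apply)

lemma flin_dd: "flin dd" by (rule flinI) (auto simp: dd_def fun_eq_iff algebra_simps sum.distrib sum_distrib_left)

lemmas dd_add = flin_add[OF flin_dd] and dd_scl = flin_scl[OF flin_dd]
  and dd_0 [simp] = flin_0[OF flin_dd] and dd_diff = flin_diff[OF flin_dd]

text \<open>Deleting \<open>v\<close> lowers the position of every later index by one and leaves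
  that of the earlier ones alone.\<close>

lemma sg_remove_less:
  fixes S :: "'n::{finite,linorder} set"
  assumes "v : S" "v < w"
  shows "(sg (S - {v}) w :: 'k::field) = - sg S w" "(sg (S - {w}) v :: 'k) = sg S v"
proof -
  have "{u \<in> S. u < w} = insert v {u \<in> S - {v}. u < w}" using assms by auto
  then have "card {u \<in> S. u < w} = Suc (card {u \<in> S - {v}. u < w})" by simp
  then show "(sg (S - {v}) w :: 'k) = - sg S w" by (simp add: sg_def)
  have "{u \<in> S - {w}. u < v} = {u \<in> S. u < v}" using assms by auto
  then show "(sg (S - {w}) v :: 'k) = sg S v" by (simp add: sg_def)
qed

text \<open>Removing \<open>v\<close> and \<open>w\<close> in the two possible orders gives opposite
  signs; the double sum is split into \<open>v < w\<close> and \<open>w < v\<close>, and the second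
  half is reindexed.\<close>

lemma dd_dd [simp]: "dd (dd c) = (0 :: ('n::{finite,linorder}, 'k::field) lcoch)"
proof
  fix y :: "'n set \<times> nat \<times> ('n => int)"
  obtain S x where y: "y = (S, x)" by (cases y)
  define F where "F v w = sg S v * (sg (S - {v}) w * c (S - {v} - {w}, x))" for v w
  have F: "F v w + F w v = 0" if "v : S" "w : S" "v < w" for v w
  proof -
    have "S - {w} - {v} = S - {v} - {w}" by auto
    then show ?thesis using sg_remove_less[of v S w, where 'k = 'k] that by (simp add: F_def)
  qed
  have "dd (dd c) y = (\<Sum>v\<in>S. \<Sum>w\<in>S - {v}. F v w)" by (simp add: y dd_def F_def sum_distrib_left)
  also have "\<dots> = (\<Sum>v\<in>S. (\<Sum>w | w : S & v < w. F v w) + (\<Sum>w | w : S & w < v. F v w))"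
  proof (rule sum.cong[OF refl])
    fix v
    have "S - {v} = {w \<in> S. v < w} Un {w \<in> S. w < v}" by auto
    moreover have "{w \<in> S. v < w} Int {w \<in> S. w < v} = {}" by auto
    ultimately show "(\<Sum>w\<in>S - {v}. F v w) = (\<Sum>w | w : S & v < w. F v w) + (\<Sum>w | w : S & w < v. F v w)"
      by (simp add: sum.union_disjoint)
  qed
  also have "\<dots> = (\<Sum>v\<in>S. \<Sum>w | w : S & v < w. F v w) + (\<Sum>v\<in>S. \<Sum>w | w : S & w < v. F v w)"
    by (simp add: sum.distrib)
  also have "(\<Sum>v\<in>S. \<Sum>w | w : S & w < v. F v w) = (\<Sum>w\<in>S. \<Sum>v | v : S & w < v. F v w)"
    by (rule sum.swap_restrict) auto
  also have "(\<Sum>v\<in>S. \<Sum>w | w : S & v < w. F v w) + (\<Sum>w\<in>S. \<Sum>v | v : S & w < v. F v w)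
      = (\<Sum>v\<in>S. \<Sum>w | w : S & v < w. F v w + F w v)" by (simp add: sum.distrib)
  also have "\<dots> = 0" by (intro sum.neutral ballI) (auto simp: F)
  finally show "dd (dd c) y = 0 y" by simp
qed

lemma dd_Cc:
  assumes V: "gsub V" and c: "c : Cc p V t"
  shows "dd c : Cc (p + 1) V t"
proof (rule CcI)
  fix S :: "'a set" assume S: "int (card S) = p + 1"
  show "sl (dd c) S : loc V S t" unfolding sl_dd
  proof (rule fs.subspace_sum[OF subspace_loc[OF V]], rule fs.subspace_scale[OF subspace_loc[OF V]])
    fix v assume v: "v : S"
    then have "int (card (S - {v})) = p" using S card_Suc_Diff1[of S v] by simp
    then have "sl c (S - {v}) : loc V (S - {v}) t" by (rule Cc_loc[OF c])
    then show "sl c (S - {v}) : loc V S t" using loc_mono_set[of "S - {v}" S V t] by auto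
  qed
next
  fix S :: "'a set" assume S: "int (card S) ~= p + 1"
  have "sl c (S - {v}) = 0" if "v : S" for v using that S card_Suc_Diff1[of S v] by (intro Cc_zero[OF c]) auto
  then show "sl (dd c) S = 0" by (simp add: sl_dd)
qed

text \<open>Together with \<open>BB\<close> this describes the Cech complex of \<open>V/U\<close> by
  cochains of \<open>V\<close>: the cocycle condition holds modulo \<open>U\<close>, and all
  cochains of \<open>U\<close> count as coboundaries.\<close>

definition ZZ :: "int => ('n::{finite,linorder}, 'k::field) fam => ('n, 'k) fam => int => ('n, 'k) lcoch set" where
  "ZZ p V U t = {c \<in> Cc p V t. dd c : Cc (p + 1) U t}"

definition BB :: "int => ('n::{finite,linorder}, 'k::field) fam => ('n, 'k) fam => int => ('n, 'k) lcoch set" where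
  "BB p V U t = sadd (dd ` Cc (p - 1) V t) (Cc p U t)"

definition hh :: "int => ('n::{finite,linorder}, 'k::field) fam => ('n, 'k) fam => int => enat" where
  "hh p V U t = qdim (ZZ p V U t) (BB p V U t)"

lemma ZZ_I: "c : Cc p V t ==> dd c : Cc (p + 1) U t ==> c : ZZ p V U t"
  and ZZ_Cc: "c : ZZ p V U t ==> c : Cc p V t"
  and ZZ_dd: "c : ZZ p V U t ==> dd c : Cc (p + 1) U t" by (simp_all add: ZZ_def)

lemma BB_I: "w : Cc (p - 1) V t ==> u : Cc p U t ==> dd w + u : BB p V U t" unfolding BB_def by (rule saddI) auto

lemma BB_E:
  assumes "b : BB p V U t"
  obtains w u where "w : Cc (p - 1) V t" "u : Cc p U t" "b = dd w + u" using assms unfolding BB_def by (auto elim!: saddE)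

lemma subspace_ZZ: "gsub V ==> gsub U ==> fs.subspace (ZZ p V U t)"
  unfolding ZZ_def by (intro subspace_vimage flin_dd subspace_Cc)

lemma subspace_BB: "gsub V ==> gsub U ==> fs.subspace (BB p V U t)"
  unfolding BB_def by (intro subspace_sadd subspace_image flin_dd subspace_Cc)

lemma Cc_BB: "gsub V ==> u : Cc p U t ==> u : BB p V U t" using BB_I[of 0 p V t u U] fs.subspace_0[OF subspace_Cc] by force

lemma dd_BB: "gsub U ==> w : Cc (p - 1) V t ==> dd w : BB p V U t"
  using BB_I[of w p V t 0 U] fs.subspace_0[OF subspace_Cc] by force

lemma BB_ZZ:
  assumes V: "gsub V" and U: "gsub U" and UV: "!!t. U t <= V t"
  shows "BB p V U t <= ZZ p V U t"
proof
  fix b assume "b : BB p V U t"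
  then obtain w u where wu: "w : Cc (p - 1) V t" "u : Cc p U t" "b = dd w + u" by (rule BB_E)
  have "dd w : Cc p V t" using dd_Cc[OF V wu(1)] by simp
  moreover have "u : Cc p V t" using Cc_mono[of U V p t] UV wu(2) by auto
  moreover have "dd b = dd u" using wu(3) by (simp add: dd_add)
  ultimately show "b : ZZ p V U t" using wu(3) dd_Cc[OF U wu(2)] by (auto intro!: ZZ_I fs.subspace_add[OF subspace_Cc[OF V]])
qed

subsection \<open>The long exact sequence\<close>

text \<open>For \<open>U <= V <= W\<close>, the rank of the connecting map \<open>H\<^sup>p\<^sup>-\<^sup>1(W/V) \<rightarrow> H\<^sup>p(V/U)\<close>.\<close>

definition conn_rank :: "int => ('n::{finite,linorder}, 'k::field) fam => ('n, 'k) fam => ('n, 'k) fam => int => enat" where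
  "conn_rank p U V W t = qdim (ZZ p V U t Int BB p W U t) (BB p V U t)"

context
  fixes U V W :: "('n::{finite,linorder}, 'k::field) fam"
  assumes U: "gsub U" and V: "gsub V" and W: "gsub W"
    and UV: "!!t. U t <= V t" and VW: "!!t. V t <= W t"
begin

lemma Cc_UV: "c : Cc p U t ==> c : Cc p V t" using Cc_mono[OF UV] by (rule subsetD)

lemma Cc_VW: "c : Cc p V t ==> c : Cc p W t" using Cc_mono[OF VW] by (rule subsetD)

lemma BB_VW: "BB p V U t <= BB p W U t" unfolding BB_def by (intro sadd_mono image_mono Cc_mono VW order_refl)

lemma BB_UV: "BB p W U t <= BB p W V t" unfolding BB_def by (intro sadd_mono image_mono Cc_mono UV order_refl)

lemma ZZ_VW: "ZZ p V U t <= ZZ p W U t" unfolding ZZ_def using Cc_VW by blast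

lemma ZZ_UV: "ZZ p W U t <= ZZ p W V t" unfolding ZZ_def using Cc_UV by blast

text \<open>The first summand is the rank of the map from H^p(V/U) to H^p(W/U), the second the
  dimension of its kernel, which is the image of the connecting map.\<close>

lemma hh_sub_split: "hh p V U t = qdim (ZZ p V U t) (ZZ p V U t Int BB p W U t) + conn_rank p U V W t"
  unfolding hh_def conn_rank_def by (rule qdim_add)
    (use BB_ZZ[OF V U UV] BB_VW in \<open>auto intro!: fs.subspace_inter subspace_BB subspace_ZZ U V W\<close>)

text \<open>Cokernel and image of the map from H^p(V/U) to H^p(W/U); the image is rewritten by the
  second isomorphism theorem to match \<open>hh_sub_split\<close>.\<close>

lemma hh_mid_split: "hh p W U t = qdim (ZZ p W U t) (sadd (ZZ p V U t) (BB p W U t))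
    + qdim (ZZ p V U t) (ZZ p V U t Int BB p W U t)"
proof -
  have UW: "!!t. U t <= W t" using UV VW by blast
  have "hh p W U t = qdim (ZZ p W U t) (sadd (ZZ p V U t) (BB p W U t))
      + qdim (sadd (ZZ p V U t) (BB p W U t)) (BB p W U t)" unfolding hh_def
  proof (rule qdim_add)
    show "BB p W U t <= sadd (ZZ p V U t) (BB p W U t)" by (auto intro: sadd_right subspace_ZZ U V)
    show "sadd (ZZ p V U t) (BB p W U t) <= ZZ p W U t" by (intro sadd_least subspace_ZZ W U ZZ_VW BB_ZZ UW)
  qed (intro subspace_BB subspace_ZZ subspace_sadd U V W)+
  then show ?thesis by (simp add: qdim_second_iso subspace_ZZ subspace_BB U V W)
qed

text \<open>Exactness at H^p(W/U): a cocycle that bounds modulo \<open>V\<close> differs from a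
  coboundary of \<open>W\<close> by a cochain of \<open>V\<close>, which is again a cocycle modulo
  \<open>U\<close>.\<close>

lemma ZZ_inter_BB: "ZZ p W U t Int BB p W V t = sadd (ZZ p V U t) (BB p W U t)"
proof
  show "ZZ p W U t Int BB p W V t <= sadd (ZZ p V U t) (BB p W U t)"
  proof
    fix c assume c: "c : ZZ p W U t Int BB p W V t"
    then obtain w v where wv: "w : Cc (p - 1) W t" "v : Cc p V t" "c = dd w + v" by (auto elim: BB_E)
    have "dd v = dd c" using wv by (simp add: dd_add)
    then have "dd v : Cc (p + 1) U t" using c ZZ_dd[of c p W U t] by simp
    then have "v : ZZ p V U t" by (rule ZZ_I[OF wv(2)])
    then have "v + dd w : sadd (ZZ p V U t) (BB p W U t)" using dd_BB[OF U wv(1)] by (rule saddI)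
    then show "c : sadd (ZZ p V U t) (BB p W U t)" using wv by (simp add: add.commute)
  qed
  have "ZZ p V U t <= BB p W V t" using Cc_BB[OF W] ZZ_Cc by blast
  moreover have "BB p W U t <= ZZ p W U t" using UV VW by (intro BB_ZZ W U) blast
  ultimately show "sadd (ZZ p V U t) (BB p W U t) <= ZZ p W U t Int BB p W V t"
    by (intro sadd_least fs.subspace_inter subspace_ZZ subspace_BB W U V) (use ZZ_VW BB_UV in auto)
qed

text \<open>On cocycles of \<open>W/V\<close> the coboundary \<open>dd\<close> itself induces the
  connecting map; its kernel is the image of H^p(W/U).\<close>

lemma hh_quot_split: "hh p W V t = conn_rank (p + 1) U V W t
    + qdim (ZZ p W U t) (sadd (ZZ p V U t) (BB p W U t))"
proof -
  have "hh p W V t = qdim (ZZ p W V t) (sadd (ZZ p W U t) (BB p W V t))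
      + qdim (sadd (ZZ p W U t) (BB p W V t)) (BB p W V t)" unfolding hh_def
  proof (rule qdim_add)
    show "BB p W V t <= sadd (ZZ p W U t) (BB p W V t)" by (auto intro: sadd_right subspace_ZZ U W)
    show "sadd (ZZ p W U t) (BB p W V t) <= ZZ p W V t" by (intro sadd_least subspace_ZZ W V ZZ_UV BB_ZZ VW)
  qed (intro subspace_BB subspace_ZZ subspace_sadd U V W)+
  also have "qdim (sadd (ZZ p W U t) (BB p W V t)) (BB p W V t)
      = qdim (ZZ p W U t) (sadd (ZZ p V U t) (BB p W U t))"
    by (simp add: qdim_second_iso subspace_ZZ subspace_BB U V W ZZ_inter_BB)
  also have "qdim (ZZ p W V t) (sadd (ZZ p W U t) (BB p W V t)) = conn_rank (p + 1) U V W t" unfolding conn_rank_def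
  proof (rule qdim_iso[OF flin_dd])
    fix c assume c: "c : ZZ p W V t"
    show "dd c : ZZ (p + 1) V U t Int BB (p + 1) W U t"
    proof
      show "dd c : ZZ (p + 1) V U t" using ZZ_dd[OF c] by (auto intro!: ZZ_I simp: fs.subspace_0[OF subspace_Cc[OF U]])
      show "dd c : BB (p + 1) W U t" using ZZ_Cc[OF c] by (intro dd_BB U) simp
    qed
    show "dd c : BB (p + 1) V U t \<longleftrightarrow> c : sadd (ZZ p W U t) (BB p W V t)"
    proof
      assume "dd c : BB (p + 1) V U t"
      then obtain v u where vu: "v : Cc p V t" "u : Cc (p + 1) U t" "dd c = dd v + u" by (auto elim: BB_E)
      have "c - v : Cc p W t" using fs.subspace_diff[OF subspace_Cc[OF W] ZZ_Cc[OF c] Cc_VW[OF vu(1)]] .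
      moreover have "dd (c - v) = u" using vu by (simp add: dd_diff)
      ultimately have "c - v : ZZ p W U t" using vu by (auto intro: ZZ_I)
      then have "(c - v) + v : sadd (ZZ p W U t) (BB p W V t)" using Cc_BB[OF W vu(1)] by (rule saddI)
      then show "c : sadd (ZZ p W U t) (BB p W V t)" by simp
    next
      assume "c : sadd (ZZ p W U t) (BB p W V t)"
      then obtain z b where zb: "z : ZZ p W U t" "b : BB p W V t" "c = z + b" by (rule saddE)
      obtain w v where wv: "w : Cc (p - 1) W t" "v : Cc p V t" "b = dd w + v" using zb(2) by (rule BB_E)
      have "dd c = dd v + dd z" using zb wv by (simp add: dd_add)
      moreover have "dd v + dd z : BB (p + 1) V U t" using wv ZZ_dd[OF zb(1)] by (intro BB_I) auto
      ultimately show "dd c : BB (p + 1) V U t" by simp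
    qed
  next
    fix z assume z: "z : ZZ (p + 1) V U t Int BB (p + 1) W U t"
    then obtain w u where wu: "w : Cc p W t" "u : Cc (p + 1) U t" "z = dd w + u" by (auto elim: BB_E)
    have "dd w = z - u" using wu by simp
    also have "\<dots> : Cc (p + 1) V t" using z wu by (intro fs.subspace_diff[OF subspace_Cc[OF V]]) (auto intro: ZZ_Cc Cc_UV)
    finally have "w : ZZ p W V t" using wu by (intro ZZ_I)
    moreover have "dd w - z : BB (p + 1) V U t" using Cc_BB[OF V fs.subspace_neg[OF subspace_Cc[OF U] wu(2)]] wu by simp
    ultimately show "\<exists>w\<in>ZZ p W V t. dd w - z : BB (p + 1) V U t" by blast
  next
    show "sadd (ZZ p W U t) (BB p W V t) <= ZZ p W V t" by (intro sadd_least subspace_ZZ W V ZZ_UV BB_ZZ VW)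
  qed (intro subspace_ZZ subspace_BB U V W)+
  finally show ?thesis .
qed

text \<open>Exactness in additive form: the dimensions may be infinite at this stage, so ranks are
  added on the left instead of subtracted on the right.\<close>

theorem long_exact_sequence:
  "hh p W U t + conn_rank p U V W t + conn_rank (p + 1) U V W t = hh p V U t + hh p W V t"
  unfolding hh_sub_split[of p t] hh_mid_split[of p t] hh_quot_split[of p t] by (simp add: ac_simps)

lemma conn_rank_le_sub: "conn_rank p U V W t <= hh p V U t" unfolding hh_sub_split[of p t] by simp

lemma conn_rank_le_quot: "conn_rank (p + 1) U V W t <= hh p W V t" unfolding hh_quot_split[of p t] by simp

lemma hh_quot_le: "hh p W V t <= hh (p + 1) V U t + hh p W U t"
proof -
  have "hh p W V t <= conn_rank (p + 1) U V W t + hh p W U t"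
    unfolding hh_quot_split[of p t] hh_mid_split[of p t] by (intro add_mono) auto
  also have "\<dots> <= hh (p + 1) V U t + hh p W U t" by (intro add_mono conn_rank_le_sub) auto
  finally show ?thesis .
qed

lemma hh_sub_le: "hh (p + 1) V U t <= hh p W V t + hh (p + 1) W U t"
proof -
  have "hh (p + 1) V U t <= hh (p + 1) W U t + conn_rank (p + 1) U V W t"
    unfolding hh_sub_split[of "p + 1" t] hh_mid_split[of "p + 1" t] by (intro add_mono) auto
  also have "\<dots> <= hh (p + 1) W U t + hh p W V t" by (intro add_mono conn_rank_le_quot) auto
  finally show ?thesis by (simp add: add.commute)
qed

end

subsection \<open>Functoriality\<close>

definition eqv :: "(('n, 'k::field) lvec => ('n, 'k) lvec) => bool" where
  "eqv fv \<longleftrightarrow> flin fv & (\<forall>bv f. fv (sh bv f) = sh bv (fv f))"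

lemma eqv_flin: "eqv fv ==> flin fv"
  and eqv_sh: "eqv fv ==> fv (sh bv f) = sh bv (fv f)" by (simp_all add: eqv_def)

definition lift_c :: "(('n, 'k::field) lvec => ('n, 'k) lvec) => ('n, 'k) lcoch => ('n, 'k) lcoch" where
  "lift_c fv c = unsl (%S. fv (sl c S))"

lemma sl_lift_c [simp]: "sl (lift_c fv c) S = fv (sl c S)" by (simp add: lift_c_def)

lemma flin_lift_c:
  assumes f: "flin fv"
  shows "flin (lift_c fv)" by (rule flinI; rule sl_eqI) (simp_all only: sl_lift_c sl_add sl_scl flin_add[OF f] flin_scl[OF f])

lemma dd_lift_c:
  assumes f: "flin fv"
  shows "dd (lift_c fv c) = lift_c fv (dd c)" by (rule sl_eqI) (simp add: sl_dd flin_sum[OF f] flin_scl[OF f])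

text \<open>An equivariant map inducing isomorphisms \<open>V\<^sub>t/U\<^sub>t \<cong> V'\<^sub>t\<^sub>+\<^sub>e/U'\<^sub>t\<^sub>+\<^sub>e\<close>.\<close>

locale fam_iso =
  fixes fv :: "('n::{finite,linorder}, 'k::field) lvec => ('n, 'k) lvec"
    and V U V' U' :: "('n, 'k) fam" and e :: int
  assumes phi: "eqv fv" and gV: "gsub V" and gU: "gsub U" and gV': "gsub V'" and gU': "gsub U'"
    and sub: "!!t. U t <= V t" and sub': "!!t. U' t <= V' t"
    and map: "!!t v. v : V t ==> fv v : V' (t + e)"
    and ker: "!!t v. v : V t ==> fv v : U' (t + e) \<longleftrightarrow> v : U t"
    and surj: "!!t v'. v' : V' (t + e) ==> \<exists>v\<in>V t. fv v - v' : U' (t + e)"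
begin

lemmas lin = eqv_flin[OF phi]

lemma loc_map:
  assumes "v : loc V S t"
  shows "fv v : loc V' S (t + e)"
proof -
  obtain bv where b: "0 <= bv" "!!i. i ~: S ==> bv i = 0" "sh bv v : V (t + edeg bv)" using assms by (metis locE)
  have "sh bv (fv v) : V' ((t + e) + edeg bv)" using map[OF b(3)] by (simp add: eqv_sh[OF phi] algebra_simps)
  then show ?thesis by (intro locI[OF b(1,2)])
qed

lemma loc_ker:
  assumes v: "v : loc V S t"
  shows "fv v : loc U' S (t + e) \<longleftrightarrow> v : loc U S t"
proof
  obtain bv where b: "0 <= bv" "!!i. i ~: S ==> bv i = 0" "sh bv v : V (t + edeg bv)" using v by (metis locE)
  assume "fv v : loc U' S (t + e)"
  then obtain gv where g: "0 <= gv" "!!i. i ~: S ==> gv i = 0" "sh gv (fv v) : U' ((t + e) + edeg gv)" by (metis locE)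
  have "sh (gv + bv) v : V (t + edeg (gv + bv))" by (rule loc_shift_more[OF gV g(1) b(3)])
  moreover have "fv (sh (gv + bv) v) : U' (t + edeg (gv + bv) + e)"
    using loc_shift_more[OF gU' b(1) g(3)] by (simp add: eqv_sh[OF phi] algebra_simps)
  ultimately have "sh (gv + bv) v : U (t + edeg (gv + bv))" using ker by blast
  then show "v : loc U S t" by (intro locI[OF add_nonneg_nonneg[OF g(1) b(1)]]) (simp_all add: b(2) g(2))
next
  assume "v : loc U S t"
  then obtain bv where b: "0 <= bv" "!!i. i ~: S ==> bv i = 0" "sh bv v : U (t + edeg bv)" by (metis locE)
  have "sh bv v : V (t + edeg bv)" using b(3) sub by blast
  then have "fv (sh bv v) : U' (t + edeg bv + e)" using ker b(3) by blast
  then have "sh bv (fv v) : U' ((t + e) + edeg bv)" by (simp add: eqv_sh[OF phi] algebra_simps)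
  then show "fv v : loc U' S (t + e)" by (intro locI[OF b(1,2)])
qed

lemma loc_surj:
  assumes "v' : loc V' S (t + e)"
  shows "\<exists>v\<in>loc V S t. fv v - v' : loc U' S (t + e)"
proof -
  obtain bv where b: "0 <= bv" "!!i. i ~: S ==> bv i = 0" "sh bv v' : V' (t + e + edeg bv)" using assms by (metis locE)
  have "sh bv v' : V' (t + edeg bv + e)" using b(3) by (simp add: algebra_simps)
  then obtain v where v: "v : V (t + edeg bv)" "fv v - sh bv v' : U' (t + edeg bv + e)" using surj by blast
  have "sh (- bv) v : loc V S t" by (rule locI[OF b(1,2)]) (use v(1) in auto)
  moreover have "fv (sh (- bv) v) - v' : loc U' S (t + e)"
    by (rule locI[OF b(1,2)]) (use v(2) in \<open>auto simp: eqv_sh[OF phi] sh_diff algebra_simps\<close>)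
  ultimately show ?thesis by blast
qed

lemma Cc_map: "c : Cc p V t ==> lift_c fv c : Cc p V' (t + e)"
  by (rule CcI) (simp_all only: sl_lift_c loc_map Cc_loc Cc_zero flin_0[OF lin] not_False_eq_True)

lemma Cc_ker:
  assumes c: "c : Cc p V t"
  shows "lift_c fv c : Cc p U' (t + e) \<longleftrightarrow> c : Cc p U t"
proof
  assume a: "lift_c fv c : Cc p U' (t + e)"
  show "c : Cc p U t"
  proof (rule CcI)
    fix S :: "'n set" assume S: "int (card S) = p"
    have "fv (sl c S) : loc U' S (t + e)" using Cc_loc[OF a S] by simp
    then show "sl c S : loc U S t" using loc_ker[OF Cc_loc[OF c S]] by blast
  qed (rule Cc_zero[OF c])
next
  assume a: "c : Cc p U t"
  show "lift_c fv c : Cc p U' (t + e)"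
  proof (rule CcI)
    fix S :: "'n set" assume S: "int (card S) = p"
    show "sl (lift_c fv c) S : loc U' S (t + e)" using loc_ker[OF Cc_loc[OF c S]] Cc_loc[OF a S] by simp
  next
    fix S :: "'n set" assume S: "int (card S) ~= p"
    show "sl (lift_c fv c) S = 0" by (simp only: sl_lift_c Cc_zero[OF a S] flin_0[OF lin])
  qed
qed

lemma Cc_surj:
  assumes c': "c' : Cc p V' (t + e)"
  shows "\<exists>c\<in>Cc p V t. lift_c fv c - c' : Cc p U' (t + e)"
proof -
  have "\<forall>S. \<exists>v. int (card S) = p --> v : loc V S t & fv v - sl c' S : loc U' S (t + e)"
    using loc_surj[OF Cc_loc[OF c']] by blast
  then obtain f where f: "!!S. int (card S) = p ==> f S : loc V S t & fv (f S) - sl c' S : loc U' S (t + e)" by metis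
  define c where "c = unsl (%S. if int (card S) = p then f S else 0)"
  have "c : Cc p V t" by (rule CcI) (auto simp: c_def f)
  moreover have "lift_c fv c - c' : Cc p U' (t + e)"
  proof (rule CcI)
    fix S :: "'n set" assume S: "int (card S) = p"
    then show "sl (lift_c fv c - c') S : loc U' S (t + e)" using f[OF S] by (simp add: c_def sl_diff)
  next
    fix S :: "'n set" assume S: "int (card S) ~= p"
    then have "sl c S = 0" by (simp add: c_def zero_fun_def)
    then show "sl (lift_c fv c - c') S = 0" by (simp only: sl_diff sl_lift_c flin_0[OF lin] Cc_zero[OF c' S] diff_self)
  qed
  ultimately show ?thesis by blast
qed

text \<open>The locale assumptions survive inverse shifts, hence hold for localizations and
  cochains. A bounding cochain of \<open>V'\<close> lifts up to an error in \<open>U'\<close>, and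
  \<open>Cc_ker\<close> pulls that error back to \<open>U\<close>.\<close>

lemma hh_eq: "hh p V U t = hh p V' U' (t + e)" unfolding hh_def
proof (rule qdim_iso[OF flin_lift_c[OF lin]])
  fix c assume c: "c : ZZ p V U t"
  have "lift_c fv (dd c) : Cc (p + 1) U' (t + e)" using Cc_ker[OF dd_Cc[OF gV ZZ_Cc[OF c]]] ZZ_dd[OF c] by blast
  then show "lift_c fv c : ZZ p V' U' (t + e)" using Cc_map[OF ZZ_Cc[OF c]] by (intro ZZ_I) (simp_all add: dd_lift_c[OF lin])
  show "lift_c fv c : BB p V' U' (t + e) \<longleftrightarrow> c : BB p V U t"
  proof
    assume "lift_c fv c : BB p V' U' (t + e)"
    then obtain w' u' where w': "w' : Cc (p - 1) V' (t + e)" "u' : Cc p U' (t + e)" "lift_c fv c = dd w' + u'" by (rule BB_E)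
    obtain w where w: "w : Cc (p - 1) V t" "lift_c fv w - w' : Cc (p - 1) U' (t + e)" using Cc_surj[OF w'(1)] by blast
    have dw: "dd w : Cc p V t" using dd_Cc[OF gV w(1)] by simp
    have cw: "c - dd w : Cc p V t" by (rule fs.subspace_diff[OF subspace_Cc[OF gV] ZZ_Cc[OF c] dw])
    have "lift_c fv (c - dd w) = u' - dd (lift_c fv w - w')"
      using w'(3) by (simp add: flin_diff[OF flin_lift_c[OF lin]] dd_lift_c[OF lin] dd_diff)
    also have "\<dots> : Cc p U' (t + e)" using dd_Cc[OF gU' w(2)] w'(2) by (intro fs.subspace_diff[OF subspace_Cc[OF gU']]) auto
    finally have "c - dd w : Cc p U t" using Cc_ker[OF cw] by blast
    then have "dd w + (c - dd w) : BB p V U t" by (rule BB_I[OF w(1)])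
    then show "c : BB p V U t" by simp
  next
    assume "c : BB p V U t"
    then obtain w u where w: "w : Cc (p - 1) V t" "u : Cc p U t" "c = dd w + u" by (rule BB_E)
    have "u : Cc p V t" using Cc_mono[of U V, OF sub] w(2) by blast
    then have "lift_c fv u : Cc p U' (t + e)" using Cc_ker w(2) by blast
    then have "dd (lift_c fv w) + lift_c fv u : BB p V' U' (t + e)" by (rule BB_I[OF Cc_map[OF w(1)]])
    then show "lift_c fv c : BB p V' U' (t + e)" using w(3) by (simp add: flin_add[OF flin_lift_c[OF lin]] dd_lift_c[OF lin])
  qed
next
  fix z' assume z': "z' : ZZ p V' U' (t + e)"
  obtain c where c: "c : Cc p V t" "lift_c fv c - z' : Cc p U' (t + e)" using Cc_surj[OF ZZ_Cc[OF z']] by blast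
  have "lift_c fv (dd c) = dd (lift_c fv c - z') + dd z'" by (simp add: dd_lift_c[OF lin] dd_diff)
  also have "\<dots> : Cc (p + 1) U' (t + e)" by (intro fs.subspace_add[OF subspace_Cc[OF gU']] dd_Cc[OF gU'] c(2) ZZ_dd[OF z'])
  finally have "dd c : Cc (p + 1) U t" using Cc_ker[OF dd_Cc[OF gV c(1)]] by blast
  then have "c : ZZ p V U t" by (rule ZZ_I[OF c(1)])
  moreover have "lift_c fv c - z' : BB p V' U' (t + e)" by (rule Cc_BB[OF gV' c(2)])
  ultimately show "\<exists>c\<in>ZZ p V U t. lift_c fv c - z' : BB p V' U' (t + e)" by blast
qed (intro subspace_ZZ subspace_BB BB_ZZ gV gU gV' gU' sub)+

end

subsection \<open>Torsion\<close>

text \<open>Every element of \<open>V/U\<close> is killed by a power of the maximal ideal, since for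
  N >= 0 the monomials of degree at least N generate the N-th power.\<close>

definition tors :: "('n::finite, 'k::field) fam => ('n, 'k) fam => bool" where
  "tors V U \<longleftrightarrow> (\<forall>t. \<forall>v\<in>V t. \<exists>N. \<forall>bv. 0 <= bv --> N <= edeg bv --> sh bv v : U (t + edeg bv))"

definition mono_exp :: "'n => nat => 'n => int" where
  "mono_exp i m = (%j. if j = i then int m else 0)"

lemma mono_exp_nonneg: "0 <= mono_exp i m" by (auto simp: mono_exp_def le_fun_def)

lemma edeg_mono_exp [simp]: "edeg (mono_exp i m) = int m" by (simp add: edeg_def mono_exp_def)

text \<open>A high power of a single variable of \<open>S\<close> already carries an element of
  \<open>V\<close> into \<open>U\<close>.\<close>

lemma tors_loc:
  assumes T: "tors V U" and UV: "!!t. U t <= V t" and S: "S ~= {}"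
  shows "loc V S t = loc U S t"
proof
  show "loc U S t <= loc V S t" by (rule loc_mono[OF UV])
  show "loc V S t <= loc U S t"
  proof
    fix v assume "v : loc V S t"
    then obtain bv where b: "0 <= bv" "!!i. i ~: S ==> bv i = 0" "sh bv v : V (t + edeg bv)" by (metis locE)
    obtain N where N: "!!gv. 0 <= gv ==> N <= edeg gv ==> sh gv (sh bv v) : U (t + edeg bv + edeg gv)"
      using T b(3) unfolding tors_def by blast
    obtain i where i: "i : S" using S by blast
    let ?g = "mono_exp i (nat N)"
    have "sh ?g (sh bv v) : U (t + edeg bv + edeg ?g)" by (rule N) (simp_all add: mono_exp_nonneg)
    then have "sh (?g + bv) v : U (t + edeg (?g + bv))" by (simp add: sh_sh algebra_simps)
    moreover have "(?g + bv) j = 0" if "j ~: S" for j using that i b(2)[OF that] by (auto simp: mono_exp_def)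
    ultimately show "v : loc U S t" by (intro locI[OF add_nonneg_nonneg[OF mono_exp_nonneg b(1)]])
  qed
qed

lemma tors_Cc:
  assumes "tors V U" "!!t. U t <= V t" "p ~= 0"
  shows "Cc p V t = Cc p U t"
proof -
  have "S ~= {}" if "int (card S) = p" for S :: "'a set" using that assms(3) by auto
  then have "loc V S t = loc U S t" if "int (card S) = p" for S using that tors_loc[OF assms(1,2)] by blast
  then show ?thesis unfolding Cc_def by auto
qed

lemma hh_tors:
  assumes T: "tors V U" and UV: "!!t. U t <= V t" and "gsub V" "gsub U" "p ~= 0"
  shows "hh p V U t = 0" unfolding hh_def qdim_eq_0_iff[OF subspace_BB[OF assms(3,4)]]
  using tors_Cc[OF T UV assms(5)] ZZ_Cc Cc_BB[OF assms(3)] by blast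

text \<open>A 0-cochain is a single element of \<open>V\<close>, because localizing at the empty set
  changes nothing.\<close>

lemma hh_0_le: 
  assumes V: "gsub V" and U: "gsub U"
  shows "hh 0 V U t <= qdim (V t) (U t)" unfolding hh_def
proof (rule qdim_inj[OF flin_sl[of "{}"] subspace_ZZ[OF V U] gsub_subspace[OF U]])
  fix c assume c: "c : ZZ 0 V U t"
  show "sl c {} : V t" using Cc_loc[OF ZZ_Cc[OF c], of "{}"] by (simp add: loc_empty)
  assume "sl c {} : U t"
  then have "c : Cc 0 U t" using Cc_zero[OF ZZ_Cc[OF c]] by (intro CcI) (auto simp: loc_empty)
  then show "c : BB 0 V U t" by (rule Cc_BB[OF V])
qed

text \<open>For a torsion quotient all 1-cochains of \<open>V\<close> are cochains of
  \<open>U\<close>, so every element of \<open>V\<close> is a cocycle.\<close>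

lemma hh_0_tors:
  assumes T: "tors V U" and UV: "!!t. U t <= V t" and V: "gsub V" and U: "gsub U"
  shows "hh 0 V U t = qdim (V t) (U t)"
proof (rule antisym[OF hh_0_le[OF V U]])
  show "qdim (V t) (U t) <= hh 0 V U t" unfolding hh_def
  proof (rule qdim_surj[OF flin_sl[of "{}"] gsub_subspace[OF U]])
    fix b assume "b : BB 0 V U t"
    then obtain w u where w: "w : Cc (- 1) V t" "u : Cc 0 U t" "b = dd w + u" by (auto elim: BB_E)
    have "w = 0" by (rule sl_eqI) (simp add: Cc_zero[OF w(1)])
    then show "sl b {} : U t" using Cc_loc[OF w(2), of "{}"] w(3) by (simp add: loc_empty)
  next
    fix v assume v: "v : V t"
    define c where "c = unsl (%S. if S = {} then v else 0)"
    have "c : Cc 0 V t" by (rule CcI) (use v in \<open>auto simp: c_def loc_empty\<close>)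
    moreover from this have "dd c : Cc 1 U t" using dd_Cc[OF V, of c 0 t] tors_Cc[OF T UV, of 1 t] by simp
    ultimately have "c : ZZ 0 V U t" by (intro ZZ_I) auto
    then show "\<exists>z\<in>ZZ 0 V U t. sl z {} - v : U t"
      by (rule bexI[rotated]) (simp add: c_def fs.subspace_0[OF gsub_subspace[OF U]])
  qed
qed

lemma hh_out_of_range:
  fixes V U :: "('n::{finite,linorder}, 'k::field) fam"
  assumes "p < 0 | int CARD('n) < p" "gsub V" "gsub U"
  shows "hh p V U t = 0"
proof -
  have "c = 0" if "c : Cc p V t" for c
  proof (rule sl_eqI)
    fix S :: "'n set"
    have "card S <= CARD('n)" by (rule card_mono) auto
    then have "int (card S) ~= p" using assms(1) by auto
    then show "sl c S = sl 0 S" using Cc_zero[OF that] by simp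
  qed
  then have "ZZ p V U t <= BB p V U t" using ZZ_Cc fs.subspace_0[OF subspace_BB[OF assms(2,3)]] by blast
  then show ?thesis unfolding hh_def qdim_eq_0_iff[OF subspace_BB[OF assms(2,3)]] .
qed

section \<open>Graded free modules and their local cohomology\<close>

text \<open>Indexes the monomial basis in degree \<open>t\<close> of the free module with shifts
  \<open>a\<close>.\<close>

definition fr_index :: "int list => int => (nat \<times> ('n::finite => int)) set" where
  "fr_index a t = {(j, av). j < length a & 0 <= av & edeg av = t - a ! j}"

definition fr :: "int list => ('n::finite, 'k::field) fam" where
  "fr a t = funs_on (fr_index a t)"

lemma fr_index_iff: "(j, av) : fr_index a t \<longleftrightarrow> j < length a & 0 <= av & edeg av = t - a ! j"
  by (simp add: fr_index_def)

lemma fr_iff: "v : fr a t \<longleftrightarrow> (\<forall>j av. v (j, av) ~= 0 --> j < length a & 0 <= av & edeg av = t - a ! j)"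
  by (auto simp: fr_def funs_on_def fr_index_iff)

lemma finite_nonneg_edeg: "finite {av :: 'n::finite => int. 0 <= av & edeg av = d}"
proof (rule finite_subset)
  show "{av :: 'n => int. 0 <= av & edeg av = d} <= Pi\<^sub>E UNIV (%_. {0..d})"
  proof
    fix av :: "'n => int" assume "av : {av. 0 <= av & edeg av = d}"
    then have a: "!!i. 0 <= av i" "(\<Sum>i\<in>UNIV. av i) = d" by (auto simp: le_fun_def edeg_def)
    have "av i <= d" for i using a(1) member_le_sum[of i UNIV av] a(2) by auto
    then show "av : Pi\<^sub>E UNIV (%_. {0..d})" using a(1) by auto
  qed
  show "finite (Pi\<^sub>E (UNIV :: 'n set) (%_. {0..d}))" by (rule finite_PiE) auto
qed

lemma finite_fr_index: "finite (fr_index a t)"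
proof (rule finite_subset)
  show "fr_index a t <= (SIGMA j:{..<length a}. {av. 0 <= av & edeg av = t - a ! j})" by (auto simp: fr_index_def)
  show "finite (SIGMA j:{..<length a}. {av :: 'a => int. 0 <= av & edeg av = t - a ! j})"
    by (rule finite_SigmaI) (auto intro: finite_nonneg_edeg)
qed

lemma fr_finite_support: "v : fr a t ==> finite {x. v x ~= 0}"
  by (rule finite_subset[OF _ finite_fr_index[of a t]]) (auto simp: fr_def funs_on_def)

lemma nonneg_add_shift: "0 <= av - bv ==> 0 <= bv ==> 0 <= (av :: 'n => int)" by (auto simp: le_fun_def) (metis order_trans)

lemma gsub_fr: "gsub (fr a)" unfolding gsub_def
proof (intro conjI allI impI)
  show "fs.subspace (fr a t)" for t unfolding fr_def by (rule subspace_funs_on)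
  fix t and bv :: "'a => int" and v :: "('a, 'b) lvec" assume b: "0 <= bv" and v: "v : fr a t"
  show "sh bv v : fr a (t + edeg bv)" unfolding fr_iff
  proof (intro allI impI)
    fix j av assume "sh bv v (j, av) ~= 0"
    then have "v (j, av - bv) ~= 0" by simp
    then have *: "j < length a" "0 <= av - bv" "edeg (av - bv) = t - a ! j" using v unfolding fr_iff by blast+
    show "j < length a & 0 <= av & edeg av = t + edeg bv - a ! j" using *(1,3) nonneg_add_shift[OF *(2) b] by simp
  qed
qed

definition zf :: "('n, 'k::zero) fam" where
  "zf t = {%_. 0}"

lemma zf_eq: "zf t = {0}" by (simp add: zf_def zero_fun_def)

lemma gsub_zf: "gsub zf" unfolding gsub_def zf_eq using subspace_zero by auto

lemma zf_sub: "gsub V ==> zf t <= V t" by (simp add: zf_eq fs.subspace_0[OF gsub_subspace])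

lemma loc_zf: "loc zf S t = {0}"
proof -
  have "v = 0" if v: "v : loc zf S t" for v
  proof -
    obtain bv where "sh bv v = 0" using v unfolding loc_def zf_eq by blast
    then have "sh (- bv) (sh bv v) = sh (- bv) 0" by (simp only:)
    then show "v = 0" by (simp only: sh_minus sh_zero)
  qed
  then show ?thesis using fs.subspace_0[OF subspace_loc[OF gsub_zf]] by auto
qed

lemma Cc_zf: "Cc p zf t = {0}"
proof -
  have "c = 0" if "c : Cc p zf t" for c
  proof (rule sl_eqI)
    fix S show "sl c S = sl 0 S"
      using Cc_loc[OF that, of S] Cc_zero[OF that, of S] by (cases "int (card S) = p") (auto simp: loc_zf)
  qed
  then show ?thesis using fs.subspace_0[OF subspace_Cc[OF gsub_zf]] by auto
qed

text \<open>Localizing at \<open>S\<close> allows negative exponents exactly there; conversely,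
  finite support lets one monomial clear all denominators.\<close>

lemma loc_fr_iff:
  "v : loc (fr a) S t \<longleftrightarrow> finite {x. v x ~= 0} \<and>
    (\<forall>j av. v (j, av) ~= 0 --> j < length a & (\<forall>i. i ~: S --> 0 <= av i) & edeg av = t - a ! j)"
  (is "_ \<longleftrightarrow> ?F v & ?Q v")
proof
  assume "v : loc (fr a) S t"
  then obtain bv where b: "0 <= bv" "!!i. i ~: S ==> bv i = 0" "sh bv v : fr a (t + edeg bv)" by (metis locE)
  have *: "j < length a & 0 <= av + bv & edeg (av + bv) = t + edeg bv - a ! j" if "v (j, av) ~= 0" for j av
  proof -
    have "sh bv v (j, av + bv) ~= 0" using that by simp
    then show ?thesis using b(3) unfolding fr_iff by blast
  qed
  have "?Q v"
  proof (intro allI impI)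
    fix j av assume v: "v (j, av) ~= 0"
    have "0 <= av i" if "i ~: S" for i using *[OF v] b(2)[OF that] by (auto simp: le_fun_def dest: spec[of _ i])
    then show "j < length a & (\<forall>i. i ~: S --> 0 <= av i) & edeg av = t - a ! j" using *[OF v] by simp
  qed
  moreover have "?F v"
  proof (rule finite_subset)
    show "{x. v x ~= 0} <= (%(j, av). (j, av - bv)) ` {x. sh bv v x ~= 0}"
    proof
      fix x assume "x : {x. v x ~= 0}"
      then have "sh bv v (fst x, snd x + bv) ~= 0" by (cases x) simp
      then show "x : (%(j, av). (j, av - bv)) ` {x. sh bv v x ~= 0}"
        by (intro image_eqI[of _ _ "(fst x, snd x + bv)"]) (cases x, auto)
    qed
    show "finite ((%(j, av). (j, av - bv)) ` {x. sh bv v x ~= 0})" by (rule finite_imageI[OF fr_finite_support[OF b(3)]])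
  qed
  ultimately show "?F v & ?Q v" by blast
next
  assume "?F v & ?Q v"
  then have F: "?F v" and Q: "?Q v" by blast+
  \<comment> \<open>A common bound for the absolute values of all exponents in the support;
    multiplying by the \<open>m\<close>-th power of each variable of \<open>S\<close> makes them
    nonnegative.\<close>
  define m where "m = (\<Sum>x | v x ~= 0. \<Sum>i\<in>UNIV. \<bar>snd x i\<bar>)"
  define bv where "bv = (%i. if i : S then m else 0)"
  have m: "\<bar>av i\<bar> <= m" if "v (j, av) ~= 0" for j av i
  proof -
    have "\<bar>av i\<bar> <= (\<Sum>i\<in>UNIV. \<bar>snd (j, av) i\<bar>)" using member_le_sum[of i UNIV "%i. \<bar>av i\<bar>"] by simp
    also have "\<dots> <= m" unfolding m_def
      by (rule member_le_sum[where f = "%x. \<Sum>i\<in>UNIV. \<bar>snd x i\<bar>"]) (use that F in \<open>auto intro: sum_nonneg\<close>)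
    finally show ?thesis .
  qed
  have m0: "0 <= m" unfolding m_def by (intro sum_nonneg) auto
  show "v : loc (fr a) S t"
  proof (rule locI[of bv])
    show "0 <= bv" using m0 by (auto simp: bv_def le_fun_def)
    show "bv i = 0" if "i ~: S" for i using that by (simp add: bv_def)
    show "sh bv v : fr a (t + edeg bv)" unfolding fr_iff
    proof (intro allI impI)
      fix j av assume "sh bv v (j, av) ~= 0"
      then have v: "v (j, av - bv) ~= 0" by simp
      have "0 <= av i" for i
      proof (cases "i : S")
        case True
        then show ?thesis using m[OF v, of i] by (auto simp: bv_def)
      next
        case False
        then show ?thesis using Q[rule_format, OF v] by (auto simp: bv_def)
      qed
      then show "j < length a & 0 <= av & edeg av = t + edeg bv - a ! j" using Q[rule_format, OF v] by (auto simp: le_fun_def)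
    qed
  qed
qed

text \<open>A contracting homotopy in all multidegrees \<open>av\<close> having a nonnegative entry: insert the chosen
  variable \<open>pick av\<close>.\<close>

definition pick :: "('n => int) => 'n" where
  "pick av = (SOME i. 0 <= av i)"

definition htp :: "('n::{finite,linorder}, 'k::field) lcoch => ('n, 'k) lcoch" where
  "htp c = (%(S, j, av). if (\<exists>i. 0 <= av i) & pick av ~: S
     then sg (insert (pick av) S) (pick av) * c (insert (pick av) S, j, av) else 0)"

lemma pick_nonneg: "\<exists>i. 0 <= av i ==> 0 <= av (pick av)" unfolding pick_def by (rule someI_ex)

lemma sg_sq: "sg S v * (sg S v * x) = (x :: 'k::field)" by (simp add: sg_def mult.assoc[symmetric] power_mult_distrib[symmetric])

lemma sg_swap:
  fixes T :: "'n::{finite,linorder} set"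
  assumes "v : T" "i : T" "v ~= i"
  shows "(sg (T - {i}) v :: 'k::field) * sg (T - {v}) i = - (sg T i * sg T v)"
proof (cases "v < i")
  case True
  then show ?thesis using sg_remove_less[OF assms(1) True, where 'k = 'k] by (simp add: mult.commute)
next
  case False
  then have "i < v" using assms by auto
  then show ?thesis using sg_remove_less[OF assms(2), where 'k = 'k] by simp
qed

text \<open>If the picked index lies in \<open>S\<close>, only the term removing it survives and
  gives back \<open>c\<close>; if not, the two sums cancel up to the term \<open>c\<close> by the
  sign rule \<open>sg_swap\<close>.\<close>

lemma htp_homotopy:
  fixes c :: "('n::{finite,linorder}, 'k::field) lcoch"
  assumes a: "\<exists>i. 0 <= av i"
  shows "dd (htp c) (S, j, av) + htp (dd c) (S, j, av) = c (S, j, av)"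
proof -
  define i where "i = pick av"
  have ddh: "dd (htp c) (S, j, av) = (\<Sum>v\<in>S. sg S v * (if i ~: S - {v}
      then sg (insert i (S - {v})) i * c (insert i (S - {v}), j, av) else 0))"
    using a by (simp add: dd_def htp_def i_def cong: if_cong)
  show ?thesis
  proof (cases "i : S")
    case True
    have "dd (htp c) (S, j, av) = (\<Sum>v\<in>S. if v = i then c (S, j, av) else 0)" unfolding ddh
    proof (rule sum.cong[OF refl])
      fix v assume "v : S"
      show "sg S v * (if i ~: S - {v} then sg (insert i (S - {v})) i * c (insert i (S - {v}), j, av) else 0)
          = (if v = i then c (S, j, av) else 0)" using True by (auto simp: insert_absorb sg_sq)
    qed
    also have "\<dots> = c (S, j, av)" using True by simp
    moreover have "htp (dd c) (S, j, av) = 0" using True by (simp add: htp_def i_def)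
    ultimately show ?thesis by simp
  next
    case False
    let ?T = "insert i S"
    have "htp (dd c) (S, j, av) = sg ?T i * (\<Sum>v\<in>?T. sg ?T v * c (?T - {v}, j, av))"
      using False a by (simp add: htp_def i_def[symmetric] dd_def)
    also have "\<dots> = sg ?T i * (sg ?T i * c (S, j, av)) + (\<Sum>v\<in>S. sg ?T i * (sg ?T v * c (?T - {v}, j, av)))"
      using False by (simp add: distrib_left sum_distrib_left)
    also have "\<dots> = c (S, j, av) + (\<Sum>v\<in>S. sg ?T i * (sg ?T v * c (?T - {v}, j, av)))" by (simp add: sg_sq)
    finally have 1: "htp (dd c) (S, j, av) = c (S, j, av) + (\<Sum>v\<in>S. sg ?T i * (sg ?T v * c (?T - {v}, j, av)))" .
    have "dd (htp c) (S, j, av) = (\<Sum>v\<in>S. - (sg ?T i * (sg ?T v * c (?T - {v}, j, av))))" unfolding ddh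
    proof (rule sum.cong[OF refl])
      fix v assume v: "v : S"
      have vi: "v ~= i" using v False by auto
      have e: "insert i (S - {v}) = ?T - {v}" "?T - {i} = S" using vi False by auto
      have "(sg S v :: 'k) * sg (?T - {v}) i = - (sg ?T i * sg ?T v)" using sg_swap[of v ?T i, where 'k = 'k] v vi e(2) by simp
      then show "sg S v * (if i ~: S - {v} then sg (insert i (S - {v})) i * c (insert i (S - {v}), j, av) else 0)
          = - (sg ?T i * (sg ?T v * c (?T - {v}, j, av)))" using False e(1) by (simp add: mult.assoc[symmetric])
    qed
    then show ?thesis using 1 by (simp add: sum_negf)
  qed
qed

lemma htp_Cc:
  assumes c: "c : Cc p (fr a) t"
  shows "htp c : Cc (p - 1) (fr a) t"
proof (rule CcI)
  fix S :: "'a set" assume S: "int (card S) = p - 1"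
  show "sl (htp c) S : loc (fr a) S t" unfolding loc_fr_iff
  proof
    have f: "finite {x. sl c (insert i S) x ~= 0}" for i
    proof (cases "int (card (insert i S)) = p")
      case True
      then show ?thesis using Cc_loc[OF c True] by (simp add: loc_fr_iff)
    next
      case False
      then show ?thesis using Cc_zero[OF c False] by simp
    qed
    have "{x. sl (htp c) S x ~= 0} <= (\<Union>i. {x. sl c (insert i S) x ~= 0})" by (auto simp: sl_def htp_def split: if_splits)
    then show "finite {x. sl (htp c) S x ~= 0}" by (rule finite_subset) (use f in auto)
    show "\<forall>j av. sl (htp c) S (j, av) ~= 0 --> j < length a & (\<forall>i. i ~: S --> 0 <= av i) & edeg av = t - a ! j"
    proof (intro allI impI)
      fix j av assume "sl (htp c) S (j, av) ~= 0"
      then have *: "\<exists>i. 0 <= av i" "pick av ~: S" "sl c (insert (pick av) S) (j, av) ~= 0"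
        by (auto simp: sl_def htp_def split: if_splits)
      have "int (card (insert (pick av) S)) = p" using *(2) S by simp
      from Cc_loc[OF c this] *(3) have "j < length a" "!!i. i ~: insert (pick av) S ==> 0 <= av i" "edeg av = t - a ! j"
        unfolding loc_fr_iff by blast+
      then show "j < length a & (\<forall>i. i ~: S --> 0 <= av i) & edeg av = t - a ! j"
        using pick_nonneg[OF *(1)] by (metis insertE)
    qed
  qed
next
  fix S :: "'a set" assume S: "int (card S) ~= p - 1"
  have "htp c (S, j, av) = 0" for j av
  proof (cases "(\<exists>i. 0 <= av i) & pick av ~: S")
    case True
    then have "int (card (insert (pick av) S)) ~= p" using S by simp
    then have "sl c (insert (pick av) S) (j, av) = 0" using Cc_zero[OF c] by simp
    then show ?thesis by (simp add: htp_def sl_def)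
  next
    case False
    then show ?thesis by (auto simp: htp_def)
  qed
  then show "sl (htp c) S = 0" by (auto simp: sl_def fun_eq_iff)
qed

lemma htp_0: "htp 0 = 0" by (auto simp: htp_def fun_eq_iff)

text \<open>The homotopy settles all multidegrees with a nonnegative entry, and the others are
  excluded by the hypothesis \<open>neg\<close>.\<close>

lemma cocycle_exact:
  assumes "dd c = 0" and neg: "!!S j av. (!!i. av i < 0) ==> c (S, j, av) = 0"
  shows "c = dd (htp c)"
proof
  fix y :: "'a set \<times> nat \<times> ('a => int)"
  obtain S j av where y: "y = (S, j, av)" by (metis prod_cases3)
  show "c y = dd (htp c) y"
  proof (cases "\<exists>i. 0 <= av i")
    case True
    from htp_homotopy[OF True, of c S j] assms(1) show ?thesis by (simp add: y htp_0)
  next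
    case False
    then have "dd (htp c) y = 0" by (simp add: y dd_def htp_def)
    moreover have "c y = 0" unfolding y by (rule neg) (use False not_le in blast)
    ultimately show ?thesis by simp
  qed
qed

text \<open>An exponent with only negative entries lives solely in the localization at all
  variables, that is, in cochain degree n.\<close>

lemma fr_cochain_neg:
  fixes c :: "('n::{finite,linorder}, 'k::field) lcoch"
  assumes c: "c : Cc p (fr a) t" and S: "S ~= UNIV | p ~= int CARD('n)" and a: "!!i. av i < 0"
  shows "c (S, j, av) = 0"
proof (rule ccontr)
  assume n: "c (S, j, av) ~= 0"
  then have "sl c S ~= 0" by (auto simp: sl_def fun_eq_iff)
  then have cS: "int (card S) = p" using Cc_zero[OF c] by blast
  then have "S ~= UNIV" using S by auto
  then obtain i where i: "i ~: S" by blast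
  have "sl c S (j, av) ~= 0" using n by (simp add: sl_def)
  then have "0 <= av i" using Cc_loc[OF c cS] i unfolding loc_fr_iff by blast
  then show False using a[of i] by simp
qed

lemma hh_fr_below:
  assumes p: "p < int CARD('n)"
  shows "hh p (fr a :: ('n::{finite,linorder}, 'k::field) fam) zf t = 0"
  unfolding hh_def qdim_eq_0_iff[OF subspace_BB[OF gsub_fr gsub_zf]]
proof
  fix c :: "('n, 'k) lcoch" assume c: "c : ZZ p (fr a) zf t"
  have "dd c = 0" using ZZ_dd[OF c] by (simp add: Cc_zf)
  then have "c = dd (htp c)" by (rule cocycle_exact) (use p fr_cochain_neg[OF ZZ_Cc[OF c]] in auto)
  moreover have "dd (htp c) : BB p (fr a) zf t" by (rule dd_BB[OF gsub_zf htp_Cc[OF ZZ_Cc[OF c]]])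
  ultimately show "c : BB p (fr a) zf t" by simp
qed

text \<open>Coboundaries come from cochain degree n - 1, where no exponent is negative throughout;
  elsewhere the homotopy applies. Hence H^n of a free module is given by the monomials with all
  exponents negative.\<close>

lemma top_coboundary_iff:
  fixes c :: "('n::{finite,linorder}, 'k::field) lcoch"
  assumes c: "c : Cc (int CARD('n)) (fr a) t"
  shows "c : dd ` Cc (int CARD('n) - 1) (fr a) t \<longleftrightarrow> (\<forall>j av. (\<forall>i. av i < 0) --> sl c UNIV (j, av) = 0)"
proof
  assume "c : dd ` Cc (int CARD('n) - 1) (fr a) t"
  then obtain w where w: "w : Cc (int CARD('n) - 1) (fr a) t" "c = dd w" by blast
  show "\<forall>j av. (\<forall>i. av i < 0) --> sl c UNIV (j, av) = 0"
  proof (intro allI impI)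
    fix j and av :: "'n => int" assume "\<forall>i. av i < 0"
    then have "w (S, j, av) = 0" for S by (intro fr_cochain_neg[OF w(1)]) auto
    then show "sl c UNIV (j, av) = 0" by (simp add: w(2) sl_def dd_def)
  qed
next
  assume a: "\<forall>j av. (\<forall>i. av i < 0) --> sl c UNIV (j, av) = 0"
  have "dd c : Cc (int CARD('n) + 1) (fr a) t" by (rule dd_Cc[OF gsub_fr c])
  then have "sl (dd c) S = 0" for S by (rule Cc_zero) (use card_mono[of UNIV S] in auto)
  then have "dd c = 0" by (intro sl_eqI) simp
  then have "c = dd (htp c)"
  proof (rule cocycle_exact)
    fix S j and av :: "'n => int" assume al: "!!i. av i < 0"
    show "c (S, j, av) = 0" using a al fr_cochain_neg[OF c, of S av j] by (cases "S = UNIV") (auto simp: sl_def)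
  qed
  then show "c : dd ` Cc (int CARD('n) - 1) (fr a) t" using htp_Cc[OF c] by blast
qed

text \<open>Indexes the monomial basis of H^n of the free module in degree \<open>t\<close>.\<close>

definition neg_index :: "int list => int => (nat \<times> ('n::finite => int)) set" where
  "neg_index a t = {(j, av). j < length a & (\<forall>i. av i < 0) & edeg av = t - a ! j}"

lemma edeg_neg: "(!!i. av i < 0) ==> edeg av <= - int CARD('n)" for av :: "'n::finite => int"
proof -
  assume a: "!!i. av i < 0"
  have "av i <= - 1" for i using a[of i] by simp
  then have "edeg av <= (\<Sum>i\<in>(UNIV :: 'n set). - 1)" unfolding edeg_def by (intro sum_mono)
  then show ?thesis by simp
qed

lemma finite_neg_index: "finite (neg_index a t :: (nat \<times> ('n::finite => int)) set)"
proof (rule finite_subset)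
  show "neg_index a t <= (SIGMA j:{..<length a}. uminus ` {av :: 'n => int. 0 <= av & edeg av = a ! j - t})"
  proof
    fix x :: "nat \<times> ('n => int)" assume "x : neg_index a t"
    then obtain j av where x: "x = (j, av)" "j < length a" "!!i. av i < 0" "edeg av = t - a ! j" by (auto simp: neg_index_def)
    have "0 <= - av & edeg (- av) = a ! j - t" using x(3,4) by (auto simp: le_fun_def less_imp_le)
    then have "av : uminus ` {av. 0 <= av & edeg av = a ! j - t}" by (intro image_eqI[of _ _ "- av"]) simp_all
    then show "x : (SIGMA j:{..<length a}. uminus ` {av. 0 <= av & edeg av = a ! j - t})" using x by simp
  qed
  show "finite (SIGMA j:{..<length a}. uminus ` {av :: 'n => int. 0 <= av & edeg av = a ! j - t})"
    by (rule finite_SigmaI) (auto intro: finite_nonneg_edeg)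
qed

lemma hh_fr_top_le:
  "hh (int CARD('n)) (fr a :: ('n::{finite,linorder}, 'k::field) fam) zf t
    <= enat (card (neg_index a t :: (nat \<times> ('n => int)) set))"
proof -
  let ?n = "int CARD('n)" and ?I = "neg_index a t :: (nat \<times> ('n => int)) set"
  define f :: "('n, 'k) lcoch => ('n, 'k) lvec" where "f c = (%x. if x : ?I then c (UNIV, x) else 0)" for c
  have f: "flin f" by (rule flinI) (auto simp: f_def fun_eq_iff)
  have "hh ?n (fr a :: ('n, 'k) fam) zf t <= qdim (funs_on ?I :: ('n, 'k) lvec set) {0}" unfolding hh_def
  proof (rule qdim_inj[OF f subspace_ZZ[OF gsub_fr gsub_zf] subspace_zero])
    fix c :: "('n, 'k) lcoch" assume c: "c : ZZ ?n (fr a) zf t"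
    show "f c : funs_on ?I" by (simp add: f_def funs_on_def)
    assume "f c : {0}"
    then have f0: "f c = 0" by simp
    have U: "sl c UNIV : loc (fr a) UNIV t" by (rule Cc_loc[OF ZZ_Cc[OF c]]) simp
    have "sl c UNIV (j, av) = 0" if al: "\<forall>i. av i < 0" for j av
    proof (rule ccontr)
      assume n: "sl c UNIV (j, av) ~= 0"
      then have "(j, av) : ?I" using U al unfolding loc_fr_iff neg_index_def by blast
      then show False using fun_cong[OF f0, of "(j, av)"] n by (simp add: f_def sl_def)
    qed
    then have "c : dd ` Cc (?n - 1) (fr a) t" using top_coboundary_iff[OF ZZ_Cc[OF c]] by blast
    then show "c : BB ?n (fr a) zf t" using dd_BB[OF gsub_zf] by blast
  qed
  also have "\<dots> <= enat (card ?I)" by (rule qdim_funs_on_le[OF finite_neg_index])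
  finally show ?thesis .
qed

lemma enat_bounded: "x <= enat m ==> x ~= \<infinity>" by (cases x) auto

lemma hh_fr_finite: "hh p (fr a :: ('n::{finite,linorder}, 'k::field) fam) zf t ~= \<infinity>"
proof (cases "p = int CARD('n)")
  case True
  show ?thesis using enat_bounded[OF hh_fr_top_le[of a t, where 'n = 'n and 'k = 'k]] True by simp
next
  case False
  then have "hh p (fr a :: ('n, 'k) fam) zf t = 0"
    using hh_fr_below[of p a t] hh_out_of_range[OF _ gsub_fr gsub_zf, of p a t] by (metis linorder_neqE)
  then show ?thesis by simp
qed

lemma hh_fr_eventually_0:
  "\<exists>t0. \<forall>t\<ge>t0. \<forall>p. hh p (fr a :: ('n::{finite,linorder}, 'k::field) fam) zf t = 0"
proof (intro exI allI impI)
  \<comment> \<open>From here on \<open>t - a ! j\<close> is nonnegative for all \<open>j\<close>,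
    whereas an exponent with only negative entries has degree at most -n.\<close>
  fix t p assume t: "t >= (\<Sum>x\<leftarrow>a. \<bar>x\<bar>)"
  have "neg_index a t = ({} :: (nat \<times> ('n => int)) set)"
  proof (rule equals0I)
    fix x :: "nat \<times> ('n => int)" assume "x : neg_index a t"
    then obtain j av where x: "j < length a" "!!i. av i < 0" "edeg (av :: 'n => int) = t - a ! j" by (auto simp: neg_index_def)
    have "\<bar>a ! j\<bar> <= (\<Sum>x\<leftarrow>a. \<bar>x\<bar>)" using nth_mem[OF x(1)] by (intro member_le_sum_list) auto
    moreover have "edeg av <= - int CARD('n)" using edeg_neg[of av] x(2) by blast
    moreover have "0 < CARD('n)" by simp
    ultimately show False using t x(3) by linarith
  qed
  then have top: "hh (int CARD('n)) (fr a :: ('n, 'k) fam) zf t = 0"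
    using hh_fr_top_le[of a t, where 'n = 'n and 'k = 'k] by (simp add: zero_enat_def[symmetric])
  show "hh p (fr a :: ('n, 'k) fam) zf t = 0"
    using top hh_fr_below[of p a t] hh_out_of_range[OF _ gsub_fr gsub_zf, of p a t] by (metis linorder_neqE)
qed

subsection \<open>Graded submodules of free modules are finitely generated\<close>

text \<open>The homomorphism of free modules sending the \<open>j\<close>-th basis vector to
  \<open>g j\<close>. Written as a convolution it extends to Laurent exponents and commutes with all
  shifts, so it acts on every localization.\<close>

definition gact :: "nat => (nat => ('n, 'k::field) lvec) => ('n, 'k) lvec => ('n, 'k) lvec" where
  "gact L g f = (%(j', gv). \<Sum>j<L. \<Sum>av | g j (j', av) ~= 0. g j (j', av) * f (j, gv - av))"

lemma flin_gact: "flin (gact L g)"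
  by (rule flinI) (auto simp: gact_def fun_eq_iff distrib_left sum.distrib sum_distrib_left mult.left_commute)

lemma eqv_gact: "eqv (gact L g)"
proof -
  have "gact L g (sh bv f) = sh bv (gact L g f)" for bv f
  proof -
    have "gv - av - bv = gv - bv - av" for gv av :: "'a => int" by (simp add: algebra_simps)
    then show ?thesis unfolding gact_def by (intro ext) (simp only: sh_def prod.case split_beta fst_conv snd_conv)
  qed
  then show ?thesis unfolding eqv_def using flin_gact by blast
qed

lemma gact_dirac:
  assumes "j < L" "finite {x. g j x ~= 0}"
  shows "gact L g (dirac (j, av)) = sh av (g j)"
proof
  fix y :: "nat \<times> ('a => int)"
  obtain j' gv where y: "y = (j', gv)" by (cases y)
  have fin: "finite {av. g j (j', av) ~= 0}" by (rule finite_subset[OF _ finite_imageI[OF assms(2), of snd]]) force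
  have "gact L g (dirac (j, av)) y = (\<Sum>i<L. if i = j then (\<Sum>bv | g j (j', bv) ~= 0. if bv = gv - av then g j (j', bv) else 0) else 0)"
    unfolding y gact_def prod.case
  proof (rule sum.cong[OF refl])
    fix i
    have e: "gv - bv = av \<longleftrightarrow> bv = gv - av" for bv by (auto simp: algebra_simps)
    show "(\<Sum>bv | g i (j', bv) ~= 0. g i (j', bv) * dirac (j, av) (i, gv - bv))
      = (if i = j then (\<Sum>bv | g j (j', bv) ~= 0. if bv = gv - av then g j (j', bv) else 0) else 0)"
      by (auto simp: dirac_def e intro!: sum.cong)
  qed
  also have "\<dots> = (\<Sum>bv | g j (j', bv) ~= 0. if bv = gv - av then g j (j', bv) else 0)" using assms(1) by simp
  also have "\<dots> = sh av (g j) y" using fin by (simp add: y sum.delta')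
  finally show "gact L g (dirac (j, av)) y = sh av (g j) y" .
qed

lemma dirac_fr: "(j, av) : fr_index a t ==> dirac (j, av) : fr a t" by (auto simp: fr_def funs_on_def dirac_def)

lemma fr_eq_sum: "f : fr a t ==> f = (\<Sum>x\<in>fr_index a t. scl (f x) (dirac x))"
  unfolding fr_def by (rule fun_eq_sum_dirac[OF finite_fr_index])

lemma gact_in:
  assumes U: "gsub U" and g: "!!j. j < length b ==> g j : U (b ! j)"
    and fin: "!!j. j < length b ==> finite {x. g j x ~= 0}" and f: "f : fr b t"
  shows "gact (length b) g f : U t"
proof -
  have "gact (length b) g f = (\<Sum>x\<in>fr_index b t. scl (f x) (gact (length b) g (dirac x)))"
    by (subst fr_eq_sum[OF f]) (simp only: flin_sum[OF flin_gact] flin_scl[OF flin_gact])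
  also have "\<dots> : U t"
  proof (rule fs.subspace_sum[OF gsub_subspace[OF U]], rule fs.subspace_scale[OF gsub_subspace[OF U]])
    fix x :: "nat \<times> ('a => int)" assume x: "x : fr_index b t"
    obtain j av where j: "x = (j, av)" "j < length b" "0 <= av" "edeg av = t - b ! j"
      using x by (cases x) (auto simp: fr_index_iff)
    have t: "t = b ! j + edeg av" using j(4) by simp
    show "gact (length b) g (dirac x) : U t" unfolding j(1) gact_dirac[of j "length b" g av, OF j(2) fin[OF j(2)]] t
      by (rule gsub_sh[OF U j(3) g[OF j(2)]])
  qed
  finally show ?thesis .
qed

text \<open>Dickson's lemma, one coordinate at a time. The set \<open>G\<close> found for the
  coordinates \<open>T\<close> handles all elements that are large in coordinate \<open>k\<close>;
  each of the finitely many small values of that coordinate gets its own finite set.\<close>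

lemma dickson:
  fixes A :: "('n => nat) set"
  assumes "finite T"
  shows "\<exists>G. finite G & G <= A & (\<forall>av\<in>A. \<exists>gv\<in>G. \<forall>i\<in>T. gv i <= av i)" using assms
proof (induction T arbitrary: A rule: finite_induct)
  case empty
  show ?case
  proof (cases "A = {}")
    case False
    then obtain x where "x : A" by blast
    then show ?thesis by (intro exI[of _ "{x}"]) auto
  qed auto
next
  case (insert k T)
  obtain G where G: "finite G" "G <= A" "!!av. av : A ==> \<exists>gv\<in>G. \<forall>i\<in>T. gv i <= av i"
    using insert.IH[of A] by blast
  \<comment> \<open>A bound for the \<open>k\<close>-th coordinates occurring in
    \<open>G\<close>.\<close>
  define N where "N = (\<Sum>gv\<in>G. gv k)"
  define Q where "Q m H \<longleftrightarrow> finite H & H <= {av \<in> A. av k = m} \<and>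
    (\<forall>av\<in>{av \<in> A. av k = m}. \<exists>gv\<in>H. \<forall>i\<in>T. gv i <= av i)" for m and H :: "('n => nat) set"
  have "\<exists>H. Q m H" for m unfolding Q_def by (rule insert.IH)
  then obtain H where H': "!!m. Q m (H m)" by metis
  have H: "finite (H m)" "H m <= {av \<in> A. av k = m}" for m using H'[of m] unfolding Q_def by simp_all
  have H3: "\<exists>gv\<in>H (av k). \<forall>i\<in>T. gv i <= av i" if "av : A" for av
    using H'[of "av k"] that unfolding Q_def by simp
  let ?G = "G Un (\<Union>m<N. H m)"
  have "\<exists>gv\<in>?G. \<forall>i\<in>insert k T. gv i <= av i" if a: "av : A" for av
  proof (cases "av k < N")
    case True
    obtain gv where g: "gv : H (av k)" "\<forall>i\<in>T. gv i <= av i" using H3[OF a] by blast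
    then have "gv k = av k" using H(2)[of "av k"] by auto
    then show ?thesis using g True by (intro bexI[of _ gv]) auto
  next
    case False
    obtain gv where g: "gv : G" "\<forall>i\<in>T. gv i <= av i" using G(3)[OF a] by blast
    have "gv k <= N" unfolding N_def using g(1) G(1) by (intro member_le_sum) auto
    then show ?thesis using g False by (intro bexI[of _ gv]) auto
  qed
  moreover have "finite ?G" "?G <= A" using G(1,2) H(1,2) by auto
  ultimately show ?case by (intro exI[of _ ?G]) simp
qed

lemma dickson_int:
  fixes A :: "('n::finite => int) set"
  assumes "!!av. av : A ==> 0 <= av"
  shows "\<exists>G. finite G & G <= A & (\<forall>av\<in>A. \<exists>gv\<in>G. gv <= av)"
proof -
  let ?n = "%av :: 'n => int. %i. nat (av i)"
  obtain G where G: "finite G" "G <= ?n ` A" "\<forall>av\<in>?n ` A. \<exists>gv\<in>G. \<forall>i\<in>UNIV. gv i <= av i"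
    using dickson[of "UNIV :: 'n set" "?n ` A"] by auto
  obtain G' where G': "G' <= A" "finite G'" "G = ?n ` G'" using finite_subset_image[OF G(1,2)] by blast
  have "\<exists>gv\<in>G'. gv <= av" if a: "av : A" for av
  proof -
    obtain gv where g: "gv : G'" "!!i. nat (gv i) <= nat (av i)" using G(3) a G'(3) by auto
    have "gv i <= av i" for i
    proof -
      have "0 <= av i" using assms[OF a] by (simp add: le_fun_def)
      then show ?thesis using g(2)[of i] by linarith
    qed
    then show ?thesis using g(1) by (auto simp: le_fun_def)
  qed
  then show ?thesis using G' by blast
qed

text \<open>A position-over-term order with lexicographic comparison of exponents. It is compatible
  with shifts; termination will come from finite degree pieces instead of a well-order.\<close>

definition idx_less :: "nat \<times> ('n::linorder => int) => nat \<times> ('n => int) => bool" where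
  "idx_less x y \<longleftrightarrow> fst x < fst y | (fst x = fst y & less_fun (snd x) (snd y))"

lemma idx_less_trans: "idx_less x y ==> idx_less y z ==> idx_less x z"
  unfolding idx_less_def using less_fun_trans[of "snd x" "snd y" "snd z"] by auto

lemma idx_less_irrefl: "\<not> idx_less x x" by (simp add: idx_less_def less_fun_irrefl)

lemma idx_less_total: "idx_less x y | x = y | idx_less y x" for x :: "nat \<times> ('n::{finite,linorder} => int)"
proof (cases "fst x = fst y")
  case True
  have "finite {k. snd x k ~= snd y k}" by simp
  from less_fun_trichotomy[OF this] True show ?thesis by (auto simp: idx_less_def prod_eq_iff)
qed (auto simp: idx_less_def)

lemma less_fun_add: "less_fun av av' ==> less_fun (av + bv) (av' + (bv :: 'n::linorder => int))" by (auto simp: less_fun_def)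

definition is_lead :: "('n::linorder, 'k::zero) lvec => nat \<times> ('n => int) => bool" where
  "is_lead v x \<longleftrightarrow> v x ~= 0 & (\<forall>y. v y ~= 0 --> y = x | idx_less y x)"

lemma lead_exists:
  fixes v :: "('n::{finite,linorder}, 'k::field) lvec"
  assumes "finite {x. v x ~= 0}" "v ~= 0"
  obtains x where "is_lead v x"
proof -
  have "\<exists>x\<in>A. \<forall>y\<in>A. y = x | idx_less y x" if "finite A" "A ~= {}" for A :: "(nat \<times> ('n => int)) set"
    using that
  proof (induction A rule: finite_ne_induct)
    case (insert z A)
    then obtain x where x: "x : A" "\<forall>y\<in>A. y = x | idx_less y x" by blast
    show ?case
    proof (cases "idx_less x z")
      case True
      then have "\<forall>y\<in>A. idx_less y z" using x(2) idx_less_trans[OF _ True] by auto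
      then show ?thesis by auto
    next
      case False
      then show ?thesis using x idx_less_total[of z x] by auto
    qed
  qed auto
  note max = this
  have "{x. v x ~= 0} ~= {}" using assms(2) by (auto simp: fun_eq_iff)
  from max[OF assms(1) this] obtain x where "v x ~= 0" "\<forall>y\<in>{x. v x ~= 0}. y = x | idx_less y x" by blast
  then show thesis by (intro that[of x]) (simp add: is_lead_def)
qed

lemma is_lead_sh: "is_lead v (j, av) ==> is_lead (sh bv v) (j, av + bv)" unfolding is_lead_def
proof (intro conjI allI impI)
  assume a: "v (j, av) ~= 0 & (\<forall>y. v y ~= 0 --> y = (j, av) | idx_less y (j, av))"
  show "sh bv v (j, av + bv) ~= 0" using a by simp
  fix y assume "sh bv v y ~= 0"
  then have "v (fst y, snd y - bv) ~= 0" by (cases y) simp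
  then have "(fst y, snd y - bv) = (j, av) | idx_less (fst y, snd y - bv) (j, av)" using a by blast
  then show "y = (j, av + bv) | idx_less y (j, av + bv)"
    using less_fun_add[of "snd y - bv" av bv] by (cases y) (auto simp: idx_less_def)
qed

text \<open>A Groebner basis: Dickson's lemma selects finitely many elements of \<open>U\<close>
  whose leading exponents divide all leading exponents in the same position, and every element of
  \<open>U\<close> is reduced to zero by division.\<close>

theorem noetherian:
  fixes U :: "('n::{finite,linorder}, 'k::field) fam"
  assumes U: "gsub U" and Ua: "!!t. U t <= fr a t"
  obtains b g where "!!j. j < length b ==> g j : U (b ! j)"
    "!!t. gact (length b) g ` fr b t = U t"
proof -
  define A where "A j = {av. \<exists>t. \<exists>v\<in>U t. is_lead v (j, av)}" for j
  have Apos: "0 <= av" if al: "av : A j" for av j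
  proof -
    obtain t v where "v : U t" "v (j, av) ~= 0" using al by (auto simp: A_def is_lead_def)
    then have "v : fr a t" "v (j, av) ~= 0" using Ua by blast+
    then show ?thesis unfolding fr_iff by blast
  qed
  have "\<exists>G. finite G & G <= A j & (\<forall>av\<in>A j. \<exists>gv\<in>G. gv <= av)" for j
    by (rule dickson_int[of "A j", OF Apos[of _ j]])
  then obtain G where G: "!!j. finite (G j)" "!!j. G j <= A j" "!!j av. av : A j ==> \<exists>gv\<in>G j. gv <= av" by metis
  have "finite (SIGMA j:{..<length a}. G j)" using G(1) by (intro finite_SigmaI) auto
  then obtain xs where xs: "set xs = (SIGMA j:{..<length a}. G j)" using finite_list by blast
  have "\<forall>x\<in>set xs. \<exists>p. snd p : U (fst p) & is_lead (snd p) x" using G(2) unfolding xs A_def by fastforce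
  then obtain q where q: "!!x. x : set xs ==> snd (q x) : U (fst (q x)) & is_lead (snd (q x)) x" by metis
  define b where "b = map (%x. fst (q x)) xs"
  define g where "g i = snd (q (xs ! i))" for i
  have gU: "g i : U (b ! i)" if "i < length b" for i using q[of "xs ! i"] that by (simp add: b_def g_def)
  have gfin: "finite {x. g i x ~= 0}" if "i < length b" for i using gU[OF that] Ua fr_finite_support by blast
  let ?W = "%t. gact (length b) g ` fr b t"
  have Wsub: "fs.subspace (?W t)" for t by (rule subspace_image[OF flin_gact gsub_subspace[OF gsub_fr]])
  \<comment> \<open>The measure counts the basis monomials of degree \<open>t\<close> that do not
    exceed some support element of \<open>v\<close>. A division step cancels the leading term and
    leaves only smaller ones, so the leading index drops out of that set.\<close>
  have UW: "v : ?W t" if "v : U t" for v t using that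
  proof (induction "card {y \<in> fr_index a t. \<exists>x. v x ~= 0 & (y = x | idx_less y x)}" arbitrary: v rule: less_induct)
    case (less v)
    show ?case
    proof (cases "v = 0")
      case True
      then show ?thesis using fs.subspace_0[OF Wsub] by simp
    next
      case False
      have vfr: "v : fr a t" using less.prems Ua by blast
      obtain x where x: "is_lead v x" using lead_exists[OF fr_finite_support[OF vfr] False] .
      obtain j av where xj: "x = (j, av)" by (cases x)
      have vx: "v (j, av) ~= 0" using x xj by (simp add: is_lead_def)
      have ja: "j < length a" "0 <= av" "edeg av = t - a ! j" using vfr vx unfolding fr_iff by blast+
      have "av : A j" using less.prems x xj by (auto simp: A_def)
      then obtain gv where gv: "gv : G j" "gv <= av" using G(3) by blast
      have jx: "(j, gv) : set xs" using gv ja xs by auto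
      then obtain i where i: "i < length xs" "xs ! i = (j, gv)" by (auto simp: in_set_conv_nth)
      have ib: "i < length b" using i by (simp add: b_def)
      have lg: "is_lead (g i) (j, gv)" using q[OF jx] i by (simp add: g_def)
      then have gj: "g i (j, gv) ~= 0" by (simp add: is_lead_def)
      have "edeg gv = b ! i - a ! j"
      proof -
        have "g i : fr a (b ! i)" using gU[OF ib] Ua by blast
        then show ?thesis using gj unfolding fr_iff by blast
      qed
      then have dg: "edeg (av - gv) = t - b ! i" using ja by simp
      have ng: "0 <= av - gv" using gv(2) by (simp add: le_fun_def)
      define u where "u = sh (av - gv) (g i)"
      have uW: "u : ?W t" unfolding u_def gact_dirac[of i "length b" g, OF ib gfin[OF ib], symmetric]
        by (intro imageI dirac_fr) (simp only: fr_index_iff ib ng dg simp_thms)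
      have uU: "u : U t" using gsub_sh[OF U ng gU[OF ib]] dg by (simp add: u_def)
      have lu: "is_lead u (j, av)" using is_lead_sh[OF lg, of "av - gv"] by (simp add: u_def)
      then have ux: "u (j, av) ~= 0" by (simp add: is_lead_def)
      define c where "c = v (j, av) / u (j, av)"
      define v' where "v' = v - scl c u"
      have v'U: "v' : U t"
        unfolding v'_def by (intro fs.subspace_diff[OF gsub_subspace[OF U]] fs.subspace_scale[OF gsub_subspace[OF U]] less.prems uU)
      have v'x: "v' (j, av) = 0" using ux by (simp add: v'_def c_def)
      have v'l: "idx_less y (j, av)" if "v' y ~= 0" for y
      proof -
        have "v y ~= 0 | u y ~= 0" using that by (auto simp: v'_def)
        then have "y = (j, av) | idx_less y (j, av)" using x lu xj unfolding is_lead_def by blast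
        then show ?thesis using that v'x by auto
      qed
      let ?D = "%v. {y \<in> fr_index a t. \<exists>x. v x ~= 0 & (y = x | idx_less y x)}"
      have "?D v' \<subset> ?D v"
      proof (rule psubsetI)
        show "?D v' <= ?D v"
        proof clarsimp
          fix k \<kappa> i \<iota> assume "v' (i, \<iota>) ~= 0" and l: "k = i & \<kappa> = \<iota> | idx_less (k, \<kappa>) (i, \<iota>)"
          then have "idx_less (i, \<iota>) (j, av)" using v'l by blast
          then have "idx_less (k, \<kappa>) (j, av)" using l idx_less_trans[of "(k, \<kappa>)" "(i, \<iota>)" "(j, av)"] by auto
          then show "\<exists>i \<iota>. v (i, \<iota>) ~= 0 & (k = i & \<kappa> = \<iota> | idx_less (k, \<kappa>) (i, \<iota>))"
            using vx by blast
        qed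
        have "(j, av) : ?D v" using vx ja by (auto simp: fr_index_iff)
        moreover have "(j, av) ~: ?D v'"
        proof
          assume "(j, av) : ?D v'"
          then obtain y where y: "v' y ~= 0" "(j, av) = y | idx_less (j, av) y" by blast
          then have "idx_less (j, av) (j, av)" using v'l[OF y(1)] idx_less_trans[of "(j, av)" y "(j, av)"] by auto
          then show False using idx_less_irrefl by blast
        qed
        ultimately show "?D v' ~= ?D v" by blast
      qed
      then have "card (?D v') < card (?D v)" by (intro psubset_card_mono) (use finite_fr_index[of a t] in auto)
      then have "v' : ?W t" using less.hyps v'U by blast
      then have "v' + scl c u : ?W t" using uW by (intro fs.subspace_add[OF Wsub] fs.subspace_scale[OF Wsub])
      then show ?thesis by (simp add: v'_def)
    qed
  qed
  have WU: "?W t <= U t" for t by (intro image_subsetI gact_in[OF U gU gfin])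
  have "?W t = U t" for t using UW WU[of t] by auto
  then show thesis by (intro that[of b g] gU)
qed

lemma noetherian_eqv:
  fixes U :: "('n::{finite,linorder}, 'k::field) fam"
  assumes "gsub U" and "!!t. U t <= fr a t"
  shows "\<exists>b fv. eqv fv & (\<forall>t. fv ` fr b t = U t)"
proof (rule noetherian[OF assms])
  fix b g assume "!!t. gact (length b) g ` fr b t = U t"
  then show ?thesis using eqv_gact by blast
qed

subsection \<open>Finiteness and the Hilbert polynomial\<close>

text \<open>By \<open>noetherian\<close> the inclusion in a free module makes \<open>V/U\<close> a
  finitely generated graded module.\<close>

definition adm :: "('n::finite, 'k::field) fam => ('n, 'k) fam => bool" where
  "adm V U \<longleftrightarrow> gsub V & gsub U & (\<forall>t. U t <= V t) & (\<exists>a. \<forall>t. V t <= fr a t)"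

lemma admD:
  assumes "adm V U"
  shows "gsub V" "gsub U" "U t <= V t" using assms by (auto simp: adm_def)

lemma adm_sub: "adm W U ==> gsub V ==> (!!t. U t <= V t) ==> (!!t. V t <= W t) ==> adm V U"
  unfolding adm_def by (meson order_trans)

lemma adm_quot: "adm W U ==> gsub V ==> (!!t. V t <= W t) ==> adm W V" unfolding adm_def by blast

lemma adm_fr: "gsub U ==> (!!t. U t <= fr a t) ==> adm (fr a) U" unfolding adm_def using gsub_fr by blast

lemma adm_zf: "gsub U ==> (!!t. U t <= fr a t) ==> adm U zf" unfolding adm_def using gsub_zf zf_sub by blast

lemma gsub_vimage:
  assumes "eqv fv" "gsub V" "gsub U"
  shows "gsub (%t. {v \<in> V t. fv v : U (t + e)})" unfolding gsub_def
proof (intro conjI allI impI)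
  show "fs.subspace {v \<in> V t. fv v : U (t + e)}" for t by (intro subspace_vimage eqv_flin assms(1) gsub_subspace assms(2,3))
next
  fix t and bv :: "'a => int" and v assume b: "0 <= bv" and "v : {v \<in> V t. fv v : U (t + e)}"
  then have v: "v : V t" "fv v : U (t + e)" by auto
  have "fv (sh bv v) : U (t + edeg bv + e)" using gsub_sh[OF assms(3) b v(2)] by (simp add: eqv_sh[OF assms(1)] algebra_simps)
  then show "sh bv v : {v \<in> V (t + edeg bv). fv v : U (t + edeg bv + e)}" using gsub_sh[OF assms(2) b v(1)] by simp
qed

lemma (in fam_iso) qdim_eq: "qdim (V t) (U t) = qdim (V' (t + e)) (U' (t + e))"
  by (rule qdim_iso[OF lin gsub_subspace[OF gV] gsub_subspace[OF gU']])
    (use map ker sub surj in blast)+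

text \<open>Generators of \<open>V\<close> give a surjection from a free module onto
  \<open>V\<close>, and \<open>W\<close> is the preimage of \<open>U\<close>.\<close>

lemma free_presentation:
  fixes V U :: "('n::{finite,linorder}, 'k::field) fam"
  assumes VU: "adm V U"
  shows "\<exists>b (W :: ('n, 'k) fam). gsub W & (\<forall>t. W t <= fr b t) & (\<forall>p t. hh p V U t = hh p (fr b) W t)"
proof -
  obtain a where a: "!!t. V t <= fr a t" using VU by (auto simp: adm_def)
  obtain b fv where p: "eqv fv" "!!t. fv ` fr b t = V t" using noetherian_eqv[OF admD(1)[OF VU] a] by blast
  define W where "W = (%t. {v \<in> fr b t. fv v : U (t + 0)})"
  have W: "gsub W" unfolding W_def by (rule gsub_vimage[OF p(1) gsub_fr admD(2)[OF VU]])
  interpret fam_iso fv "fr b" W V U 0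
  proof (unfold_locales)
    show "fv v : V (t + 0)" if "v : fr b t" for t v using p(2)[of t] that by auto
    show "fv v : U (t + 0) \<longleftrightarrow> v : W t" if "v : fr b t" for t v using that by (simp add: W_def)
    show "\<exists>v\<in>fr b t. fv v - v' : U (t + 0)" if v': "v' : V (t + 0)" for t v'
    proof -
      have "v' : fv ` fr b t" using v' p(2)[of t] by simp
      then obtain v where "v : fr b t" "fv v = v'" by blast
      then show ?thesis using fs.subspace_0[OF gsub_subspace[OF admD(2)[OF VU]]] by (intro bexI[of _ v]) auto
    qed
  qed (use p W VU gsub_fr in \<open>auto simp: adm_def W_def\<close>)
  have "W t <= fr b t" "hh p V U t = hh p (fr b) W t" for p t using hh_eq[of p t] by (auto simp: W_def)
  then show ?thesis using W by blast
qed

lemma enat_add_bounded: "x <= y + z ==> y ~= \<infinity> ==> z ~= \<infinity> ==> x ~= (\<infinity> :: enat)"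
  by (cases x; cases y; cases z) auto

text \<open>Descending induction on \<open>p\<close>, starting above n. For a presentation F/W the
  long exact sequence bounds H^p(F/W) by H^p(F), known explicitly, and H^(p+1)(W), covered by
  induction because \<open>W\<close> is again finitely generated.\<close>

lemma hh_finite_vanishing:
  fixes V U :: "('n::{finite,linorder}, 'k::field) fam"
  assumes "adm V U"
  shows "(\<forall>t. hh p V U t ~= \<infinity>) & (\<exists>t0. \<forall>t\<ge>t0. hh p V U t = 0)" using assms
proof (induction "nat (int CARD('n) + 1 - p)" arbitrary: p V U)
  case 0
  then have "hh p V U t = 0" for t by (intro hh_out_of_range) (auto simp: adm_def)
  then show ?case by simp
next
  case (Suc m)
  obtain b and W :: "('n, 'k) fam" where W: "gsub W" "!!t. W t <= fr b t" "!!p t. hh p V U t = hh p (fr b) W t"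
    using free_presentation[OF Suc.prems] by blast
  have IH: "\<forall>t. hh (p + 1) W zf t ~= \<infinity>" "\<exists>t0. \<forall>t\<ge>t0. hh (p + 1) W zf t = 0"
    using Suc.hyps(1)[of "p + 1" W zf] Suc.hyps(2) adm_zf[OF W(1,2)] by auto
  have le: "hh p V U t <= hh (p + 1) W zf t + hh p (fr b :: ('n, 'k) fam) zf t" for t
    unfolding W(3) by (rule hh_quot_le[OF gsub_zf W(1) gsub_fr zf_sub[OF W(1)] W(2)])
  have "hh p V U t ~= \<infinity>" for t using enat_add_bounded[OF le[of t] _ hh_fr_finite] IH(1) by blast
  moreover obtain t0 where t0: "!!t. t >= t0 ==> hh (p + 1) W zf t = 0" using IH(2) by blast
  obtain t1 where t1: "!!t. t >= t1 ==> hh p (fr b :: ('n, 'k) fam) zf t = 0"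
    using hh_fr_eventually_0[of b, where 'n = 'n and 'k = 'k] by blast
  have "hh p V U t = 0" if "t >= max t0 t1" for t using le[of t] t0[of t] t1[of t] that by simp
  ultimately show ?case by blast
qed

lemma qdim_adm_finite:
  assumes "adm V U"
  shows "qdim (V t) (U t) ~= \<infinity>"
proof -
  obtain a where "!!t. V t <= fr a t" using assms by (auto simp: adm_def)
  then have "V t <= fr a t" .
  then have "qdim (V t) (U t) <= qdim (fr a t) (U t)" by (rule qdim_mono) auto
  also have "\<dots> <= enat (card (fr_index a t :: (nat \<times> ('a => int)) set))"
    unfolding fr_def by (rule qdim_funs_on_le[OF finite_fr_index])
  finally show ?thesis by (rule enat_bounded)
qed

text \<open>Alternating sums require subtraction; the conversion is meaningful for finite
  dimensions, which \<open>adm\<close> guarantees.\<close>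

definition eint :: "enat => int" where
  "eint x = int (the_enat x)"

lemma eint_add: "x ~= \<infinity> ==> y ~= \<infinity> ==> eint (x + y) = eint x + eint y"
  by (cases x; cases y) (auto simp: eint_def)

lemma eint_0 [simp]: "eint 0 = 0" by (simp add: eint_def zero_enat_def)

lemma eint_mono: "x <= y ==> y ~= \<infinity> ==> eint x <= eint y" by (cases x; cases y) (auto simp: eint_def)

lemma eint_nonneg [simp]: "0 <= eint x" by (simp add: eint_def)

definition hI :: "int => ('n::{finite,linorder}, 'k::field) fam => ('n, 'k) fam => int => int" where
  "hI p V U t = eint (hh p V U t)"

definition qI :: "('n::{finite,linorder}, 'k::field) fam => ('n, 'k) fam => int => int" where
  "qI V U t = eint (qdim (V t) (U t))"

text \<open>\<open>dim (V/U)\<^sub>t - \<Sum>\<^sub>p (-1)\<^sup>p dim H\<^sup>p(V/U)\<^sub>t\<close>, which turns out to be the Hilbert polynomial.\<close>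

definition chi :: "('n::{finite,linorder}, 'k::field) fam => ('n, 'k) fam => int => int" where
  "chi V U t = qI V U t - (\<Sum>p\<le>CARD('n). (- 1) ^ p * hI (int p) V U t)"

lemma hh_adm_finite: "adm V U ==> hh p V U t ~= \<infinity>" using hh_finite_vanishing by blast

lemma hI_nonneg [simp]: "0 <= hI p V U t" by (simp add: hI_def)

lemma qI_nonneg [simp]: "0 <= qI V U t" by (simp add: qI_def)

context
  fixes U V W :: "('n::{finite,linorder}, 'k::field) fam"
  assumes WU: "adm W U" and V: "gsub V" and UV: "!!t. U t <= V t" and VW: "!!t. V t <= W t"
begin

lemmas gs = admD(2)[OF WU] V admD(1)[OF WU] UV VW
lemmas adms = WU adm_sub[OF WU V UV VW] adm_quot[OF WU V VW]

lemma conn_rank_finite: "conn_rank p U V W t ~= \<infinity>"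
  using conn_rank_le_sub[OF gs, of p t] hh_adm_finite[OF adms(2), of p t] by (cases "hh p V U t") (auto dest: enat_bounded)

lemma long_exact_sequence_int:
  "hI p W U t + eint (conn_rank p U V W t) + eint (conn_rank (p + 1) U V W t) = hI p V U t + hI p W V t"
proof -
  have f: "hh p W U t + conn_rank p U V W t ~= \<infinity>"
    by (rule enat_add_bounded[OF order_refl hh_adm_finite[OF adms(1)] conn_rank_finite])
  show ?thesis using arg_cong[OF long_exact_sequence[OF gs, of p t], of eint]
    by (simp add: hI_def eint_add hh_adm_finite[OF adms(1)] hh_adm_finite[OF adms(2)]
        hh_adm_finite[OF adms(3)] conn_rank_finite f)
qed

lemma conn_rank_int_le:
  "eint (conn_rank p U V W t) <= hI p V U t" "eint (conn_rank (p + 1) U V W t) <= hI p W V t" unfolding hI_def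
  by (intro eint_mono conn_rank_le_sub[OF gs] conn_rank_le_quot[OF gs] hh_adm_finite adms)+

lemma qI_add: "qI W U t = qI V U t + qI W V t" unfolding qI_def
  using qdim_add[OF gsub_subspace gsub_subspace UV VW, OF gs(1) V, of t]
  by (simp add: eint_add qdim_adm_finite[OF adms(2)] qdim_adm_finite[OF adms(3)])

text \<open>In the alternating sum of the long exact sequences the ranks of the connecting maps
  telescope, and the two end ranks vanish because cohomology does so outside the range 0..n.\<close>

lemma chi_add: "chi W U t = chi V U t + chi W V t"
proof -
  define r where "r p = eint (conn_rank (int p) U V W t)" for p
  have tele: "(\<Sum>p\<le>n. (- 1) ^ p * (r p + r (Suc p))) = r 0 + (- 1) ^ n * r (Suc n)" for n
    by (induction n) (auto simp: algebra_simps)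
  have "conn_rank (- 1 + 1) U V W t <= hh (- 1) W V t" by (rule conn_rank_le_quot[OF gs])
  also have "\<dots> = 0" by (rule hh_out_of_range) (use gs in auto)
  finally have r0: "r 0 = 0" by (simp add: r_def)
  have "conn_rank (int (Suc CARD('n))) U V W t <= hh (int (Suc CARD('n))) V U t" by (rule conn_rank_le_sub[OF gs])
  also have "\<dots> = 0" by (rule hh_out_of_range) (use gs in auto)
  finally have rn: "r (Suc CARD('n)) = 0" by (simp add: r_def)
  have "hI (int p) W U t = hI (int p) V U t + hI (int p) W V t - (r p + r (Suc p))" for p
    using long_exact_sequence_int[of "int p" t] by (simp add: r_def add.commute)
  then have "(\<Sum>p\<le>CARD('n). (- 1) ^ p * hI (int p) W U t) =
      (\<Sum>p\<le>CARD('n). (- 1) ^ p * hI (int p) V U t) + (\<Sum>p\<le>CARD('n). (- 1) ^ p * hI (int p) W V t)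
      - (\<Sum>p\<le>CARD('n). (- 1) ^ p * (r p + r (Suc p)))"
    by (simp only: sum.distrib[symmetric] sum_subtractf[symmetric] right_diff_distrib distrib_left)
  then show ?thesis unfolding chi_def qI_add tele r0 rn by simp
qed

end

lemma (in fam_iso) chi_eq: "chi V U t = chi V' U' (t + e)"
  by (simp add: chi_def qI_def hI_def hh_eq[symmetric] qdim_eq[symmetric])

text \<open>For torsion modules H^0 is the whole module and the higher cohomology is zero.\<close>

lemma chi_tors:
  fixes V U :: "('n::{finite,linorder}, 'k::field) fam"
  assumes VU: "adm V U" and T: "tors V U"
  shows "chi V U t = 0"
proof -
  note d = admD[OF VU]
  have "hI (int p) V U t = (if p = 0 then qI V U t else 0)" for p
    using hh_tors[OF T d(3) d(1,2), of "int p"] hh_0_tors[OF T d(3) d(1,2)] by (simp add: hI_def qI_def)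
  then have "(\<Sum>p\<le>CARD('n). (- 1) ^ p * hI (int p) V U t) = (\<Sum>p\<le>CARD('n). if p = 0 then qI V U t else 0)"
    by (intro sum.cong) auto
  then show ?thesis by (simp add: chi_def)
qed

section \<open>Antidifferences and integer-valued polynomials\<close>

text \<open>Rising factorials play the role of powers for the backward difference: the difference of
  \<open>rising (Suc m)\<close> is \<open>Suc m\<close> times \<open>rising m\<close>.\<close>

definition rising :: "nat => rat poly" where
  "rising m = (\<Prod>i<m. [:of_nat i, 1:])"

lemma poly_rising: "poly (rising m) x = pochhammer x m"
  by (simp add: rising_def poly_prod pochhammer_prod add.commute atLeast0LessThan)

lemma coeff_rising: "m <= k ==> coeff (rising m) k = (if k = m then 1 else 0)"
proof (induction m arbitrary: k)
  case (Suc m)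
  have "rising (Suc m) = [:of_nat m, 1:] * rising m" by (simp add: rising_def mult.commute)
  then show ?case using Suc by (cases k) (auto simp: mult_pCons_left coeff_pCons split: nat.splits)
qed (auto simp: rising_def)

lemma rising_diff: "pochhammer x (Suc m) - pochhammer (x - 1) (Suc m) = of_nat (Suc m) * pochhammer (x :: rat) m"
  using pochhammer_rec[of "x - 1" m] by (simp add: pochhammer_Suc algebra_simps)

text \<open>Induction on a degree bound: the top coefficient is removed with the monic polynomial
  \<open>rising m\<close>, whose antidifference is a multiple of
  \<open>rising (Suc m)\<close>.\<close>

lemma poly_antidifference: "\<exists>P :: rat poly. \<forall>x. poly P x - poly P (x - 1) = poly Q x"
proof -
  have *: "\<exists>P :: rat poly. \<forall>x. poly P x - poly P (x - 1) = poly Q x" if "\<forall>k\<ge>m. coeff Q k = 0" for m Q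
    using that
  proof (induction m arbitrary: Q)
    case 0
    then have "Q = 0" by (auto intro: poly_eqI)
    then show ?case by (intro exI[of _ 0]) simp
  next
    case (Suc m)
    have "\<forall>k\<ge>m. coeff (Q - Polynomial.smult (coeff Q m) (rising m)) k = 0"
      using Suc.prems by (auto simp: coeff_rising)
    then obtain P where P: "!!x. poly P x - poly P (x - 1) = poly (Q - Polynomial.smult (coeff Q m) (rising m)) x"
      using Suc.IH by blast
    let ?P = "P + Polynomial.smult (coeff Q m / of_nat (Suc m)) (rising (Suc m))"
    have "poly ?P x - poly ?P (x - 1) = poly Q x" for x
    proof -
      have "poly ?P x - poly ?P (x - 1) = (poly P x - poly P (x - 1))
          + coeff Q m / of_nat (Suc m) * (pochhammer x (Suc m) - pochhammer (x - 1) (Suc m))"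
        by (simp add: poly_rising right_diff_distrib)
      also have "\<dots> = poly Q x" unfolding P rising_diff by (simp add: poly_rising)
      finally show ?thesis .
    qed
    then show ?case by blast
  qed
  show ?thesis by (rule *[of "Suc (degree Q)"]) (simp add: coeff_eq_0)
qed

lemma int_step_const:
  fixes g :: "int => 'a"
  assumes "!!t. g t = g (t - 1)"
  shows "g t = g 0"
proof (induction t rule: int_induct[of _ 0])
  case (step1 i)
  then show ?case using assms[of "i + 1"] by simp
next
  case (step2 i)
  then show ?case using assms[of i] by simp
qed simp

lemma poly_of_difference:
  fixes f :: "int => rat"
  assumes "!!t. f t - f (t - 1) = poly Q (of_int t)"
  shows "\<exists>P. \<forall>t. poly P (of_int t) = f t"
proof -
  obtain P where P: "!!x. poly P x - poly P (x - 1) = poly Q x" using poly_antidifference by blast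
  define g where "g t = f t - poly P (of_int t)" for t
  have "g t = g (t - 1)" for t using assms[of t] P[of "of_int t"] by (simp add: g_def)
  then have "g t = g 0" for t by (rule int_step_const)
  then have "f t - poly P (of_int t) = g 0" for t unfolding g_def[of t, symmetric] .
  then have "poly (P + [:g 0:]) (of_int t) = f t" for t using diff_eq_eq by (simp add: algebra_simps)
  then show ?thesis by blast
qed

lemma gsub_shift_sum:
  assumes V: "gsub V" and U: "gsub U" and f: "eqv fv"
  shows "gsub (%t. sadd (fv ` V (t - e)) (U t))" unfolding gsub_def
proof (intro conjI allI impI)
  show "fs.subspace (sadd (fv ` V (t - e)) (U t))" for t by (intro subspace_sadd subspace_image eqv_flin f gsub_subspace V U)
next
  fix t and bv :: "'a => int" and c assume b: "0 <= bv" and "c : sadd (fv ` V (t - e)) (U t)"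
  then obtain v u where vu: "v : V (t - e)" "u : U t" "c = fv v + u" by (auto elim!: saddE)
  have "sh bv v : V (t + edeg bv - e)" using gsub_sh[OF V b vu(1)] by (simp add: algebra_simps)
  then have "fv (sh bv v) + sh bv u : sadd (fv ` V (t + edeg bv - e)) (U (t + edeg bv))"
    using gsub_sh[OF U b vu(2)] by (intro saddI imageI)
  then show "sh bv c : sadd (fv ` V (t + edeg bv - e)) (U (t + edeg bv))" by (simp only: vu(3) sh_add eqv_sh[OF f])
qed

lemma eqv_sh_map: "eqv (sh gv)" unfolding eqv_def using flin_sh by (auto simp: sh_sh add.commute)

lemma tors_of_variables:
  assumes U: "gsub U" and x: "!!i t v. v : V t ==> sh (mono_exp i 1) v : U (t + 1)"
  shows "tors V U" unfolding tors_def
proof (intro allI ballI exI[of _ 1] impI)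
  fix t v and bv :: "'a => int" assume v: "v : V t" and b: "0 <= bv" "1 <= edeg bv"
  have "\<exists>i. 1 <= bv i"
  proof (rule ccontr)
    assume "\<not> ?thesis"
    then have "bv i = 0" for i using le_funD[OF b(1), of i] by (auto simp: not_le dest: spec[of _ i])
    then have "edeg bv = 0" by (simp add: edeg_def)
    then show False using b(2) by simp
  qed
  then obtain i where i: "1 <= bv i" by blast
  define gv where "gv = bv - mono_exp i 1"
  have g: "0 <= gv" using b(1) i by (auto simp: gv_def le_fun_def mono_exp_def)
  have "sh gv (sh (mono_exp i 1) v) : U (t + 1 + edeg gv)" by (rule gsub_sh[OF U g x[OF v]])
  moreover have "gv + mono_exp i 1 = bv" by (simp add: gv_def)
  moreover have "t + 1 + edeg gv = t + edeg bv" by (simp add: gv_def)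
  ultimately show "sh bv v : U (t + edeg bv)" by (simp only: sh_sh)
qed

text \<open>Induction on the set \<open>T\<close> of variables that may act nontrivially on
  \<open>V/U\<close>. Kernel \<open>K/U\<close> and cokernel \<open>V/C\<close> of one such variable
  are annihilated by it, and \<open>chi\<close> of these two gives the difference of consecutive
  values of \<open>chi V U\<close>.\<close>

theorem chi_polynomial:
  fixes V U :: "('n::{finite,linorder}, 'k::field) fam"
  assumes "finite T" "adm V U" "!!i t v. i ~: T ==> v : V t ==> sh (mono_exp i 1) v : U (t + 1)"
  shows "\<exists>P :: rat poly. \<forall>t. poly P (of_int t) = of_int (chi V U t)" using assms
proof (induction T arbitrary: V U rule: finite_induct)
  case empty
  have "tors V U" by (rule tors_of_variables[OF admD(2)[OF empty.prems(1)]]) (use empty.prems in auto)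
  then have "chi V U t = 0" for t by (rule chi_tors[OF empty.prems(1)])
  then show ?case by (intro exI[of _ 0]) simp
next
  case (insert x T)
  note VU = insert.prems(1)
  note d = admD[OF VU]
  let ?s = "sh (mono_exp x 1) :: ('n, 'k) lvec => ('n, 'k) lvec"
  define K where "K = (%t. {v \<in> V t. ?s v : U (t + 1)})"
  define C where "C = (%t. sadd (?s ` V (t - 1)) (U t))"
  have K: "gsub K" unfolding K_def by (rule gsub_vimage[OF eqv_sh_map d(1,2)])
  have C: "gsub C" unfolding C_def by (rule gsub_shift_sum[OF d(1,2) eqv_sh_map])
  have sV: "?s v : V (t + 1)" if "v : V t" for v t using gsub_sh[OF d(1) mono_exp_nonneg that, of x 1] by simp
  have sU: "?s v : U (t + 1)" if "v : U t" for v t using gsub_sh[OF d(2) mono_exp_nonneg that, of x 1] by simp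
  have UK: "U t <= K t" for t using d(3) sU by (auto simp: K_def)
  have KV: "K t <= V t" for t by (auto simp: K_def)
  have UC: "U t <= C t" for t unfolding C_def by (intro subsetI sadd_right subspace_image flin_sh gsub_subspace d(1))
  have CV: "C t <= V t" for t unfolding C_def using sV[of _ "t - 1"] by (intro sadd_least gsub_subspace d(1) d(3)) auto
  \<comment> \<open>Multiplication by the variable identifies \<open>V/K\<close> with its image
    \<open>C/U\<close>, one degree higher.\<close>
  interpret fam_iso ?s V K C U 1
  proof unfold_locales
    show "?s v : C (t + 1)" if "v : V t" for t v unfolding C_def using that by (intro sadd_left gsub_subspace d(2)) simp
    show "?s v : U (t + 1) \<longleftrightarrow> v : K t" if "v : V t" for t v using that by (simp add: K_def)
    show "\<exists>v\<in>V t. ?s v - c : U (t + 1)" if c: "c : C (t + 1)" for t c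
    proof -
      obtain v u where vu: "v : V t" "u : U (t + 1)" "c = ?s v + u" using c unfolding C_def by (auto elim!: saddE)
      have "?s v - c = - u" using vu(3) by simp
      then show ?thesis using vu fs.subspace_neg[OF gsub_subspace[OF d(2)] vu(2)] by (intro bexI[of _ v]) simp_all
    qed
  qed (use d C K KV UC eqv_sh_map in auto)
  have aVC: "adm V C" by (rule adm_quot[OF VU C CV])
  have aKU: "adm K U" by (rule adm_sub[OF VU K UK KV])
  have diff: "chi V U t - chi V U (t - 1) = chi V C t - chi K U (t - 1)" for t
    using chi_add[OF VU C UC CV, of t] chi_add[OF VU K UK KV, of "t - 1"] chi_eq[of "t - 1"] by simp
  obtain P1 where P1: "!!t. poly P1 (of_int t) = (of_int (chi V C t) :: rat)"
  proof -
    have "sh (mono_exp i 1) v : C (t + 1)" if "i ~: T" "v : V t" for i t v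
      using that insert.prems(2)[of i v t] map[of v t] UC by (cases "i = x") auto
    then show thesis using insert.IH[OF aVC] that by blast
  qed
  obtain P2 where P2: "!!t. poly P2 (of_int t) = (of_int (chi K U t) :: rat)"
  proof -
    have "sh (mono_exp i 1) v : U (t + 1)" if "i ~: T" "v : K t" for i t v
      using that insert.prems(2)[of i v t] KV by (cases "i = x") (auto simp: K_def)
    then show thesis using insert.IH[OF aKU] that by blast
  qed
  have "of_int (chi V U t) - of_int (chi V U (t - 1)) = poly (P1 - pcompose P2 [:- 1, 1:]) (of_int t)" for t
  proof -
    have "poly P2 (of_int t - 1) = (of_int (chi K U (t - 1)) :: rat)" using P2[of "t - 1"] by simp
    then have "poly (P1 - pcompose P2 [:- 1, 1:]) (of_int t) = (of_int (chi V C t - chi K U (t - 1)) :: rat)"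
      using P1[of t] by (simp add: poly_pcompose)
    then show ?thesis unfolding diff[symmetric] by simp
  qed
  then show ?case by (rule poly_of_difference[of "%t. of_int (chi V U t)"])
qed

lemma chi_eventually:
  fixes V U :: "('n::{finite,linorder}, 'k::field) fam"
  assumes "adm V U"
  shows "\<exists>t0. \<forall>t\<ge>t0. chi V U t = qI V U t"
proof -
  have "\<forall>p. \<exists>t0. \<forall>t\<ge>t0. hh p V U t = 0" using hh_finite_vanishing[OF assms] by blast
  then obtain T where T: "!!p t. t >= T p ==> hh p V U t = 0" by metis
  have "chi V U t = qI V U t" if "t >= (\<Sum>p\<le>CARD('n). \<bar>T (int p)\<bar>)" for t
  proof -
    have "hI (int p) V U t = 0" if "p <= CARD('n)" for p
    proof -
      have "\<bar>T (int p)\<bar> <= (\<Sum>p\<le>CARD('n). \<bar>T (int p)\<bar>)" using that by (intro member_le_sum) auto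
      then show ?thesis using T[of "int p" t] \<open>t >= _\<close> by (simp add: hI_def)
    qed
    then show ?thesis by (simp add: chi_def)
  qed
  then show ?thesis by blast
qed

subsection \<open>Saturation and hyperplane sections\<close>

text \<open>The preimage of H^0_m(F/U) in the free module F, so that F modulo \<open>sat a U\<close>
  is F/U modulo torsion.\<close>

definition sat :: "int list => ('n::finite, 'k::field) fam => ('n, 'k) fam" where
  "sat a U t = {v \<in> fr a t. \<exists>N. \<forall>bv. 0 <= bv --> N <= edeg bv --> sh bv v : U (t + edeg bv)}"

lemma satI: "v : fr a t ==> (!!bv. 0 <= bv ==> N <= edeg bv ==> sh bv v : U (t + edeg bv)) ==> v : sat a U t"
  unfolding sat_def by blast

lemma satE:
  assumes "v : sat a U t"
  shows "v : fr a t" "\<exists>N. \<forall>bv. 0 <= bv --> N <= edeg bv --> sh bv v : U (t + edeg bv)"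
  using assms unfolding sat_def by blast+

lemma sat_fr: "sat a U t <= fr a t" unfolding sat_def by blast

lemma sat_base: "gsub U ==> U t <= fr a t ==> U t <= sat a U t" using gsub_sh unfolding sat_def by blast

lemma tors_sat: "tors (sat a U) U" unfolding tors_def sat_def by blast

lemma gsub_sat:
  assumes U: "gsub U"
  shows "gsub (sat a U)" unfolding gsub_def
proof (intro conjI allI impI)
  fix t
  show "fs.subspace (sat a U t)"
  proof (rule fs.subspaceI)
    show "0 : sat a U t"
      by (rule satI[of _ _ _ 0]) (simp_all add: fs.subspace_0[OF gsub_subspace[OF U]] fs.subspace_0[OF gsub_subspace[OF gsub_fr]])
  next
    fix x y assume xy: "x : sat a U t" "y : sat a U t"
    obtain N where N: "!!bv. 0 <= bv ==> N <= edeg bv ==> sh bv x : U (t + edeg bv)" using satE(2)[OF xy(1)] by blast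
    obtain N' where N': "!!bv. 0 <= bv ==> N' <= edeg bv ==> sh bv y : U (t + edeg bv)" using satE(2)[OF xy(2)] by blast
    show "x + y : sat a U t"
    proof (rule satI[of _ _ _ "max N N'"])
      show "x + y : fr a t" using xy by (intro fs.subspace_add[OF gsub_subspace[OF gsub_fr]] satE(1))
      fix bv :: "'a => int" assume "0 <= bv" "max N N' <= edeg bv"
      then show "sh bv (x + y) : U (t + edeg bv)" unfolding sh_add by (intro fs.subspace_add[OF gsub_subspace[OF U]] N N') auto
    qed
  next
    fix c x assume x: "x : sat a U t"
    obtain N where N: "!!bv. 0 <= bv ==> N <= edeg bv ==> sh bv x : U (t + edeg bv)" using satE(2)[OF x] by blast
    show "scl c x : sat a U t"
    proof (rule satI[of _ _ _ N])
      show "scl c x : fr a t" using x by (intro fs.subspace_scale[OF gsub_subspace[OF gsub_fr]] satE(1))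
      fix bv :: "'a => int" assume "0 <= bv" "N <= edeg bv"
      then show "sh bv (scl c x) : U (t + edeg bv)" unfolding sh_scl by (intro fs.subspace_scale[OF gsub_subspace[OF U]] N)
    qed
  qed
next
  fix t and gv :: "'a => int" and v assume g: "0 <= gv" and v: "v : sat a U t"
  obtain N where N: "!!bv. 0 <= bv ==> N <= edeg bv ==> sh bv v : U (t + edeg bv)" using satE(2)[OF v] by blast
  show "sh gv v : sat a U (t + edeg gv)"
  proof (rule satI[of _ _ _ N])
    show "sh gv v : fr a (t + edeg gv)" by (rule gsub_sh[OF gsub_fr g satE(1)[OF v]])
    fix bv :: "'a => int" assume b: "0 <= bv" "N <= edeg bv"
    have "sh (bv + gv) v : U (t + edeg (bv + gv))"
      by (rule N[OF add_nonneg_nonneg[OF b(1) g]]) (use b(2) edeg_nonneg[OF g] in simp)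
    then show "sh bv (sh gv v) : U (t + edeg gv + edeg bv)" by (simp add: sh_sh algebra_simps)
  qed
qed

lemma exponent_split:
  fixes gv :: "'n::finite => int"
  assumes "0 <= gv" "0 <= N" "N <= edeg gv"
  shows "\<exists>bv. 0 <= bv & bv <= gv & edeg bv = N" using assms
proof (induction "nat (edeg gv - N)" arbitrary: gv)
  case 0
  then show ?case by (intro exI[of _ gv]) auto
next
  case (Suc m)
  have "\<exists>i. 1 <= gv i"
  proof (rule ccontr)
    assume "\<not> ?thesis"
    then have "gv i <= 0" for i by (auto simp: not_le dest: spec[of _ i])
    then have "edeg gv <= 0" unfolding edeg_def by (intro sum_nonpos) auto
    then show False using Suc by simp
  qed
  then obtain i where i: "1 <= gv i" by blast
  define dv where "dv = gv - mono_exp i 1"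
  have d: "0 <= dv" "dv <= gv" "edeg dv = edeg gv - 1"
    using Suc.prems(1) i by (auto simp: dv_def le_fun_def mono_exp_def) (simp add: mono_exp_def[symmetric])
  have "\<exists>bv. 0 <= bv & bv <= dv & edeg bv = N" by (rule Suc.hyps(1)) (use d Suc in auto)
  then show ?case using d(2) order_trans by blast
qed

text \<open>Every monomial of large degree is divisible by one of the finitely many monomials of
  degree \<open>N0\<close>. These carry \<open>v\<close> into the saturation, and finitely many
  torsion bounds have a common bound.\<close>

lemma sat_sat:
  fixes U :: "('n::finite, 'k::field) fam"
  assumes U: "gsub U" and v: "v : fr a t"
    and N: "!!bv. 0 <= bv ==> N <= edeg bv ==> sh bv v : sat a U (t + edeg bv)"
  shows "v : sat a U t"
proof -
  define N0 where "N0 = max N 0"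
  have "\<forall>bv. \<exists>M. 0 <= bv --> N <= edeg bv -->
      (\<forall>gv. 0 <= gv --> M <= edeg gv --> sh gv (sh bv v) : U (t + edeg bv + edeg gv))" using N satE(2) by blast
  then obtain M where M: "!!bv gv. 0 <= bv ==> N <= edeg bv ==> 0 <= gv ==> M bv <= edeg gv
      ==> sh gv (sh bv v) : U (t + edeg bv + edeg gv)" by metis
  let ?B = "{bv :: 'n => int. 0 <= bv & edeg bv = N0}"
  \<comment> \<open>Dominates the torsion bounds of all multiples of \<open>v\<close> by monomials
    of degree \<open>N0\<close>.\<close>
  define K where "K = (\<Sum>bv\<in>?B. \<bar>M bv\<bar>)"
  show ?thesis
  proof (rule satI[OF v, of "N0 + K"])
    fix gv :: "'n => int" assume g: "0 <= gv" "N0 + K <= edeg gv"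
    have K0: "0 <= K" unfolding K_def by (rule sum_nonneg) auto
    have "0 <= N0" "N0 <= edeg gv" using g(2) K0 unfolding N0_def by linarith+
    then obtain bv where b: "0 <= bv" "bv <= gv" "edeg bv = N0" using exponent_split[OF g(1), of N0] by blast
    have "\<bar>M bv\<bar> <= K" unfolding K_def by (rule member_le_sum) (use b finite_nonneg_edeg in auto)
    then have "M bv <= edeg (gv - bv)" using g(2) b(3) by simp
    moreover have "0 <= gv - bv" using b(2) by (simp add: le_fun_def)
    ultimately have "sh (gv - bv) (sh bv v) : U (t + edeg bv + edeg (gv - bv))" using b by (intro M) (auto simp: N0_def)
    then show "sh gv v : U (t + edeg gv)" by (simp add: sh_sh)
  qed
qed

text \<open>A 0-cocycle is an element \<open>v\<close> that vanishes after inverting any single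
  variable, so a power \<open>m i\<close> of each variable moves it into the saturation. A monomial
  of degree at least the sum of the \<open>m i\<close> contains one of these powers, and
  \<open>sat_sat\<close> applies.\<close>

lemma hh_0_sat:
  fixes U :: "('n::{finite,linorder}, 'k::field) fam"
  assumes U: "gsub U"
  shows "hh 0 (fr a) (sat a U) t = 0"
proof -
  note S = gsub_sat[OF U, of a]
  have "ZZ 0 (fr a) (sat a U) t <= BB 0 (fr a) (sat a U) t"
  proof
    fix c assume c: "c : ZZ 0 (fr a) (sat a U) t"
    define v where "v = sl c {}"
    have v: "v : fr a t" using Cc_loc[OF ZZ_Cc[OF c], of "{}"] by (simp add: v_def loc_empty)
    have "\<exists>m. sh (mono_exp i m) v : sat a U (t + int m)" for i
    proof -
      have "sl (dd c) {i} : loc (sat a U) {i} t" using Cc_loc[OF ZZ_dd[OF c], of "{i}"] by simp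
      moreover have "sl (dd c) {i} = v"
      proof -
        have "{w \<in> {i}. w < i} = {}" by auto
        then have "sg {i} i = (1 :: 'k)" by (simp only: sg_def card.empty power_0)
        then show ?thesis by (simp add: sl_dd v_def)
      qed
      ultimately have "v : loc (sat a U) {i} t" by simp
      then obtain bv where b: "0 <= bv" "!!j. j ~: {i} ==> bv j = 0" "sh bv v : sat a U (t + edeg bv)" by (metis locE)
      have "bv = mono_exp i (nat (bv i))" using b(1,2) by (auto simp: fun_eq_iff mono_exp_def le_fun_def)
      then show ?thesis using b(3) by (metis edeg_mono_exp)
    qed
    then obtain m where m: "!!i. sh (mono_exp i (m i)) v : sat a U (t + int (m i))" by metis
    have "v : sat a U t"
    proof (rule sat_sat[OF U v, of "\<Sum>i\<in>UNIV. int (m i)"])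
      fix bv :: "'n => int" assume b: "0 <= bv" "(\<Sum>i\<in>UNIV. int (m i)) <= edeg bv"
      have "\<exists>i. int (m i) <= bv i"
      proof (rule ccontr)
        assume "\<not> ?thesis"
        then have "bv i < int (m i)" for i by (simp add: not_le)
        then have "edeg bv < (\<Sum>i\<in>UNIV. int (m i))" unfolding edeg_def by (intro sum_strict_mono) auto
        then show False using b(2) by simp
      qed
      then obtain i where i: "int (m i) <= bv i" by blast
      define gv where "gv = bv - mono_exp i (m i)"
      have "0 <= gv" using b(1) i by (auto simp: gv_def le_fun_def mono_exp_def)
      then have "sh gv (sh (mono_exp i (m i)) v) : sat a U (t + int (m i) + edeg gv)" by (rule gsub_sh[OF S _ m])
      moreover have "gv + mono_exp i (m i) = bv" by (simp add: gv_def)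
      moreover have "t + int (m i) + edeg gv = t + edeg bv" by (simp add: gv_def)
      ultimately show "sh bv v : sat a U (t + edeg bv)" by (simp only: sh_sh)
    qed
    then have "c : Cc 0 (sat a U) t" using Cc_zero[OF ZZ_Cc[OF c]] by (intro CcI) (auto simp: loc_empty v_def)
    then show "c : BB 0 (fr a) (sat a U) t" by (rule Cc_BB[OF gsub_fr])
  qed
  then show ?thesis unfolding hh_def qdim_eq_0_iff[OF subspace_BB[OF gsub_fr S]] .
qed

text \<open>Torsion has cohomology in degree 0 only, hence in the relevant part of the long exact
  sequence both connecting ranks vanish.\<close>

lemma hI_mod_tors:
  assumes FU: "adm F U" and T: "gsub T" "!!t. U t <= T t" "!!t. T t <= F t" and tors: "tors T U" and p: "1 <= p"
  shows "hI p F U t = hI p F T t"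
proof -
  have z: "hI q T U t = 0" if "1 <= q" for q using hh_tors[OF tors T(2) T(1) admD(2)[OF FU], of q t] that by (simp add: hI_def)
  have "eint (conn_rank p U T F t) <= 0" "eint (conn_rank (p + 1) U T F t) <= 0"
    using conn_rank_int_le(1)[OF FU T, of p t] conn_rank_int_le(1)[OF FU T, of "p + 1" t] z[of p] z[of "p + 1"] p by auto
  then have "eint (conn_rank p U T F t) = 0" "eint (conn_rank (p + 1) U T F t) = 0" using eint_nonneg by (metis order_antisym)+
  then show ?thesis using long_exact_sequence_int[OF FU T, of p t] z[OF p] by simp
qed

lemma chi_mod_tors:
  assumes FU: "adm F U" and T: "gsub T" "!!t. U t <= T t" "!!t. T t <= F t" and tors: "tors T U"
  shows "chi F U t = chi F T t" using chi_add[OF FU T, of t] chi_tors[OF adm_sub[OF FU T] tors, of t] by simp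

text \<open>Abstract multiplication by a linear form. Quantifying over all graded submodules
  replaces the statement that the map is given by an element of the ring.\<close>

definition lin1 :: "(('n::finite, 'k::field) lvec => ('n, 'k) lvec) => bool" where
  "lin1 fv \<longleftrightarrow> eqv fv & (\<forall>V t v. gsub V --> v : V t --> fv v : V (t + 1))"

text \<open>If \<open>U\<close> presents M, then this family presents M/lM.\<close>

definition hstep :: "int list => (('n::finite, 'k::field) lvec => ('n, 'k) lvec) => ('n, 'k) fam => ('n, 'k) fam" where
  "hstep a fv U t = sadd (fv ` fr a (t - 1)) (U t)"

text \<open>Filter regularity in the form used here: the kernel of the form on M = F/U lies in
  H^0_m(M).\<close>

definition freg1 :: "int list => (('n::finite, 'k::field) lvec => ('n, 'k) lvec) => ('n, 'k) fam => bool" where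
  "freg1 a fv U \<longleftrightarrow> (\<forall>t v. v : fr a t --> fv v : U (t + 1) --> v : sat a U t)"

text \<open>Write M = F/U and M' = F/S, where \<open>S\<close> is the saturation of
  \<open>U\<close>. Then \<open>U'\<close> presents M/lM and \<open>C\<close> presents M'/lM'; the
  two differ by torsion, hence agree in cohomology of positive degree and in
  \<open>chi\<close>.\<close>

locale hyperplane_section =
  fixes a :: "int list" and fv :: "('n::{finite,linorder}, 'k::field) lvec => ('n, 'k) lvec" and U :: "('n, 'k) fam"
  assumes U: "gsub U" and Ua: "!!t. U t <= fr a t" and l1: "lin1 fv" and fr1: "freg1 a fv U"
begin

abbreviation "F \<equiv> (fr a :: ('n, 'k) fam)"
abbreviation "S \<equiv> sat a U"
abbreviation "U' \<equiv> hstep a fv U"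
abbreviation "C \<equiv> hstep a fv S"

lemma phi_eqv: "eqv fv" and phi_deg: "gsub V ==> v : V t ==> fv v : V (t + 1)" using l1 unfolding lin1_def by blast+

lemma S: "gsub S" by (rule gsub_sat[OF U])
lemma US: "U t <= S t" by (rule sat_base[OF U Ua])
lemma SF: "S t <= F t" by (rule sat_fr)

lemma gsub_hstep: "gsub W ==> gsub (hstep a fv W)" unfolding hstep_def by (rule gsub_shift_sum[OF gsub_fr _ phi_eqv])

lemma hstep_base: "W t <= hstep a fv W t" unfolding hstep_def
  by (intro subsetI sadd_right subspace_image eqv_flin phi_eqv gsub_subspace gsub_fr)

lemma hstep_fr: "(!!t. W t <= F t) ==> hstep a fv W t <= F t" unfolding hstep_def
proof (intro sadd_least gsub_subspace gsub_fr image_subsetI)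
  fix v assume "v : F (t - 1)"
  then show "fv v : F t" using phi_deg[OF gsub_fr, of v a "t - 1"] by simp
qed

lemma hstep_mono: "(!!t. W t <= W' t) ==> hstep a fv W t <= hstep a fv W' t" unfolding hstep_def by (intro sadd_mono order_refl)

lemma tors_hstep: "tors C U'" unfolding tors_def
proof (intro allI ballI)
  fix t c assume "c : C t"
  then obtain v s where vs: "v : F (t - 1)" "s : S t" "c = fv v + s" unfolding hstep_def by (auto elim!: saddE)
  obtain N where N: "!!bv. 0 <= bv ==> N <= edeg bv ==> sh bv s : U (t + edeg bv)" using satE(2)[OF vs(2)] by blast
  show "\<exists>N. \<forall>bv. 0 <= bv --> N <= edeg bv --> sh bv c : U' (t + edeg bv)"
  proof (intro exI[of _ N] allI impI)
    fix bv :: "'n => int" assume b: "0 <= bv" "N <= edeg bv"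
    have "sh bv v : F (t + edeg bv - 1)" using gsub_sh[OF gsub_fr b(1) vs(1)] by (simp add: algebra_simps)
    then have "fv (sh bv v) + sh bv s : U' (t + edeg bv)" unfolding hstep_def using N[OF b] by (intro saddI imageI)
    then show "sh bv c : U' (t + edeg bv)" by (simp only: vs(3) sh_add eqv_sh[OF phi_eqv])
  qed
qed

lemma adm_FU: "adm F U" by (rule adm_fr[OF U Ua])
lemma adm_FS: "adm F S" by (rule adm_fr[OF S SF])
lemma adm_FU': "adm F U'" by (rule adm_fr[OF gsub_hstep[OF U] hstep_fr[OF Ua]])
lemma adm_FC: "adm F C" by (rule adm_fr[OF gsub_hstep[OF S] hstep_fr[OF SF]])

lemma hI_U: "1 <= p ==> hI p F U t = hI p F S t" by (rule hI_mod_tors[OF adm_FU S US SF tors_sat])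

lemma chi_U: "chi F U t = chi F S t" by (rule chi_mod_tors[OF adm_FU S US SF tors_sat])

lemma hI_U': "1 <= p ==> hI p F U' t = hI p F C t"
  by (rule hI_mod_tors[OF adm_FU' gsub_hstep[OF S] hstep_mono[OF US] hstep_fr[OF SF] tors_hstep])

lemma chi_U': "chi F U' t = chi F C t"
  by (rule chi_mod_tors[OF adm_FU' gsub_hstep[OF S] hstep_mono[OF US] hstep_fr[OF SF] tors_hstep])

text \<open>The form is a nonzerodivisor on M': if \<open>fv v\<close> is torsion, high multiples of
  \<open>v\<close> are mapped into \<open>U\<close>, so they are torsion by filter regularity, and
  then so is \<open>v\<close> by \<open>sat_sat\<close>.\<close>

lemma mult_injective: "v : F t ==> fv v : S (t + 1) \<longleftrightarrow> v : S t"
proof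
  assume v: "v : F t" and pv: "fv v : S (t + 1)"
  obtain N where N: "!!bv. 0 <= bv ==> N <= edeg bv ==> sh bv (fv v) : U (t + 1 + edeg bv)" using satE(2)[OF pv] by blast
  show "v : S t"
  proof (rule sat_sat[OF U v, of N])
    fix bv :: "'n => int" assume b: "0 <= bv" "N <= edeg bv"
    have "fv (sh bv v) : U (t + edeg bv + 1)" using N[OF b] by (simp add: eqv_sh[OF phi_eqv] algebra_simps)
    then show "sh bv v : S (t + edeg bv)" using fr1 gsub_sh[OF gsub_fr b(1) v] unfolding freg1_def by blast
  qed
qed (rule phi_deg[OF S])

text \<open>Identifies M'(-1) with lM' = C/S.\<close>

sublocale fam_iso fv F S C S 1
proof unfold_locales
  show "fv v : C (t + 1)" if "v : F t" for t v unfolding hstep_def using that by (intro sadd_left gsub_subspace S) simp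
  show "\<exists>v\<in>F t. fv v - c : S (t + 1)" if c: "c : C (t + 1)" for t c
  proof -
    obtain v u where vu: "v : F t" "u : S (t + 1)" "c = fv v + u" using c unfolding hstep_def by (auto elim!: saddE)
    have "fv v - c = - u" using vu(3) by simp
    then show ?thesis using vu fs.subspace_neg[OF gsub_subspace[OF S] vu(2)] by (intro bexI[of _ v]) simp_all
  qed
qed (use phi_eqv gsub_fr S gsub_hstep[OF S] SF hstep_base mult_injective in auto)

text \<open>Here \<open>r p\<close> is the rank of the connecting map from H^(p-1)(M'/lM') in degree
  t to H^p(M') in degree t - 1.\<close>

lemma section_sequence:
  obtains r where
    "!!p. hI p F S t + r p + r (p + 1) = hI p F S (t - 1) + hI p F C t"
    "!!p. 0 <= r p" "!!p. r (p + 1) <= hI p F C t" "!!p. r p <= hI p F S (t - 1)"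
proof -
  note F = adm_FS gsub_hstep[OF S] hstep_base hstep_fr[OF SF]
  have e: "hI p C S t = hI p F S (t - 1)" for p using hh_eq[of p "t - 1"] by (simp add: hI_def)
  show thesis by (rule that[of "%p. eint (conn_rank p S C F t)"])
      (use long_exact_sequence_int[OF F, of _ t] conn_rank_int_le[OF F, of _ t] e in auto)
qed

text \<open>Exactness of H^p(M'/lM')_t, H^(p+1)(M')_(t-1), H^(p+1)(M')_t.\<close>

lemma hI_step: "hI (p + 1) F S (t - 1) <= hI (p + 1) F S t + hI p F C t"
proof -
  obtain r where r: "!!p. hI p F S t + r p + r (p + 1) = hI p F S (t - 1) + hI p F C t"
    "!!p. 0 <= r p" "!!p. r (p + 1) <= hI p F C t" "!!p. r p <= hI p F S (t - 1)" using section_sequence[of t] by metis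
  from r(1)[of "p + 1"] r(3)[of p] r(3)[of "p + 1"] show ?thesis by linarith
qed

text \<open>If H^p(M'/lM')_t vanishes, then H^p(M')_(t-1) maps onto H^p(M')_t.\<close>

lemma hI_decr: "hI p F C t = 0 ==> hI p F S t <= hI p F S (t - 1)"
proof -
  obtain r where r: "!!p. hI p F S t + r p + r (p + 1) = hI p F S (t - 1) + hI p F C t"
    "!!p. 0 <= r p" "!!p. r (p + 1) <= hI p F C t" "!!p. r p <= hI p F S (t - 1)" using section_sequence[of t] by metis
  from r(1)[of p] r(2)[of p] r(2)[of "p + 1"] show "hI p F C t = 0 ==> ?thesis" by linarith
qed

lemma qI_section: "qI F S t = qI F S (t - 1) + qI F C t"
  using qI_add[OF adm_FS gsub_hstep[OF S] hstep_base hstep_fr[OF SF], of t] qdim_eq[of "t - 1"] by (simp add: qI_def)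

text \<open>Torsion is invisible to \<open>chi\<close>, so the nonzerodivisor sequence on M'
  computes the difference for M itself.\<close>

lemma chi_section: "chi F U t - chi F U (t - 1) = chi F U' t"
  using chi_add[OF adm_FS gsub_hstep[OF S] hstep_base hstep_fr[OF SF], of t] chi_eq[of "t - 1"] by (simp add: chi_U chi_U')

text \<open>H^1 loses at most dim H^0(M'/lM')_t from degree t - 1 to t, while M' gains dim
  (M'/lM')_t, which is at least as large.\<close>

lemma q_plus_h1_mono: "qI F S (t - 1) + hI 1 F S (t - 1) <= qI F S t + hI 1 F S t"
proof -
  have "hI 0 F C t <= qI F C t" unfolding hI_def qI_def by (intro eint_mono hh_0_le gsub_fr gsub_hstep S qdim_adm_finite adm_FC)
  then show ?thesis using hI_step[of 0 t] qI_section[of t] by simp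
qed

end

text \<open>Downward induction started in large degrees, where local cohomology is zero.\<close>

lemma descend:
  fixes Q :: "int => bool"
  assumes "\<exists>t0. \<forall>t\<ge>t0. Q t" "!!t. t > m ==> Q t ==> Q (t - 1)" "t >= m"
  shows "Q t"
proof -
  obtain t0 where t0: "!!t. t >= t0 ==> Q t" using assms(1) by blast
  have "Q s" if "m <= s" "s <= max t0 m" for s using that(2,1)
  proof (induction s rule: int_le_induct)
    case base
    show ?case using t0[of "max t0 m"] by simp
  next
    case (step i)
    then show ?case using assms(2)[of i] by simp
  qed
  then show ?thesis using t0[of t] assms(3) by (cases "t <= max t0 m") auto
qed

subsection \<open>The bound on local cohomology\<close>

primrec hseq :: "int list => (('n::finite, 'k::field) lvec => ('n, 'k) lvec) list => ('n, 'k) fam => ('n, 'k) fam" where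
  "hseq a [] U = U"
| "hseq a (fv # ls) U = hseq a ls (hstep a fv U)"

primrec freg :: "int list => (('n::finite, 'k::field) lvec => ('n, 'k) lvec) list => ('n, 'k) fam => bool" where
  "freg a [] U \<longleftrightarrow> True"
| "freg a (fv # ls) U \<longleftrightarrow> lin1 fv & freg1 a fv U & freg a ls (hstep a fv U)"

text \<open>The saturation makes this a bound for the regularity of the module modulo torsion,
  matching the numbers \<open>rbar j\<close>.\<close>

definition reg_le :: "int list => ('n::{finite,linorder}, 'k::field) fam => int extended => bool" where
  "reg_le a U \<rho> \<longleftrightarrow> (\<forall>p t. hI (int p) (fr a) (sat a U) t ~= 0 --> Fin (int p + t) <= \<rho>)"

lemma reg_leD: "reg_le a U \<rho> ==> 0 <= p ==> \<not> Fin (p + t) <= \<rho> ==> hI p (fr a) (sat a U) t = 0"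
  unfolding reg_le_def by (metis nonneg_int_cases)

lemma poly_Delta: "poly (Delta P) x = poly P x - poly P (x - 1)" by (simp add: Delta_def poly_pcompose)

lemma poly_eq_of_infinite:
  fixes P Q :: "rat poly"
  assumes "infinite {t :: int. poly P (of_int t) = poly Q (of_int t)}"
  shows "P = Q"
proof (rule ccontr)
  assume "P ~= Q"
  then have "finite {x. poly (P - Q) x = 0}" by (intro poly_roots_finite) simp
  moreover have "inj_on (of_int :: int => rat) {t. poly P (of_int t) = poly Q (of_int t)}" by (auto intro: inj_onI)
  moreover have "(of_int :: int => rat) ` {t. poly P (of_int t) = poly Q (of_int t)} <= {x. poly (P - Q) x = 0}" by auto
  ultimately show False using assms by (meson finite_imageD finite_subset)
qed

lemma infinite_int_atMost: "infinite {..(T :: int)}"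
proof
  assume f: "finite {..T}"
  then have "T - 1 - \<bar>Min {..T}\<bar> - \<bar>T\<bar> >= Min {..T}" by (intro Min_le) auto
  then show False by linarith
qed

lemma infinite_int_atLeast: "infinite {(T :: int)..}"
proof
  assume f: "finite {T..}"
  then have "T + 1 + \<bar>Max {T..}\<bar> + \<bar>T\<bar> <= Max {T..}" by (intro Max_ge) auto
  then show False by linarith
qed

text \<open>\<open>Delta P\<close> has infinitely many zeros, hence is zero.\<close>

lemma poly_const_of_step:
  fixes P :: "rat poly"
  assumes "!!t :: int. t <= T ==> poly P (of_int t) = poly P (of_int (t - 1))"
  shows "poly P (of_int t) = coeff P 0"
proof -
  have "{..T} <= {t :: int. poly (Delta P) (of_int t) = poly 0 (of_int t)}" using assms by (auto simp: poly_Delta)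
  then have "Delta P = 0" by (intro poly_eq_of_infinite) (use infinite_int_atMost[of T] finite_subset in blast)
  then have "poly P (of_int s) = poly P (of_int (s - 1))" for s :: int using poly_Delta[of P "of_int s"] by simp
  then have "poly P (of_int t) = poly P (of_int 0)" by (rule int_step_const[of "%t. poly P (of_int t)"])
  then show ?thesis by (simp add: poly_0_coeff_0)
qed

lemma fr_empty_below: "\<exists>T. \<forall>t\<le>T. fr a t = ({0} :: ('n::finite, 'k::field) lvec set)"
proof (intro exI allI impI)
  fix t assume t: "t <= - (\<Sum>x\<leftarrow>a. \<bar>x\<bar>) - 1"
  have "v = 0" if v: "v : fr a t" for v :: "('n, 'k) lvec"
  proof (rule ccontr)
    assume "v ~= 0"
    then obtain j av where "v (j, av) ~= 0" by (auto simp: fun_eq_iff)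
    then have j: "j < length a" "0 <= av" "edeg av = t - a ! j" using v unfolding fr_iff by blast+
    have "\<bar>a ! j\<bar> <= (\<Sum>x\<leftarrow>a. \<bar>x\<bar>)" using nth_mem[OF j(1)] by (intro member_le_sum_list) auto
    then show False using edeg_nonneg[OF j(2)] j(3) t by linarith
  qed
  then show "fr a t = ({0} :: ('n, 'k) lvec set)" using fs.subspace_0[OF gsub_subspace[OF gsub_fr]] by blast
qed

context hyperplane_section
begin

context
  fixes \<rho> :: "int extended"
  assumes reg: "reg_le a U' \<rho>" and fin: "\<rho> ~= Pinf"
begin

text \<open>In positive cohomological degree F/C, F/U' and F/U' modulo torsion have the same
  cohomology, so the regularity bound carries over to M'/lM'.\<close>

lemma C_vanish: "1 <= p ==> \<not> Fin (p + t) <= \<rho> ==> hI p F C t = 0" using reg_leD[OF reg, of p t]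
    hI_mod_tors[OF adm_FU' gsub_sat[OF gsub_hstep[OF U]] sat_base[OF gsub_hstep[OF U] hstep_fr[OF Ua]] sat_fr tors_sat, of p t]
    hI_U'[of p t] by simp

lemma eventually_hI_0: "\<exists>t0. \<forall>t\<ge>t0. hI p F S t = 0"
  using hh_finite_vanishing[OF adm_FS, of p] unfolding hI_def by (metis eint_0)

text \<open>Downwards along \<open>hI_step\<close>: for \<open>s > t\<close> the group
  H^(p-1)(M'/lM')_s lies beyond the regularity, because p - 1 + s >= t + 2.\<close>

lemma S_vanish:
  assumes p: "2 <= p" and t: "\<not> Fin (t + 2) <= \<rho>"
  shows "hI p F S t = 0"
proof (rule descend[of "%t. hI p F S t = 0" t, OF eventually_hI_0 _ order_refl])
  fix s assume s: "t < s" "hI p F S s = 0"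
  have "\<not> Fin (p - 1 + s) <= \<rho>" using t p s(1) by (cases \<rho>) auto
  then have "hI (p - 1) F C s = 0" using p by (intro C_vanish) auto
  then show "hI p F S (s - 1) = 0" using hI_step[of "p - 1" s] s(2) by (simp add: order_antisym)
qed

text \<open>H^0(M') is zero and the groups with p >= 2 vanish here, so the alternating sum keeps
  only H^1, with sign -1.\<close>

lemma chi_S:
  assumes t: "\<not> Fin (t + 2) <= \<rho>"
  shows "chi F U t = qI F S t + hI 1 F S t"
proof -
  have "(- 1) ^ p * hI (int p) F S t = (if p = 1 then - hI 1 F S t else 0)" for p
  proof -
    consider "p = 0" | "p = 1" | "p >= 2" by linarith
    then show ?thesis
    proof cases
      case 1
      then show ?thesis using hh_0_sat[OF U, of a t] by (simp add: hI_def)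
    next
      case 3
      then show ?thesis using S_vanish[OF _ t, of "int p"] by simp
    qed simp
  qed
  then have "(\<Sum>p\<le>CARD('n). (- 1) ^ p * hI (int p) F S t) = (\<Sum>p\<le>CARD('n). if p = 1 then - hI 1 F S t else 0)"
    by (intro sum.cong) auto
  also have "\<dots> = - hI 1 F S t" using zero_less_card_finite[where 'a = 'n] by (simp add: Suc_leI)
  finally show ?thesis unfolding chi_U by (simp add: chi_def)
qed

lemma h1_decr: "\<not> Fin (t + 1) <= \<rho> ==> hI 1 F S t <= hI 1 F S (t - 1)"
  by (intro hI_decr C_vanish) (simp_all add: add.commute)

lemma g_mono: "s <= t ==> qI F S s + hI 1 F S s <= qI F S t + hI 1 F S t"
proof (induction s rule: int_le_induct)
  case (step i)
  then show ?case using q_plus_h1_mono[of i] by linarith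
qed simp

text \<open>Up to degree r - 1 the nondecreasing quantity dim M' + dim H^1(M') bounds H^1; from
  there on dim H^1(M') is nonincreasing. Both bounds meet at r - 1.\<close>

lemma h1_bound:
  assumes P: "!!t. poly P (of_int t) = (of_int (chi F U t) :: rat)"
  shows "0 <= ext_poly P (\<rho> - 1)" "of_int (hI 1 F U t) <= ext_poly P (\<rho> - 1)"
proof -
  have "0 <= ext_poly P (\<rho> - 1) & of_int (hI 1 F S t) <= ext_poly P (\<rho> - 1)"
  proof (cases \<rho>)
    case (Fin r)
    \<comment> \<open>The degree r - 1 is the smallest one with t + 2 > r, as \<open>chi_S\<close>
      requires.\<close>
    have g: "chi F U (r - 1) = qI F S (r - 1) + hI 1 F S (r - 1)" by (rule chi_S) (simp add: Fin)
    have K: "ext_poly P (\<rho> - 1) = of_int (qI F S (r - 1) + hI 1 F S (r - 1))"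
      using P[of "r - 1"] g by (simp add: Fin ext_poly_def one_extended_def)
    have "hI 1 F S t <= qI F S (r - 1) + hI 1 F S (r - 1)"
    proof (cases "t <= r - 1")
      case True
      then show ?thesis using g_mono[OF True] qI_nonneg[of F S t] by linarith
    next
      case False
      have "hI 1 F S t <= hI 1 F S (r - 1)" if "r - 1 <= t" for t using that
      proof (induction t rule: int_ge_induct)
        case (step i)
        have "hI 1 F S (i + 1) <= hI 1 F S (i + 1 - 1)" by (rule h1_decr) (use step Fin in simp)
        then show ?case using step by simp
      qed simp
      then show ?thesis using False qI_nonneg[of F S "r - 1"] by (smt (verit))
    qed
    then have "of_int (hI 1 F S t) <= (of_int (qI F S (r - 1) + hI 1 F S (r - 1)) :: rat)" by (rule of_int_le_iff[THEN iffD2])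
    moreover have "0 <= (of_int (qI F S (r - 1) + hI 1 F S (r - 1)) :: rat)"
      unfolding of_int_0_le_iff using qI_nonneg[of F S "r - 1"] hI_nonneg[of 1 F S "r - 1"] by linarith
    ultimately show ?thesis unfolding K by blast
  next
    case Minf
    have g: "chi F U s = qI F S s + hI 1 F S s" for s by (rule chi_S) (simp add: Minf)
    obtain T where T: "!!t. t <= T ==> fr a t = ({0} :: ('n, 'k) lvec set)"
      using fr_empty_below[of a, where 'n = 'n and 'k = 'k] by blast
    have q0: "qI F S s = 0" if "s <= T" for s
    proof -
      have "qdim (F s) (S s) = 0" unfolding qdim_eq_0_iff[OF gsub_subspace[OF S]]
        using T[OF that] fs.subspace_0[OF gsub_subspace[OF S]] by auto
      then show ?thesis by (simp add: qI_def)
    qed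
    \<comment> \<open>In low degrees M' is zero, so dim H^1(M') is nondecreasing by
      \<open>q_plus_h1_mono\<close> and nonincreasing by \<open>h1_decr\<close>. Thus P is constant,
      and its constant coefficient is the value of \<open>ext_poly\<close> at minus
      infinity.\<close>
    have "poly P (of_int s) = poly P (of_int (s - 1))" if "s <= T" for s
      using that q_plus_h1_mono[of s] h1_decr[of s] q0[of s] q0[of "s - 1"] unfolding P g by (simp add: Minf)
    then have c: "poly P (of_int s) = coeff P 0" for s by (rule poly_const_of_step)
    have "of_int (qI F S t + hI 1 F S t) = coeff P 0" using P[of t] g[of t] c[of t] by simp
    moreover have "of_int (hI 1 F S t) <= (of_int (qI F S t + hI 1 F S t) :: rat)" by (simp add: order_trans)
    moreover have "(0 :: rat) <= of_int (qI F S t + hI 1 F S t)"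
      unfolding of_int_0_le_iff by (intro add_nonneg_nonneg qI_nonneg hI_nonneg)
    ultimately show ?thesis by (simp add: Minf ext_poly_def one_extended_def)
  qed (use fin in simp)
  then show "0 <= ext_poly P (\<rho> - 1)" "of_int (hI 1 F U t) <= ext_poly P (\<rho> - 1)" by (simp_all add: hI_U)
qed

end
end

text \<open>Lowering the degree by one raises the upper argument by one. The convention that small
  upper arguments give 0 keeps Pascal's rule true for negative values.\<close>

lemma ext_binomial_pascal:
  assumes "\<rho> ~= Pinf"
  shows "ext_binomial (Fin (- (t - 1)) + \<rho> - 1) (Suc m)
    = ext_binomial (Fin (- t) + \<rho> - 1) (Suc m) + ext_binomial (Fin (- t) + \<rho> - 1) m"
proof (cases \<rho>)
  case (Fin r)
  define c where "c = r - t - 1"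
  have "ext_binomial (Fin (c + 1)) (Suc m) = ext_binomial (Fin c) (Suc m) + ext_binomial (Fin c) m"
  proof (cases "0 <= c")
    case True
    then obtain k where k: "c = int k" by (metis nonneg_int_cases)
    have *: "ext_binomial (Fin (int k)) m = k choose m" for k m by (auto simp: ext_binomial_def binomial_eq_0)
    have "c + 1 = int (Suc k)" using k by simp
    then show ?thesis unfolding k by (simp only: * binomial_Suc_Suc add.commute)
  qed (auto simp: ext_binomial_def)
  then show ?thesis by (simp add: Fin c_def one_extended_def algebra_simps)
next
  case Minf
  then show ?thesis by (simp add: ext_binomial_def one_extended_def)
qed (use assms in simp)

text \<open>The induction removes the first form, replacing M by M/lM and P by
  \<open>Delta P\<close>; \<rho> and \<sigma> belong to the ends of the sequence and do not change.
  Nonnegativity of the polynomial value is carried along for the degrees in which the cohomology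
  vanishes.\<close>

theorem local_cohomology_bound:
  fixes U :: "('n::{finite,linorder}, 'k::field) fam" and P :: "rat poly"
  assumes "length ls = Suc m" "gsub U" "!!t. U t <= fr a t" "freg a ls U"
    and "reg_le a (hseq a (butlast ls) U) \<rho>" "\<rho> ~= Pinf" "reg_le a (hseq a ls U) \<sigma>" "\<sigma> ~= Pinf"
    and "!!t. poly P (of_int t) = of_int (chi (fr a) U t)"
  shows "0 <= ext_poly ((Delta ^^ m) P) (\<sigma> - 1) \<and>
    (\<forall>t. of_int (hI (int (Suc m)) (fr a) U t) \<le>
      of_nat (ext_binomial (Fin (- t) + \<rho> - 1) m) * ext_poly ((Delta ^^ m) P) (\<sigma> - 1))" using assms
proof (induction m arbitrary: ls U P)
  case 0
  obtain fv where ls: "ls = [fv]" using 0(1) by (metis length_0_conv length_Suc_conv)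
  interpret hyperplane_section a fv U using 0 ls by unfold_locales auto
  have r: "reg_le a (hstep a fv U) \<sigma>" "reg_le a U \<rho>" using 0 ls by simp_all
  note b = h1_bound[OF r(1) 0(8) 0(9)]
  \<comment> \<open>Up to the regularity the upper argument is nonnegative and the coefficient with
    lower index 0 equals 1; beyond it H^1 is zero.\<close>
  have "of_int (hI 1 F U t) <= of_nat (ext_binomial (Fin (- t) + \<rho> - 1) 0) * ext_poly P (\<sigma> - 1)" for t
  proof (cases "Fin (1 + t) <= \<rho>")
    case True
    then have "ext_binomial (Fin (- t) + \<rho> - 1) 0 = 1"
      using 0(6) by (cases \<rho>) (auto simp: ext_binomial_def one_extended_def)
    then show ?thesis using b(2)[of t] by simp
  next
    case False
    then have "hI 1 F U t = 0" using reg_leD[OF r(2), of 1 t] hI_U[of 1 t] by simp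
    then show ?thesis using b(1) by simp
  qed
  then show ?case using b(1) by simp
next
  case (Suc m)
  obtain fv ls' where ls: "ls = fv # ls'" "length ls' = Suc m" using Suc.prems(1) by (metis length_Suc_conv)
  have ne: "ls' ~= []" using ls by auto
  interpret hyperplane_section a fv U using Suc.prems ls by unfold_locales auto
  have P': "poly (Delta P) (of_int t) = of_int (chi F U' t)" for t
    using Suc.prems(9)[of t] Suc.prems(9)[of "t - 1"] chi_section[of t, symmetric] by (simp add: poly_Delta)
  define K where "K = ext_poly ((Delta ^^ Suc m) P) (\<sigma> - 1)"
  define B where "B t j = (of_nat (ext_binomial (Fin (- t) + \<rho> - 1) j) :: rat)" for t j
  have "0 <= ext_poly ((Delta ^^ m) (Delta P)) (\<sigma> - 1) & (\<forall>t. of_int (hI (int (Suc m)) F U' t) \<le>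
      of_nat (ext_binomial (Fin (- t) + \<rho> - 1) m) * ext_poly ((Delta ^^ m) (Delta P)) (\<sigma> - 1))"
    by (rule Suc.IH[OF ls(2) gsub_hstep[OF U] hstep_fr[OF Ua] _ _ Suc.prems(6) _ Suc.prems(8) P'])
      (use Suc.prems ls ne in auto)
  then have IH: "0 <= K" "of_int (hI (int (Suc m)) F U' t) <= B t m * K" for t by (simp_all add: K_def B_def funpow_swap1)
  have pascal: "B (t - 1) (Suc m) = B t (Suc m) + B t m" for t unfolding B_def ext_binomial_pascal[OF Suc.prems(6)] by simp
  \<comment> \<open>The sum over the degrees above \<open>t\<close> is built up one degree at a
    time: \<open>hI_step\<close> adds a term bounded by \<open>B s m * K\<close>, and Pascal's rule
    absorbs it.\<close>
  have "of_int (hI (int (Suc (Suc m))) F U t) <= B t (Suc m) * K" for t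
  proof (rule descend[of _ t, OF _ _ order_refl])
    show "\<exists>t0. \<forall>t\<ge>t0. of_int (hI (int (Suc (Suc m))) F U t) <= B t (Suc m) * K"
    proof -
      obtain t0 where "!!t. t >= t0 ==> hh (int (Suc (Suc m))) F U t = 0" using hh_finite_vanishing[OF adm_FU] by blast
      then have "of_int (hI (int (Suc (Suc m))) F U t) <= B t (Suc m) * K" if "t >= t0" for t
        using that IH(1) by (simp add: hI_def B_def)
      then show ?thesis by blast
    qed
    fix s assume s: "of_int (hI (int (Suc (Suc m))) F U s) <= B s (Suc m) * K"
    have "hI (int (Suc (Suc m))) F U (s - 1) <= hI (int (Suc (Suc m))) F U s + hI (int (Suc m)) F U' s"
      using hI_step[of "int (Suc m)" s] by (simp add: hI_U hI_U' add.commute)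
    then have "of_int (hI (int (Suc (Suc m))) F U (s - 1)) \<le>
        (of_int (hI (int (Suc (Suc m))) F U s) + of_int (hI (int (Suc m)) F U' s) :: rat)" by (metis of_int_add of_int_le_iff)
    also have "\<dots> <= B s (Suc m) * K + B s m * K" by (intro add_mono s IH(2))
    finally show "of_int (hI (int (Suc (Suc m))) F U (s - 1)) <= B (s - 1) (Suc m) * K" by (simp only: pascal distrib_right)
  qed
  then show ?case using IH(1) unfolding K_def B_def by blast
qed

subsection \<open>Local duality\<close>

text \<open>The residue pairing: the coefficient of the monomial with all exponents -1 in the
  product of \<open>g\<close> and \<open>f\<close>, summed over the basis positions.\<close>

definition pr :: "('n, 'k::field) lvec => ('n, 'k) lvec => 'k" where
  "pr g f = (\<Sum>x | f x ~= 0. g (fst x, - 1 - snd x) * f x)"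

lemma pr_superset: "finite A ==> {x. f x ~= 0} <= A ==> pr g f = (\<Sum>x\<in>A. g (fst x, - 1 - snd x) * f x)"
  unfolding pr_def by (rule sum.mono_neutral_left) auto

lemma pr_add1: "pr (g + h) f = pr g f + pr h f" by (simp add: pr_def distrib_right sum.distrib)

lemma pr_scl1: "pr (scl c g) f = c * pr g f" by (simp add: pr_def sum_distrib_left mult.assoc)

lemma pr_add2:
  assumes "finite {x. f x ~= 0}" "finite {x. h x ~= 0}"
  shows "pr g (f + h) = pr g f + pr g h"
proof -
  let ?A = "{x. f x ~= 0} Un {x. h x ~= 0}"
  have A: "finite ?A" using assms by simp
  have "pr g (f + h) = (\<Sum>x\<in>?A. g (fst x, - 1 - snd x) * (f + h) x)" by (rule pr_superset[OF A]) auto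
  also have "\<dots> = (\<Sum>x\<in>?A. g (fst x, - 1 - snd x) * f x) + (\<Sum>x\<in>?A. g (fst x, - 1 - snd x) * h x)"
    by (simp add: distrib_left sum.distrib)
  also have "\<dots> = pr g f + pr g h" using pr_superset[OF A, of f g] pr_superset[OF A, of h g] by simp
  finally show ?thesis .
qed

lemma pr_scl2: "finite {x. f x ~= 0} ==> pr g (scl c f) = c * pr g f"
  by (subst pr_superset[of "{x. f x ~= 0}"]) (auto simp: pr_def sum_distrib_left mult_ac)

lemma finite_support_scl: "finite {x. f x ~= 0} ==> finite {x. scl c f x ~= 0}" by (rule finite_subset[of _ "{x. f x ~= 0}"]) auto

lemma finite_support_add:
  fixes f h :: "'i => 'k::field"
  shows "finite {x. f x ~= 0} ==> finite {x. h x ~= 0} ==> finite {x. (f + h) x ~= 0}"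
  by (rule finite_subset[of _ "{x. f x ~= 0} Un {x. h x ~= 0}"]) auto

lemma pr_sum2:
  assumes "finite I" "!!i. i : I ==> finite {x. f i x ~= 0}"
  shows "finite {x. (\<Sum>i\<in>I. f i) x ~= 0} & pr g (\<Sum>i\<in>I. f i) = (\<Sum>i\<in>I. pr g (f i))" using assms
proof (induction I rule: finite_induct)
  case empty
  then show ?case by (simp add: pr_def)
next
  case (insert i I)
  then show ?case
    using pr_add2[of "f i" "\<Sum>i\<in>I. f i" g] finite_support_add[of "f i" "\<Sum>i\<in>I. f i"] by (simp del: plus_fun_apply)
qed

text \<open>The transpose of \<open>gact L g\<close>, that is, the map induced on dual
  modules.\<close>

definition tact :: "nat => (nat => ('n, 'k::field) lvec) => ('n, 'k) lvec => ('n, 'k) lvec" where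
  "tact L g f = (%(j, gv). if j < L then \<Sum>x | g j x ~= 0. g j x * f (fst x, gv - snd x) else 0)"

lemma flin_tact: "flin (tact L g)"
  by (rule flinI) (auto simp: tact_def fun_eq_iff distrib_left sum.distrib sum_distrib_left mult.left_commute)

lemma finite_support_sh: "finite {x. f x ~= 0} ==> finite {x. sh av f x ~= 0}"
proof -
  assume f: "finite {x. f x ~= 0}"
  have "{x. sh av f x ~= 0} <= (%x. (fst x, snd x + av)) ` {x. f x ~= 0}"
  proof
    fix x assume "x : {x. sh av f x ~= 0}"
    then show "x : (%x. (fst x, snd x + av)) ` {x. f x ~= 0}" by (cases x) (auto intro!: image_eqI[of _ _ "(fst x, snd x - av)"])
  qed
  then show ?thesis using f finite_subset by blast
qed

lemma pr_sh:
  assumes "finite {x. f x ~= 0}"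
  shows "pr h (sh av f) = (\<Sum>x | f x ~= 0. f x * h (fst x, (- 1 - av) - snd x))"
proof -
  let ?s = "%x :: nat \<times> ('a => int). (fst x, snd x + av)"
  have inj: "inj_on ?s {x. f x ~= 0}" by (rule inj_onI) (auto simp: prod_eq_iff)
  have eq: "{x. sh av f x ~= 0} = ?s ` {x. f x ~= 0}"
  proof
    show "?s ` {x. f x ~= 0} <= {x. sh av f x ~= 0}" by auto
    show "{x. sh av f x ~= 0} <= ?s ` {x. f x ~= 0}"
    proof
      fix x assume "x : {x. sh av f x ~= 0}"
      then show "x : ?s ` {x. f x ~= 0}" by (cases x) (auto intro!: image_eqI[of _ _ "(fst x, snd x - av)"])
    qed
  qed
  have "pr h (sh av f) = (\<Sum>x | f x ~= 0. h (fst (?s x), - 1 - snd (?s x)) * sh av f (?s x))"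
    unfolding pr_def eq by (simp only: sum.reindex[OF inj] o_def)
  also have "\<dots> = (\<Sum>x | f x ~= 0. f x * h (fst x, (- 1 - av) - snd x))"
    by (rule sum.cong) (auto simp: mult.commute diff_diff_eq add.commute)
  finally show ?thesis .
qed

text \<open>Adjointness of \<open>gact\<close> and \<open>tact\<close>; by linearity
  \<open>f\<close> may be taken to be a monomial, whose image is a shifted column.\<close>

lemma pr_gact:
  assumes col: "!!j. j < L ==> finite {x. g j x ~= 0}" and f: "finite {x. f x ~= 0}" "!!j av. f (j, av) ~= 0 ==> j < L"
  shows "pr h (gact L g f) = pr (tact L g h) f"
proof -
  let ?A = "{x. f x ~= 0}"
  have d: "gact L g (dirac x) = sh (snd x) (g (fst x))" if "x : ?A" for x
  proof -
    have "fst x < L" using that f(2)[of "fst x" "snd x"] by simp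
    then show ?thesis using gact_dirac[of "fst x" L g "snd x"] col by simp
  qed
  have fin: "finite {y. scl (f x) (sh (snd x) (g (fst x))) y ~= 0}" if "x : ?A" for x
    using that f(2)[of "fst x" "snd x"] by (intro finite_support_scl finite_support_sh col) simp
  have fs: "f = (\<Sum>x\<in>?A. scl (f x) (dirac x))" by (rule fun_eq_sum_dirac[OF f(1)]) (simp add: funs_on_def)
  have "gact L g f = (\<Sum>x\<in>?A. scl (f x) (gact L g (dirac x)))"
    by (subst fs) (simp only: flin_sum[OF flin_gact] flin_scl[OF flin_gact])
  also have "\<dots> = (\<Sum>x\<in>?A. scl (f x) (sh (snd x) (g (fst x))))" using d by (intro sum.cong) simp_all
  finally have "pr h (gact L g f) = pr h (\<Sum>x\<in>?A. scl (f x) (sh (snd x) (g (fst x))))" by (simp only:)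
  also have "\<dots> = (\<Sum>x\<in>?A. pr h (scl (f x) (sh (snd x) (g (fst x)))))" by (rule pr_sum2[OF f(1) fin, THEN conjunct2])
  also have "\<dots> = (\<Sum>x\<in>?A. tact L g h (fst x, - 1 - snd x) * f x)"
  proof (rule sum.cong[OF refl])
    fix x assume x: "x : ?A"
    have l: "fst x < L" using x f(2)[of "fst x" "snd x"] by simp
    have "pr h (scl (f x) (sh (snd x) (g (fst x)))) = f x * pr h (sh (snd x) (g (fst x)))"
      by (rule pr_scl2[OF finite_support_sh[OF col[OF l]]])
    also have "pr h (sh (snd x) (g (fst x))) = tact L g h (fst x, - 1 - snd x)"
      unfolding pr_sh[OF col[OF l]] using l by (simp add: tact_def)
    finally show "pr h (scl (f x) (sh (snd x) (g (fst x)))) = tact L g h (fst x, - 1 - snd x) * f x" by (simp only: mult.commute)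
  qed
  finally show ?thesis by (simp add: pr_def)
qed

text \<open>The elements of the localization at all variables that become zero in H^n of the free
  module, by \<open>top_coboundary_iff\<close>.\<close>

definition neg_zero :: "int list => ('n::finite, 'k::field) fam" where
  "neg_zero a t = {f \<in> loc (fr a) UNIV t. \<forall>j av. (\<forall>i. av i < 0) --> f (j, av) = 0}"

lemma subspace_neg_zero: "fs.subspace (neg_zero a t)"
  using subspace_loc[OF gsub_fr, of a UNIV t] unfolding neg_zero_def fs.subspace_def by auto

text \<open>The dual of the free module with generators in degrees \<open>a ! j\<close> has
  generators in degrees \<open>- a ! j\<close>.\<close>

definition dual_shifts :: "int list => int list" where
  "dual_shifts a = map uminus a"

lemma dual_index: "(j, gv) : fr_index (dual_shifts a) \<mu> \<longleftrightarrow> j < length a & 0 <= gv & edeg gv = \<mu> + a ! j"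
  by (auto simp: fr_index_iff dual_shifts_def)

text \<open>The reflection \<open>av\<close> to \<open>- 1 - av\<close> matches the monomials of H^n
  in degree t with those of the dual module in degree -t - n; this is the origin of the twist by
  n.\<close>

lemma dual_index_neg:
  "(j, - 1 - av) : fr_index (dual_shifts a) (- t - int CARD('n)) \<longleftrightarrow> (j, av :: 'n::finite => int) : neg_index a t"
proof -
  have "av i <= - 1 \<longleftrightarrow> av i < 0" for i by linarith
  then have "0 <= - 1 - av \<longleftrightarrow> (\<forall>i. av i < 0)" by (simp add: le_fun_def)
  moreover have "edeg (- 1 - av) = - int CARD('n) - edeg av" by (simp only: edeg_diff) (simp add: edeg_def)
  ultimately show ?thesis unfolding dual_index neg_index_def by auto
qed

definition unslU :: "('n, 'k::field) lvec => ('n, 'k) lcoch" where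
  "unslU v = unsl (%S. if S = UNIV then v else 0)"

lemma flin_unslU: "flin unslU" by (rule flinI) (auto simp: unslU_def unsl_def fun_eq_iff)

lemma sl_unslU: "sl (unslU v) S = (if S = UNIV then v else 0)" by (simp add: unslU_def)

lemma unslU_Cc:
  fixes V :: "('n::finite, 'k::field) fam"
  assumes "v : loc V UNIV t"
  shows "unslU v : Cc (int CARD('n)) V t"
proof (rule CcI)
  fix S :: "'n set" assume "int (card S) = int CARD('n)"
  then have "S = UNIV" using card_subset_eq[of UNIV S] by simp
  then show "sl (unslU v) S : loc V S t" using assms by (simp add: sl_unslU)
next
  fix S :: "'n set" assume "int (card S) ~= int CARD('n)"
  then have "S ~= UNIV" by auto
  then show "sl (unslU v) S = 0" unfolding sl_unslU by (simp only: if_False)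
qed

lemma top_ZZ:
  fixes V :: "('n::{finite,linorder}, 'k::field) fam"
  assumes "c : Cc (int CARD('n)) V t" "gsub V" "gsub U"
  shows "c : ZZ (int CARD('n)) V U t"
proof (rule ZZ_I[OF assms(1)])
  have "dd c : Cc (int CARD('n) + 1) V t" by (rule dd_Cc[OF assms(2,1)])
  then have "sl (dd c) S = 0" for S by (rule Cc_zero) (use card_mono[of UNIV S] in auto)
  then have "dd c = 0" by (intro sl_eqI) simp
  then show "dd c : Cc (int CARD('n) + 1) U t" by (simp add: fs.subspace_0[OF subspace_Cc[OF assms(3)]])
qed

text \<open>A graded free resolution of F_0/U in matrix form: \<open>g q j\<close> is the
  \<open>j\<close>-th column of the differential from F_(q+1) to F_q.\<close>

locale conc_res =
  fixes a :: "nat => int list" and g :: "nat => nat => ('n::{finite,linorder}, 'k::field) lvec" and U :: "('n, 'k) fam"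
  assumes gU: "gsub U" and Ua: "!!t. U t <= fr (a 0) t"
    and col: "!!q j. j < length (a (Suc q)) ==> g q j : fr (a q) (a (Suc q) ! j)"
    and img0: "!!t. gact (length (a (Suc 0))) (g 0) ` fr (a (Suc 0)) t = U t"
    and img: "!!q t. gact (length (a (Suc (Suc q)))) (g (Suc q)) ` fr (a (Suc (Suc q))) t
      = {v \<in> fr (a (Suc q)) t. gact (length (a (Suc q))) (g q) v = 0}"
begin

abbreviation "d q \<equiv> gact (length (a (Suc q))) (g q)"
abbreviation "F q \<equiv> (fr (a q) :: ('n, 'k) fam)"

text \<open>The submodule of F_q onto which F_(q+1) maps: the relations for q = 0 and the successive
  syzygy modules afterwards.\<close>

definition Zf :: "nat => ('n, 'k) fam" where
  "Zf q = (case q of 0 => U | Suc q' => (%t. {v \<in> F q t. d q' v = 0}))"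

lemma Zf_img: "d q ` F (Suc q) t = Zf q t" using img0 img by (cases q) (simp_all add: Zf_def)

lemma Zf_sub: "Zf q t <= F q t" using Ua by (cases q) (auto simp: Zf_def)

lemma gsub_Zf: "gsub (Zf q)"
proof (cases q)
  case (Suc q')
  have "gsub (%t. {v \<in> F q t. d q' v : zf (t + 0)})" by (rule gsub_vimage[OF eqv_gact gsub_fr gsub_zf])
  then show ?thesis using Suc by (simp add: Zf_def zf_eq)
qed (simp add: Zf_def gU)

sublocale iso: fam_iso "d q" "F (Suc q)" "Zf (Suc q)" "Zf q" zf 0 for q
proof unfold_locales
  show "d q v : Zf q (t + 0)" if "v : F (Suc q) t" for t v using Zf_img[of q t] that by auto
  show "d q v : zf (t + 0) \<longleftrightarrow> v : Zf (Suc q) t" if "v : F (Suc q) t" for t v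
    using that by (simp add: Zf_def zf_eq)
  show "\<exists>v\<in>F (Suc q) t. d q v - v' : zf (t + 0)" if v': "v' : Zf q (t + 0)" for t v'
  proof -
    have "v' : d q ` F (Suc q) t" using v' Zf_img[of q t] by simp
    then obtain v where "v : F (Suc q) t" "d q v = v'" by blast
    then show ?thesis by (intro bexI[of _ v]) (simp_all add: zf_eq)
  qed
qed (use eqv_gact gsub_fr gsub_Zf gsub_zf Zf_sub zf_sub[OF gsub_Zf] in auto)

text \<open>F_(q+1)/Zf(q+1) is isomorphic to Zf q, and below n the cohomology of F_q vanishes, so
  H^(p+1)(Zf q) is covered by H^p(F_q/Zf q).\<close>

lemma dimension_shift:
  assumes "p + 1 < int CARD('n)"
  shows "hh (p + 1) (F (Suc q)) (Zf (Suc q)) t <= hh p (F q) (Zf q) t"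
proof -
  have "hh (p + 1) (F (Suc q)) (Zf (Suc q)) t = hh (p + 1) (Zf q) zf t" using iso.hh_eq[of "p + 1" q t] by simp
  also have "\<dots> <= hh p (F q) (Zf q) t + hh (p + 1) (F q) zf t"
    by (rule hh_sub_le[OF gsub_zf gsub_Zf gsub_fr zf_sub[OF gsub_Zf] Zf_sub])
  also have "hh (p + 1) (F q) zf t = 0" by (rule hh_fr_below[OF assms])
  finally show ?thesis by simp
qed

lemma dimension_shift_iter:
  assumes "p + int q < int CARD('n)"
  shows "hh (p + int q) (F q) (Zf q) t <= hh p (F 0) U t" using assms
proof (induction q)
  case 0
  then show ?case by (simp add: Zf_def)
next
  case (Suc q)
  then have "hh (p + int q + 1) (F (Suc q)) (Zf (Suc q)) t <= hh (p + int q) (F q) (Zf q) t" by (intro dimension_shift) simp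
  also have "\<dots> <= hh p (F 0) U t" using Suc by simp
  finally show ?case by (simp add: algebra_simps)
qed

text \<open>Cycles and boundaries of the complex \<open>H\<^sup>n(F\<^sub>q)\<close>.\<close>

definition KK :: "nat => int => ('n, 'k) lvec set" where
  "KK q t = (case q of 0 => loc (F 0) UNIV t | Suc q' => {f \<in> loc (F q) UNIV t. d q' f : neg_zero (a q') t})"

definition II :: "nat => int => ('n, 'k) lvec set" where
  "II q t = sadd (d q ` loc (F (Suc q)) UNIV t) (neg_zero (a q) t)"

lemma subspace_KK: "fs.subspace (KK q t)"
  by (cases q) (auto simp: KK_def intro!: subspace_loc gsub_fr subspace_vimage flin_gact subspace_neg_zero)

lemma loc_Zf_img: "loc (Zf q) UNIV t = d q ` loc (F (Suc q)) UNIV t"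
proof
  show "d q ` loc (F (Suc q)) UNIV t <= loc (Zf q) UNIV t" using iso.loc_map[of _ q UNIV t] by auto
  show "loc (Zf q) UNIV t <= d q ` loc (F (Suc q)) UNIV t"
  proof
    fix v' assume "v' : loc (Zf q) UNIV t"
    then obtain v where v: "v : loc (F (Suc q)) UNIV t" "d q v - v' : loc zf UNIV t" using iso.loc_surj[of v' q UNIV t] by auto
    then have "v' = d q v" by (simp add: loc_zf)
    then show "v' : d q ` loc (F (Suc q)) UNIV t" using v(1) by blast
  qed
qed

lemma d_loc: "v : loc (F (Suc q)) UNIV t ==> d q v : loc (F q) UNIV t"
  using loc_Zf_img[of q t] loc_mono[of "Zf q" "F q" UNIV t, OF Zf_sub] by blast

text \<open>The differentials respect \<open>neg_zero\<close>: its elements are exactly the top Cech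
  coboundaries, and \<open>lift_c\<close> commutes with \<open>dd\<close>. Consecutive differentials
  compose to zero because localization is exact.\<close>

lemma II_sub_KK: "II q t <= KK q t"
proof -
  have n: "neg_zero (a q) t <= loc (F q) UNIV t" by (auto simp: neg_zero_def)
  have "sadd (d q ` loc (F (Suc q)) UNIV t) (neg_zero (a q) t) <= KK q t"
  proof (rule sadd_least[OF subspace_KK])
    show "d q ` loc (F (Suc q)) UNIV t <= KK q t"
    proof (cases q)
      case (Suc q')
      have "d q' (d q v) = 0" if "v : loc (F (Suc q)) UNIV t" for v
      proof -
        have "d q v : loc (Zf (Suc q')) UNIV t" using that loc_Zf_img[of q t] Suc by auto
        then have "d q' (d q v) : loc zf UNIV t" using iso.loc_ker[of "d q v" q' UNIV t] d_loc[OF that] Suc by simp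
        then show ?thesis by (simp add: loc_zf)
      qed
      then show ?thesis using d_loc[of _ q t] Suc fs.subspace_0[OF subspace_neg_zero] by (auto simp: KK_def)
    qed (use d_loc in \<open>auto simp: KK_def\<close>)
    show "neg_zero (a q) t <= KK q t"
    proof (cases q)
      case (Suc q')
      have "d q' f : neg_zero (a q') t" if f: "f : neg_zero (a q) t" for f
      proof -
        have fl: "f : loc (F (Suc q')) UNIV t" using f n Suc by auto
        have "unslU f : dd ` Cc (int CARD('n) - 1) (F (Suc q')) t"
          using f Suc by (subst top_coboundary_iff[OF unslU_Cc[OF fl]]) (auto simp: sl_unslU neg_zero_def)
        then obtain w where w: "w : Cc (int CARD('n) - 1) (F (Suc q')) t" "unslU f = dd w" by blast
        have "lift_c (d q') w : Cc (int CARD('n) - 1) (Zf q') t" using iso.Cc_map[OF w(1)] by simp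
        then have "lift_c (d q') w : Cc (int CARD('n) - 1) (F q') t" using Cc_mono[of "Zf q'" "F q'", OF Zf_sub] by blast
        moreover have "unslU (d q' f) = dd (lift_c (d q') w)" unfolding dd_lift_c[OF flin_gact] w(2)[symmetric]
        proof (rule sl_eqI)
          fix S :: "'n set"
          show "sl (unslU (d q' f)) S = sl (lift_c (d q') (unslU f)) S"
            by (cases "S = UNIV") (simp_all only: sl_unslU sl_lift_c if_True if_False flin_0[OF flin_gact] simp_thms)
        qed
        ultimately have "unslU (d q' f) : dd ` Cc (int CARD('n) - 1) (F q') t" by blast
        then show ?thesis using top_coboundary_iff[OF unslU_Cc[OF d_loc[OF fl]]] d_loc[OF fl]
          by (auto simp: neg_zero_def sl_unslU)
      qed
      then show ?thesis using n Suc by (auto simp: KK_def)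
    qed (use n in \<open>auto simp: KK_def\<close>)
  qed
  then show ?thesis by (simp add: II_def)
qed

text \<open>The cokernel of H^n(F_1) -> H^n(F_0) embeds into H^n(F_0/U).\<close>

lemma KK_le_top: "qdim (KK 0 t) (II 0 t) <= hh (int CARD('n)) (F 0) U t" unfolding hh_def
proof (rule qdim_inj[OF flin_unslU subspace_KK subspace_BB[OF gsub_fr gU]])
  fix v assume "v : KK 0 t"
  then have v: "v : loc (F 0) UNIV t" by (simp add: KK_def)
  show "unslU v : ZZ (int CARD('n)) (F 0) U t" by (rule top_ZZ[OF unslU_Cc[OF v] gsub_fr gU])
  assume "unslU v : BB (int CARD('n)) (F 0) U t"
  then obtain w u where w: "w : Cc (int CARD('n) - 1) (F 0) t" "u : Cc (int CARD('n)) U t" "unslU v = dd w + u" by (rule BB_E)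
  have dw: "dd w : Cc (int CARD('n)) (F 0) t" using dd_Cc[OF gsub_fr w(1)] by simp
  have "\<forall>j av. (\<forall>i. av i < 0) --> sl (dd w) UNIV (j, av) = 0" using top_coboundary_iff[OF dw] w(1) by blast
  then have 1: "sl (dd w) UNIV : neg_zero (a 0) t" using Cc_loc[OF dw, of UNIV] by (simp add: neg_zero_def)
  have 2: "sl u UNIV : d 0 ` loc (F (Suc 0)) UNIV t" using Cc_loc[OF w(2), of UNIV] loc_Zf_img[of 0 t] by (simp add: Zf_def)
  have "v = sl u UNIV + sl (dd w) UNIV" using arg_cong[OF w(3), of "%c. sl c UNIV"] by (simp add: sl_unslU sl_add add.commute)
  then show "v : II 0 t" unfolding II_def using 1 2 saddI by simp
qed

text \<open>A cycle in H^n(F_(q+1)) maps to a class of H^n(Zf q) that dies in H^n(F_q), hence lies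
  in the image of the connecting map. If the class is already zero, a lifted bounding cochain
  changes the cycle into an element of Zf(q+1), which is a boundary.\<close>

lemma KK_le_conn: "qdim (KK (Suc q) t) (II (Suc q) t) <= conn_rank (int CARD('n)) zf (Zf q) (F q) t" unfolding conn_rank_def
proof (rule qdim_inj[OF flin_comp[OF flin_unslU flin_gact] subspace_KK subspace_BB[OF gsub_Zf gsub_zf]])
  fix v assume "v : KK (Suc q) t"
  then have v: "v : loc (F (Suc q)) UNIV t" "d q v : neg_zero (a q) t" by (simp_all add: KK_def)
  have dv: "d q v : loc (Zf q) UNIV t" using loc_Zf_img[of q t] v(1) by blast
  show "unslU (d q v) : ZZ (int CARD('n)) (Zf q) zf t Int BB (int CARD('n)) (F q) zf t"
  proof
    show "unslU (d q v) : ZZ (int CARD('n)) (Zf q) zf t" by (rule top_ZZ[OF unslU_Cc[OF dv] gsub_Zf gsub_zf])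
    have "unslU (d q v) : dd ` Cc (int CARD('n) - 1) (F q) t"
      using v(2) by (subst top_coboundary_iff[OF unslU_Cc[OF d_loc[OF v(1)]]]) (auto simp: sl_unslU neg_zero_def)
    then obtain w where "w : Cc (int CARD('n) - 1) (F q) t" "unslU (d q v) = dd w" by blast
    then show "unslU (d q v) : BB (int CARD('n)) (F q) zf t" using dd_BB[OF gsub_zf, of w "int CARD('n)" "F q" t] by simp
  qed
  assume "unslU (d q v) : BB (int CARD('n)) (Zf q) zf t"
  then obtain w where w: "w : Cc (int CARD('n) - 1) (Zf q) t" "unslU (d q v) = dd w" by (auto simp: Cc_zf elim!: BB_E)
  obtain w' where w': "w' : Cc (int CARD('n) - 1) (F (Suc q)) t" "lift_c (d q) w' - w : Cc (int CARD('n) - 1) zf t"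
    using iso.Cc_surj[of w "int CARD('n) - 1" q t] w(1) by auto
  then have ww: "lift_c (d q) w' = w" by (simp add: Cc_zf)
  have dw: "dd w' : Cc (int CARD('n)) (F (Suc q)) t" using dd_Cc[OF gsub_fr w'(1)] by simp
  have "\<forall>j av. (\<forall>i. av i < 0) --> sl (dd w') UNIV (j, av) = 0" using top_coboundary_iff[OF dw] w'(1) by blast
  then have 1: "sl (dd w') UNIV : neg_zero (a (Suc q)) t" using Cc_loc[OF dw, of UNIV] by (simp add: neg_zero_def)
  have "d q (sl (dd w') UNIV) = sl (dd w) UNIV"
    using dd_lift_c[OF flin_gact, of "length (a (Suc q))" "g q" w'] ww by (metis sl_lift_c)
  also have "\<dots> = d q v" unfolding w(2)[symmetric] by (simp add: sl_unslU)
  finally have "d q (v - sl (dd w') UNIV) = 0" by (simp only: flin_diff[OF flin_gact] diff_self)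
  moreover have vl: "v - sl (dd w') UNIV : loc (F (Suc q)) UNIV t"
    using v(1) Cc_loc[OF dw, of UNIV] by (intro fs.subspace_diff[OF subspace_loc[OF gsub_fr]]) auto
  ultimately have "v - sl (dd w') UNIV : loc (Zf (Suc q)) UNIV t" using iso.loc_ker[OF vl] by (simp add: loc_zf)
  then have "v - sl (dd w') UNIV : d (Suc q) ` loc (F (Suc (Suc q))) UNIV t" using loc_Zf_img by blast
  then have "(v - sl (dd w') UNIV) + sl (dd w') UNIV : II (Suc q) t" unfolding II_def using 1 by (rule saddI)
  then show "v : II (Suc q) t" by simp
qed

text \<open>The connecting rank is at most dim H^(n-1)(F_(q-1)/Zf(q-1)), and q - 1 dimension shifts
  lead down to H^(n-q)(F_0/U).\<close>

lemma KK_le: "q <= CARD('n) ==> qdim (KK q t) (II q t) <= hh (int CARD('n) - int q) (F 0) U t"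
proof (cases q)
  case 0
  then show ?thesis using KK_le_top by simp
next
  case (Suc q')
  assume q: "q <= CARD('n)"
  let ?n = "int CARD('n)"
  have "qdim (KK q t) (II q t) <= conn_rank (?n - 1 + 1) zf (Zf q') (F q') t" using KK_le_conn[of q' t] Suc by simp
  also have "\<dots> <= hh (?n - 1) (F q') (Zf q') t"
    by (rule conn_rank_le_quot[OF gsub_zf gsub_Zf gsub_fr zf_sub[OF gsub_Zf] Zf_sub])
  also have "\<dots> = hh ((?n - int q) + int q') (F q') (Zf q') t" using Suc by (simp add: algebra_simps)
  also have "\<dots> <= hh (?n - int q) (F 0) U t" by (rule dimension_shift_iter) (use q Suc in auto)
  finally show ?thesis .
qed

section \<open>The transposed complex and its pairing with top cohomology\<close>

text \<open>With \<open>ExtB\<close>, the degree \<mu> cocycles and coboundaries of the complex of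
  dual modules; the quotient is the degree \<mu> part of Ext of F_0/U into R.\<close>

definition ExtZ :: "nat => int => ('n, 'k) lvec set" where
  "ExtZ q \<mu> = {h \<in> fr (dual_shifts (a q)) \<mu>. tact (length (a (Suc q))) (g q) h = 0}"

definition ExtB :: "nat => int => ('n, 'k) lvec set" where
  "ExtB q \<mu> = (case q of 0 => {0} | Suc q' => tact (length (a q)) (g q') ` fr (dual_shifts (a q')) \<mu>)"

lemma subspace_ExtZ: "fs.subspace (ExtZ q \<mu>)"
proof -
  have "ExtZ q \<mu> = {h \<in> fr (dual_shifts (a q)) \<mu>. tact (length (a (Suc q))) (g q) h : {0}}" by (simp add: ExtZ_def)
  then show ?thesis using subspace_vimage[OF flin_tact gsub_subspace[OF gsub_fr] subspace_zero] by simp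
qed

lemma subspace_ExtB: "fs.subspace (ExtB q \<mu>)"
  by (cases q) (auto simp: ExtB_def intro!: subspace_zero subspace_image[OF flin_tact gsub_subspace[OF gsub_fr]])

lemma col_finite: "j < length (a (Suc q)) ==> finite {x. g q j x ~= 0}" using fr_finite_support[OF col] .

lemma loc_fr_supp:
  assumes "f : loc (F q) UNIV t"
  shows "finite {x. f x ~= 0}" "!!j av. f (j, av) ~= 0 ==> j < length (a q)" using assms unfolding loc_fr_iff by blast+

lemma KK_supp: "f : KK q t ==> f : loc (F q) UNIV t" by (cases q) (auto simp: KK_def)

lemma pr_adjoint: "f : loc (F (Suc q)) UNIV t ==> pr h (d q f) = pr (tact (length (a (Suc q))) (g q) h) f"
  by (rule pr_gact[OF col_finite loc_fr_supp])

lemma pr_neg_zero: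
  assumes h: "h : fr b \<mu>" and f: "f : neg_zero b' t"
  shows "pr h f = 0" unfolding pr_def
proof (rule sum.neutral, rule ballI)
  fix x assume "x : {x. f x ~= 0}"
  show "h (fst x, - 1 - snd x) * f x = 0"
  proof (cases "\<forall>i. snd x i < 0")
    case True
    then show ?thesis using f unfolding neg_zero_def by (cases x) auto
  next
    case False
    then obtain i where i: "0 <= snd x i" by (auto simp: not_less)
    have "\<not> 0 <= - 1 - snd x"
    proof
      assume "0 <= - 1 - snd x"
      from le_funD[OF this, of i] i show False by simp
    qed
    then have "h (fst x, - 1 - snd x) = 0" using h unfolding fr_iff by blast
    then show ?thesis by simp
  qed
qed

text \<open>The residue pairing has no left kernel on \<open>ExtZ\<close> modulo
  \<open>ExtB\<close>: a functional vanishing on \<open>ExtB\<close> but not at \<open>z\<close> is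
  represented by an element \<open>w\<close> of H^n(F_q), and vanishing on coboundaries is exactly
  what makes \<open>w\<close> a cycle.\<close>

theorem duality_le:
  assumes t: "t = - \<mu> - int CARD('n)"
  shows "qdim (ExtZ q \<mu>) (ExtB q \<mu>) <= qdim (KK q t) (II q t)"
proof (rule qdim_pairing_le[where P = pr, OF subspace_ExtZ pr_add1 pr_scl1 _ _ subspace_KK II_sub_KK])
  show "pr x (w + w') = pr x w + pr x w'" if "w : KK q t" "w' : KK q t" for x w w'
    by (intro pr_add2 loc_fr_supp(1)[OF KK_supp[OF that(1)]] loc_fr_supp(1)[OF KK_supp[OF that(2)]])
  show "pr x (scl c w) = c * pr x w" if "w : KK q t" for c x w by (intro pr_scl2 loc_fr_supp(1)[OF KK_supp[OF that]])
  show "pr z b = 0" if z: "z : ExtZ q \<mu>" and b: "b : II q t" for z b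
  proof -
    obtain f m where fm: "f : loc (F (Suc q)) UNIV t" "m : neg_zero (a q) t" "b = d q f + m"
      using b unfolding II_def by (auto elim!: saddE)
    have "m : loc (F q) UNIV t" using fm(2) by (simp add: neg_zero_def)
    then have "pr z b = pr z (d q f) + pr z m" unfolding fm(3) using d_loc[OF fm(1)] by (intro pr_add2 loc_fr_supp(1))
    also have "pr z (d q f) = 0" using pr_adjoint[OF fm(1)] z by (simp add: ExtZ_def pr_def)
    also have "pr z m = 0" using z fm(2) by (intro pr_neg_zero) (auto simp: ExtZ_def)
    finally show ?thesis by simp
  qed
  show "z : ExtB q \<mu>" if z: "z : ExtZ q \<mu>" and van: "!!w. w : KK q t ==> pr z w = 0" for z
  proof (rule ccontr)
    assume "z ~: ExtB q \<mu>"
    then obtain \<psi> where add: "!!x y. \<psi> (x + y) = \<psi> x + \<psi> y" and scale: "!!c x. \<psi> (scl c x) = c * \<psi> x"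
      and \<psi>z: "\<psi> z ~= 0" and \<psi>B: "!!b. b : ExtB q \<mu> ==> \<psi> b = 0"
      using separating_functional[OF subspace_ExtB] by metis
    have \<psi>0: "\<psi> 0 = 0" using scale[of 0 0] by (simp only: fs.scale_zero_left mult_zero_left)
    have \<psi>sum: "\<psi> (\<Sum>y\<in>I. f y) = (\<Sum>y\<in>I. \<psi> (f y))" if "finite I" for I and f :: "nat \<times> ('n => int) => ('n, 'k) lvec"
      using that by (induction I rule: finite_induct) (simp_all only: sum.empty sum.insert \<psi>0 add not_False_eq_True)
    let ?N = "neg_index (a q) t :: (nat \<times> ('n => int)) set"
    let ?D = "fr_index (dual_shifts (a q)) \<mu> :: (nat \<times> ('n => int)) set"
    let ?r = "%x :: nat \<times> ('n => int). (fst x, - 1 - snd x)"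
    have mu: "\<mu> = - t - int CARD('n)" using t by simp
    \<comment> \<open>The coefficients of \<open>w\<close> are the values of the functional on the
      reflected basis monomials, so pairing with \<open>w\<close> is the functional.\<close>
    define w where "w = (%x. if x : ?N then \<psi> (dirac (?r x)) else 0)"
    have wl: "w : loc (F q) UNIV t" unfolding loc_fr_iff
    proof
      show "finite {x. w x ~= 0}" by (rule finite_subset[OF _ finite_neg_index[of "a q" t]]) (auto simp: w_def)
      show "\<forall>j av. w (j, av) ~= 0 --> j < length (a q) & (\<forall>i. i ~: UNIV --> 0 <= av i) & edeg av = t - a q ! j"
        by (auto simp: w_def neg_index_def split: if_splits)
    qed
    have bij: "bij_betw ?r ?N ?D"
    proof (rule bij_betwI[where g = ?r])
      show "?r : ?N \<rightarrow> ?D"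
        using dual_index_neg[of _ _ "a q" t, where 'n = 'n] unfolding mu by (auto simp: split_paired_all)
      show "?r : ?D \<rightarrow> ?N"
      proof
        fix y assume "y : ?D"
        then have "(fst y, - 1 - (- 1 - snd y)) : ?D" by simp
        then show "?r y : ?N" using dual_index_neg[of "fst y" "- 1 - snd y" "a q" t] unfolding mu by simp
      qed
    qed (auto simp: prod_eq_iff)
    have prw: "pr h w = \<psi> h" if h: "h : fr (dual_shifts (a q)) \<mu>" for h
    proof -
      have "pr h w = (\<Sum>x\<in>?N. h (?r x) * w x)" by (rule pr_superset[OF finite_neg_index]) (auto simp: w_def)
      also have "\<dots> = (\<Sum>x\<in>?N. h (?r x) * \<psi> (dirac (?r x)))" by (rule sum.cong) (auto simp: w_def)
      also have "\<dots> = (\<Sum>y\<in>?D. h y * \<psi> (dirac y))" by (rule sum.reindex_bij_betw[OF bij])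
      also have "\<dots> = \<psi> (\<Sum>y\<in>?D. scl (h y) (dirac y))" by (simp only: \<psi>sum[OF finite_fr_index] scale)
      also have "\<dots> = \<psi> h" by (simp only: fr_eq_sum[OF h, symmetric])
      finally show ?thesis .
    qed
    have "w : KK q t"
    proof (cases q)
      case 0
      then show ?thesis using wl by (simp add: KK_def)
    next
      case (Suc q')
      have wl': "w : loc (F (Suc q')) UNIV t" using wl Suc by simp
      note dl = d_loc[OF wl']
      \<comment> \<open>A coefficient of the image of \<open>w\<close> at an exponent with only
        negative entries is a pairing with a basis monomial. By adjointness it is the functional
        evaluated on an element of \<open>ExtB\<close>.\<close>
      have "d q' w (j, av) = 0" if al: "\<forall>i. av i < 0" for j av
      proof (rule ccontr)
        assume nz: "d q' w (j, av) ~= 0"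
        then have "(j, av) : neg_index (a q') t" using dl al unfolding loc_fr_iff neg_index_def by blast
        then have D: "(j, - 1 - av) : fr_index (dual_shifts (a q')) \<mu>" using dual_index_neg[of j av "a q'" t] mu by simp
        let ?h = "dirac (j, - 1 - av) :: ('n, 'k) lvec"
        have h: "?h : fr (dual_shifts (a q')) \<mu>" by (rule dirac_fr[OF D])
        have "pr ?h (d q' w) = (\<Sum>x | d q' w x ~= 0. if x = (j, av) then d q' w x else 0)"
          unfolding pr_def by (rule sum.cong) (auto simp: dirac_def prod_eq_iff)
        also have "\<dots> = d q' w (j, av)" using nz loc_fr_supp(1)[OF dl] by simp
        finally have "d q' w (j, av) = pr (tact (length (a (Suc q'))) (g q') ?h) w" using pr_adjoint[OF wl', of ?h] by simp
        also have tB: "tact (length (a (Suc q'))) (g q') ?h : ExtB q \<mu>" using h Suc by (auto simp: ExtB_def)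
        have "tact (length (a (Suc q'))) (g q') ?h : fr (dual_shifts (a q)) \<mu>" unfolding fr_iff
        proof (intro allI impI)
          fix i gv assume "tact (length (a (Suc q'))) (g q') ?h (i, gv) ~= 0"
          then have i: "i < length (a q)" and "(\<Sum>x | g q' i x ~= 0. g q' i x * ?h (fst x, gv - snd x)) ~= 0"
            by (auto simp: tact_def Suc split: if_splits)
          then obtain x where x: "g q' i x ~= 0" "?h (fst x, gv - snd x) ~= 0"
            by (elim sum.not_neutral_contains_not_neutral) (simp only: mem_Collect_eq mult_eq_0_iff de_Morgan_disj simp_thms)
          have c: "g q' i : fr (a q') (a q ! i)" using col[of i q'] i Suc by simp
          have x1: "0 <= snd x" "edeg (snd x) = a q ! i - a q' ! fst x"
            using c[unfolded fr_iff, rule_format, of "fst x" "snd x"] x(1) by simp_all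
          have x2: "0 <= gv - snd x" "edeg (gv - snd x) = \<mu> - dual_shifts (a q') ! fst x" "fst x < length (a q')"
            using h[unfolded fr_iff, rule_format, OF x(2)] by (simp_all only: dual_shifts_def length_map simp_thms)
          have "0 <= gv" by (rule nonneg_add_shift[OF x2(1) x1(1)])
          moreover have "edeg gv = \<mu> + a q ! i" using x2(2,3) x1(2) by (simp add: dual_shifts_def)
          ultimately show "i < length (dual_shifts (a q)) & 0 <= gv & edeg gv = \<mu> - dual_shifts (a q) ! i"
            using i by (simp add: dual_shifts_def)
        qed
        then have "pr (tact (length (a (Suc q'))) (g q') ?h) w = \<psi> (tact (length (a (Suc q'))) (g q') ?h)" by (rule prw)
        also have "\<dots> = 0" by (rule \<psi>B[OF tB])
        finally show False using nz by simp
      qed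
      then show ?thesis using dl wl' Suc by (simp add: KK_def neg_zero_def)
    qed
    then have "pr z w = 0" by (rule van)
    moreover have "pr z w = \<psi> z" by (rule prw) (use z in \<open>simp add: ExtZ_def\<close>)
    ultimately show False using \<psi>z by simp
  qed
qed

theorem Ext_le_local_cohomology:
  assumes "q <= CARD('n)"
  shows "qdim (ExtZ q \<mu>) (ExtB q \<mu>) <= hh (int CARD('n) - int q) (F 0) U (- \<mu> - int CARD('n))"
  using duality_le[OF refl, of q \<mu>] KK_le[OF assms] order_trans by blast

end

subsection \<open>Polynomials as exponent functions\<close>

abbreviation lookup :: "('a \<Rightarrow>\<^sub>0 'b::zero) => 'a => 'b" where
  "lookup == Poly_Mapping.lookup"

abbreviation keys :: "('a \<Rightarrow>\<^sub>0 'b::zero) => 'a set" where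
  "keys == Poly_Mapping.keys"

abbreviation single :: "'a => 'b => 'a \<Rightarrow>\<^sub>0 'b::zero" where
  "single == Poly_Mapping.single"

abbreviation FC :: "int list => (nat => ('n::finite, 'k::field) mpolynomial) set" where
  "FC a == carrier (free_gmodule a)"

definition iexp :: "('n \<Rightarrow>\<^sub>0 nat) => 'n => int" where
  "iexp m = (%i. int (lookup m i))"

text \<open>Inverse of \<open>iexp\<close> on nonnegative exponents; negative entries are sent to
  0.\<close>

definition mexp :: "('n::finite => int) => 'n \<Rightarrow>\<^sub>0 nat" where
  "mexp av = Poly_Mapping.Abs_poly_mapping (%i. nat (av i))"

lemma lookup_mexp [simp]: "lookup (mexp av) i = nat (av i)" by (simp add: mexp_def)

lemma iexp_mexp: "0 <= av ==> iexp (mexp av) = av" by (auto simp: iexp_def fun_eq_iff le_fun_def)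

lemma mexp_iexp [simp]: "mexp (iexp m) = m" by (rule poly_mapping_eqI) (simp add: iexp_def)

lemma iexp_nonneg: "0 <= iexp m" by (auto simp: iexp_def le_fun_def)

lemma iexp_add: "iexp (m + m') = iexp m + iexp m'" by (auto simp: iexp_def fun_eq_iff lookup_add)

lemma iexp_0: "iexp 0 = 0" by (auto simp: iexp_def fun_eq_iff)

lemma edeg_iexp: "edeg (iexp m) = int (mono_degree m)" by (simp add: edeg_def iexp_def mono_degree_def)

lemma iexp_inj: "iexp m = iexp m' \<longleftrightarrow> m = m'" for m :: "'n::finite \<Rightarrow>\<^sub>0 nat"
  by (metis mexp_iexp)

lemma sum_single: "p = (\<Sum>m\<in>keys p. single m (lookup p m))"
proof (rule poly_mapping_eqI)
  fix k
  have "(\<Sum>m\<in>keys p. lookup (single m (lookup p m)) k)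
      = (\<Sum>m\<in>keys p. if m = k then lookup p m else 0)" by (rule sum.cong) (auto simp: lookup_single when_def)
  also have "\<dots> = lookup p k" by (auto simp: in_keys_iff)
  finally show "lookup p k = lookup (\<Sum>m\<in>keys p. single m (lookup p m)) k" by (simp add: lookup_sum)
qed

lemma mpoly_induct [case_names zero single add]:
  assumes "P 0" "!!m c. P (single m c)" "!!p q. P p ==> P q ==> P (p + q)"
  shows "P (p :: 'a \<Rightarrow>\<^sub>0 'b::comm_monoid_add)"
proof -
  have "P (\<Sum>m\<in>A. single m (lookup p m))" for A by (induction A rule: infinite_finite_induct) (auto intro: assms)
  then show ?thesis using sum_single[of p] by metis
qed

text \<open>The action of the polynomial ring on exponent functions, Laurent ones included.\<close>

definition pact :: "('n::finite, 'k::field) mpolynomial => ('n, 'k) lvec => ('n, 'k) lvec" where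
  "pact r f = (\<Sum>m\<in>keys r. scl (lookup r m) (sh (iexp m) f))"

lemma pact_superset:
  assumes "finite A" "keys r <= A"
  shows "pact r f = (\<Sum>m\<in>A. scl (lookup r m) (sh (iexp m) f))" unfolding pact_def
  by (rule sum.mono_neutral_left[OF assms]) (auto simp: in_keys_iff)

lemma pact_add: "pact (r + s) f = pact r f + pact s f"
proof -
  let ?A = "keys r Un keys s"
  have A: "finite ?A" by simp
  show ?thesis using pact_superset[OF A, of r f] pact_superset[OF A, of s f] pact_superset[OF A keys_add, of f]
    by (simp add: lookup_add fs.scale_left_distrib sum.distrib)
qed

lemma pact_0 [simp]: "pact 0 f = 0" by (simp add: pact_def)

lemma pact_single: "pact (single m c) f = scl c (sh (iexp m) f)" by (subst pact_superset[of "{m}"]) auto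

lemma pact_one: "pact 1 f = f" using pact_single[of 0 1 f] by (simp add: iexp_0)

lemma flin_pact: "flin (pact r)" by (rule flinI)
    (simp_all only: pact_def sh_add sh_scl fs.scale_right_distrib sum.distrib fs.scale_sum_right
      fs.scale_left_commute)

lemma pact_single_mult: "pact (single m c * s) f = pact (single m c) (pact s f)"
proof (induction s rule: mpoly_induct)
  case zero
  show ?case by (simp only: mult_zero_right pact_0 flin_0[OF flin_pact])
next
  case (single m' c')
  show ?case by (simp only: mult_single pact_single sh_scl sh_sh iexp_add fs.scale_scale)
next
  case (add p q)
  then show ?case by (simp only: distrib_left pact_add flin_add[OF flin_pact])
qed

lemma pact_mult: "pact (r * s) f = pact r (pact s f)"
proof (induction r rule: mpoly_induct)
  case (single m c)
  show ?case by (rule pact_single_mult)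
next
  case (add p q)
  then show ?case by (simp only: distrib_right pact_add)
qed simp

lemma eqv_pact: "eqv (pact r)" unfolding eqv_def using flin_pact by (auto simp: pact_def sh_sum sh_scl sh_sh add.commute)

lemma lin1_pact:
  assumes "l : homogeneous_part 1"
  shows "lin1 (pact l)" unfolding lin1_def
proof (intro conjI allI impI eqv_pact)
  fix V :: "('a, 'b) fam" and t v assume V: "gsub V" and v: "v : V t"
  have "sh (iexp m) v : V (t + 1)" if "m : keys l" for m
  proof -
    have "edeg (iexp m) = 1" using assms that unfolding homogeneous_part_def edeg_iexp by blast
    then show ?thesis using gsub_sh[OF V iexp_nonneg v, of m] by simp
  qed
  then show "pact l v : V (t + 1)" unfolding pact_def by (intro fs.subspace_sum fs.subspace_scale gsub_subspace V)
qed

text \<open>The free module as a whole, of which the \<open>fr a t\<close> are the homogeneous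
  components.\<close>

definition Ftot :: "int list => ('n::finite, 'k::field) lvec set" where
  "Ftot a = {v. finite {x. v x ~= 0} & (\<forall>j av. v (j, av) ~= 0 --> j < length a & 0 <= av)}"

lemma Ftot_iff: "v : Ftot a \<longleftrightarrow> finite {x. v x ~= 0} & (\<forall>j av. v (j, av) ~= 0 --> j < length a & 0 <= av)"
  by (simp add: Ftot_def)

lemma fr_Ftot: "fr a t <= Ftot a" using fr_finite_support unfolding Ftot_def by (auto simp: fr_iff)

lemma subspace_Ftot: "fs.subspace (Ftot a :: ('n::finite, 'k::field) lvec set)"
proof (rule fs.subspaceI)
  fix x y :: "('n, 'k) lvec" assume xy: "x : Ftot a" "y : Ftot a"
  show "x + y : Ftot a" unfolding Ftot_iff
  proof (intro conjI allI impI)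
    show "finite {z. (x + y) z ~= 0}" using xy by (intro finite_support_add) (auto simp: Ftot_iff)
    fix j av assume "(x + y) (j, av) ~= 0"
    then have "x (j, av) ~= 0 | y (j, av) ~= 0" by auto
    then have "j < length a & 0 <= av" using xy unfolding Ftot_iff by blast
    then show "j < length a" "0 <= av" by auto
  qed
next
  fix c and x :: "('n, 'k) lvec" assume x: "x : Ftot a"
  have "finite {z. scl c x z ~= 0}" using x by (intro finite_support_scl) (auto simp: Ftot_iff)
  then show "scl c x : Ftot a" using x by (auto simp: Ftot_iff)
qed (auto simp: Ftot_iff)

lemma sh_Ftot: "0 <= bv ==> v : Ftot a ==> sh bv v : Ftot a"
proof -
  assume b: "0 <= bv" and v: "v : Ftot a"
  have "j < length a & 0 <= av" if "sh bv v (j, av) ~= 0" for j av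
  proof -
    have "v (j, av - bv) ~= 0" using that by simp
    then have "j < length a" "0 <= av - bv" using v unfolding Ftot_iff by blast+
    then show ?thesis using nonneg_add_shift[of av bv] b by blast
  qed
  moreover have "finite {x. sh bv v x ~= 0}" using v by (intro finite_support_sh) (simp add: Ftot_iff)
  ultimately show ?thesis unfolding Ftot_iff by blast
qed

lemma pact_Ftot: "v : Ftot a ==> pact r v : Ftot a"
  unfolding pact_def by (intro fs.subspace_sum fs.subspace_scale subspace_Ftot sh_Ftot iexp_nonneg)

text \<open>The component of degree \<open>t\<close>, defined for Laurent exponents too so that it
  also applies to localizations.\<close>

definition proj :: "int list => int => ('n::finite, 'k::field) lvec => ('n, 'k) lvec" where
  "proj a t v = (%(j, av). if edeg av = t - a ! j then v (j, av) else 0)"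

lemma proj_apply: "proj a t v (j, av) = (if edeg av = t - a ! j then v (j, av) else 0)" by (simp add: proj_def)

lemma flin_proj: "flin (proj a t)" by (rule flinI) (auto simp: proj_def fun_eq_iff)

lemma proj_sh: "proj a (t + edeg bv) (sh bv v) = sh bv (proj a t v)" by (auto simp: proj_def sh_def fun_eq_iff)

lemma proj_fr: "v : Ftot a ==> proj a t v : fr a t" unfolding fr_iff Ftot_iff by (auto simp: proj_apply split: if_splits)

lemma proj_of_fr: "v : fr a t ==> proj a s v = (if s = t then v else 0)"
proof
  fix x :: "nat \<times> ('a => int)" assume v: "v : fr a t"
  obtain j av where x: "x = (j, av)" by (cases x)
  have "v (j, av) = 0 | edeg av = t - a ! j" using v unfolding fr_iff by blast
  then show "proj a s v x = (if s = t then v else 0) x" by (auto simp: x proj_apply)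
qed

lemma proj_pact:
  assumes "r : homogeneous_part e"
  shows "proj a (t + e) (pact r v) = pact r (proj a t v)"
proof -
  have "proj a (t + e) (sh (iexp m) v) = sh (iexp m) (proj a t v)" if "m : keys r" for m
  proof -
    have "edeg (iexp m) = e" using that assms by (auto simp: homogeneous_part_def edeg_iexp)
    then show ?thesis using proj_sh[of a t "iexp m" v] by simp
  qed
  then show ?thesis unfolding pact_def flin_sum[OF flin_proj] flin_scl[OF flin_proj] by (intro sum.cong) simp_all
qed

lemma sum_proj:
  assumes v: "v : Ftot a"
  obtains T where "finite T" "v = (\<Sum>t\<in>T. proj a t v)" "!!t. t ~: T ==> proj a t v = 0"
proof -
  let ?T = "(%x. a ! fst x + edeg (snd x)) ` {x. v x ~= 0}"
  have fin: "finite ?T" using v by (simp add: Ftot_iff)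
  have "v x = (\<Sum>t\<in>?T. proj a t v x)" for x
  proof -
    obtain j av where x: "x = (j, av)" by (cases x)
    have "(\<Sum>t\<in>?T. proj a t v x) = (\<Sum>t\<in>?T. if t = a ! j + edeg av then v x else 0)"
      by (rule sum.cong) (auto simp: x proj_apply)
    also have "\<dots> = v x"
    proof (cases "v x = 0")
      case False
      then have "a ! j + edeg av : ?T" by (intro image_eqI[of _ _ x]) (simp_all add: x)
      then show ?thesis using fin by simp
    qed simp
    finally show ?thesis by simp
  qed
  then have 1: "v = (\<Sum>t\<in>?T. proj a t v)" by (intro ext) (unfold fun_sum_apply)
  have 2: "proj a t v = 0" if "t ~: ?T" for t
  proof (rule ext)
    fix x :: "nat \<times> ('a => int)"
    obtain j av where x: "x = (j, av)" by (cases x)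
    show "proj a t v x = 0 x"
    proof (cases "edeg av = t - a ! j & v x ~= 0")
      case True
      then have "t : ?T" by (intro image_eqI[of _ _ x]) (simp_all add: x)
      then show ?thesis using that by contradiction
    next
      case False
      then show ?thesis by (auto simp: x proj_apply)
    qed
  qed
  show thesis by (rule that[OF fin 1 2])
qed

text \<open>Translates tuples of polynomials, the elements of \<open>free_gmodule\<close>, into
  exponent functions.\<close>

definition emb :: "(nat => ('n::finite, 'k::field) mpolynomial) => ('n, 'k) lvec" where
  "emb w = (%(j, av). if 0 <= av then lookup (w j) (mexp av) else 0)"

definition unemb :: "('n::finite, 'k::field) lvec => nat => ('n, 'k) mpolynomial" where
  "unemb v j = Poly_Mapping.Abs_poly_mapping (%m. v (j, iexp m))"

lemma lookup_unemb:
  fixes v :: "('n::finite, 'k::field) lvec"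
  assumes "v : Ftot a"
  shows "lookup (unemb v j) m = v (j, iexp m)"
proof -
  have "inj_on (%m :: 'n \<Rightarrow>\<^sub>0 nat. (j, iexp m)) {m. v (j, iexp m) ~= 0}" by (auto intro!: inj_onI simp: iexp_inj)
  moreover have "(%m. (j, iexp m)) ` {m. v (j, iexp m) ~= 0} <= {x. v x ~= 0}" by auto
  moreover have "finite {x. v x ~= 0}" using assms by (simp add: Ftot_iff)
  ultimately have "finite {m. v (j, iexp m) ~= 0}" by (meson finite_imageD finite_subset)
  then show ?thesis by (simp add: unemb_def)
qed

lemma emb_unemb: "v : Ftot a ==> emb (unemb v) = v"
  by (rule ext) (auto simp: emb_def lookup_unemb iexp_mexp split: prod.splits, auto simp: Ftot_iff)

lemma unemb_emb: "emb w : Ftot a ==> unemb (emb w) = w"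
  by (rule ext, rule poly_mapping_eqI) (simp add: lookup_unemb, simp add: emb_def iexp_nonneg)

lemma emb_Ftot: "(!!j. length a <= j ==> w j = 0) ==> emb w : Ftot a"
proof -
  assume w: "!!j. length a <= j ==> w j = 0"
  have "{x. emb w x ~= 0} <= (SIGMA j:{..<length a}. iexp ` keys (w j))"
  proof
    fix x assume "x : {x. emb w x ~= 0}"
    then obtain j av where x: "x = (j, av)" "0 <= av" "lookup (w j) (mexp av) ~= 0"
      by (cases x) (auto simp: emb_def split: if_splits)
    have "j < length a" using w[of j] x(3) by (cases "j < length a") auto
    moreover have "av : iexp ` keys (w j)" using x by (intro image_eqI[of _ _ "mexp av"]) (auto simp: iexp_mexp in_keys_iff)
    ultimately show "x : (SIGMA j:{..<length a}. iexp ` keys (w j))" using x by simp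
  qed
  moreover have "finite (SIGMA j:{..<length a}. iexp ` keys (w j))" by simp
  ultimately have "finite {x. emb w x ~= 0}" using finite_subset by blast
  moreover have "j < length a & 0 <= av" if "emb w (j, av) ~= 0" for j av
    using that w[of j] by (cases "j < length a") (auto simp: emb_def split: if_splits)
  ultimately show ?thesis unfolding Ftot_iff by blast
qed

lemma unemb_outside: "v : Ftot a ==> length a <= j ==> unemb v j = 0"
proof (rule poly_mapping_eqI)
  fix m assume v: "v : Ftot a" and j: "length a <= j"
  then have "v (j, iexp m) = 0" unfolding Ftot_iff by (meson not_le)
  then show "lookup (unemb v j) m = lookup 0 m" by (simp add: lookup_unemb[OF v])
qed

lemma carrier_free: "FC a = {w. \<forall>j\<ge>length a. w j = 0}" by (simp add: free_gmodule_def)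

lemma emb_carrier: "emb ` FC a = Ftot a"
proof
  show "emb ` FC a <= Ftot a" using emb_Ftot by (auto simp: carrier_free)
  show "Ftot a <= emb ` FC a"
  proof
    fix v assume v: "v : Ftot a"
    then show "v : emb ` FC a"
      using unemb_outside[OF v] emb_unemb[OF v] by (intro image_eqI[of _ _ "unemb v"]) (auto simp: carrier_free)
  qed
qed

lemma unemb_carrier: "v : Ftot a ==> unemb v : FC a" using unemb_outside by (auto simp: carrier_free)

lemma emb_add: "emb (%j. w j + w' j) = emb w + emb w'" by (auto simp: emb_def fun_eq_iff lookup_add)

lemma emb_monom:
  "emb (%j. single m c * w j) = scl c (sh (iexp m) (emb w))"
proof
  fix x :: "nat \<times> ('a => int)"
  obtain j av where x: "x = (j, av)" by (cases x)
  have "emb (%j. single m c * p) (0, av) = scl c (sh (iexp m) (emb (%j. p))) (0, av)" for p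
  proof (induction p rule: mpoly_induct)
    case (single m' c')
    have *: "emb (%j. single k d) (0, av) = (if av = iexp k then d else 0)" for k d av
      by (auto simp: emb_def lookup_single when_def iexp_mexp iexp_nonneg)
    have "av = iexp m + iexp m' \<longleftrightarrow> av - iexp m = iexp m'" by (auto simp: algebra_simps)
    then show ?case by (simp add: mult_single * iexp_add)
  next
    case (add p q)
    then show ?case by (simp add: distrib_left emb_add)
  qed (simp add: emb_def)
  from this[of "w j"] show "emb (%j. single m c * w j) x = scl c (sh (iexp m) (emb w)) x" by (simp add: x emb_def)
qed

lemma emb_smult: "emb (%j. r * w j) = pact r (emb w)"
proof (induction r rule: mpoly_induct)
  case zero
  show ?case by (simp add: emb_def fun_eq_iff)
next
  case (single m c)
  show ?case by (simp only: emb_monom pact_single)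
next
  case (add p q)
  have "emb (%j. (p + q) * w j) = emb (%j. p * w j) + emb (%j. q * w j)" by (simp only: distrib_right emb_add)
  then show ?case using add by (simp only: pact_add)
qed

lemma emb_component: "w : component (free_gmodule a) t \<longleftrightarrow> w : FC a & emb w : fr a t"
proof
  assume w: "w : component (free_gmodule a) t"
  then have w1: "!!j. length a <= j ==> w j = 0" and w2: "!!j. j < length a ==> w j : homogeneous_part (t - a ! j)"
    by (auto simp: free_gmodule_def)
  have "emb w : fr a t" unfolding fr_iff
  proof (intro allI impI)
    fix j av assume "emb w (j, av) ~= 0"
    then have e: "0 <= av" "lookup (w j) (mexp av) ~= 0" by (auto simp: emb_def split: if_splits)
    have j: "j < length a" using w1[of j] e(2) by (cases "j < length a") auto
    have "int (mono_degree (mexp av)) = t - a ! j" using w2[OF j] e(2) by (auto simp: homogeneous_part_def in_keys_iff)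
    then show "j < length a & 0 <= av & edeg av = t - a ! j" using j e(1) edeg_iexp[of "mexp av"] by (simp add: iexp_mexp)
  qed
  then show "w : FC a & emb w : fr a t" using w1 by (auto simp: carrier_free)
next
  assume w: "w : FC a & emb w : fr a t"
  have "w j : homogeneous_part (t - a ! j)" if "j < length a" for j unfolding homogeneous_part_def
  proof (intro CollectI ballI)
    fix m assume "m : keys (w j)"
    then have "emb w (j, iexp m) ~= 0" by (simp add: emb_def iexp_nonneg in_keys_iff)
    then have "edeg (iexp m) = t - a ! j" using w unfolding fr_iff by blast
    then show "int (mono_degree m) = t - a ! j" by (simp add: edeg_iexp)
  qed
  then show "w : component (free_gmodule a) t" using w by (auto simp: free_gmodule_def)
qed

subsection \<open>Additive images of vector spaces\<close>

text \<open>The carrier of \<open>G\<close> is an additive image of a subspace, so the group laws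
  and finite sums of \<open>G\<close> are inherited from functions instead of being checked for each
  construction.\<close>

locale lin_image =
  fixes Z :: "('i => 'k::field) set" and G :: "('m, 'z) ring_scheme" and \<Phi> :: "('i => 'k) => 'm"
  assumes Zs: "fs.subspace Z" and img: "\<Phi> ` Z = carrier G"
    and hadd: "!!x y. x : Z ==> y : Z ==> \<Phi> (x + y) = \<Phi> x \<oplus>\<^bsub>G\<^esub> \<Phi> y"
    and hzero: "\<Phi> 0 = \<zero>\<^bsub>G\<^esub>"
begin

lemma closed [intro]: "x : Z ==> \<Phi> x : carrier G" using img by blast

lemma obtain_pre:
  assumes "y : carrier G"
  obtains x where "x : Z" "y = \<Phi> x" using assms img by blast

lemma group: "abelian_group G"
proof (rule abelian_groupI)
  fix x y assume "x : carrier G" "y : carrier G"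
  then obtain u v where uv: "u : Z" "v : Z" "x = \<Phi> u" "y = \<Phi> v" by (metis obtain_pre)
  show "x \<oplus>\<^bsub>G\<^esub> y : carrier G" unfolding uv hadd[OF uv(1,2), symmetric] by (intro closed fs.subspace_add[OF Zs] uv)
  show "x \<oplus>\<^bsub>G\<^esub> y = y \<oplus>\<^bsub>G\<^esub> x" unfolding uv hadd[OF uv(1,2), symmetric] hadd[OF uv(2,1), symmetric] by (simp only: add.commute)
  fix z assume "z : carrier G"
  then obtain w where w: "w : Z" "z = \<Phi> w" by (metis obtain_pre)
  show "x \<oplus>\<^bsub>G\<^esub> y \<oplus>\<^bsub>G\<^esub> z = x \<oplus>\<^bsub>G\<^esub> (y \<oplus>\<^bsub>G\<^esub> z)"
    unfolding uv w hadd[OF uv(1,2), symmetric] hadd[OF uv(2) w(1), symmetric]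
      hadd[OF fs.subspace_add[OF Zs uv(1,2)] w(1), symmetric] hadd[OF uv(1) fs.subspace_add[OF Zs uv(2) w(1)], symmetric]
    by (simp only: add.assoc)
next
  show "\<zero>\<^bsub>G\<^esub> : carrier G" unfolding hzero[symmetric] by (intro closed fs.subspace_0[OF Zs])
  fix x assume "x : carrier G"
  then obtain u where u: "u : Z" "x = \<Phi> u" by (metis obtain_pre)
  show "\<zero>\<^bsub>G\<^esub> \<oplus>\<^bsub>G\<^esub> x = x"
    unfolding u hzero[symmetric] hadd[OF fs.subspace_0[OF Zs] u(1), symmetric] by (simp only: add_0_left)
  show "\<exists>y\<in>carrier G. y \<oplus>\<^bsub>G\<^esub> x = \<zero>\<^bsub>G\<^esub>"
  proof (rule bexI)
    show "\<Phi> (- u) \<oplus>\<^bsub>G\<^esub> x = \<zero>\<^bsub>G\<^esub>"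
      unfolding u hzero[symmetric] hadd[OF fs.subspace_neg[OF Zs u(1)] u(1), symmetric] by (simp only: left_minus)
    show "\<Phi> (- u) : carrier G" by (intro closed fs.subspace_neg[OF Zs] u)
  qed
qed

sublocale G: abelian_group G by (rule group)

lemma huminus: "x : Z ==> \<Phi> (- x) = \<ominus>\<^bsub>G\<^esub> \<Phi> x"
proof -
  assume x: "x : Z"
  have "\<Phi> (- x) \<oplus>\<^bsub>G\<^esub> \<Phi> x = \<zero>\<^bsub>G\<^esub>"
    unfolding hzero[symmetric] hadd[OF fs.subspace_neg[OF Zs x] x, symmetric] by (simp only: left_minus)
  then show ?thesis using x by (intro G.minus_equality[symmetric]) (auto intro: fs.subspace_neg[OF Zs])
qed

lemma eq_iff: "x : Z ==> y : Z ==> \<Phi> x = \<Phi> y \<longleftrightarrow> \<Phi> (x - y) = \<zero>\<^bsub>G\<^esub>"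
proof -
  assume xy: "x : Z" "y : Z"
  have "\<Phi> (x - y) = \<Phi> x \<oplus>\<^bsub>G\<^esub> \<ominus>\<^bsub>G\<^esub> \<Phi> y"
    using hadd[OF xy(1) fs.subspace_neg[OF Zs xy(2)]] huminus[OF xy(2)] by simp
  then show ?thesis using closed[OF xy(1)] closed[OF xy(2)]
    by (metis G.a_inv_closed G.add.inv_solve_right' G.l_zero G.r_neg G.zero_closed)
qed

lemma hsum:
  assumes "!!i. i : A ==> v i : Z"
  shows "finsum G (%i. \<Phi> (v i)) A = \<Phi> (\<Sum>i\<in>A. v i)"
proof (cases "finite A")
  case True
  then show ?thesis using assms
  proof (induction A rule: finite_induct)
    case empty
    then show ?case by (simp only: G.finsum_empty sum.empty hzero)
  next
    case (insert i A)
    have "finsum G (%i. \<Phi> (v i)) (insert i A) = \<Phi> (v i) \<oplus>\<^bsub>G\<^esub> finsum G (%i. \<Phi> (v i)) A"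
      by (rule G.finsum_insert) (use insert in auto)
    also have "\<dots> = \<Phi> (v i) \<oplus>\<^bsub>G\<^esub> \<Phi> (\<Sum>i\<in>A. v i)" using insert by simp
    also have "\<dots> = \<Phi> (v i + (\<Sum>i\<in>A. v i))"
      by (rule hadd[symmetric]) (use insert in \<open>auto intro: fs.subspace_sum[OF Zs]\<close>)
    finally show ?case using insert by (simp only: sum.insert not_False_eq_True)
  qed
next
  case False
  then show ?thesis by (simp add: hzero finsum_def finprod_def)
qed

end

text \<open>Since \<open>W\<close> contains the kernel, the cosets of its image correspond exactly
  to the classes of \<open>Z\<close> modulo \<open>W\<close>.\<close>

locale lin_quot = lin_image Z G \<Phi>
  for Z :: "('i => 'k::field) set" and G :: "('m, 'z) ring_scheme" and \<Phi> :: "('i => 'k) => 'm" +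
  fixes W :: "('i => 'k) set"
  assumes Wsub: "fs.subspace W" and WF: "W <= Z" and Wker: "!!v. v : Z ==> \<Phi> v = \<zero>\<^bsub>G\<^esub> ==> v : W"
begin

definition Q :: "('i => 'k) => 'm set" where
  "Q v = \<Phi> ` W +>\<^bsub>G\<^esub> \<Phi> v"

lemma W_F: "w : W ==> w : Z" using WF by blast

lemma Q_eq: "v : Z ==> Q v = {\<Phi> (w + v) | w. w : W}"
proof -
  assume v: "v : Z"
  have *: "\<Phi> w \<oplus>\<^bsub>G\<^esub> \<Phi> v = \<Phi> (w + v)" if "w : W" for w using hadd[OF W_F[OF that] v] by simp
  show ?thesis unfolding Q_def a_r_coset_def' by (auto simp: *)
qed

lemma Q_eq_iff: "v : Z ==> v' : Z ==> Q v = Q v' \<longleftrightarrow> v - v' : W"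
proof
  assume v: "v : Z" "v' : Z" and "Q v = Q v'"
  moreover have "\<Phi> (0 + v) : Q v" unfolding Q_eq[OF v(1)] using fs.subspace_0[OF Wsub] by blast
  ultimately obtain w where w: "w : W" "\<Phi> v = \<Phi> (w + v')" unfolding Q_eq[OF v(2)] by auto
  have F: "w + v' : Z" by (rule fs.subspace_add[OF Zs W_F[OF w(1)] v(2)])
  have "v - (w + v') : W" by (rule Wker) (use eq_iff[OF v(1) F] w(2) fs.subspace_diff[OF Zs v(1) F] in auto)
  then have "(v - (w + v')) + w : W" using w(1) by (rule fs.subspace_add[OF Wsub])
  then show "v - v' : W" by (simp add: algebra_simps)
next
  assume v: "v : Z" "v' : Z" and d: "v - v' : W"
  have "{\<Phi> (w + v) | w. w : W} <= {\<Phi> (w + v') | w. w : W}" if "v - v' : W" for v v'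
  proof
    fix x assume "x : {\<Phi> (w + v) | w. w : W}"
    then obtain w where w: "w : W" "x = \<Phi> (w + v)" by blast
    have "w + v = (w + (v - v')) + v'" by simp
    then show "x : {\<Phi> (w + v') | w. w : W}"
      using w fs.subspace_add[OF Wsub w(1) that] by (intro CollectI exI[of _ "w + (v - v')"]) simp_all
  qed
  moreover have "v' - v : W" using fs.subspace_neg[OF Wsub d] by simp
  ultimately show "Q v = Q v'" unfolding Q_eq[OF v(1)] Q_eq[OF v(2)] using d by blast
qed

lemma Q_0: "Q 0 = \<Phi> ` W" unfolding Q_eq[OF fs.subspace_0[OF Zs]] by auto

lemma Q_zero_iff: "v : Z ==> Q v = \<Phi> ` W \<longleftrightarrow> v : W"
  using Q_eq_iff[of v 0, OF _ fs.subspace_0[OF Zs]] by (simp add: Q_0)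

lemma Q_add:
  assumes xy: "x : Z" "y : Z"
  shows "Q (x + y) = set_add G (Q x) (Q y)"
proof -
  note s = fs.subspace_add[OF Zs]
  have *: "\<Phi> (w + x) \<oplus>\<^bsub>G\<^esub> \<Phi> (w' + y) = \<Phi> ((w + w') + (x + y))" if w: "w : W" "w' : W" for w w'
  proof -
    have e: "(w + w') + (x + y) = (w + x) + (w' + y)" by (simp add: algebra_simps)
    show ?thesis unfolding e hadd[OF s[OF W_F[OF w(1)] xy(1)] s[OF W_F[OF w(2)] xy(2)]] ..
  qed
  show ?thesis unfolding set_add_def'
  proof
    show "Q (x + y) <= (\<Union>h\<in>Q x. \<Union>k\<in>Q y. {h \<oplus>\<^bsub>G\<^esub> k})"
    proof
      fix z assume "z : Q (x + y)"
      then obtain w where w: "w : W" "z = \<Phi> (w + (x + y))" unfolding Q_eq[OF s[OF xy]] by blast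
      then have "z = \<Phi> (w + x) \<oplus>\<^bsub>G\<^esub> \<Phi> (0 + y)" using *[OF w(1) fs.subspace_0[OF Wsub]] by simp
      moreover have "\<Phi> (w + x) : Q x" unfolding Q_eq[OF xy(1)] using w(1) by blast
      moreover have "\<Phi> (0 + y) : Q y" unfolding Q_eq[OF xy(2)] using fs.subspace_0[OF Wsub] by blast
      ultimately show "z : (\<Union>h\<in>Q x. \<Union>k\<in>Q y. {h \<oplus>\<^bsub>G\<^esub> k})" by blast
    qed
    show "(\<Union>h\<in>Q x. \<Union>k\<in>Q y. {h \<oplus>\<^bsub>G\<^esub> k}) <= Q (x + y)"
    proof
      fix z assume "z : (\<Union>h\<in>Q x. \<Union>k\<in>Q y. {h \<oplus>\<^bsub>G\<^esub> k})"
      then obtain h k where hk: "h : Q x" "k : Q y" "z = h \<oplus>\<^bsub>G\<^esub> k" by blast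
      obtain w where w: "w : W" "h = \<Phi> (w + x)" using hk(1) unfolding Q_eq[OF xy(1)] by blast
      obtain w' where w': "w' : W" "k = \<Phi> (w' + y)" using hk(2) unfolding Q_eq[OF xy(2)] by blast
      show "z : Q (x + y)" unfolding Q_eq[OF s[OF xy]] hk(3) w(2) w'(2) *[OF w(1) w'(1)]
        using fs.subspace_add[OF Wsub w(1) w'(1)] by blast
    qed
  qed
qed

end

subsection \<open>Presentations of graded modules\<close>

text \<open>A graded presentation: \<open>E\<close> maps the free module with shifts
  \<open>a\<close> onto \<open>N\<close>, compatibly with components and with graded kernel.\<close>

locale pres = lin_image "Ftot a" N E
  for a :: "int list" and N :: "(('n::{finite,linorder}, 'k::field) mpolynomial, 'm) gmodule"
    and E :: "('n, 'k) lvec => 'm" +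
  assumes hsmult: "!!r v. v : Ftot a ==> E (pact r v) = r \<odot>\<^bsub>N\<^esub> E v"
    and hcomp: "!!t. E ` fr a t = component N t"
    and graded: "!!v t. v : Ftot a ==> E v = \<zero>\<^bsub>N\<^esub> ==> E (proj a t v) = \<zero>\<^bsub>N\<^esub>"
begin

abbreviation zN :: 'm where
  "zN == \<zero>\<^bsub>N\<^esub>"

definition ker :: "('n, 'k) fam" where
  "ker t = {v \<in> fr a t. E v = zN}"

lemma frF: "v : fr a t ==> v : Ftot a" using fr_Ftot by blast

lemma E_zero_add: "v : Ftot a ==> w : Ftot a ==> E v = zN ==> E (v + w) = E w"
  using hadd[of v w] closed[of w] by simp

lemma E_zero_pact: "v : Ftot a ==> E v = zN ==> E (pact r v) = zN"
  using hsmult[of v r] hsmult[of 0 r] fs.subspace_0[OF subspace_Ftot] hzero flin_0[OF flin_pact] by metis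

lemma scl_pact: "scl c v = pact (single 0 c) v" by (simp add: pact_single iexp_0)

lemma sh_pact: "0 <= bv ==> sh bv v = pact (single (mexp bv) 1) v" by (simp only: pact_single iexp_mexp fs.scale_one)

lemma E_zero_sh: "v : Ftot a ==> E v = zN ==> 0 <= bv ==> E (sh bv v) = zN"
  by (simp only: sh_pact E_zero_pact)

lemma E_zero_scl: "v : Ftot a ==> E v = zN ==> E (scl c v) = zN"
  by (simp only: scl_pact E_zero_pact)

lemma subspace_kernel: "fs.subspace {v \<in> Ftot a. E v = zN}" by (rule fs.subspaceI)
    (auto simp: hzero fs.subspace_0[OF subspace_Ftot] fs.subspace_add[OF subspace_Ftot]
      fs.subspace_scale[OF subspace_Ftot] E_zero_add E_zero_scl)

lemma gsub_ker: "gsub ker" unfolding gsub_def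
proof (intro conjI allI impI)
  show "fs.subspace (ker t)" for t
  proof -
    have "ker t = fr a t Int {v \<in> Ftot a. E v = zN}" using frF by (auto simp: ker_def)
    then show ?thesis using fs.subspace_inter[OF gsub_subspace[OF gsub_fr] subspace_kernel] by simp
  qed
next
  fix t and bv :: "'n => int" and v assume b: "0 <= bv" and v: "v : ker t"
  then have "v : fr a t" "E v = zN" by (simp_all add: ker_def)
  then show "sh bv v : ker (t + edeg bv)" using gsub_sh[OF gsub_fr b] E_zero_sh[OF frF _ b] unfolding ker_def by blast
qed

lemma ker_fr: "ker t <= fr a t" by (auto simp: ker_def)

lemma E_zero_iff_proj: "v : Ftot a ==> E v = zN \<longleftrightarrow> (\<forall>t. E (proj a t v) = zN)"
proof
  assume v: "v : Ftot a" and z: "\<forall>t. E (proj a t v) = zN"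
  obtain T where T: "finite T" "v = (\<Sum>t\<in>T. proj a t v)" by (rule sum_proj[OF v]) blast
  have "(\<Sum>t\<in>T. proj a t v) : {v \<in> Ftot a. E v = zN}"
    by (rule fs.subspace_sum[OF subspace_kernel]) (use z frF[OF proj_fr[OF v]] in auto)
  then show "E v = zN" using T(2) by simp
qed (use graded in blast)

lemma module: "Module.module class_ring N"
proof (rule Module.moduleI)
  show "cring (class_ring :: ('n, 'k) mpolynomial ring)" ..
  show "abelian_group N" by (rule group)
next
  fix r x assume "x : carrier N"
  then obtain v where v: "v : Ftot a" "x = E v" by (rule obtain_pre)
  show "r \<odot>\<^bsub>N\<^esub> x : carrier N" unfolding v(2) hsmult[OF v(1), symmetric] by (intro closed pact_Ftot v(1))
  show "\<one>\<^bsub>class_ring\<^esub> \<odot>\<^bsub>N\<^esub> x = x" unfolding v(2) hsmult[OF v(1), symmetric] by (simp add: class_ring_simps pact_one)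
  fix s
  show "(r \<oplus>\<^bsub>class_ring\<^esub> s) \<odot>\<^bsub>N\<^esub> x = r \<odot>\<^bsub>N\<^esub> x \<oplus>\<^bsub>N\<^esub> s \<odot>\<^bsub>N\<^esub> x"
    unfolding v(2) hsmult[OF v(1), symmetric] hadd[OF pact_Ftot[OF v(1)] pact_Ftot[OF v(1)], symmetric]
    by (simp only: class_ring_simps pact_add)
  show "(r \<otimes>\<^bsub>class_ring\<^esub> s) \<odot>\<^bsub>N\<^esub> x = r \<odot>\<^bsub>N\<^esub> (s \<odot>\<^bsub>N\<^esub> x)"
    unfolding v(2) hsmult[OF v(1), symmetric] hsmult[OF pact_Ftot[OF v(1)], symmetric] by (simp only: class_ring_simps pact_mult)
next
  fix r x y assume "x : carrier N" "y : carrier N"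
  then obtain v w where v: "v : Ftot a" "x = E v" and w: "w : Ftot a" "y = E w" by (metis obtain_pre)
  show "r \<odot>\<^bsub>N\<^esub> (x \<oplus>\<^bsub>N\<^esub> y) = r \<odot>\<^bsub>N\<^esub> x \<oplus>\<^bsub>N\<^esub> r \<odot>\<^bsub>N\<^esub> y"
    unfolding v(2) w(2) hadd[OF v(1) w(1), symmetric] hsmult[OF fs.subspace_add[OF subspace_Ftot v(1) w(1)], symmetric]
      hsmult[OF v(1), symmetric] hsmult[OF w(1), symmetric] hadd[OF pact_Ftot[OF v(1)] pact_Ftot[OF w(1)], symmetric]
    by (simp only: flin_add[OF flin_pact])
qed

end

text \<open>A graded submodule of \<open>N\<close>, given by its preimage \<open>W\<close> in the
  free module.\<close>

locale pres_sub = pres a N E + lin_quot "Ftot a" N E W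
  for a :: "int list" and N :: "(('n::{finite,linorder}, 'k::field) mpolynomial, 'm) gmodule"
    and E :: "('n, 'k) lvec => 'm" and W :: "('n, 'k) lvec set" +
  assumes Wpact: "!!r w. w : W ==> pact r w : W" and Wproj: "!!t w. w : W ==> proj a t w : W"
begin

text \<open>Scalar multiplication on \<open>quot_gmodule\<close> is a union over representatives;
  all its members coincide because \<open>W\<close> is stable under the ring.\<close>

lemma pres_quot: "pres a (quot_gmodule N (E ` W)) Q"
proof (unfold_locales)
  let ?N = "quot_gmodule N (E ` W)"
  show "fs.subspace (Ftot a)" by (rule subspace_Ftot)
  show "Q ` Ftot a = carrier ?N" unfolding quot_gmodule_def A_RCOSETS_def' img[symmetric] by (auto simp: Q_def)
  show "Q (x + y) = Q x \<oplus>\<^bsub>?N\<^esub> Q y" if "x : Ftot a" "y : Ftot a" for x y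
    using Q_add[OF that] by (simp add: quot_gmodule_def)
  show "Q 0 = \<zero>\<^bsub>?N\<^esub>" by (simp add: Q_0 quot_gmodule_def)
  show "Q (pact r v) = r \<odot>\<^bsub>?N\<^esub> Q v" if v: "v : Ftot a" for r v
  proof -
    have "r \<odot>\<^bsub>?N\<^esub> Q v = (\<Union>x\<in>Q v. E ` W +>\<^bsub>N\<^esub> (r \<odot>\<^bsub>N\<^esub> x))" by (simp add: quot_gmodule_def)
    also have "\<dots> = (\<Union>x\<in>Q v. Q (pact r v))"
    proof (rule SUP_cong[OF refl])
      fix x assume "x : Q v"
      then obtain w where w: "w : W" "x = E (w + v)" unfolding Q_eq[OF v] by blast
      have F: "w + v : Ftot a" by (rule fs.subspace_add[OF subspace_Ftot W_F[OF w(1)] v])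
      have "E ` W +>\<^bsub>N\<^esub> (r \<odot>\<^bsub>N\<^esub> x) = Q (pact r (w + v))" unfolding Q_def w(2) hsmult[OF F] ..
      also have "\<dots> = Q (pact r v)"
        using Q_eq_iff[OF pact_Ftot[OF F] pact_Ftot[OF v], of r r] Wpact[OF w(1), of r] by (simp add: flin_add[OF flin_pact])
      finally show "E ` W +>\<^bsub>N\<^esub> (r \<odot>\<^bsub>N\<^esub> x) = Q (pact r v)" .
    qed
    also have "\<dots> = Q (pact r v)" using fs.subspace_0[OF Wsub] unfolding Q_eq[OF v] by auto
    finally show ?thesis by simp
  qed
  show "Q ` fr a t = component ?N t" for t unfolding quot_gmodule_def hcomp[symmetric] by (auto simp: Q_def)
  show "Q (proj a t v) = \<zero>\<^bsub>?N\<^esub>" if v: "v : Ftot a" "Q v = \<zero>\<^bsub>?N\<^esub>" for v t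
  proof -
    have "v : W" using v Q_zero_iff[OF v(1)] by (simp add: quot_gmodule_def)
    then have "proj a t v : W" by (rule Wproj)
    then show ?thesis using Q_zero_iff[OF W_F] by (simp add: quot_gmodule_def)
  qed
qed

lemma quot_zero_iff: "v : Ftot a ==> Q v = \<zero>\<^bsub>quot_gmodule N (E ` W)\<^esub> \<longleftrightarrow> v : W"
  using Q_zero_iff by (simp add: quot_gmodule_def)

end

section \<open>Powers of the irrelevant ideal and the torsion submodule\<close>

text \<open>The polynomials without constant term form an ideal that contains the variables.\<close>

lemma irrelevant_ideal_keys: "r : irrelevant_ideal ==> m : keys r ==> 1 <= mono_degree m"
proof -
  let ?I = "{r :: ('a, 'b) mpolynomial. \<forall>m\<in>keys r. 1 <= mono_degree m}"
  have R: "ring (class_ring :: ('a, 'b) mpolynomial ring)" ..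
  have md_add: "mono_degree (m + m') = mono_degree m + mono_degree m'" for m m' :: "'a \<Rightarrow>\<^sub>0 nat"
    by (simp add: mono_degree_def lookup_add sum.distrib)
  have mult: "r * s : ?I" if "s : ?I" for r s
  proof (intro CollectI ballI)
    fix m assume "m : keys (r * s)"
    then obtain m1 m2 where "m2 : keys s" "m = m1 + m2" using keys_mult[of r s] by auto
    then show "1 <= mono_degree m" using that md_add[of m1 m2] by auto
  qed
  have add: "r + s : ?I" if "r : ?I" "s : ?I" for r s using that keys_add[of r s] by blast
  have neg: "- r : ?I" if "r : ?I" for r using that by (auto simp: in_keys_iff)
  have "ideal ?I class_ring"
  proof (rule idealI)
    show "ring (class_ring :: ('a, 'b) mpolynomial ring)" by (rule R)
    show "subgroup ?I (add_monoid class_ring)"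
    proof (rule subgroup.intro)
      show "x \<otimes>\<^bsub>add_monoid class_ring\<^esub> y : ?I" if "x : ?I" "y : ?I" for x y
      proof -
        have "x \<otimes>\<^bsub>add_monoid class_ring\<^esub> y = x + y" by (simp add: class_ring_simps)
        then show ?thesis using add[OF that] by simp
      qed
      show "inv\<^bsub>add_monoid class_ring\<^esub> x : ?I" if "x : ?I" for x
      proof -
        have "inv\<^bsub>add_monoid class_ring\<^esub> x = \<ominus>\<^bsub>class_ring\<^esub> x" by (simp add: a_inv_def)
        also have "\<dots> = - x" by (simp add: class_ring_simps)
        finally show ?thesis using neg[OF that] by simp
      qed
    qed (simp_all add: class_ring_simps)
    show "x \<otimes>\<^bsub>class_ring\<^esub> r : ?I" "r \<otimes>\<^bsub>class_ring\<^esub> x : ?I" if "r : ?I" for r x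
      using mult[OF that, of x] by (simp_all only: class_ring_simps mult.commute[of r x])
  qed
  moreover have "range pvar <= ?I" by (auto simp: pvar_def mono_degree_def lookup_single when_def)
  ultimately have "irrelevant_ideal <= ?I" unfolding irrelevant_ideal_def by (rule ring.genideal_minimal[OF R])
  then show "r : irrelevant_ideal ==> m : keys r ==> 1 <= mono_degree m" by auto
qed

lemma irrelevant_power_Suc: "irrelevant_power (Suc s) = ideal_prod class_ring irrelevant_ideal (irrelevant_power s)"
  by (simp add: irrelevant_power_def)

lemma irrelevant_power_keys:
  "r : irrelevant_power s ==> m : keys (r :: ('n::finite, 'k::field) mpolynomial) ==> s <= mono_degree m"
proof (induction s arbitrary: r m)
  case (Suc s)
  have md_add: "mono_degree (m + m') = mono_degree m + mono_degree m'" for m m' :: "'n \<Rightarrow>\<^sub>0 nat"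
    by (simp add: mono_degree_def lookup_add sum.distrib)
  have "\<forall>m\<in>keys r. Suc s <= mono_degree m" using Suc.prems(1) unfolding irrelevant_power_Suc
  proof (induction rule: ideal_prod.induct)
    case (prod i j)
    show ?case
    proof
      fix m assume "m : keys (i \<otimes>\<^bsub>class_ring\<^esub> j)"
      then obtain m1 m2 where "m1 : keys i" "m2 : keys j" "m = m1 + m2" using keys_mult[of i j] by (auto simp: class_ring_simps)
      then show "Suc s <= mono_degree m"
        using irrelevant_ideal_keys[OF prod(1)] Suc.IH[OF prod(2)] md_add by (metis add_mono plus_1_eq_Suc)
    qed
  next
    case (sum s1 s2)
    then show ?case using keys_add[of s1 s2] by (auto simp: class_ring_simps)
  qed
  then show ?case using Suc.prems(2) by blast
qed simp

text \<open>One variable is split off the monomial for each factor of the ideal power.\<close>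

lemma single_irrelevant_power:
  "s <= mono_degree m ==> single m 1 : (irrelevant_power s :: ('n::finite, 'k::field) mpolynomial set)"
proof (induction s arbitrary: m)
  case 0
  then show ?case by (simp add: irrelevant_power_def)
next
  case (Suc s)
  have R: "ring (class_ring :: ('n, 'k) mpolynomial ring)" ..
  have "\<exists>i. lookup m i ~= 0"
  proof (rule ccontr)
    assume "\<not> ?thesis"
    then show False using Suc.prems by (simp add: mono_degree_def)
  qed
  then obtain i where i: "lookup m i ~= 0" by blast
  define m' where "m' = m - single i 1"
  have mm: "m = single i 1 + m'"
    by (rule poly_mapping_eqI) (use i in \<open>auto simp: m'_def lookup_add lookup_minus lookup_single when_def\<close>)
  have "mono_degree m = mono_degree (single i 1) + mono_degree m'"
    unfolding mm by (simp add: mono_degree_def lookup_add sum.distrib)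
  moreover have "mono_degree (single i 1) = 1" by (simp add: mono_degree_def lookup_single when_def)
  ultimately have "s <= mono_degree m'" using Suc.prems by simp
  then have j: "single m' 1 : (irrelevant_power s :: ('n, 'k) mpolynomial set)" by (rule Suc.IH)
  have v: "pvar i : (irrelevant_ideal :: ('n, 'k) mpolynomial set)"
    unfolding irrelevant_ideal_def using ring.genideal_self[OF R, of "range pvar"] by (auto simp: class_ring_simps)
  have "pvar i \<otimes>\<^bsub>class_ring\<^esub> single m' 1 : (irrelevant_power (Suc s) :: ('n, 'k) mpolynomial set)"
    unfolding irrelevant_power_Suc by (rule ideal_prod.prod[OF v j])
  moreover have "pvar i \<otimes>\<^bsub>class_ring\<^esub> single m' 1 = (single m 1 :: ('n, 'k) mpolynomial)"
    unfolding class_ring_simps pvar_def mult_single mm[symmetric] mult_1 ..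
  ultimately show ?case by simp
qed

context pres
begin

definition Wtor :: "('n, 'k) lvec set" where
  "Wtor = {v \<in> Ftot a. \<exists>n. \<forall>bv. 0 <= bv --> n <= edeg bv --> E (sh bv v) = zN}"

lemma WtorI: "v : Ftot a ==> (!!bv. 0 <= bv ==> n <= edeg bv ==> E (sh bv v) = zN) ==> v : Wtor"
  unfolding Wtor_def by blast

lemma WtorE:
  assumes "v : Wtor"
  shows "v : Ftot a" "\<exists>n. \<forall>bv. 0 <= bv --> n <= edeg bv --> E (sh bv v) = zN"
  using assms unfolding Wtor_def by blast+

lemma Wtor_add:
  assumes "v : Wtor" "w : Wtor"
  shows "v + w : Wtor"
proof -
  obtain n where n: "!!bv. 0 <= bv ==> n <= edeg bv ==> E (sh bv v) = zN" using WtorE(2)[OF assms(1)] by blast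
  obtain n' where n': "!!bv. 0 <= bv ==> n' <= edeg bv ==> E (sh bv w) = zN" using WtorE(2)[OF assms(2)] by blast
  note F = WtorE(1)[OF assms(1)] WtorE(1)[OF assms(2)]
  show ?thesis
  proof (rule WtorI[of _ "max n n'"])
    show "v + w : Ftot a" by (rule fs.subspace_add[OF subspace_Ftot F])
    fix bv :: "'n => int" assume b: "0 <= bv" "max n n' <= edeg bv"
    have "E (sh bv v) = zN" "E (sh bv w) = zN" using b n n' by auto
    then show "E (sh bv (v + w)) = zN"
      unfolding sh_add using E_zero_add[OF sh_Ftot[OF b(1) F(1)] sh_Ftot[OF b(1) F(2)]] by simp
  qed
qed

lemma Wtor_scl_sh:
  assumes v: "v : Wtor" and g: "0 <= gv"
  shows "scl c (sh gv v) : Wtor"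
proof -
  obtain n where n: "!!bv. 0 <= bv ==> n <= edeg bv ==> E (sh bv v) = zN" using WtorE(2)[OF v] by blast
  note F = WtorE(1)[OF v]
  show ?thesis
  proof (rule WtorI[of _ n])
    show "scl c (sh gv v) : Ftot a" by (intro fs.subspace_scale[OF subspace_Ftot] sh_Ftot g F)
    fix bv :: "'n => int" assume b: "0 <= bv" "n <= edeg bv"
    have "E (sh bv (sh gv v)) = zN"
      using n[of "bv + gv"] b edeg_nonneg[OF g] add_nonneg_nonneg[OF b(1) g] by (simp add: sh_sh)
    then show "E (sh bv (scl c (sh gv v))) = zN" unfolding sh_scl by (intro E_zero_scl sh_Ftot b(1) g F)
  qed
qed

lemma subspace_Wtor: "fs.subspace Wtor"
proof (rule fs.subspaceI)
  show "0 : Wtor" by (rule WtorI[of _ 0]) (simp_all add: fs.subspace_0[OF subspace_Ftot] hzero)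
  show "scl c v : Wtor" if "v : Wtor" for c v using Wtor_scl_sh[OF that order_refl, of c] by simp
qed (rule Wtor_add)

lemma Wtor_pact: "v : Wtor ==> pact r v : Wtor"
  unfolding pact_def by (intro fs.subspace_sum[OF subspace_Wtor] Wtor_scl_sh iexp_nonneg)

sublocale tor: pres_sub a N E Wtor
proof unfold_locales
  show "fs.subspace Wtor" by (rule subspace_Wtor)
  show "Wtor <= Ftot a" using WtorE(1) by blast
  show "pact r w : Wtor" if "w : Wtor" for r w by (rule Wtor_pact[OF that])
  show "v : Wtor" if "v : Ftot a" "E v = zN" for v by (rule WtorI[of _ 0]) (use that E_zero_sh in auto)
  show "proj a t w : Wtor" if w: "w : Wtor" for t w
  proof -
    obtain n where n: "!!bv. 0 <= bv ==> n <= edeg bv ==> E (sh bv w) = zN" using WtorE(2)[OF w] by blast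
    show ?thesis
    proof (rule WtorI[of _ n])
      show "proj a t w : Ftot a" by (rule frF[OF proj_fr[OF WtorE(1)[OF w]]])
      fix bv :: "'n => int" assume b: "0 <= bv" "n <= edeg bv"
      show "E (sh bv (proj a t w)) = zN"
        unfolding proj_sh[symmetric] by (intro graded sh_Ftot b(1) WtorE(1)[OF w] n[OF b])
    qed
  qed
qed

text \<open>The \<open>s\<close>-th power of the irrelevant ideal contains all monomials of degree
  at least \<open>s\<close>, and only such monomials occur in its elements; so annihilation by a
  power can be tested on monomials.\<close>

lemma torsion_eq: "torsion N = E ` Wtor"
proof
  show "E ` Wtor <= torsion N"
  proof
    fix x assume "x : E ` Wtor"
    then obtain v where v: "v : Wtor" "x = E v" by blast
    obtain n where n: "!!bv. 0 <= bv ==> n <= edeg bv ==> E (sh bv v) = zN" using WtorE(2)[OF v(1)] by blast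
    have "r \<odot>\<^bsub>N\<^esub> x = zN" if r: "r : irrelevant_power (nat n)" for r
    proof -
      have "pact r v : {v \<in> Ftot a. E v = zN}" unfolding pact_def
      proof (intro fs.subspace_sum[OF subspace_kernel] fs.subspace_scale[OF subspace_kernel])
        fix m assume "m : keys r"
        then have "nat n <= mono_degree m" by (rule irrelevant_power_keys[OF r])
        then have "n <= edeg (iexp m)" by (simp add: edeg_iexp)
        then show "sh (iexp m) v : {v \<in> Ftot a. E v = zN}"
          using n[OF iexp_nonneg] sh_Ftot[OF iexp_nonneg WtorE(1)[OF v(1)]] by blast
      qed
      then show ?thesis unfolding v(2) hsmult[OF WtorE(1)[OF v(1)], symmetric] by blast
    qed
    moreover have "x : carrier N" using v WtorE(1) by blast
    ultimately show "x : torsion N" unfolding torsion_def by blast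
  qed
  show "torsion N <= E ` Wtor"
  proof
    fix x assume "x : torsion N"
    then obtain s where x: "x : carrier N" and s: "!!r. r : irrelevant_power s ==> r \<odot>\<^bsub>N\<^esub> x = zN"
      unfolding torsion_def by blast
    obtain v where v: "v : Ftot a" "x = E v" using x by (rule obtain_pre)
    have "v : Wtor"
    proof (rule WtorI[OF v(1), of "int s"])
      fix bv :: "'n => int" assume b: "0 <= bv" "int s <= edeg bv"
      have "s <= mono_degree (mexp bv)" using b edeg_iexp[of "mexp bv"] by (simp add: iexp_mexp)
      then have "single (mexp bv) 1 \<odot>\<^bsub>N\<^esub> x = zN" by (intro s single_irrelevant_power)
      then show "E (sh bv v) = zN" unfolding sh_pact[OF b(1)] hsmult[OF v(1)] v(2) .
    qed
    then show "x : E ` Wtor" using v(2) by blast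
  qed
qed

lemma Wtor_fr: "v : fr a t ==> v : Wtor \<longleftrightarrow> v : sat a ker t"
  using frF[of v t] gsub_sh[OF gsub_fr, of _ v a t] unfolding Wtor_def sat_def ker_def by auto

lemma pres_mod_torsion: "pres a (mod_torsion N) tor.Q" unfolding mod_torsion_def torsion_eq by (rule tor.pres_quot)

text \<open>Dividing by the torsion replaces the relations by their saturation, which links
  \<open>mod_torsion\<close> with \<open>reg_le\<close>.\<close>

lemma mod_torsion_ker: "pres.ker a (mod_torsion N) tor.Q = sat a ker"
proof
  fix t
  have "pres.ker a (mod_torsion N) tor.Q t = {v \<in> fr a t. tor.Q v = \<zero>\<^bsub>mod_torsion N\<^esub>}"
    by (rule pres.ker_def[OF pres_mod_torsion])
  also have "\<dots> = {v \<in> fr a t. v : Wtor}" unfolding mod_torsion_def torsion_eq using tor.quot_zero_iff[OF frF] by auto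
  also have "\<dots> = sat a ker t" using Wtor_fr sat_fr[of a ker t] by blast
  finally show "pres.ker a (mod_torsion N) tor.Q t = sat a ker t" .
qed

end

subsection \<open>Quotients by linear forms\<close>

lemma hseq_append: "hseq a (ls @ [fv]) U = hstep a fv (hseq a ls U)" by (induction ls arbitrary: U) auto

lemma pact_commute: "pact r (pact s v) = pact s (pact r v)" by (simp only: pact_mult[symmetric] mult.commute)

context pres
begin

text \<open>The preimage in the free module of the submodule generated by the first \<open>j\<close>
  forms.\<close>

definition Wseq :: "(nat => ('n, 'k) mpolynomial) => nat => ('n, 'k) lvec set" where
  "Wseq l j = {v \<in> Ftot a. \<exists>w. (\<forall>s\<in>{1..j}. w s : Ftot a) & E (v - (\<Sum>s\<in>{1..j}. pact (l s) (w s))) = zN}"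

lemma WseqI: "v : Ftot a ==> (!!s. s : {1..j} ==> w s : Ftot a) ==>
    E (v - (\<Sum>s\<in>{1..j}. pact (l s) (w s))) = zN ==> v : Wseq l j" unfolding Wseq_def by blast

lemma WseqE: "v : Wseq l j ==> v : Ftot a & (\<exists>w. (\<forall>s\<in>{1..j}. w s : Ftot a) \<and>
    E (v - (\<Sum>s\<in>{1..j}. pact (l s) (w s))) = zN)" unfolding Wseq_def by blast

lemma sum_pact_Ftot: "(!!s. s : A ==> w s : Ftot a) ==> (\<Sum>s\<in>A. pact (l s) (w s)) : Ftot a"
  by (intro fs.subspace_sum[OF subspace_Ftot] pact_Ftot)

lemma pres_sub_Wseq:
  assumes l: "!!s. s : {1..j} ==> l s : homogeneous_part 1"
  shows "pres_sub a N E (Wseq l j)"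
proof unfold_locales
  let ?S = "%w. (\<Sum>s\<in>{1..j}. pact (l s) (w s))"
  show "Wseq l j <= Ftot a" unfolding Wseq_def by blast
  show ker: "v : Wseq l j" if "v : Ftot a" "E v = zN" for v by (rule WseqI[of _ _ "%_. 0"])
      (use that in \<open>simp_all add: fs.subspace_0[OF subspace_Ftot] flin_0[OF flin_pact] sum.neutral\<close>)
  show pc: "pact r v : Wseq l j" if v: "v : Wseq l j" for r v
  proof -
    obtain w where w: "v : Ftot a" "\<forall>s\<in>{1..j}. w s : Ftot a" "E (v - ?S w) = zN" using WseqE[OF v] by blast
    note w2 = w(2)[rule_format]
    have "?S (%s. pact r (w s)) = pact r (?S w)" unfolding flin_sum[OF flin_pact] by (rule sum.cong) (simp_all only: pact_commute)
    then have "pact r v - ?S (%s. pact r (w s)) = pact r (v - ?S w)" by (simp only: flin_diff[OF flin_pact])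
    moreover have "E (pact r (v - ?S w)) = zN"
      by (rule E_zero_pact[OF fs.subspace_diff[OF subspace_Ftot w(1) sum_pact_Ftot[of "{1..j}" w l, OF w2]] w(3)])
    ultimately have "E (pact r v - ?S (%s. pact r (w s))) = zN" by (simp only:)
    then show ?thesis by (intro WseqI[of _ _ "%s. pact r (w s)"] pact_Ftot w(1) w2)
  qed
  show "fs.subspace (Wseq l j)"
  proof (rule fs.subspaceI)
    show "0 : Wseq l j" by (rule ker) (simp_all add: fs.subspace_0[OF subspace_Ftot] hzero)
    show "scl c v : Wseq l j" if "v : Wseq l j" for c v unfolding scl_pact by (rule pc[OF that])
    fix x y assume "x : Wseq l j" "y : Wseq l j"
    note xy = WseqE[OF this(1)] WseqE[OF this(2)]
    obtain w where w: "x : Ftot a" "\<forall>s\<in>{1..j}. w s : Ftot a" "E (x - ?S w) = zN" using xy(1) by blast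
    obtain w' where w': "y : Ftot a" "\<forall>s\<in>{1..j}. w' s : Ftot a" "E (y - ?S w') = zN" using xy(2) by blast
    note w2 = w(2)[rule_format] w'(2)[rule_format]
    have F: "x - ?S w : Ftot a" "y - ?S w' : Ftot a"
      by (intro fs.subspace_diff[OF subspace_Ftot] w(1) w'(1) sum_pact_Ftot w2; assumption)+
    have "?S (%s. w s + w' s) = ?S w + ?S w'" by (simp only: flin_add[OF flin_pact] sum.distrib)
    then have e: "(x + y) - ?S (%s. w s + w' s) = (x - ?S w) + (y - ?S w')" by (simp only: algebra_simps)
    have "E ((x + y) - ?S (%s. w s + w' s)) = zN" unfolding e E_zero_add[OF F w(3)] by (rule w'(3))
    then show "x + y : Wseq l j" by (intro WseqI[of _ _ "%s. w s + w' s"] fs.subspace_add[OF subspace_Ftot] w(1) w'(1) w2)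
  qed
  show "proj a t v : Wseq l j" if v: "v : Wseq l j" for t v
  proof -
    obtain w where w: "v : Ftot a" "\<forall>s\<in>{1..j}. w s : Ftot a" "E (v - ?S w) = zN" using WseqE[OF v] by blast
    note w2 = w(2)[rule_format]
    have "proj a t (?S w) = ?S (%s. proj a (t - 1) (w s))" unfolding flin_sum[OF flin_proj]
    proof (rule sum.cong[OF refl])
      fix s assume "s : {1..j}"
      then show "proj a t (pact (l s) (w s)) = pact (l s) (proj a (t - 1) (w s))"
        using proj_pact[OF l, of s a "t - 1" "w s"] by simp
    qed
    then have e: "proj a t v - ?S (%s. proj a (t - 1) (w s)) = proj a t (v - ?S w)" by (simp only: flin_diff[OF flin_proj])
    have "E (proj a t v - ?S (%s. proj a (t - 1) (w s))) = zN"
      unfolding e by (rule graded[OF fs.subspace_diff[OF subspace_Ftot w(1) sum_pact_Ftot[of "{1..j}" w l, OF w2]] w(3)])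
    then show ?thesis by (intro WseqI[of _ _ "%s. proj a (t - 1) (w s)"] frF[OF proj_fr] w(1) w2)
  qed
qed

lemma Wseq_image:
  "E ` Wseq l j = {\<Oplus>\<^bsub>N\<^esub>s\<in>{1..j}. l s \<odot>\<^bsub>N\<^esub> m s | m. m : {1..j} \<rightarrow> carrier N}"
proof
  let ?S = "%w. (\<Sum>s\<in>{1..j}. pact (l s) (w s))"
  have ES: "E (?S w) = (\<Oplus>\<^bsub>N\<^esub>s\<in>{1..j}. l s \<odot>\<^bsub>N\<^esub> E (w s))" if "!!s. s : {1..j} ==> w s : Ftot a" for w
  proof -
    have "E (?S w) = (\<Oplus>\<^bsub>N\<^esub>s\<in>{1..j}. E (pact (l s) (w s)))" by (rule hsum[symmetric]) (use that pact_Ftot in auto)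
    also have "\<dots> = (\<Oplus>\<^bsub>N\<^esub>s\<in>{1..j}. l s \<odot>\<^bsub>N\<^esub> E (w s))"
    proof (rule G.finsum_cong'[OF refl])
      show "(%s. l s \<odot>\<^bsub>N\<^esub> E (w s)) : {1..j} \<rightarrow> carrier N"
      proof
        fix s assume "s : {1..j}"
        then have F: "w s : Ftot a" by (rule that)
        show "l s \<odot>\<^bsub>N\<^esub> E (w s) : carrier N" unfolding hsmult[OF F, symmetric] by (intro closed pact_Ftot F)
      qed
      show "E (pact (l s) (w s)) = l s \<odot>\<^bsub>N\<^esub> E (w s)" if "s : {1..j}" for s
        using that \<open>!!s. s : {1..j} ==> w s : Ftot a\<close> by (intro hsmult)
    qed
    finally show ?thesis .
  qed
  show "E ` Wseq l j <= {\<Oplus>\<^bsub>N\<^esub>s\<in>{1..j}. l s \<odot>\<^bsub>N\<^esub> m s | m. m : {1..j} \<rightarrow> carrier N}"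
  proof
    fix x assume "x : E ` Wseq l j"
    then obtain v where v: "v : Wseq l j" "x = E v" by blast
    obtain w where w: "v : Ftot a" "\<forall>s\<in>{1..j}. w s : Ftot a" "E (v - ?S w) = zN" using WseqE[OF v(1)] by blast
    note w2 = w(2)[rule_format]
    have "E v = E (?S w)" using eq_iff[OF w(1) sum_pact_Ftot[of "{1..j}" w l, OF w2]] w(3) by simp
    then have "x = (\<Oplus>\<^bsub>N\<^esub>s\<in>{1..j}. l s \<odot>\<^bsub>N\<^esub> E (w s))" using ES[of w, OF w2] v(2) by simp
    moreover have "(%s. E (w s)) : {1..j} \<rightarrow> carrier N" using w(2) by blast
    ultimately show "x : {\<Oplus>\<^bsub>N\<^esub>s\<in>{1..j}. l s \<odot>\<^bsub>N\<^esub> m s | m. m : {1..j} \<rightarrow> carrier N}"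
      by (intro CollectI exI[of _ "%s. E (w s)"]) simp
  qed
  show "{\<Oplus>\<^bsub>N\<^esub>s\<in>{1..j}. l s \<odot>\<^bsub>N\<^esub> m s | m. m : {1..j} \<rightarrow> carrier N} <= E ` Wseq l j"
  proof
    fix x assume "x : {\<Oplus>\<^bsub>N\<^esub>s\<in>{1..j}. l s \<odot>\<^bsub>N\<^esub> m s | m. m : {1..j} \<rightarrow> carrier N}"
    then obtain m where m: "m : {1..j} \<rightarrow> carrier N" "x = (\<Oplus>\<^bsub>N\<^esub>s\<in>{1..j}. l s \<odot>\<^bsub>N\<^esub> m s)" by blast
    have "\<forall>s. \<exists>v. s : {1..j} --> v : Ftot a & m s = E v" using m(1) img by (metis Pi_mem imageE)
    then obtain w where w: "!!s. s : {1..j} ==> w s : Ftot a" "!!s. s : {1..j} ==> m s = E (w s)" by metis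
    have "x = (\<Oplus>\<^bsub>N\<^esub>s\<in>{1..j}. l s \<odot>\<^bsub>N\<^esub> E (w s))" unfolding m(2)
    proof (rule G.finsum_cong'[OF refl])
      show "(%s. l s \<odot>\<^bsub>N\<^esub> E (w s)) : {1..j} \<rightarrow> carrier N"
      proof
        fix s assume "s : {1..j}"
        then have F: "w s : Ftot a" by (rule w(1))
        show "l s \<odot>\<^bsub>N\<^esub> E (w s) : carrier N" unfolding hsmult[OF F, symmetric] by (intro closed pact_Ftot F)
      qed
    qed (use w(2) in simp)
    then have "x = E (?S w)" using ES[of w, OF w(1)] by simp
    moreover have "?S w : Wseq l j" by (intro WseqI[of _ _ w] sum_pact_Ftot w(1)) (simp_all only: diff_self hzero)
    ultimately show "x : E ` Wseq l j" by blast
  qed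
qed

lemma quot_by_seq_eq: "quot_by_seq N l j = quot_gmodule N (E ` Wseq l j)" unfolding quot_by_seq_def Wseq_image ..

text \<open>Identifies the relations of \<open>quot_by_seq\<close> with the iterated
  \<open>hstep\<close>. For homogeneous \<open>v\<close> arbitrary coefficients can be replaced by
  their components of degree t - 1.\<close>

lemma Wseq_fr:
  assumes l: "!!s. s : {1..j} ==> l s : homogeneous_part 1"
  shows "{v \<in> fr a t. v : Wseq l j} = hseq a (map (%s. pact (l s)) [1..<Suc j]) ker t" using assms
proof (induction j arbitrary: t)
  case 0
  show ?case using frF by (auto simp: Wseq_def ker_def)
next
  case (Suc j)
  have S: "(\<Sum>s\<in>{1..Suc j}. f s) = (\<Sum>s\<in>{1..j}. f s) + f (Suc j)" for f :: "nat => ('n, 'k) lvec"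
    by (simp only: sum.cl_ivl_Suc) simp
  have lS: "l (Suc j) : homogeneous_part 1" using Suc.prems by simp
  have lfr: "pact (l (Suc j)) f : fr a t" if "f : fr a (t - 1)" for f
  proof -
    have "\<forall>V t v. gsub V --> v : V t --> pact (l (Suc j)) v : V (t + 1)" using lin1_pact[OF lS] unfolding lin1_def by blast
    from this[rule_format, OF gsub_fr that] show ?thesis by simp
  qed
  have IH: "{v \<in> fr a t. v : Wseq l j} = hseq a (map (%s. pact (l s)) [1..<Suc j]) ker t"
    by (rule Suc.IH) (use Suc.prems in auto)
  have "map (%s. pact (l s)) [1..<Suc (Suc j)] = map (%s. pact (l s)) [1..<Suc j] @ [pact (l (Suc j))]" by simp
  then have "hseq a (map (%s. pact (l s)) [1..<Suc (Suc j)]) ker t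
      = sadd (pact (l (Suc j)) ` fr a (t - 1)) {v \<in> fr a t. v : Wseq l j}" unfolding IH by (simp only: hseq_append hstep_def)
  also have "\<dots> = {v \<in> fr a t. v : Wseq l (Suc j)}"
  proof
    show "sadd (pact (l (Suc j)) ` fr a (t - 1)) {v \<in> fr a t. v : Wseq l j} <= {v \<in> fr a t. v : Wseq l (Suc j)}"
    proof
      fix v assume "v : sadd (pact (l (Suc j)) ` fr a (t - 1)) {v \<in> fr a t. v : Wseq l j}"
      then obtain f u where f: "f : fr a (t - 1)" and u: "u : fr a t" "u : Wseq l j" and v: "v = pact (l (Suc j)) f + u"
        by (auto elim!: saddE)
      obtain w where w: "\<forall>s\<in>{1..j}. w s : Ftot a" "E (u - (\<Sum>s\<in>{1..j}. pact (l s) (w s))) = zN"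
        using WseqE[OF u(2)] by blast
      have "pact (l (Suc j)) f : fr a t" by (rule lfr[OF f])
      then have vf: "v : fr a t" unfolding v by (rule fs.subspace_add[OF gsub_subspace[OF gsub_fr] _ u(1)])
      have "(\<Sum>s\<in>{1..j}. pact (l s) ((w(Suc j := f)) s)) = (\<Sum>s\<in>{1..j}. pact (l s) (w s))" by (rule sum.cong) auto
      then have e: "v - (\<Sum>s\<in>{1..Suc j}. pact (l s) ((w(Suc j := f)) s)) = u - (\<Sum>s\<in>{1..j}. pact (l s) (w s))"
        unfolding S v by (simp add: algebra_simps)
      have "v : Wseq l (Suc j)"
      proof (rule WseqI[of _ _ "w(Suc j := f)"])
        show "(w(Suc j := f)) s : Ftot a" if "s : {1..Suc j}" for s using that w(1) frF[OF f] by (cases "s = Suc j") simp_all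
        show "E (v - (\<Sum>s\<in>{1..Suc j}. pact (l s) ((w(Suc j := f)) s))) = zN" unfolding e by (rule w(2))
      qed (rule frF[OF vf])
      then show "v : {v \<in> fr a t. v : Wseq l (Suc j)}" using vf by blast
    qed
    show "{v \<in> fr a t. v : Wseq l (Suc j)} <= sadd (pact (l (Suc j)) ` fr a (t - 1)) {v \<in> fr a t. v : Wseq l j}"
    proof
      fix v assume "v : {v \<in> fr a t. v : Wseq l (Suc j)}"
      then have v: "v : fr a t" "v : Wseq l (Suc j)" by blast+
      obtain w where w0: "\<forall>s\<in>{1..Suc j}. w s : Ftot a" "E (v - (\<Sum>s\<in>{1..Suc j}. pact (l s) (w s))) = zN"
        using WseqE[OF v(2)] by blast
      note w = w0(1)[rule_format] w0(2)
      \<comment> \<open>The forms have degree 1, so taking the component of degree \<open>t\<close>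
        of the relation selects degree t - 1 in each coefficient.\<close>
      define w' where "w' s = proj a (t - 1) (w s)" for s
      have w'f: "w' s : fr a (t - 1)" if "s : {1..Suc j}" for s unfolding w'_def by (rule proj_fr[OF w(1)[OF that]])
      have "proj a t (\<Sum>s\<in>{1..Suc j}. pact (l s) (w s)) = (\<Sum>s\<in>{1..Suc j}. pact (l s) (w' s))"
        unfolding flin_sum[OF flin_proj] w'_def
      proof (rule sum.cong[OF refl])
        fix s assume "s : {1..Suc j}"
        then show "proj a t (pact (l s) (w s)) = pact (l s) (proj a (t - 1) (w s))"
          using proj_pact[OF Suc.prems, of s a "t - 1" "w s"] by simp
      qed
      then have e: "proj a t (v - (\<Sum>s\<in>{1..Suc j}. pact (l s) (w s))) = v - (\<Sum>s\<in>{1..Suc j}. pact (l s) (w' s))"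
        using proj_of_fr[OF v(1), of t] by (simp only: flin_diff[OF flin_proj]) simp
      have z: "E (v - (\<Sum>s\<in>{1..Suc j}. pact (l s) (w' s))) = zN" unfolding e[symmetric]
        by (rule graded[OF fs.subspace_diff[OF subspace_Ftot frF[OF v(1)] sum_pact_Ftot[of "{1..Suc j}" w l, OF w(1)]] w(2)])
      define u where "u = v - pact (l (Suc j)) (w' (Suc j))"
      have "pact (l (Suc j)) (w' (Suc j)) : fr a t" by (rule lfr[OF w'f]) simp
      then have uf: "u : fr a t" unfolding u_def by (rule fs.subspace_diff[OF gsub_subspace[OF gsub_fr] v(1)])
      have "u - (\<Sum>s\<in>{1..j}. pact (l s) (w' s)) = v - (\<Sum>s\<in>{1..Suc j}. pact (l s) (w' s))"
        unfolding S u_def by (simp add: algebra_simps)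
      then have "E (u - (\<Sum>s\<in>{1..j}. pact (l s) (w' s))) = zN" using z by (simp only:)
      then have "u : Wseq l j" by (intro WseqI[of _ _ w'] frF[OF uf] frF[OF w'f]) simp_all
      moreover have "v = pact (l (Suc j)) (w' (Suc j)) + u" by (simp add: u_def)
      ultimately show "v : sadd (pact (l (Suc j)) ` fr a (t - 1)) {v \<in> fr a t. v : Wseq l j}"
        using uf w'f[of "Suc j"] by (simp only:) (intro saddI imageI CollectI conjI, auto)
    qed
  qed
  finally show ?case by simp
qed

end

subsection \<open>Filter regularity\<close>

lemma freg_append: "freg a (ls @ [fv]) U \<longleftrightarrow> freg a ls U & lin1 fv & freg1 a fv (hseq a ls U)"
  by (induction ls arbitrary: U) auto

context pres
begin

lemma E_zero_diff: "v : Ftot a ==> w : Ftot a ==> E v = E w ==> E (proj a t v) = E (proj a t w)"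
proof -
  assume F: "v : Ftot a" "w : Ftot a" and e: "E v = E w"
  have "E (proj a t (v - w)) = zN"
    by (rule graded[OF fs.subspace_diff[OF subspace_Ftot F]]) (use e eq_iff[OF F] in simp)
  then show ?thesis unfolding flin_diff[OF flin_proj] using eq_iff[OF frF[OF proj_fr[OF F(1)]] frF[OF proj_fr[OF F(2)]]] by blast
qed

text \<open>A non-torsion element of the kernel has nonzero multiples in arbitrarily high degrees,
  all in the kernel. Cutting the kernel off below increasing degrees then gives strict chains of
  submodules of every length.\<close>

lemma freg1_of_finite_length:
  assumes fl: "finite_length (sub_gmodule N {x \<in> carrier N. r \<odot>\<^bsub>N\<^esub> x = zN})"
  shows "freg1 a (pact r) ker"
proof (rule ccontr)
  define S where "S = sub_gmodule N {x \<in> carrier N. r \<odot>\<^bsub>N\<^esub> x = zN}"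
  define Z where "Z = {w \<in> Ftot a. E (pact r w) = zN}"
  assume "\<not> freg1 a (pact r) ker"
  then obtain t v where v: "v : fr a t" "pact r v : ker (t + 1)" "v ~: sat a ker t" unfolding freg1_def by blast
  have ZF: "w : Ftot a" if "w : Z" for w using that by (simp add: Z_def)
  have Zpact: "pact p w : Z" if "w : Z" for p w
  proof -
    have w: "w : Ftot a" "E (pact r w) = zN" using that by (simp_all add: Z_def)
    have "E (pact r (pact p w)) = zN"
      unfolding pact_commute[of r p w] by (rule E_zero_pact[OF pact_Ftot[OF w(1)] w(2)])
    then show ?thesis using pact_Ftot[OF w(1)] by (simp add: Z_def)
  qed
  interpret Z: lin_image Z S E
  proof
    show "fs.subspace Z"
    proof (rule fs.subspaceI)
      show "0 : Z" by (simp add: Z_def fs.subspace_0[OF subspace_Ftot] flin_0[OF flin_pact] hzero)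
      show "scl c w : Z" if "w : Z" for c w unfolding scl_pact by (rule Zpact[OF that])
      show "x + y : Z" if "x : Z" "y : Z" for x y
      proof -
        have z: "E (pact r x) = zN" "E (pact r y) = zN" using that by (simp_all add: Z_def)
        have "E (pact r (x + y)) = zN"
          unfolding flin_add[OF flin_pact] E_zero_add[OF pact_Ftot[OF ZF[OF that(1)]] pact_Ftot[OF ZF[OF that(2)]] z(1)] by (rule z(2))
        then show ?thesis using fs.subspace_add[OF subspace_Ftot ZF[OF that(1)] ZF[OF that(2)]] by (simp add: Z_def)
      qed
    qed
    show "E ` Z = carrier S"
    proof
      show "E ` Z <= carrier S" using hsmult by (auto simp: Z_def S_def sub_gmodule_def)
      show "carrier S <= E ` Z"
      proof
        fix x assume "x : carrier S"
        then have x: "x : carrier N" "r \<odot>\<^bsub>N\<^esub> x = zN" by (simp_all add: S_def sub_gmodule_def)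
        obtain w where w: "w : Ftot a" "x = E w" using x(1) by (rule obtain_pre)
        have "w : Z" using w x(2) hsmult by (simp add: Z_def)
        then show "x : E ` Z" using w(2) by blast
      qed
    qed
    show "E (x + y) = E x \<oplus>\<^bsub>S\<^esub> E y" if "x : Z" "y : Z" for x y
      using hadd[OF ZF ZF] that by (simp add: S_def sub_gmodule_def)
    show "E 0 = \<zero>\<^bsub>S\<^esub>" by (simp add: S_def sub_gmodule_def hzero)
  qed
  \<comment> \<open>The elements of the kernel without components in degrees below \<open>s\<close>;
    they form a submodule because the ring lives in nonnegative degrees.\<close>
  define H where "H s = {w \<in> Z. \<forall>u<s. E (proj a u w) = zN}" for s
  have HZ: "w : Z" if "w : H s" for w s using that by (simp add: H_def)
  have Hpact: "pact p w : H s" if w: "w : H s" for p w s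
  proof -
    have "E (proj a u (pact p w)) = zN" if u: "u < s" for u
    proof -
      have "proj a u (pact p w) : {v \<in> Ftot a. E v = zN}"
        unfolding pact_def flin_sum[OF flin_proj] flin_scl[OF flin_proj]
      proof (intro fs.subspace_sum[OF subspace_kernel] fs.subspace_scale[OF subspace_kernel])
        fix m :: "'n \<Rightarrow>\<^sub>0 nat"
        have "u - edeg (iexp m) < s" using u edeg_nonneg[OF iexp_nonneg, of m] by simp
        then have "E (proj a (u - edeg (iexp m)) w) = zN" using w unfolding H_def by blast
        then have "sh (iexp m) (proj a (u - edeg (iexp m)) w) : {v \<in> Ftot a. E v = zN}"
          using E_zero_sh[OF frF[OF proj_fr[OF ZF[OF HZ[OF w]]]] _ iexp_nonneg]
            sh_Ftot[OF iexp_nonneg frF[OF proj_fr[OF ZF[OF HZ[OF w]]]]] by blast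
        then show "proj a u (sh (iexp m) w) : {v \<in> Ftot a. E v = zN}"
          using proj_sh[of a "u - edeg (iexp m)" "iexp m" w] by simp
      qed
      then show ?thesis by blast
    qed
    then show ?thesis using Zpact[OF HZ[OF w]] unfolding H_def by blast
  qed
  have Hadd: "x + y : H s" if x: "x : H s" and y: "y : H s" for x y s
  proof -
    have "E (proj a u (x + y)) = zN" if u: "u < s" for u
    proof -
      have "E (proj a u x) = zN" "E (proj a u y) = zN" using x y u unfolding H_def by blast+
      then show ?thesis unfolding flin_add[OF flin_proj]
        using E_zero_add[OF frF[OF proj_fr[OF ZF[OF HZ[OF x]]]] frF[OF proj_fr[OF ZF[OF HZ[OF y]]]]] by simp
    qed
    then show ?thesis using fs.subspace_add[OF Z.Zs HZ[OF x] HZ[OF y]] unfolding H_def by blast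
  qed
  have H0: "0 : H s" for s by (simp add: H_def fs.subspace_0[OF Z.Zs] flin_0[OF flin_proj] hzero)
  have submod: "Module.submodule (E ` H s) class_ring S" for s
  proof (rule Module.submodule.intro)
    show "subgroup (E ` H s) (add_monoid S)"
    proof (rule subgroup.intro)
      show "E ` H s <= carrier (add_monoid S)" using HZ Z.closed by auto
      show "\<one>\<^bsub>add_monoid S\<^esub> : E ` H s" using imageI[OF H0[of s], of E] Z.hzero by simp
      show "x \<otimes>\<^bsub>add_monoid S\<^esub> y : E ` H s" if "x : E ` H s" "y : E ` H s" for x y
      proof -
        obtain p q where pq: "p : H s" "q : H s" "x = E p" "y = E q" using \<open>x : E ` H s\<close> \<open>y : E ` H s\<close> by blast
        have "x \<otimes>\<^bsub>add_monoid S\<^esub> y = E (p + q)" using Z.hadd[OF HZ[OF pq(1)] HZ[OF pq(2)]] pq by simp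
        then show ?thesis using Hadd[OF pq(1,2)] by blast
      qed
      show "inv\<^bsub>add_monoid S\<^esub> x : E ` H s" if x: "x : E ` H s" for x
      proof -
        obtain p where p: "p : H s" "x = E p" using x by blast
        have "inv\<^bsub>add_monoid S\<^esub> x = E (- p)" using Z.huminus[OF HZ[OF p(1)]] p by (simp add: a_inv_def)
        moreover have "- p = pact (single 0 (- 1)) p" unfolding scl_pact[symmetric] by (simp add: fun_eq_iff)
        ultimately show ?thesis using imageI[OF Hpact[OF p(1), of "single 0 (- 1)"], of E] by simp
      qed
    qed
    show "Module.submodule_axioms (E ` H s) class_ring S"
    proof
      fix p x assume "x : E ` H s"
      then obtain w where w: "w : H s" "x = E w" by blast
      have "p \<odot>\<^bsub>S\<^esub> x = E (pact p w)" using hsmult[OF ZF[OF HZ[OF w(1)]]] w(2) by (simp add: S_def sub_gmodule_def)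
      then show "p \<odot>\<^bsub>S\<^esub> x : E ` H s" using Hpact[OF w(1)] by simp
    qed
  qed
  have strict: "E ` H s' \<subset> E ` H s"
    if s: "s < s'" and w: "w : fr a s" "E (pact r w) = zN" "E w ~= zN" for s s' w
  proof
    show "E ` H s' <= E ` H s" using s by (auto simp: H_def)
    have "w : H s" using w(2) frF[OF w(1)] proj_of_fr[OF w(1)] by (simp add: H_def Z_def hzero)
    moreover have "E w ~: E ` H s'"
    proof
      assume "E w : E ` H s'"
      then obtain w' where w': "w' : H s'" "E w = E w'" by blast
      have "E (proj a s w) = E (proj a s w')" by (rule E_zero_diff[OF frF[OF w(1)] ZF[OF HZ[OF w'(1)]] w'(2)])
      also have "\<dots> = zN" using w'(1) s unfolding H_def by blast
      finally show False using w(3) proj_of_fr[OF w(1), of s] by simp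
    qed
    ultimately show "E ` H s' ~= E ` H s" by blast
  qed
  define P where "P s \<longleftrightarrow> (\<exists>w. w : fr a s & E (pact r w) = zN & E w ~= zN)" for s
  \<comment> \<open>Failure of saturation provides monomials of arbitrarily large degree that do not
    kill \<open>v\<close>.\<close>
  have unb: "\<exists>s'. s' > s & P s'" for s
  proof -
    have "\<exists>bv. 0 <= bv & s - t + 1 <= edeg bv & sh bv v ~: ker (t + edeg bv)"
      using v(3) satI[OF v(1), of "s - t + 1" ker] by blast
    then obtain bv where b: "0 <= bv" "s - t + 1 <= edeg bv" "sh bv v ~: ker (t + edeg bv)" by blast
    have f: "sh bv v : fr a (t + edeg bv)" by (rule gsub_sh[OF gsub_fr b(1) v(1)])
    have "E (pact r (sh bv v)) = zN"
      unfolding eqv_sh[OF eqv_pact] by (rule E_zero_sh[OF pact_Ftot[OF frF[OF v(1)]] _ b(1)]) (use v(2) in \<open>simp add: ker_def\<close>)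
    then have "P (t + edeg bv)" unfolding P_def using f b(3) unfolding ker_def by blast
    then show ?thesis using b(2) by (intro exI[of _ "t + edeg bv"]) simp
  qed
  have "\<exists>f. \<forall>n. P (f n) & f n < f (Suc n)" by (rule dependent_nat_choice) (use unb in auto)
  then obtain f :: "nat => int" where f: "!!n. P (f n)" "!!n. f n < f (Suc n)" by blast
  \<comment> \<open>Higher cut-offs give smaller submodules, hence the reversed index
    \<open>R - i\<close> for an increasing chain.\<close>
  have chain: "\<exists>L. (\<forall>i\<le>R. Module.submodule (L i) class_ring S) & (\<forall>i<R. L i \<subset> L (Suc i))" for R
  proof (intro exI[of _ "%i. E ` H (f (R - i))"] conjI allI impI submod)
    fix i assume i: "i < R"
    then have "R - i = Suc (R - Suc i)" by simp
    then have "f (R - Suc i) < f (R - i)" using f(2)[of "R - Suc i"] by simp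
    moreover obtain w where "w : fr a (f (R - Suc i))" "E (pact r w) = zN" "E w ~= zN"
      using f(1)[of "R - Suc i"] unfolding P_def by blast
    ultimately show "E ` H (f (R - i)) \<subset> E ` H (f (R - Suc i))" by (rule strict)
  qed
  let ?A = "{int R | R. \<exists>L. (\<forall>i\<le>R. Module.submodule (L i) (class_ring :: ('n, 'k) mpolynomial ring) S) & (\<forall>i<R. L i \<subset> L (Suc i))}"
  have A: "int R : ?A" for R by (intro CollectI exI[of _ R] conjI refl chain)
  have "\<not> bdd_above ?A"
  proof
    assume "bdd_above ?A"
    then obtain B where B: "\<forall>x\<in>?A. x <= B" unfolding bdd_above_def by (rule exE)
    have "int (nat (B + 1)) <= B" by (rule bspec[OF B A])
    then show False by linarith
  qed
  moreover have "?A ~= {}" using A[of 0] by blast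
  ultimately have "module_length S = Pinf" unfolding module_length_def ext_Sup_def by simp
  then show False using fl unfolding finite_length_def S_def[symmetric] by simp
qed

lemma seq_pres:
  assumes l: "!!s. s : {1..j} ==> l s : homogeneous_part 1"
  shows "\<exists>Q. pres a (quot_by_seq N l j) Q & pres.ker a (quot_by_seq N l j) Q = hseq a (map (%s. pact (l s)) [1..<Suc j]) ker"
proof -
  interpret S: pres_sub a N E "Wseq l j" by (rule pres_sub_Wseq[OF l])
  have p: "pres a (quot_by_seq N l j) S.Q" unfolding quot_by_seq_eq by (rule S.pres_quot)
  have "pres.ker a (quot_by_seq N l j) S.Q t = hseq a (map (%s. pact (l s)) [1..<Suc j]) ker t" for t
  proof -
    have "pres.ker a (quot_by_seq N l j) S.Q t = {v \<in> fr a t. S.Q v = \<zero>\<^bsub>quot_by_seq N l j\<^esub>}"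
      by (rule pres.ker_def[OF p])
    also have "\<dots> = {v \<in> fr a t. v : Wseq l j}" unfolding quot_by_seq_eq using S.quot_zero_iff[OF frF] by blast
    also have "\<dots> = hseq a (map (%s. pact (l s)) [1..<Suc j]) ker t" by (rule Wseq_fr) (rule l)
    finally show ?thesis .
  qed
  then show ?thesis using p by blast
qed

lemma freg_of_filter_regular:
  assumes l: "!!s. s : {1..d} ==> l s : homogeneous_part 1" and fr: "filter_regular N l d" and j: "j <= d"
  shows "freg a (map (%s. pact (l s)) [1..<Suc j]) ker" using j
proof (induction j)
  case 0
  show ?case by simp
next
  case (Suc j)
  have "\<exists>Q. pres a (quot_by_seq N l j) Q & pres.ker a (quot_by_seq N l j) Q = hseq a (map (%s. pact (l s)) [1..<Suc j]) ker"
    by (rule seq_pres) (use l Suc.prems in auto)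
  then obtain Q where Q: "pres a (quot_by_seq N l j) Q"
    "pres.ker a (quot_by_seq N l j) Q = hseq a (map (%s. pact (l s)) [1..<Suc j]) ker" by blast
  have "freg1 a (pact (l (Suc j))) (pres.ker a (quot_by_seq N l j) Q)" by (rule pres.freg1_of_finite_length[OF Q(1)])
      (use fr Suc.prems in \<open>auto simp: filter_regular_def Let_def dest!: bspec[of _ _ "Suc j"]\<close>)
  moreover have "map (%s. pact (l s)) [1..<Suc (Suc j)] = map (%s. pact (l s)) [1..<Suc j] @ [pact (l (Suc j))]" by simp
  moreover have "lin1 (pact (l (Suc j)))" using l Suc.prems by (intro lin1_pact) simp
  ultimately show ?case using Suc by (simp only: freg_append Q(2))
qed

end

subsection \<open>The Cech complex of a presentation\<close>

text \<open>The exponent of the \<open>k\<close>-th power of \<open>var_prod S\<close>.\<close>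

definition ones :: "'n set => nat => 'n => int" where
  "ones S k = (%i. if i : S then int k else 0)"

lemma ones_nonneg: "0 <= ones S k" by (auto simp: ones_def le_fun_def)

lemma ones_add: "ones S (k + l) = ones S k + ones S l" by (auto simp: ones_def fun_eq_iff)

lemma ones_0 [simp]: "ones S 0 = 0" by (auto simp: ones_def fun_eq_iff)

lemma edeg_ones [simp]: "edeg (ones (S :: 'n::finite set) k) = int (k * card S)"
proof -
  have "edeg (ones S k) = (\<Sum>i\<in>S. int k)" unfolding edeg_def ones_def by (simp add: sum.If_cases)
  then show ?thesis by (simp add: mult.commute)
qed

lemma ones_insert: "i ~: S ==> ones (insert i S) k = ones {i} k + ones S k" by (auto simp: ones_def fun_eq_iff)

lemma le_ones:
  fixes bv :: "'n::finite => int"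
  assumes "0 <= bv" "!!i. i ~: S ==> bv i = 0"
  shows "\<exists>k. 0 <= ones S k - bv"
proof (intro exI)
  have "bv i <= edeg bv" for i unfolding edeg_def by (rule member_le_sum) (use assms(1) in \<open>auto simp: le_fun_def\<close>)
  then show "0 <= ones S (nat (edeg bv)) - bv" using assms edeg_nonneg[OF assms(1)] by (auto simp: le_fun_def ones_def)
qed

lemma pact_pvar: "pact (pvar i) v = sh (ones {i} 1) v"
proof -
  have "iexp (single i 1) = ones {i} 1" by (auto simp: iexp_def ones_def fun_eq_iff lookup_single when_def)
  then show ?thesis unfolding pvar_def pact_single by simp
qed

lemma pact_var_prod_1:
  fixes S :: "'n::finite set"
  shows "pact (var_prod S) v = sh (ones S 1) v"
proof -
  have "finite S" by simp
  then have "pact (\<Prod>i\<in>S. pvar i) v = sh (ones S 1) v"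
  proof (induction S rule: finite_induct)
    case empty
    have e: "ones {} 1 = (0 :: 'n => int)" by (auto simp: ones_def fun_eq_iff)
    show ?case unfolding e prod.empty pact_one sh_0 ..
  next
    case (insert i S)
    then show ?case by (simp only: prod.insert pact_mult pact_pvar sh_sh ones_insert not_False_eq_True)
  qed
  then show ?thesis by (simp add: var_prod_def)
qed

lemma pact_var_prod: "pact (var_prod S ^ k) v = sh (ones S k) v"
proof (induction k)
  case (Suc k)
  show ?case unfolding power_Suc pact_mult Suc pact_var_prod_1 sh_sh ones_add[symmetric] plus_1_eq_Suc ..
next
  case 0
  show ?case unfolding power_0 pact_one ones_0 sh_0 ..
qed

lemma pact_pvar_power: "pact (pvar i ^ k) v = sh (ones {i} k) v" using pact_var_prod[of "{i}" k v] by (simp add: var_prod_def)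

text \<open>\<open>loc\<close> admits every monomial in the variables of \<open>S\<close> as
  denominator, the Cech complex only powers of their product; by \<open>le_ones\<close> these powers
  are cofinal.\<close>

lemma loc_ones_iff:
  assumes V: "gsub V"
  shows "v : loc V S t \<longleftrightarrow> (\<exists>k. sh (ones S k) v : V (t + int (k * card S)))"
proof
  assume "v : loc V S t"
  then obtain bv where b: "0 <= bv" "\<forall>i. i ~: S --> bv i = 0" "sh bv v : V (t + edeg bv)" unfolding loc_def by blast
  obtain k where k: "0 <= ones S k - bv" using le_ones[OF b(1)] b(2) by blast
  have "sh (ones S k - bv + bv) v : V (t + edeg (ones S k - bv + bv))" by (rule loc_shift_more[OF V k b(3)])
  then have "sh (ones S k) v : V (t + int (k * card S))" by simp
  then show "\<exists>k. sh (ones S k) v : V (t + int (k * card S))" ..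
next
  assume "\<exists>k. sh (ones S k) v : V (t + int (k * card S))"
  then obtain k where "sh (ones S k) v : V (t + int (k * card S))" ..
  then have "sh (ones S k) v : V (t + edeg (ones S k))" by simp
  then show "v : loc V S t" by (intro locI[of "ones S k"] ones_nonneg) (simp_all add: ones_def)
qed

text \<open>The ungraded counterpart of \<open>loc\<close>.\<close>

definition lt :: "('n::finite, 'k::field) lvec set => 'n set => ('n, 'k) lvec set" where
  "lt X S = {u. \<exists>k. sh (ones S k) u : X}"

lemma ltI: "sh (ones S k) u : X ==> u : lt X S" unfolding lt_def by blast

lemma lt_sh: "w : X ==> sh (- ones S k) w : lt X S" by (rule ltI[of S k]) simp

definition stable :: "('n::finite, 'k::field) lvec set => bool" where
  "stable X \<longleftrightarrow> fs.subspace X & (\<forall>bv v. 0 <= bv --> v : X --> sh bv v : X)"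

context
  fixes X :: "('n::finite, 'k::field) lvec set"
  assumes st: "stable X"
begin

lemma stable_subspace: "fs.subspace X" and stable_sh: "0 <= bv ==> v : X ==> sh bv v : X" using st unfolding stable_def by blast+

lemmas X = stable_subspace and Xsh = stable_sh

lemma stable_pact: "v : X ==> pact r v : X"
  unfolding pact_def by (intro fs.subspace_sum[OF X] fs.subspace_scale[OF X] Xsh iexp_nonneg)

lemma lt_pact: "u : lt X S ==> pact r u : lt X S"
  unfolding lt_def mem_Collect_eq eqv_sh[OF eqv_pact, symmetric] using stable_pact by blast

lemma lt_more: "sh (ones S k) u : X ==> sh (ones S (k + l)) u : X"
  using Xsh[OF ones_nonneg, of "sh (ones S k) u" S l] by (simp add: sh_sh ones_add add.commute)

lemma subspace_lt: "fs.subspace (lt X S)"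
proof (rule fs.subspaceI)
  show "0 : lt X S" by (rule ltI[of S 0]) (simp add: fs.subspace_0[OF X])
  show "scl c u : lt X S" if "u : lt X S" for c u
    using that fs.subspace_scale[OF X] unfolding lt_def mem_Collect_eq sh_scl by blast
  fix u v assume "u : lt X S" "v : lt X S"
  then obtain k l where "sh (ones S k) u : X" "sh (ones S l) v : X" unfolding lt_def by blast
  then have "sh (ones S (k + l)) u : X" "sh (ones S (k + l)) v : X"
    using lt_more[of S k u l] lt_more[of S l v k] by (simp_all add: add.commute)
  then show "u + v : lt X S" by (intro ltI[of S "k + l"]) (simp only: sh_add fs.subspace_add[OF X])
qed

lemma lt_mono:
  assumes "S <= S'" "u : lt X S"
  shows "u : lt X S'"
proof -
  obtain k where k: "sh (ones S k) u : X" using assms(2) unfolding lt_def by blast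
  have "ones (S' - S) k + ones S k = ones S' k" using assms(1) by (auto simp: ones_def fun_eq_iff)
  then have "sh (ones S' k) u : X" using Xsh[OF ones_nonneg k, of "S' - S" k] by (simp add: sh_sh)
  then show ?thesis by (rule ltI)
qed

end

lemma stable_Ftot: "stable (Ftot a)" unfolding stable_def using subspace_Ftot sh_Ftot by blast

context pres
begin

definition XK :: "('n, 'k) lvec set" where
  "XK = {v \<in> Ftot a. E v = zN}"

lemma stable_XK: "stable XK" unfolding stable_def XK_def using subspace_kernel sh_Ftot E_zero_sh by blast

lemmas subspace_ltF = subspace_lt[OF stable_Ftot, of a]
  and subspace_ltK = subspace_lt[OF stable_XK]

lemma lt_XK_F: "u : lt XK S ==> u : lt (Ftot a) S" unfolding lt_def XK_def by blast

text \<open>The equivalence class of all fractions representing \<open>u\<close>; division by a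
  power of \<open>var_prod S\<close> is the inverse shift.\<close>

definition phi :: "'n set => ('n, 'k) lvec => ('m \<times> nat) set" where
  "phi S u = {(E w, b) | w b. w : Ftot a & u - sh (- ones S b) w : lt XK S}"

lemma phi_iff: "(x, b) : phi S u \<longleftrightarrow> (\<exists>w. x = E w & w : Ftot a & u - sh (- ones S b) w : lt XK S)"
  unfolding phi_def by blast

text \<open>Multiplying the difference of the two fractions by the power \<open>c + b + k\<close>
  clears both denominators.\<close>

lemma fraction_eq_iff:
  assumes w: "w : Ftot a" "w' : Ftot a"
  shows "(\<exists>c. E (sh (ones S (c + b)) w) = E (sh (ones S (c + k)) w')) \<longleftrightarrow>
    sh (- ones S k) w - sh (- ones S b) w' : lt XK S"
proof -
  let ?d = "sh (- ones S k) w - sh (- ones S b) w'"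
  have d: "sh (ones S (c + b + k)) ?d = sh (ones S (c + b)) w - sh (ones S (c + k)) w'" for c
  proof -
    have "ones S (c + b + k) + - ones S k = ones S (c + b)" "ones S (c + b + k) + - ones S b = ones S (c + k)"
      by (simp_all add: ones_def fun_eq_iff)
    then show ?thesis unfolding sh_diff sh_sh by (simp only:)
  qed
  have F: "sh (ones S l) w : Ftot a" "sh (ones S l) w' : Ftot a" for l using w by (auto intro: sh_Ftot ones_nonneg)
  have iff: "E (sh (ones S (c + b)) w) = E (sh (ones S (c + k)) w') \<longleftrightarrow> sh (ones S (c + b + k)) ?d : XK" for c
    unfolding d XK_def using eq_iff[OF F(1) F(2), of "c + b" "c + k"] fs.subspace_diff[OF subspace_Ftot F(1) F(2)] by simp
  show ?thesis
  proof
    assume "\<exists>c. E (sh (ones S (c + b)) w) = E (sh (ones S (c + k)) w')"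
    then show "?d : lt XK S" unfolding iff using ltI by blast
  next
    assume "?d : lt XK S"
    then obtain c where "sh (ones S c) ?d : XK" unfolding lt_def by blast
    then have "sh (ones S (c + b + k)) ?d : XK" using lt_more[OF stable_XK, of S c ?d "b + k"] by (simp add: add.assoc)
    then show "\<exists>c. E (sh (ones S (c + b)) w) = E (sh (ones S (c + k)) w')" unfolding iff by blast
  qed
qed

lemma loc_frac_eq:
  assumes w: "w : Ftot a"
  shows "loc_frac N (var_prod S) (E w) k = phi S (sh (- ones S k) w)"
proof -
  have s: "var_prod S ^ l \<odot>\<^bsub>N\<^esub> E v = E (sh (ones S l) v)" if "v : Ftot a" for l v
    using hsmult[OF that, of "var_prod S ^ l"] by (simp add: pact_var_prod)
  have "(y, b) : loc_frac N (var_prod S) (E w) k \<longleftrightarrow> (y, b) : phi S (sh (- ones S k) w)" for y b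
  proof -
    have "(y, b) : loc_frac N (var_prod S) (E w) k \<longleftrightarrow>
        y : carrier N & (\<exists>c. var_prod S ^ (c + b) \<odot>\<^bsub>N\<^esub> E w = var_prod S ^ (c + k) \<odot>\<^bsub>N\<^esub> y)"
      unfolding loc_frac_def loc_rel_def using closed[OF w] by auto
    also have "\<dots> \<longleftrightarrow> (\<exists>w'\<in>Ftot a. y = E w' & (\<exists>c. var_prod S ^ (c + b) \<odot>\<^bsub>N\<^esub> E w = var_prod S ^ (c + k) \<odot>\<^bsub>N\<^esub> E w'))"
      unfolding img[symmetric] by blast
    also have "\<dots> \<longleftrightarrow> (\<exists>w'\<in>Ftot a. y = E w' & (\<exists>c. E (sh (ones S (c + b)) w) = E (sh (ones S (c + k)) w')))"
      by (intro bex_cong refl conj_cong) (simp only: s[OF w] s)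
    also have "\<dots> \<longleftrightarrow> (\<exists>w'\<in>Ftot a. y = E w' & sh (- ones S k) w - sh (- ones S b) w' : lt XK S)"
      using fraction_eq_iff[OF w] by blast
    also have "\<dots> \<longleftrightarrow> (y, b) : phi S (sh (- ones S k) w)" unfolding phi_def by blast
    finally show ?thesis .
  qed
  then show ?thesis by auto
qed

lemma lt_F_obtain:
  assumes "u : lt (Ftot a) S"
  obtains w k where "w : Ftot a" "u = sh (- ones S k) w"
proof -
  obtain k where "sh (ones S k) u : Ftot a" using assms unfolding lt_def by blast
  then show thesis by (intro that[of "sh (ones S k) u" k]) simp_all
qed

lemma phi_eq_iff:
  assumes u: "u : lt (Ftot a) S" "u' : lt (Ftot a) S"
  shows "phi S u = phi S u' \<longleftrightarrow> u - u' : lt XK S"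
proof
  assume e: "phi S u = phi S u'"
  obtain w' b where w': "w' : Ftot a" "u' = sh (- ones S b) w'" using u(2) by (rule lt_F_obtain)
  have "(E w', b) : phi S u'" unfolding phi_def using w' fs.subspace_0[OF subspace_ltK] by auto
  then obtain w where w: "E w' = E w" "w : Ftot a" "u - sh (- ones S b) w : lt XK S" unfolding e[symmetric] phi_iff by blast
  have "w - w' : XK" using w w'(1) eq_iff[OF w(2) w'(1)] fs.subspace_diff[OF subspace_Ftot w(2) w'(1)] by (simp add: XK_def)
  then have "sh (- ones S b) (w - w') : lt XK S" by (rule lt_sh)
  then have "(u - sh (- ones S b) w) + sh (- ones S b) (w - w') : lt XK S" by (rule fs.subspace_add[OF subspace_ltK w(3)])
  then show "u - u' : lt XK S" by (simp add: sh_diff w'(2))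
next
  assume d: "u - u' : lt XK S"
  have "phi S u <= phi S u'" if "u' - u : lt XK S" for u u'
  proof
    fix x assume "x : phi S u"
    then obtain w b where x: "x = (E w, b)" "w : Ftot a" "u - sh (- ones S b) w : lt XK S" unfolding phi_def by blast
    have "(u' - u) + (u - sh (- ones S b) w) : lt XK S" by (rule fs.subspace_add[OF subspace_ltK that x(3)])
    then show "x : phi S u'" unfolding phi_def using x(1,2) by auto
  qed
  moreover have "u' - u : lt XK S" using fs.subspace_neg[OF subspace_ltK d] by simp
  ultimately show "phi S u = phi S u'" using d by blast
qed

text \<open>The operations of \<open>localization\<close> are unions over all representatives; when
  every representative yields the same class, the union is that class.\<close>

lemma phi_UN:
  assumes u: "u : lt (Ftot a) S"
    and g: "!!w k. w : Ftot a ==> u - sh (- ones S k) w : lt XK S ==> g (E w) k = A"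
  shows "(\<Union>(x, k)\<in>phi S u. g x k) = A"
proof -
  obtain w b where w: "w : Ftot a" "u = sh (- ones S b) w" using u by (rule lt_F_obtain)
  have "(E w, b) : phi S u" unfolding phi_def using w fs.subspace_0[OF subspace_ltK] by auto
  moreover have "g x k = A" if "(x, k) : phi S u" for x k using that g unfolding phi_def by blast
  ultimately show ?thesis by auto
qed

lemma lin_image_localization: "lin_image (lt (Ftot a) S) (var_localization N S) (phi S)"
proof (rule lin_image.intro)
  show "fs.subspace (lt (Ftot a) S)" by (rule subspace_ltF)
  have C: "carrier (var_localization N S) = {loc_frac N (var_prod S) x k | x k. x : carrier N}"
    by (simp add: var_localization_def localization_def)
  show "phi S ` lt (Ftot a) S = carrier (var_localization N S)"
  proof
    show "phi S ` lt (Ftot a) S <= carrier (var_localization N S)"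
    proof
      fix y assume "y : phi S ` lt (Ftot a) S"
      then obtain u where u: "u : lt (Ftot a) S" "y = phi S u" by blast
      obtain w b where w: "w : Ftot a" "u = sh (- ones S b) w" using u(1) by (rule lt_F_obtain)
      have "y = loc_frac N (var_prod S) (E w) b" unfolding loc_frac_eq[OF w(1)] u(2) w(2) ..
      then show "y : carrier (var_localization N S)" unfolding C using closed[OF w(1)] by blast
    qed
    show "carrier (var_localization N S) <= phi S ` lt (Ftot a) S"
    proof
      fix y assume "y : carrier (var_localization N S)"
      then obtain x b where x: "x : carrier N" "y = loc_frac N (var_prod S) x b" unfolding C by blast
      obtain w where w: "w : Ftot a" "x = E w" using x(1) by (rule obtain_pre)
      have "y = phi S (sh (- ones S b) w)" unfolding x(2) w(2) by (rule loc_frac_eq[OF w(1)])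
      then show "y : phi S ` lt (Ftot a) S" using lt_sh[OF w(1)] by blast
    qed
  qed
  show "phi S 0 = \<zero>\<^bsub>var_localization N S\<^esub>"
  proof -
    have "\<zero>\<^bsub>var_localization N S\<^esub> = loc_frac N (var_prod S) (E 0) 0" by (simp add: var_localization_def localization_def hzero)
    then show ?thesis unfolding loc_frac_eq[OF fs.subspace_0[OF subspace_Ftot]] sh_zero by (rule sym)
  qed
  fix u v :: "('n, 'k) lvec" assume u: "u : lt (Ftot a) S" and v: "v : lt (Ftot a) S"
  let ?f = "var_prod S"
  have "phi S u \<oplus>\<^bsub>var_localization N S\<^esub> phi S v = (\<Union>(x, k)\<in>phi S u. \<Union>(y, l)\<in>phi S v.
      loc_frac N ?f (?f ^ l \<odot>\<^bsub>N\<^esub> x \<oplus>\<^bsub>N\<^esub> ?f ^ k \<odot>\<^bsub>N\<^esub> y) (k + l))"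
    by (simp add: var_localization_def localization_def)
  also have "\<dots> = phi S (u + v)"
  proof (rule phi_UN[OF u], rule phi_UN[OF v])
    fix w k w' l assume w: "w : Ftot a" "u - sh (- ones S k) w : lt XK S" and w': "w' : Ftot a" "v - sh (- ones S l) w' : lt XK S"
    let ?x = "sh (ones S l) w" and ?y = "sh (ones S k) w'"
    have F: "?x : Ftot a" "?y : Ftot a" by (rule sh_Ftot[OF ones_nonneg w(1)], rule sh_Ftot[OF ones_nonneg w'(1)])
    have "?f ^ l \<odot>\<^bsub>N\<^esub> E w \<oplus>\<^bsub>N\<^esub> ?f ^ k \<odot>\<^bsub>N\<^esub> E w' = E (?x + ?y)"
      unfolding hsmult[OF w(1), symmetric] hsmult[OF w'(1), symmetric] pact_var_prod hadd[OF F] ..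
    then have A: "loc_frac N ?f (?f ^ l \<odot>\<^bsub>N\<^esub> E w \<oplus>\<^bsub>N\<^esub> ?f ^ k \<odot>\<^bsub>N\<^esub> E w') (k + l) = phi S (sh (- ones S (k + l)) (?x + ?y))"
      using loc_frac_eq[OF fs.subspace_add[OF subspace_Ftot F], of S "k + l"] by (simp only:)
    have B: "sh (- ones S (k + l)) (?x + ?y) = sh (- ones S k) w + sh (- ones S l) w'"
    proof -
      have "- ones S (k + l) + ones S l = - ones S k" "- ones S (k + l) + ones S k = - ones S l"
        by (simp_all add: ones_def fun_eq_iff)
      then show ?thesis unfolding sh_add sh_sh by (simp only:)
    qed
    have "phi S (sh (- ones S k) w + sh (- ones S l) w') = phi S (u + v)"
    proof -
      have d: "(u + v) - (sh (- ones S k) w + sh (- ones S l) w') : lt XK S"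
        by (subst add_diff_add) (rule fs.subspace_add[OF subspace_ltK w(2) w'(2)])
      show ?thesis by (rule sym, rule iffD2[OF phi_eq_iff d])
          (rule fs.subspace_add[OF subspace_ltF u v], rule fs.subspace_add[OF subspace_ltF lt_sh[OF w(1)] lt_sh[OF w'(1)]])
    qed
    then show "loc_frac N ?f (?f ^ l \<odot>\<^bsub>N\<^esub> E w \<oplus>\<^bsub>N\<^esub> ?f ^ k \<odot>\<^bsub>N\<^esub> E w') (k + l) = phi S (u + v)" unfolding A B .
  qed
  finally show "phi S (u + v) = phi S u \<oplus>\<^bsub>var_localization N S\<^esub> phi S v" by simp
qed

lemma phi_zero_iff: "u : lt (Ftot a) S ==> phi S u = \<zero>\<^bsub>var_localization N S\<^esub> \<longleftrightarrow> u : lt XK S"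
  using phi_eq_iff[OF _ fs.subspace_0[OF subspace_ltF], of u S] lin_image.hzero[OF lin_image_localization, of S] by simp

lemma phi_smult:
  assumes u: "u : lt (Ftot a) S"
  shows "r \<odot>\<^bsub>var_localization N S\<^esub> phi S u = phi S (pact r u)"
proof -
  have "r \<odot>\<^bsub>var_localization N S\<^esub> phi S u = (\<Union>(x, k)\<in>phi S u. loc_frac N (var_prod S) (r \<odot>\<^bsub>N\<^esub> x) k)"
    by (simp add: var_localization_def localization_def)
  also have "\<dots> = phi S (pact r u)"
  proof (rule phi_UN[OF u])
    fix w k assume w: "w : Ftot a" "u - sh (- ones S k) w : lt XK S"
    let ?s = "sh (- ones S k) w"
    have d: "pact r u - pact r ?s : lt XK S"
      by (rule subst[OF flin_diff[OF flin_pact[of r], of u ?s]]) (rule lt_pact[OF stable_XK w(2)])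
    have "loc_frac N (var_prod S) (r \<odot>\<^bsub>N\<^esub> E w) k = phi S (sh (- ones S k) (pact r w))"
      using hsmult[OF w(1), of r] loc_frac_eq[OF pact_Ftot[OF w(1)], of S r k] by simp
    moreover have "sh (- ones S k) (pact r w) = pact r ?s" by (rule eqv_sh[OF eqv_pact, symmetric])
    moreover have "phi S (pact r u) = phi S (pact r ?s)"
      by (rule iffD2[OF phi_eq_iff d]) (rule lt_pact[OF stable_Ftot u], rule lt_pact[OF stable_Ftot lt_sh[OF w(1)]])
    ultimately show "loc_frac N (var_prod S) (r \<odot>\<^bsub>N\<^esub> E w) k = phi S (pact r u)" by (simp only:)
  qed
  finally show ?thesis .
qed

lemma phi_loc_map:
  assumes i: "i : S" and u: "u : lt (Ftot a) (S - {i})"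
  shows "loc_map N S i (phi (S - {i}) u) = phi S u" unfolding loc_map_def
proof (rule phi_UN[OF u])
  let ?S = "S - {i}"
  fix w k assume w: "w : Ftot a" "u - sh (- ones ?S k) w : lt XK ?S"
  have on: "ones S k = ones {i} k + ones ?S k" using ones_insert[of i ?S k] i by (simp add: insert_absorb)
  have F: "sh (ones {i} k) w : Ftot a" using w(1) by (auto intro: sh_Ftot ones_nonneg)
  have A: "loc_frac N (var_prod S) (pvar i ^ k \<odot>\<^bsub>N\<^esub> E w) k = phi S (sh (- ones S k) (sh (ones {i} k) w))"
    unfolding hsmult[OF w(1), symmetric] pact_pvar_power by (rule loc_frac_eq[OF F])
  have B: "sh (- ones S k) (sh (ones {i} k) w) = sh (- ones ?S k) w"
  proof -
    have "- ones S k + ones {i} k = - ones ?S k" unfolding on by (simp add: fun_eq_iff)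
    then show ?thesis unfolding sh_sh by (simp only:)
  qed
  have "phi S (sh (- ones ?S k) w) = phi S u" by (rule sym, rule iffD2[OF phi_eq_iff])
      (rule lt_mono[OF stable_Ftot Diff_subset u], rule lt_mono[OF stable_Ftot Diff_subset lt_sh[OF w(1)]],
        rule lt_mono[OF stable_XK Diff_subset w(2)])
  then show "loc_frac N (var_prod S) (pvar i ^ k \<odot>\<^bsub>N\<^esub> E w) k = phi S u" unfolding A B .
qed

lemma phi_component: "component (var_localization N S) t = phi S ` loc (fr a) S t"
proof
  have C: "component (var_localization N S) t = {loc_frac N (var_prod S) x k | x k. x : component N (t + int (k * card S))}"
    by (simp add: var_localization_def localization_def)
  show "component (var_localization N S) t <= phi S ` loc (fr a) S t"
  proof
    fix y assume "y : component (var_localization N S) t"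
    then obtain x k where x: "x : component N (t + int (k * card S))" "y = loc_frac N (var_prod S) x k" unfolding C by blast
    obtain w where w: "w : fr a (t + int (k * card S))" "x = E w" using x(1) unfolding hcomp[symmetric] by blast
    have "y = phi S (sh (- ones S k) w)" unfolding x(2) w(2) by (rule loc_frac_eq[OF frF[OF w(1)]])
    moreover have "sh (- ones S k) w : loc (fr a) S t"
      unfolding loc_ones_iff[OF gsub_fr] by (intro exI[of _ k]) (unfold sh_minus(2), rule w(1))
    ultimately show "y : phi S ` loc (fr a) S t" by blast
  qed
  show "phi S ` loc (fr a) S t <= component (var_localization N S) t"
  proof
    fix y assume "y : phi S ` loc (fr a) S t"
    then obtain u where u1: "y = phi S u" "u : loc (fr a) S t" by blast
    obtain k where "sh (ones S k) u : fr a (t + int (k * card S))" using u1(2) unfolding loc_ones_iff[OF gsub_fr] ..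
    note u = u1(1) this
    have "y = loc_frac N (var_prod S) (E (sh (ones S k) u)) k" unfolding loc_frac_eq[OF frF[OF u(2)]] u(1) by simp
    then show "y : component (var_localization N S) t" unfolding C using hcomp imageI[OF u(2), of E] by blast
  qed
qed

lemma loc_fr_lt: "u : loc (fr a) S t ==> u : lt (Ftot a) S" unfolding loc_ones_iff[OF gsub_fr] lt_def using frF by blast

lemma loc_ker_lt: "u : loc ker S t ==> u : lt XK S"
  unfolding loc_ones_iff[OF gsub_ker] lt_def XK_def using frF unfolding ker_def by blast

lemma proj_lt_F: "u : lt (Ftot a) S ==> proj a t u : loc (fr a) S t"
proof -
  assume "u : lt (Ftot a) S"
  then obtain k where k: "sh (ones S k) u : Ftot a" unfolding lt_def by blast
  show ?thesis unfolding loc_ones_iff[OF gsub_fr]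
    using proj_fr[OF k, of "t + edeg (ones S k)"] unfolding proj_sh by (intro exI[of _ k]) simp
qed

lemma proj_lt_K: "u : lt XK S ==> proj a t u : loc ker S t"
proof -
  assume "u : lt XK S"
  then obtain k where k: "sh (ones S k) u : Ftot a" "E (sh (ones S k) u) = zN" unfolding lt_def XK_def by blast
  have "proj a (t + edeg (ones S k)) (sh (ones S k) u) : ker (t + edeg (ones S k))"
    unfolding ker_def using proj_fr[OF k(1)] graded[OF k] by blast
  then show ?thesis unfolding loc_ones_iff[OF gsub_ker] proj_sh by (intro exI[of _ k]) simp
qed

lemma proj_loc: "u : loc (fr a) S t ==> proj a t u = u"
proof -
  assume "u : loc (fr a) S t"
  then obtain k where "sh (ones S k) u : fr a (t + int (k * card S))" unfolding loc_ones_iff[OF gsub_fr] by blast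
  then have "sh (ones S k) (proj a t u) = sh (ones S k) u" using proj_sh[of a t "ones S k" u] proj_of_fr by fastforce
  then show ?thesis by (metis sh_minus(1))
qed

text \<open>Ungraded cochains, since the carrier of \<open>cech_module\<close> comprises all degrees
  at once.\<close>

definition ct :: "('n, 'k) lvec set => nat => ('n, 'k) lcoch set" where
  "ct X p = {c. \<forall>S. (card S = p --> sl c S : lt X S) & (card S ~= p --> sl c S = 0)}"

definition Phi :: "nat => ('n, 'k) lcoch => 'n set => ('m \<times> nat) set" where
  "Phi p c = (\<lambda>S\<in>{S. card S = p}. phi S (sl c S))"

lemma ct_lt: "c : ct X p ==> card S = p ==> sl c S : lt X S" by (simp add: ct_def)

lemma subspace_ct:
  assumes "stable X"
  shows "fs.subspace (ct X p)"
proof -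
  note s = subspace_lt[OF assms]
  show ?thesis by (rule fs.subspaceI)
      (simp_all add: ct_def sl_add sl_scl fs.subspace_0[OF s] fs.subspace_add[OF s] fs.subspace_scale[OF s])
qed

lemma dd_ct:
  assumes X: "stable X" and c: "c : ct X p"
  shows "dd c : ct X (Suc p)" unfolding ct_def
proof (intro CollectI allI conjI impI)
  fix S :: "'n set" assume "card S = Suc p"
  then have "sl c (S - {v}) : lt X S" if "v : S" for v
    by (intro lt_mono[OF X Diff_subset[of S "{v}"]] ct_lt[OF c]) (use that in simp)
  then show "sl (dd c) S : lt X S"
    unfolding sl_dd by (intro fs.subspace_sum[OF subspace_lt[OF X]] fs.subspace_scale[OF subspace_lt[OF X]])
next
  fix S :: "'n set" assume S: "card S ~= Suc p"
  have "sl c (S - {v}) = 0" if "v : S" for v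
  proof -
    have "card (S - {v}) ~= p" using S that by (metis card_Suc_Diff1 finite)
    then show ?thesis using c by (simp add: ct_def)
  qed
  then show "sl (dd c) S = 0" unfolding sl_dd by (intro sum.neutral) simp
qed

lemmas dd_ctF = dd_ct[OF stable_Ftot] and dd_ctK = dd_ct[OF stable_XK]

lemma lin_image_cech: "lin_image (ct (Ftot a) p) (cech_module N p) (Phi p)"
proof (rule lin_image.intro)
  show "fs.subspace (ct (Ftot a) p)" by (rule subspace_ct[OF stable_Ftot])
  show "Phi p ` ct (Ftot a) p = carrier (cech_module N p)"
  proof
    show "Phi p ` ct (Ftot a) p <= carrier (cech_module N p)"
      using lin_image.closed[OF lin_image_localization] by (auto simp: Phi_def cech_module_def ct_lt)
    show "carrier (cech_module N p) <= Phi p ` ct (Ftot a) p"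
    proof
      fix b assume b: "b : carrier (cech_module N p)"
      have "\<exists>u. card S = p --> u : lt (Ftot a) S & b S = phi S u" for S
      proof (cases "card S = p")
        case True
        then have "b S : carrier (var_localization N S)" using b by (auto simp: cech_module_def)
        then show ?thesis using lin_image.img[OF lin_image_localization, of S] by blast
      qed simp
      then obtain u where u: "!!S. card S = p ==> u S : lt (Ftot a) S & b S = phi S (u S)" by metis
      let ?c = "unsl (%S. if card S = p then u S else 0)"
      have "?c : ct (Ftot a) p" using u by (simp add: ct_def zero_fun_def)
      moreover have "b = Phi p ?c"
      proof (rule extensionalityI[of _ "{S. card S = p}"])
        show "b : extensional {S. card S = p}" using b by (auto simp: cech_module_def PiE_def)
      qed (auto simp: Phi_def u)
      ultimately show "b : Phi p ` ct (Ftot a) p" by blast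
    qed
  qed
  show "Phi p (c + d) = Phi p c \<oplus>\<^bsub>cech_module N p\<^esub> Phi p d" if "c : ct (Ftot a) p" "d : ct (Ftot a) p" for c d
    unfolding Phi_def cech_module_def using lin_image.hadd[OF lin_image_localization] that[THEN ct_lt]
    by (auto simp: sl_add intro!: restrict_ext)
  show "Phi p 0 = \<zero>\<^bsub>cech_module N p\<^esub>"
    unfolding Phi_def cech_module_def using lin_image.hzero[OF lin_image_localization] by (auto intro!: restrict_ext)
qed

lemma Phi_zero_iff:
  assumes "c : ct (Ftot a) p"
  shows "Phi p c = \<zero>\<^bsub>cech_module N p\<^esub> \<longleftrightarrow> c : ct XK p"
proof -
  have "Phi p c = \<zero>\<^bsub>cech_module N p\<^esub> \<longleftrightarrow> (\<forall>S. card S = p --> phi S (sl c S) = \<zero>\<^bsub>var_localization N S\<^esub>)"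
    unfolding Phi_def cech_module_def by (auto simp: fun_eq_iff restrict_def)
  also have "\<dots> \<longleftrightarrow> (\<forall>S. card S = p --> sl c S : lt XK S)" using phi_zero_iff ct_lt[OF assms] by blast
  also have "\<dots> \<longleftrightarrow> c : ct XK p" using assms by (auto simp: ct_def)
  finally show ?thesis .
qed

lemma pact_sign: "pact ((- 1) ^ k) v = scl ((- 1) ^ k) (v :: ('n, 'k) lvec)"
proof (induction k)
  case (Suc k)
  have "pact (- 1) w = scl (- 1) w" for w :: "('n, 'k) lvec"
  proof -
    have "(- 1 :: ('n, 'k) mpolynomial) = single 0 (- 1)" by (simp only: single_uminus single_one)
    then show ?thesis by (simp only: scl_pact)
  qed
  then show ?case using Suc by (simp only: power_Suc pact_mult fs.scale_scale[symmetric])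
qed (simp add: pact_one)

lemma cech_diff_Phi:
  assumes c: "c : ct (Ftot a) p"
  shows "cech_diff N p (Phi p c) = Phi (Suc p) (dd c)" unfolding cech_diff_def Phi_def[of "Suc p"]
proof (rule restrict_ext)
  fix S :: "'n set" assume "S : {S. card S = Suc p}"
  then have S: "card S = Suc p" by simp
  have L: "sl c (S - {i}) : lt (Ftot a) (S - {i})" if "i : S" for i using S that by (intro ct_lt[OF c]) simp
  have L': "sl c (S - {i}) : lt (Ftot a) S" if "i : S" for i by (rule lt_mono[OF stable_Ftot _ L[OF that]]) auto
  interpret loc: lin_image "lt (Ftot a) S" "var_localization N S" "phi S" by (rule lin_image_localization)
  have e: "(- 1) ^ card {j \<in> S. j < i} \<odot>\<^bsub>var_localization N S\<^esub> loc_map N S i (Phi p c (S - {i}))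
      = phi S (scl (sg S i) (sl c (S - {i})))" if i: "i : S" for i
  proof -
    have "Phi p c (S - {i}) = phi (S - {i}) (sl c (S - {i}))" using S i by (simp add: Phi_def)
    then show ?thesis using phi_loc_map[OF i L[OF i]] phi_smult[OF L'[OF i]] by (simp add: pact_sign sg_def)
  qed
  have sL: "scl (sg S i) (sl c (S - {i})) : lt (Ftot a) S" if "i : S" for i
    by (rule fs.subspace_scale[OF subspace_ltF L'[OF that]])
  have "(\<Oplus>\<^bsub>var_localization N S\<^esub>i\<in>S. (- 1) ^ card {j \<in> S. j < i} \<odot>\<^bsub>var_localization N S\<^esub> loc_map N S i (Phi p c (S - {i})))
      = (\<Oplus>\<^bsub>var_localization N S\<^esub>i\<in>S. phi S (scl (sg S i) (sl c (S - {i}))))"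
    by (rule loc.G.finsum_cong'[OF refl]) (use e sL in auto)
  also have "\<dots> = phi S (sl (dd c) S)" unfolding sl_dd by (rule loc.hsum[OF sL])
  finally show "(\<Oplus>\<^bsub>var_localization N S\<^esub>i\<in>S. (- 1) ^ card {j \<in> S. j < i} \<odot>\<^bsub>var_localization N S\<^esub> loc_map N S i (Phi p c (S - {i})))
      = phi S (sl (dd c) S)" .
qed

lemma Cc_fr_ct: "c : Cc (int p) (fr a) t ==> c : ct (Ftot a) p" unfolding Cc_def ct_def using loc_fr_lt by auto

lemma Cc_ker_ct: "c : Cc (int p) ker t ==> c : ct XK p" unfolding Cc_def ct_def using loc_ker_lt by auto

lemma Phi_component: "component (cech_module N p) t = Phi p ` Cc (int p) (fr a) t"
proof
  show "component (cech_module N p) t <= Phi p ` Cc (int p) (fr a) t"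
  proof
    fix b assume "b : component (cech_module N p) t"
    then have b: "b : (\<Pi>\<^sub>E S\<in>{S. card S = p}. component (var_localization N S) t)" by (simp add: cech_module_def)
    have "\<exists>u. card S = p --> u : loc (fr a) S t & b S = phi S u" for S
    proof (cases "card S = p")
      case True
      then have "b S : component (var_localization N S) t" using b by auto
      then show ?thesis unfolding phi_component by blast
    qed simp
    then obtain u where u: "!!S. card S = p ==> u S : loc (fr a) S t & b S = phi S (u S)" by metis
    let ?c = "unsl (%S. if card S = p then u S else 0)"
    have "?c : Cc (int p) (fr a) t" using u by (intro CcI) (simp_all add: zero_fun_def)
    moreover have "b = Phi p ?c"
    proof (rule extensionalityI[of _ "{S. card S = p}"])
      show "b : extensional {S. card S = p}" using b by (auto simp: PiE_def)
    qed (auto simp: Phi_def u)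
    ultimately show "b : Phi p ` Cc (int p) (fr a) t" by blast
  qed
  show "Phi p ` Cc (int p) (fr a) t <= component (cech_module N p) t"
  proof
    fix b assume "b : Phi p ` Cc (int p) (fr a) t"
    then obtain c where c: "c : Cc (int p) (fr a) t" "b = Phi p c" by blast
    have "phi S (sl c S) : component (var_localization N S) t" if "card S = p" for S
      unfolding phi_component using Cc_loc[OF c(1), of S] that by simp
    then show "b : component (cech_module N p) t" unfolding c(2) Phi_def cech_module_def by auto
  qed
qed

lemma dd_lift: "flin fv ==> dd (lift_c fv c) = lift_c fv (dd c)" by (rule sl_eqI) (simp only: sl_dd sl_lift_c flin_sum flin_scl)

lemma lift_proj_ct: "c : ct (Ftot a) p ==> lift_c (proj a t) c : Cc (int p) (fr a) t"
  by (rule CcI) (simp_all add: ct_def proj_lt_F flin_0[OF flin_proj, unfolded zero_fun_def] zero_fun_def)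

lemma lift_proj_ctK: "c : ct XK p ==> lift_c (proj a t) c : Cc (int p) ker t"
  by (rule CcI) (simp_all add: ct_def proj_lt_K flin_0[OF flin_proj, unfolded zero_fun_def] zero_fun_def)

lemma lift_proj_Cc:
  fixes c :: "('n, 'k) lcoch"
  assumes c: "c : Cc p (fr a) t"
  shows "lift_c (proj a t) c = c"
proof (rule sl_eqI)
  fix S :: "'n set"
  show "sl (lift_c (proj a t) c) S = sl c S"
    using proj_loc[OF Cc_loc[OF c, of S]] Cc_zero[OF c, of S] flin_0[OF flin_proj, of a t] by (cases "int (card S) = p") simp_all
qed

text \<open>Cochains in all degrees that represent Cech coboundaries of \<open>N\<close>:
  coboundaries of the free module plus cochains of the relations.\<close>

definition Wcech :: "nat => ('n, 'k) lcoch set" where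
  "Wcech p = sadd (case p of 0 => {0} | Suc q => dd ` ct (Ftot a) q) (ct XK p)"

text \<open>Taking components of degree \<open>t\<close> commutes with \<open>dd\<close>, so a
  decomposition in all degrees yields one in degree \<open>t\<close>.\<close>

lemma Wcech_iff:
  assumes c: "c : Cc (int p) (fr a) t"
  shows "c : Wcech p \<longleftrightarrow> c : BB (int p) (fr a) ker t"
proof
  assume "c : Wcech p"
  then obtain b k where bk: "b : (case p of 0 => {0} | Suc q => dd ` ct (Ftot a) q)" "k : ct XK p" "c = b + k"
    unfolding Wcech_def by (blast elim: saddE)
  let ?l = "lift_c (proj a t)"
  have "sl (?l (b + k)) S = sl (?l b + ?l k) S" for S by (simp only: sl_lift_c sl_add flin_add[OF flin_proj])
  then have e: "c = ?l b + ?l k" using lift_proj_Cc[OF c] bk(3) sl_eqI[of "?l (b + k)" "?l b + ?l k"] by (simp only:)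
  have k: "?l k : Cc (int p) ker t" by (rule lift_proj_ctK[OF bk(2)])
  show "c : BB (int p) (fr a) ker t"
  proof (cases p)
    case 0
    then have "b = 0" using bk(1) by simp
    then have "sl (?l b) S = sl 0 S" for S by (simp only: sl_lift_c sl_0 flin_0[OF flin_proj])
    then have z: "?l b = 0" by (rule sl_eqI)
    show ?thesis unfolding e z add_0_left by (rule Cc_BB[OF gsub_fr k])
  next
    case (Suc q)
    then obtain d where d: "d : ct (Ftot a) q" "b = dd d" using bk(1) by auto
    have "?l b = dd (?l d)" unfolding d(2) dd_lift[OF flin_proj] ..
    moreover have "?l d : Cc (int p - 1) (fr a) t" using lift_proj_ct[OF d(1), of t] Suc by simp
    ultimately show ?thesis unfolding e using BB_I[OF _ k, of "?l d"] by (simp only:)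
  qed
next
  assume "c : BB (int p) (fr a) ker t"
  then obtain w u where wu: "w : Cc (int p - 1) (fr a) t" "u : Cc (int p) ker t" "c = dd w + u" by (rule BB_E)
  have "dd w : (case p of 0 => {0} | Suc q => dd ` ct (Ftot a) q)"
  proof (cases p)
    case 0
    have "sl w S = sl 0 S" for S using Cc_zero[OF wu(1), of S] 0 by simp
    then have "w = 0" by (rule sl_eqI)
    then show ?thesis using 0 by simp
  next
    case (Suc q)
    then have "w : ct (Ftot a) q" using Cc_fr_ct[of w q t] wu(1) by simp
    then show ?thesis unfolding Suc nat.case by (rule imageI)
  qed
  then show "c : Wcech p" unfolding Wcech_def wu(3) using Cc_ker_ct[OF wu(2)] by (rule saddI)
qed

end

section \<open>Local cohomology of a presented module\<close>

context pres
begin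

text \<open>Regularity depends only on which components vanish, so it is vanishing that is compared.
  Cocycles modulo \<open>Wcech\<close> give the cohomology module, and its component of degree
  \<open>t\<close> comes from the graded cocycles \<open>ZZ\<close>.\<close>

lemma local_cohomology_nonzero_iff:
  "component (local_cohomology N p) t ~= {\<zero>\<^bsub>local_cohomology N p\<^esub>} \<longleftrightarrow> hh (int p) (fr a) ker t ~= 0"
proof -
  define Z where "Z = {c \<in> ct (Ftot a) p. dd c : ct XK (Suc p)}"
  define S where "S = sub_gmodule (cech_module N p) {x \<in> carrier (cech_module N p). cech_diff N p x = \<zero>\<^bsub>cech_module N (Suc p)\<^esub>}"
  note ci = lin_image_cech[of p]
  have Dz: "cech_diff N p (Phi p c) = \<zero>\<^bsub>cech_module N (Suc p)\<^esub> \<longleftrightarrow> dd c : ct XK (Suc p)" if "c : ct (Ftot a) p" for c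
    unfolding cech_diff_Phi[OF that] by (rule Phi_zero_iff[OF dd_ctF[OF that]])
  have ZF: "c : ct (Ftot a) p" if "c : Z" for c using that by (simp add: Z_def)
  have ctK: "fs.subspace (ct XK p)" for p by (rule subspace_ct[OF stable_XK])
  have KF: "c : ct (Ftot a) q" if "c : ct XK q" for c q using that lt_XK_F unfolding ct_def by blast
  have bdZ: "b : Z" if bB: "b : (case p of 0 => {0} | Suc q => dd ` ct (Ftot a) q)" for b
  proof (cases p)
    case 0
    then have "b = 0" using that by simp
    then show ?thesis unfolding Z_def using fs.subspace_0[OF lin_image.Zs[OF ci]] fs.subspace_0[OF ctK[of "Suc p"]] by simp
  next
    case (Suc q)
    then obtain d where d: "d : ct (Ftot a) q" "b = dd d" using bB by auto
    show ?thesis unfolding Z_def d(2) Suc using dd_ctF[OF d(1)] fs.subspace_0[OF ctK[of "Suc (Suc q)"]] by simp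
  qed
  have KZ: "ct XK p <= Z" unfolding Z_def using KF dd_ctK by blast
  have Zsub: "fs.subspace Z" unfolding Z_def by (intro subspace_vimage flin_dd ctK lin_image.Zs[OF ci])
  have bd: "fs.subspace (case p of 0 => {0} | Suc q => dd ` ct (Ftot a) q)"
  proof (cases p)
    case (Suc q)
    show ?thesis unfolding Suc nat.case by (rule subspace_image[OF flin_dd lin_image.Zs[OF lin_image_cech]])
  qed (simp add: fs.subspace_single_0)
  have PhiW: "(case p of 0 => {\<zero>\<^bsub>cech_module N 0\<^esub>} | Suc q => cech_diff N q ` carrier (cech_module N q)) = Phi p ` Wcech p"
  proof -
    let ?B = "case p of 0 => {0} | Suc q => dd ` ct (Ftot a) q"
    have "Phi p (b + k) = Phi p b" if "b : Z" "k : ct XK p" for b k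
      using lin_image.hadd[OF ci ZF[OF that(1)] KF[OF that(2)]] Phi_zero_iff[OF KF[OF that(2)]] that(2)
        abelian_monoid.r_zero[OF abelian_group.axioms(1)[OF lin_image.group[OF ci]] lin_image.closed[OF ci ZF[OF that(1)]]] by simp
    then have P: "Phi p (b + k) = Phi p b" if "b : ?B" "k : ct XK p" for b k using that bdZ by blast
    have "Phi p ` Wcech p = Phi p ` ?B"
    proof
      show "Phi p ` Wcech p <= Phi p ` ?B"
      proof
        fix y assume "y : Phi p ` Wcech p"
        then obtain b k where "b : ?B" "k : ct XK p" "y = Phi p (b + k)" unfolding Wcech_def by (auto elim!: saddE)
        then show "y : Phi p ` ?B" using P by simp
      qed
      show "Phi p ` ?B <= Phi p ` Wcech p" unfolding Wcech_def by (intro image_mono subsetI sadd_left ctK)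
    qed
    also have "\<dots> = (case p of 0 => {\<zero>\<^bsub>cech_module N 0\<^esub>} | Suc q => cech_diff N q ` carrier (cech_module N q))"
    proof (cases p)
      case 0
      then show ?thesis using lin_image.hzero[OF lin_image_cech, of 0] by simp
    next
      case (Suc q)
      have "Phi p ` dd ` ct (Ftot a) q = cech_diff N q ` Phi q ` ct (Ftot a) q"
        unfolding image_image Suc by (rule image_cong[OF refl]) (rule cech_diff_Phi[symmetric])
      then show ?thesis unfolding lin_image.img[OF lin_image_cech] by (simp add: Suc)
    qed
    finally show ?thesis by simp
  qed
  interpret q: lin_quot Z S "Phi p" "Wcech p"
  proof
    show "fs.subspace Z" by (rule Zsub)
    show "Phi p ` Z = carrier S"
    proof
      show "Phi p ` Z <= carrier S" using lin_image.closed[OF ci] Dz by (auto simp: Z_def S_def sub_gmodule_def)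
      show "carrier S <= Phi p ` Z" using Dz by (auto simp: Z_def S_def sub_gmodule_def lin_image.img[OF ci, symmetric])
    qed
    show "Phi p (x + y) = Phi p x \<oplus>\<^bsub>S\<^esub> Phi p y" if "x : Z" "y : Z" for x y
      using lin_image.hadd[OF ci ZF[OF that(1)] ZF[OF that(2)]] by (simp add: S_def sub_gmodule_def)
    show "Phi p 0 = \<zero>\<^bsub>S\<^esub>" using lin_image.hzero[OF ci] by (simp add: S_def sub_gmodule_def)
    show "fs.subspace (Wcech p)" unfolding Wcech_def by (intro subspace_sadd bd ctK)
    show "Wcech p <= Z" unfolding Wcech_def by (rule sadd_least[OF Zsub _ KZ]) (use bdZ in blast)
    show "v : Wcech p" if "v : Z" "Phi p v = \<zero>\<^bsub>S\<^esub>" for v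
      unfolding Wcech_def by (rule sadd_right[OF bd]) (use that Phi_zero_iff[OF ZF] in \<open>simp add: S_def sub_gmodule_def\<close>)
  qed
  have H: "local_cohomology N p = quot_gmodule S (Phi p ` Wcech p)" unfolding local_cohomology_def cohomology_def S_def PhiW ..
  have ZZ: "c : ZZ (int p) (fr a) ker t \<longleftrightarrow> c : Cc (int p) (fr a) t & c : Z" for c
  proof (cases "c : Cc (int p) (fr a) t")
    case True
    have "dd c : Cc (int p + 1) (fr a) t" by (rule dd_Cc[OF gsub_fr True])
    then have "dd c : Cc (int p + 1) ker t \<longleftrightarrow> dd c : ct XK (Suc p)"
      using lift_proj_ctK[of "dd c" "Suc p" t] lift_proj_Cc[of "dd c" "int p + 1" t] Cc_ker_ct[of "dd c" "Suc p" t] by (auto simp: add.commute)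
    then show ?thesis using True Cc_fr_ct[OF True] by (simp add: ZZ_def Z_def)
  qed (simp add: ZZ_def)
  have comp: "component (local_cohomology N p) t = q.Q ` ZZ (int p) (fr a) ker t"
  proof -
    have "component S t = Phi p ` ZZ (int p) (fr a) ker t"
    proof -
      have "component S t = {x \<in> Phi p ` Cc (int p) (fr a) t. x : carrier (cech_module N p) & cech_diff N p x = \<zero>\<^bsub>cech_module N (Suc p)\<^esub>}"
        unfolding S_def sub_gmodule_def by (auto simp: Phi_component)
      also have "\<dots> = Phi p ` {c \<in> Cc (int p) (fr a) t. c : Z}"
        using Dz[OF Cc_fr_ct] Cc_fr_ct lin_image.closed[OF ci Cc_fr_ct] by (auto simp: Z_def)
      also have "{c \<in> Cc (int p) (fr a) t. c : Z} = ZZ (int p) (fr a) ker t" using ZZ by blast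
      finally show ?thesis .
    qed
    then show ?thesis unfolding H quot_gmodule_def by (auto simp: q.Q_def)
  qed
  have zero: "\<zero>\<^bsub>local_cohomology N p\<^esub> = Phi p ` Wcech p" unfolding H quot_gmodule_def by simp
  have s: "fs.subspace (ZZ (int p) (fr a) ker t)" "fs.subspace (BB (int p) (fr a) ker t)"
    by (intro subspace_ZZ subspace_BB gsub_fr gsub_ker)+
  have "component (local_cohomology N p) t = {\<zero>\<^bsub>local_cohomology N p\<^esub>} \<longleftrightarrow> (\<forall>c\<in>ZZ (int p) (fr a) ker t. q.Q c = Phi p ` Wcech p)"
    unfolding comp zero using fs.subspace_0[OF s(1)] by blast
  also have "\<dots> \<longleftrightarrow> (\<forall>c\<in>ZZ (int p) (fr a) ker t. c : BB (int p) (fr a) ker t)"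
    by (intro ball_cong refl) (use q.Q_zero_iff Wcech_iff ZZ in simp)
  also have "\<dots> \<longleftrightarrow> hh (int p) (fr a) ker t = 0" unfolding hh_def qdim_eq_0_iff[OF s(2)] by blast
  finally show ?thesis by simp
qed

end

subsection \<open>Dimensions\<close>

text \<open>A basis of \<open>Z\<close> modulo the kernel is mapped bijectively onto a basis of
  \<open>V\<close>.\<close>

lemma dim_lin_image:
  fixes V :: "('k::field, 'm) module" and Z :: "('i => 'k) set"
  assumes li: "lin_image Z V \<Phi>" and sm: "!!c z. z : Z ==> \<Phi> (scl c z) = c \<odot>\<^bsub>V\<^esub> \<Phi> z"
    and q: "qdim Z {z \<in> Z. \<Phi> z = \<zero>\<^bsub>V\<^esub>} = enat m"
  shows "vectorspace.fin_dim class_ring V & vectorspace.dim class_ring V = m"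
proof -
  interpret L: lin_image Z V \<Phi> by (rule li)
  define K where "K = {z \<in> Z. \<Phi> z = \<zero>\<^bsub>V\<^esub>}"
  note scl_Z = fs.subspace_scale[OF L.Zs]
  have mod: "Module.module class_ring V"
  proof (rule Module.moduleI)
    show "cring (class_ring :: 'k ring)" ..
    show "abelian_group V" by (rule L.group)
  next
    fix r x assume "x : carrier V"
    then obtain v where v: "v : Z" "x = \<Phi> v" by (rule L.obtain_pre)
    show "r \<odot>\<^bsub>V\<^esub> x : carrier V" unfolding v(2) sm[OF v(1), symmetric] by (intro L.closed scl_Z v(1))
    show "\<one>\<^bsub>class_ring\<^esub> \<odot>\<^bsub>V\<^esub> x = x" unfolding v(2) sm[OF v(1), symmetric] class_ring_simps fs.scale_one ..
    fix s
    show "(r \<oplus>\<^bsub>class_ring\<^esub> s) \<odot>\<^bsub>V\<^esub> x = r \<odot>\<^bsub>V\<^esub> x \<oplus>\<^bsub>V\<^esub> s \<odot>\<^bsub>V\<^esub> x"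
      unfolding v(2) sm[OF v(1), symmetric] L.hadd[OF scl_Z[OF v(1)] scl_Z[OF v(1)], symmetric] class_ring_simps fs.scale_left_distrib ..
    show "(r \<otimes>\<^bsub>class_ring\<^esub> s) \<odot>\<^bsub>V\<^esub> x = r \<odot>\<^bsub>V\<^esub> (s \<odot>\<^bsub>V\<^esub> x)"
      unfolding v(2) sm[OF v(1), symmetric] sm[OF scl_Z[OF v(1)], symmetric] class_ring_simps fs.scale_scale ..
  next
    fix r x y assume "x : carrier V" "y : carrier V"
    then obtain v w where v: "v : Z" "x = \<Phi> v" and w: "w : Z" "y = \<Phi> w" by (metis L.obtain_pre)
    show "r \<odot>\<^bsub>V\<^esub> (x \<oplus>\<^bsub>V\<^esub> y) = r \<odot>\<^bsub>V\<^esub> x \<oplus>\<^bsub>V\<^esub> r \<odot>\<^bsub>V\<^esub> y"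
      unfolding v(2) w(2) L.hadd[OF v(1) w(1), symmetric] sm[OF fs.subspace_add[OF L.Zs v(1) w(1)], symmetric]
        sm[OF v(1), symmetric] sm[OF w(1), symmetric] L.hadd[OF scl_Z[OF v(1)] scl_Z[OF w(1)], symmetric]
        fs.scale_right_distrib ..
  qed
  interpret V: vectorspace class_ring V by (intro vectorspace.intro mod class_field.field_axioms)
  have Ks: "fs.subspace K"
  proof -
    have a: "\<Phi> (x + y) = \<zero>\<^bsub>V\<^esub>" if "x : K" "y : K" for x y using that L.hadd[of x y] by (simp add: K_def)
    have b: "\<Phi> (scl c x) = \<zero>\<^bsub>V\<^esub>" if "x : K" for c x
      using that sm[of x c] sm[OF fs.subspace_0[OF L.Zs], of c] L.hzero by (simp add: K_def)
    have KZ: "x : Z" if "x : K" for x using that by (simp add: K_def)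
    show ?thesis
    proof (rule fs.subspaceI)
      show "0 : K" using L.hzero fs.subspace_0[OF L.Zs] by (simp only: K_def mem_Collect_eq)
      show "x + y : K" if "x : K" "y : K" for x y
        using a[OF that] fs.subspace_add[OF L.Zs KZ[OF that(1)] KZ[OF that(2)]] by (simp only: K_def mem_Collect_eq)
      show "scl c x : K" if "x : K" for c x using b[OF that] scl_Z[OF KZ[OF that]] by (simp only: K_def mem_Collect_eq)
    qed
  qed
  obtain T where T: "finite T" "T <= Z" "ind_mod K T" "card T = m" "Z <= fs.span (T Un K)"
    by (rule qdim_basis[OF q[folded K_def]])
  have TZ: "t : Z" if "t : T" for t using that T(2) by blast
  have inj: "inj_on \<Phi> T"
  proof (rule inj_onI, rule ccontr)
    fix x y assume xy: "x : T" "y : T" "\<Phi> x = \<Phi> y" "x ~= y"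
    have "x - y : K" using xy(3) L.eq_iff[OF TZ[OF xy(1)] TZ[OF xy(2)]] fs.subspace_diff[OF L.Zs TZ[OF xy(1)] TZ[OF xy(2)]]
      by (simp add: K_def)
    then have "(x - y) + y : fs.span ((T - {x}) Un K)" using xy by (intro fs.span_add fs.span_base) auto
    then show False using T(3) xy(1) by (simp add: ind_mod_def)
  qed
  have comb: "V.lincomb c (\<Phi> ` T) = \<Phi> (\<Sum>t\<in>T. scl (c (\<Phi> t)) t)" for c
  proof -
    have "V.lincomb c (\<Phi> ` T) = (\<Oplus>\<^bsub>V\<^esub>t\<in>T. c (\<Phi> t) \<odot>\<^bsub>V\<^esub> \<Phi> t)"
      unfolding V.lincomb_def using sm[OF TZ, symmetric] L.closed[OF scl_Z[OF TZ]] by (intro L.G.finsum_reindex inj) auto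
    also have "\<dots> = (\<Oplus>\<^bsub>V\<^esub>t\<in>T. \<Phi> (scl (c (\<Phi> t)) t))"
      by (rule L.G.finsum_cong'[OF refl]) (use sm[OF TZ] L.closed[OF scl_Z[OF TZ]] in auto)
    also have "\<dots> = \<Phi> (\<Sum>t\<in>T. scl (c (\<Phi> t)) t)" by (rule L.hsum) (rule scl_Z[OF TZ])
    finally show ?thesis .
  qed
  have fin: "finite (\<Phi> ` T)" and sub: "\<Phi> ` T <= carrier V" using T(1) L.closed[OF TZ] by auto
  have li: "V.lin_indpt (\<Phi> ` T)"
  proof (rule V.finite_lin_indpt2[OF fin sub], rule ballI, rule ccontr)
    fix c v assume c: "V.lincomb c (\<Phi> ` T) = \<zero>\<^bsub>V\<^esub>" and v: "v : \<Phi> ` T" "c v ~= \<zero>\<^bsub>class_ring\<^esub>"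
    obtain s where s: "s : T" "v = \<Phi> s" using v(1) by blast
    have cs: "c (\<Phi> s) ~= 0" using v(2) s(2) by (simp add: class_ring_simps)
    let ?S = "\<Sum>t\<in>T - {s}. scl (c (\<Phi> t)) t" and ?sp = "fs.span ((T - {s}) Un K)"
    have "(\<Sum>t\<in>T. scl (c (\<Phi> t)) t) : K" using c unfolding comb by (simp add: K_def fs.subspace_sum[OF L.Zs] scl_Z TZ)
    moreover have e: "(\<Sum>t\<in>T. scl (c (\<Phi> t)) t) = scl (c (\<Phi> s)) s + ?S" by (rule sum.remove[OF T(1) s(1)])
    ultimately have "scl (c (\<Phi> s)) s + ?S : ?sp" by (intro fs.span_base) simp
    moreover have "?S : ?sp" by (intro fs.span_sum fs.span_scale fs.span_base) simp
    ultimately have "(scl (c (\<Phi> s)) s + ?S) - ?S : ?sp" by (rule fs.span_diff)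
    then have "scl (c (\<Phi> s)) s : ?sp" unfolding add_diff_cancel_right' .
    then have "scl (inverse (c (\<Phi> s))) (scl (c (\<Phi> s)) s) : ?sp" by (rule fs.span_scale)
    then have "s : ?sp" unfolding fs.scale_scale left_inverse[OF cs] fs.scale_one .
    then show False using T(3) s(1) by (simp add: ind_mod_def)
  qed
  have gen: "V.span (\<Phi> ` T) = carrier V"
  proof
    show "V.span (\<Phi> ` T) <= carrier V" by (rule V.span_is_subset2[OF sub])
    show "carrier V <= V.span (\<Phi> ` T)"
    proof
      fix x assume "x : carrier V"
      then obtain z where z: "z : Z" "x = \<Phi> z" by (rule L.obtain_pre)
      then obtain k where k: "z - k : fs.span T" "k : K"
        using T(5) unfolding fs.span_Un fs.span_eq_iff[THEN iffD2, OF Ks] by force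
      obtain u where u: "z - k = (\<Sum>t\<in>T. scl (u t) t)" using k(1) unfolding fs.span_finite[OF T(1)] by blast
      have zk: "z - k : Z" using z(1) k(2) by (intro fs.subspace_diff[OF L.Zs]) (simp_all add: K_def)
      have "\<Phi> z = \<Phi> (z - k)" using k(2) L.eq_iff[OF z(1) zk] by (simp add: K_def)
      also have "\<dots> = V.lincomb (%v. u (inv_into T \<Phi> v)) (\<Phi> ` T)"
        unfolding comb u by (intro arg_cong[of _ _ \<Phi>] sum.cong) (simp_all add: inv_into_f_f[OF inj])
      finally show "x : V.span (\<Phi> ` T)" unfolding V.finite_span[OF fin sub] z(2) by (auto simp: class_ring_simps)
    qed
  qed
  have "V.basis (\<Phi> ` T)" unfolding V.basis_def using li gen sub by blast
  then have "V.dim = card (\<Phi> ` T)" by (rule V.dim_basis[OF fin])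
  then have "V.dim = m" using T(4) card_image[OF inj] by simp
  moreover have "V.fin_dim" unfolding V.fin_dim_def using fin sub gen by blast
  ultimately show ?thesis by blast
qed

context pres
begin

lemma adm_ker: "adm (fr a) ker" by (rule adm_fr[OF gsub_ker ker_fr])

lemma dim_component: "int (vectorspace.dim class_ring (component_space N t)) = qI (fr a) ker t"
proof -
  obtain m where m: "qdim (fr a t) (ker t) = enat m" using qdim_adm_finite[OF adm_ker, of t] by auto
  have li: "lin_image (fr a t) (component_space N t) E"
  proof (rule lin_image.intro)
    show "fs.subspace (fr a t)" by (rule gsub_subspace[OF gsub_fr])
  qed (auto simp: component_space_def hcomp[symmetric] hzero intro: hadd frF)
  have "vectorspace.fin_dim class_ring (component_space N t) & vectorspace.dim class_ring (component_space N t) = m"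
    by (rule dim_lin_image[OF li])
      (use m hsmult[OF frF] in \<open>simp_all add: component_space_def scl_pact pconst_def ker_def\<close>)
  then show ?thesis using m by (simp add: qI_def eint_def)
qed

text \<open>\<open>chi\<close> is polynomial in all degrees and agrees with the Hilbert function in
  large ones, where infinitely many values determine the polynomial.\<close>

lemma hilbert_poly_chi: "poly (hilbert_poly N) (of_int t) = of_int (chi (fr a) ker t)"
proof -
  obtain P :: "rat poly" where P: "!!t. poly P (of_int t) = of_int (chi (fr a) ker t)"
    using chi_polynomial[of UNIV, OF _ adm_ker] by auto
  obtain t0 where t0: "!!t. t >= t0 ==> chi (fr a) ker t = qI (fr a) ker t" using chi_eventually[OF adm_ker] by blast
  have ev: "poly P (of_int t) = of_nat (vectorspace.dim class_ring (component_space N t))" if "t >= t0" for t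
  proof -
    have "poly P (of_int t) = of_int (int (vectorspace.dim class_ring (component_space N t)))"
      unfolding P dim_component t0[OF that] ..
    then show ?thesis by simp
  qed
  have "hilbert_poly N = P" unfolding hilbert_poly_def
  proof (rule the_equality)
    show "\<exists>t0. \<forall>t\<ge>t0. poly P (of_int t) = of_nat (vectorspace.dim class_ring (component_space N t))" using ev by blast
  next
    fix Q :: "rat poly"
    assume "\<exists>t0. \<forall>t\<ge>t0. poly Q (of_int t) = of_nat (vectorspace.dim class_ring (component_space N t))"
    then obtain t1 where t1: "!!t. t >= t1 ==> poly Q (of_int t) = of_nat (vectorspace.dim class_ring (component_space N t))" by blast
    have "{max t0 t1..} <= {t. poly Q (of_int t) = poly P (of_int t)}" using ev t1 by auto
    then show "Q = P" using infinite_int_atLeast[of "max t0 t1"] finite_subset by (intro poly_eq_of_infinite) blast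
  qed
  then show ?thesis using P by simp
qed

lemma regularity_eq: "regularity N = ext_Sup {int i + t | i t. hh (int i) (fr a) ker t ~= 0}"
  unfolding regularity_def local_cohomology_nonzero_iff ..

text \<open>Only the indices 0..n contribute, and each cohomology vanishes in large degrees.\<close>

lemma regularity_not_Pinf: "regularity N ~= Pinf"
proof -
  have "\<exists>t0. \<forall>t\<ge>t0. hh (int p) (fr a) ker t = 0" for p using hh_finite_vanishing[OF adm_ker] by blast
  then obtain T where T: "!!p t. t >= T p ==> hh (int p) (fr a) ker t = 0" by metis
  have "bdd_above {int i + t | i t. hh (int i) (fr a) ker t ~= 0}"
  proof (rule bdd_aboveI)
    fix x assume "x : {int i + t | i t. hh (int i) (fr a) ker t ~= 0}"
    then obtain i t where it: "x = int i + t" "hh (int i) (fr a) ker t ~= 0" by blast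
    have i: "i <= CARD('n)" using hh_out_of_range[OF _ gsub_fr gsub_ker, of "int i" a t] it(2) by force
    have t: "t < T i" using T[of i t] it(2) by force
    have "\<bar>T i\<bar> <= (\<Sum>p\<le>CARD('n). \<bar>T p\<bar>)" by (rule member_le_sum) (use i in auto)
    then show "x <= int CARD('n) + (\<Sum>p\<le>CARD('n). \<bar>T p\<bar>)" using i t it(1) by linarith
  qed
  then show ?thesis unfolding regularity_eq ext_Sup_def by simp
qed

lemma le_regularity: "hh (int i) (fr a) ker t ~= 0 ==> Fin (int i + t) <= regularity N"
proof -
  let ?A = "{int i + t | i t. hh (int i) (fr a) ker t ~= 0}"
  assume "hh (int i) (fr a) ker t ~= 0"
  then have m: "int i + t : ?A" by blast
  then have "?A ~= {}" by blast
  then show ?thesis using regularity_not_Pinf m cSup_upper[OF m] unfolding regularity_eq ext_Sup_def by (auto split: if_splits)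
qed

end

subsection \<open>Homomorphisms of free modules\<close>

lemma Ftot_cong: "length a = length b ==> Ftot a = Ftot b" by (simp add: Ftot_def)

lemma homogeneous_part_0: "0 : homogeneous_part e" by (simp add: homogeneous_part_def)

lemma homogeneous_part_add: "p : homogeneous_part e ==> q : homogeneous_part e ==> p + q : homogeneous_part e"
  unfolding homogeneous_part_def using keys_add[of p q] by blast

lemma homogeneous_part_sum: "(!!i. i : A ==> p i : homogeneous_part e) ==> (\<Sum>i\<in>A. p i) : homogeneous_part e"
  by (induction A rule: infinite_finite_induct) (auto intro: homogeneous_part_0 homogeneous_part_add)

lemma homogeneous_part_mult:
  assumes "p : homogeneous_part d" "q : homogeneous_part e"
  shows "p * q : homogeneous_part (d + e)" unfolding homogeneous_part_def
proof (intro CollectI ballI)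
  fix m assume "m : keys (p * q)"
  then obtain m1 m2 where m: "m1 : keys p" "m2 : keys q" "m = m1 + m2" using keys_mult[of p q] by auto
  have "mono_degree m = mono_degree m1 + mono_degree m2" unfolding m(3) by (simp add: mono_degree_def lookup_add sum.distrib)
  then show "int (mono_degree m) = d + e" using assms m(1,2) unfolding homogeneous_part_def by force
qed

definition e_vec :: "nat => nat => ('n, 'k::field) mpolynomial" where
  "e_vec j = (%i. if i = j then 1 else 0)"

lemma e_vec_carrier: "j < length a ==> e_vec j : FC a" by (auto simp: carrier_free e_vec_def)

lemma emb_sum: "finite A ==> emb (%i. \<Sum>j\<in>A. f j i) = (\<Sum>j\<in>A. emb (f j))"
proof (induction A rule: finite_induct)
  case empty
  then show ?case by (simp add: emb_def fun_eq_iff)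
next
  case (insert x A)
  then show ?case using emb_add[of "f x" "%i. \<Sum>j\<in>A. f j i"] by (simp only: sum.insert not_False_eq_True)
qed

lemma emb_e_vec: "emb (e_vec j) = dirac (j, 0)"
proof
  fix x :: "nat \<times> ('a => int)"
  obtain i av where x: "x = (i, av)" by (cases x)
  have "mexp av = 0 \<longleftrightarrow> av = 0" if "0 <= av" using iexp_mexp[OF that] iexp_0 mexp_iexp by metis
  then show "emb (e_vec j) x = (dirac (j, 0) :: ('a, 'b) lvec) x"
    by (auto simp: x emb_def e_vec_def dirac_def lookup_one when_def)
qed

lemma free_decomp:
  assumes "w : FC a"
  shows "w = (%i. \<Sum>j<length a. w j * e_vec j i)"
proof
  fix i
  have "(\<Sum>j<length a. w j * e_vec j i) = (\<Sum>j<length a. if j = i then w i else 0)"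
    by (rule sum.cong) (auto simp: e_vec_def)
  also have "\<dots> = w i" using assms by (auto simp: carrier_free)
  finally show "w i = (\<Sum>j<length a. w j * e_vec j i)" by simp
qed

lemma Ftot_decomp:
  assumes "v : Ftot a"
  shows "v = (\<Sum>j<length a. pact (unemb v j) (dirac (j, 0)))"
proof -
  have "v = emb (%i. \<Sum>j<length a. unemb v j * e_vec j i)"
    using free_decomp[OF unemb_carrier[OF assms]] emb_unemb[OF assms] by metis
  also have "\<dots> = (\<Sum>j<length a. emb (%i. unemb v j * e_vec j i))" by (rule emb_sum) simp
  finally show ?thesis by (simp only: emb_smult emb_e_vec)
qed

lemma dirac_Ftot: "j < length a ==> dirac (j, 0) : (Ftot a :: ('n::finite, 'k::field) lvec set)"
  unfolding emb_e_vec[symmetric] by (rule emb_Ftot) (auto simp: e_vec_def)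

lemma unemb_add: "v : Ftot a ==> w : Ftot a ==> unemb (v + w) j = unemb v j + unemb w j"
  by (rule poly_mapping_eqI) (simp add: lookup_unemb[of _ a] fs.subspace_add[OF subspace_Ftot] lookup_add)

lemma unemb_0: "unemb 0 j = 0"
  using unemb_emb[of "%_. 0" "[]"] emb_Ftot[of "[]" "%_. 0"] by (rule_tac poly_mapping_eqI) (simp add: unemb_def)

lemma unemb_pact: "v : Ftot a ==> unemb (pact r v) = (%j. r * unemb v j)"
  using unemb_emb[of "%j. r * unemb v j" a] emb_smult[of r "unemb v"] emb_unemb[of v a] pact_Ftot[of v a r] by simp

lemma eqv_commutes_pact: "eqv fv ==> fv (pact r v) = pact r (fv v)"
  unfolding pact_def by (simp only: flin_sum[OF eqv_flin] flin_scl[OF eqv_flin] eqv_sh)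

text \<open>A homomorphism of free modules is determined by its values on the basis vectors, which
  serve as the columns of \<open>gact\<close>.\<close>

lemma gact_of_hom:
  assumes add: "!!x y. x : Ftot b ==> y : Ftot b ==> D (x + y) = D x + D y" and zero: "D 0 = 0"
    and lin: "!!r x. x : Ftot b ==> D (pact r x) = pact r (D x)"
    and fin: "!!j. j < length b ==> finite {x. D (dirac (j, 0)) x ~= 0}" and v: "v : Ftot b"
  shows "D v = gact (length b) (%j. D (dirac (j, 0))) v"
proof -
  let ?g = "%j. D (dirac (j, 0))"
  have F: "pact (unemb v j) (dirac (j, 0)) : Ftot b" if "j < length b" for j by (intro pact_Ftot dirac_Ftot that)
  have Dsum: "D (\<Sum>j\<in>A. pact (unemb v j) (dirac (j, 0))) = (\<Sum>j\<in>A. pact (unemb v j) (?g j))" if "A <= {..<length b}" "finite A" for A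
    using that(2,1)
  proof (induction A rule: finite_induct)
    case (insert j A)
    have j: "j < length b" and A: "A <= {..<length b}" using insert.prems by auto
    have "(\<Sum>j\<in>A. pact (unemb v j) (dirac (j, 0))) : Ftot b" by (rule fs.subspace_sum[OF subspace_Ftot]) (use A F in auto)
    from add[OF F[OF j] this] show ?case unfolding sum.insert[OF insert.hyps] insert.IH[OF A] lin[OF dirac_Ftot[OF j]] .
  qed (simp add: zero)
  have "D v = (\<Sum>j<length b. pact (unemb v j) (?g j))" using Ftot_decomp[OF v] Dsum[of "{..<length b}"] by simp
  also have "\<dots> = (\<Sum>j<length b. pact (unemb v j) (gact (length b) ?g (dirac (j, 0))))"
    by (rule sum.cong) (use gact_dirac[of _ "length b" ?g 0] fin in simp_all)
  also have "\<dots> = gact (length b) ?g (\<Sum>j<length b. pact (unemb v j) (dirac (j, 0)))"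
    unfolding flin_sum[OF flin_gact] eqv_commutes_pact[OF eqv_gact] ..
  also have "\<dots> = gact (length b) ?g v" by (rule arg_cong[OF Ftot_decomp[OF v, symmetric]])
  finally show ?thesis .
qed

subsection \<open>Graded free resolutions\<close>

text \<open>A map between tuples of polynomials, read on exponent functions.\<close>

definition transport :: "((nat => ('n::finite, 'k::field) mpolynomial) => nat => ('n, 'k) mpolynomial) => ('n, 'k) lvec => ('n, 'k) lvec" where
  "transport dv v = emb (dv (unemb v))"

context
  fixes dv :: "(nat => ('n::{finite,linorder}, 'k::field) mpolynomial) => nat => ('n, 'k) mpolynomial" and a b :: "int list"
  assumes h: "dv : graded_hom (free_gmodule b) (free_gmodule a)"
begin

lemma free_hom: "dv : LinearCombinations.module_hom class_ring (free_gmodule b) (free_gmodule a)"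
  using h unfolding graded_hom_def by blast

lemma free_hom_closed: "w : FC b ==> dv w : FC a" using module_hom_closed[OF free_hom] by blast

lemma free_hom_add: "w : FC b ==> w' : FC b ==> dv (%j. w j + w' j) = (%j. dv w j + dv w' j)"
  using LinearCombinations.module_hom_add[OF free_hom, of w w'] by (simp add: free_gmodule_def)

lemma free_hom_smult: "w : FC b ==> dv (%j. r * w j) = (%j. r * dv w j)"
  using module_hom_smult[OF free_hom, of r w] by (simp add: free_gmodule_def)

lemma free_hom_comp: "w : component (free_gmodule b) t ==> dv w : component (free_gmodule a) t"
  using h unfolding graded_hom_def by blast

lemma transport_Ftot: "v : Ftot b ==> transport dv v : Ftot a"
  unfolding transport_def using free_hom_closed[OF unemb_carrier] emb_carrier by blast

lemma unemb_transport: "v : Ftot b ==> unemb (transport dv v) = dv (unemb v)"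
  unfolding transport_def by (rule unemb_emb[of _ a]) (use transport_Ftot[unfolded transport_def] in blast)

lemma transport_add: "v : Ftot b ==> w : Ftot b ==> transport dv (v + w) = transport dv v + transport dv w"
proof -
  assume vw: "v : Ftot b" "w : Ftot b"
  have "unemb (v + w) = (%j. unemb v j + unemb w j)" using unemb_add[OF vw] by blast
  then show ?thesis unfolding transport_def using free_hom_add[OF unemb_carrier[OF vw(1)] unemb_carrier[OF vw(2)]] by (simp add: emb_add)
qed

lemma transport_pact: "v : Ftot b ==> transport dv (pact r v) = pact r (transport dv v)"
  unfolding transport_def by (simp add: unemb_pact free_hom_smult unemb_carrier emb_smult)

lemma transport_0: "transport dv 0 = 0" using transport_pact[OF fs.subspace_0[OF subspace_Ftot], of 0] by simp

lemma transport_fr: "v : fr b t ==> transport dv v : fr a t"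
proof -
  assume v: "v : fr b t"
  then have F: "v : Ftot b" using fr_Ftot by blast
  have "unemb v : component (free_gmodule b) t" unfolding emb_component using v emb_unemb[OF F] unemb_carrier[OF F] by simp
  then show ?thesis unfolding transport_def using free_hom_comp emb_component by blast
qed

lemma transport_gact:
  assumes "v : Ftot b"
  shows "transport dv v = gact (length b) (%j. transport dv (dirac (j, 0))) v"
proof (rule gact_of_hom)
  show "finite {x. transport dv (dirac (j, 0)) x ~= 0}" if "j < length b" for j
    using transport_Ftot[OF dirac_Ftot[OF that]] unfolding Ftot_iff by blast
qed (use transport_add transport_pact transport_0 assms in blast)+

lemma transport_proj: "v : Ftot b ==> proj a t (transport dv v) = transport dv (proj b t v)"
proof -
  assume v: "v : Ftot b"
  obtain T where T: "finite T" "v = (\<Sum>t\<in>T. proj b t v)" "!!t. t ~: T ==> proj b t v = 0" using sum_proj[OF v] by metis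
  have P: "proj b s v : fr b s" for s by (rule proj_fr[OF v])
  have PF: "proj b s v : Ftot b" for s using P fr_Ftot by blast
  have g: "transport dv (\<Sum>s\<in>T. proj b s v) = (\<Sum>s\<in>T. transport dv (proj b s v))"
    unfolding transport_gact[OF fs.subspace_sum[OF subspace_Ftot PF]] transport_gact[OF PF] flin_sum[OF flin_gact] ..
  have "proj a t (transport dv v) = (\<Sum>s\<in>T. proj a t (transport dv (proj b s v)))"
    using T(2) g flin_sum[OF flin_proj] by metis
  also have "\<dots> = (\<Sum>s\<in>T. if s = t then transport dv (proj b t v) else 0)"
    by (rule sum.cong[OF refl]) (simp add: proj_of_fr[OF transport_fr[OF P]])
  also have "\<dots> = transport dv (proj b t v)" using T(1) T(3)[of t] transport_0 by (simp only: sum.delta) auto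
  finally show ?thesis .
qed

end

text \<open>Decompositions into homogeneous components in \<open>M\<close> are unique, so
  \<open>E\<close> commutes with taking components; this makes the kernel graded and each component
  of \<open>M\<close> the image of its counterpart.\<close>

lemma pres_of_hom:
  fixes M :: "(('n::{finite,linorder}, 'k::field) mpolynomial, 'm) gmodule"
  assumes M: "graded_module M" and li: "lin_image (Ftot a) M E"
    and sm: "!!r v. v : Ftot a ==> E (pact r v) = r \<odot>\<^bsub>M\<^esub> E v"
    and cp: "!!t v. v : fr a t ==> E v : component M t"
  shows "pres a M E"
proof -
  interpret M: graded_module M by (rule M)
  interpret L: lin_image "Ftot a" M E by (rule li)
  have uniq: "E (proj a t v) = f t"
    if v: "v : Ftot a" and f: "!!t. f t : component M t" "finite {t. f t ~= \<zero>\<^bsub>M\<^esub>}" "E v = (\<Oplus>\<^bsub>M\<^esub>t\<in>{t. f t ~= \<zero>\<^bsub>M\<^esub>}. f t)" for v f t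
  proof -
    obtain T where T: "finite T" "v = (\<Sum>t\<in>T. proj a t v)" "!!t. t ~: T ==> proj a t v = 0" using sum_proj[OF v] by metis
    let ?e = "%t. E (proj a t v)"
    define P where "P f \<longleftrightarrow> (\<forall>t. f t : component M t) & finite {t. f t ~= \<zero>\<^bsub>M\<^esub>} & E v = (\<Oplus>\<^bsub>M\<^esub>t\<in>{t. f t ~= \<zero>\<^bsub>M\<^esub>}. f t)" for f
    have PF: "proj a s v : Ftot a" for s using proj_fr[OF v] fr_Ftot by blast
    have sub: "{t. ?e t ~= \<zero>\<^bsub>M\<^esub>} <= T" using T(3) L.hzero by force
    have "E v = (\<Oplus>\<^bsub>M\<^esub>t\<in>T. ?e t)" using L.hsum[of T "%t. proj a t v", OF PF] T(2) by simp
    also have "\<dots> = (\<Oplus>\<^bsub>M\<^esub>t\<in>{t. ?e t ~= \<zero>\<^bsub>M\<^esub>}. ?e t)"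
    proof -
      let ?T = "{t. ?e t ~= \<zero>\<^bsub>M\<^esub>}"
      have "(\<Oplus>\<^bsub>M\<^esub>t\<in>T - ?T. ?e t) = (\<Oplus>\<^bsub>M\<^esub>t\<in>T - ?T. \<zero>\<^bsub>M\<^esub>)"
        by (rule M.M.finsum_cong'[OF refl]) auto
      then have z: "(\<Oplus>\<^bsub>M\<^esub>t\<in>T - ?T. ?e t) = \<zero>\<^bsub>M\<^esub>" using M.M.finsum_zero by simp
      have "(\<Oplus>\<^bsub>M\<^esub>t\<in>(T - ?T) Un ?T. ?e t) = (\<Oplus>\<^bsub>M\<^esub>t\<in>T - ?T. ?e t) \<oplus>\<^bsub>M\<^esub> (\<Oplus>\<^bsub>M\<^esub>t\<in>?T. ?e t)"
        by (rule M.M.finsum_Un_disjoint) (use T(1) finite_subset[OF sub T(1)] L.closed[OF PF] in auto)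
      moreover have "(T - ?T) Un ?T = T" using sub by blast
      moreover have "(\<Oplus>\<^bsub>M\<^esub>t\<in>?T. ?e t) : carrier M" by (rule M.M.finsum_closed) (use L.closed[OF PF] in auto)
      ultimately show ?thesis using z M.M.l_zero by simp
    qed
    finally have "(\<forall>t. ?e t : component M t) & finite {t. ?e t ~= \<zero>\<^bsub>M\<^esub>} & E v = (\<Oplus>\<^bsub>M\<^esub>t\<in>{t. ?e t ~= \<zero>\<^bsub>M\<^esub>}. ?e t)"
      using cp[OF proj_fr[OF v]] finite_subset[OF sub T(1)] by blast
    moreover have "(\<forall>t. f t : component M t) & finite {t. f t ~= \<zero>\<^bsub>M\<^esub>} & E v = (\<Oplus>\<^bsub>M\<^esub>t\<in>{t. f t ~= \<zero>\<^bsub>M\<^esub>}. f t)"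
      using f by blast
    ultimately have "P ?e" "P f" unfolding P_def by blast+
    moreover have "\<exists>!f. P f" unfolding P_def by (rule M.component_direct_sum[OF L.closed[OF v]])
    ultimately have "?e = f" by blast
    then show ?thesis by (rule fun_cong)
  qed
  have comp0: "\<zero>\<^bsub>M\<^esub> : component M t" for t using subgroup.one_closed[OF M.component_subgroup] by simp
  have compM: "component M t <= carrier M" for t using subgroup.subset[OF M.component_subgroup] by simp
  show ?thesis
  proof (intro pres.intro[OF li] pres_axioms.intro)
    show "E (pact r v) = r \<odot>\<^bsub>M\<^esub> E v" if "v : Ftot a" for r v by (rule sm[OF that])
    show "E (proj a t v) = \<zero>\<^bsub>M\<^esub>" if "v : Ftot a" "E v = \<zero>\<^bsub>M\<^esub>" for v t
      by (rule uniq[OF that(1), of "%_. \<zero>\<^bsub>M\<^esub>"]) (use comp0 that(2) in auto)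
    show "E ` fr a t = component M t" for t
    proof
      show "E ` fr a t <= component M t" using cp by blast
      show "component M t <= E ` fr a t"
      proof
        fix x assume x: "x : component M t"
        then obtain v where v: "v : Ftot a" "x = E v" using compM L.obtain_pre by blast
        let ?f = "%s. if s = t then x else \<zero>\<^bsub>M\<^esub>"
        have "E (proj a t v) = ?f t"
        proof (rule uniq[of v ?f t, OF v(1)])
          show "?f s : component M s" for s using x comp0 by simp
          show "finite {s. ?f s ~= \<zero>\<^bsub>M\<^esub>}" by (rule finite_subset[of _ "{t}"]) auto
          show "E v = (\<Oplus>\<^bsub>M\<^esub>s\<in>{s. ?f s ~= \<zero>\<^bsub>M\<^esub>}. ?f s)"
          proof (cases "x = \<zero>\<^bsub>M\<^esub>")
            case True
            then show ?thesis using v(2) by simp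
          next
            case False
            then have "{s. ?f s ~= \<zero>\<^bsub>M\<^esub>} = {t}" by auto
            moreover have "(\<Oplus>\<^bsub>M\<^esub>s\<in>{t}. ?f s) = ?f t \<oplus>\<^bsub>M\<^esub> (\<Oplus>\<^bsub>M\<^esub>s\<in>{}. ?f s)"
              by (rule M.M.finsum_insert) (use x compM in auto)
            moreover have "x \<oplus>\<^bsub>M\<^esub> \<zero>\<^bsub>M\<^esub> = x" by (rule M.M.r_zero) (use x compM in blast)
            ultimately show ?thesis using v(2) by (simp add: M.M.finsum_empty)
          qed
        qed
        then have "x = E (proj a t v)" by simp
        then show "x : E ` fr a t" using proj_fr[OF v(1), of t] by blast
      qed
    qed
  qed
qed

locale gres =
  fixes M :: "(('n::{finite,linorder}, 'k::field) mpolynomial, 'm) gmodule" and a dv ev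
  assumes M: "graded_module M" and res: "graded_free_resolution M a dv ev"
begin

lemma hom: "dv q : graded_hom (free_gmodule (a (Suc q))) (free_gmodule (a q))"
  using res unfolding graded_free_resolution_def by blast

lemma pres_eps: "pres (a 0) M (%v. ev (unemb v))"
proof (rule pres_of_hom[OF M])
  interpret M: graded_module M by (rule M)
  have e: "ev : graded_hom (free_gmodule (a 0)) M" and sur: "ev ` FC (a 0) = carrier M"
    using res unfolding graded_free_resolution_def by blast+
  have m: "ev : LinearCombinations.module_hom class_ring (free_gmodule (a 0)) M" using e unfolding graded_hom_def by blast
  have add: "ev (%j. w j + w' j) = ev w \<oplus>\<^bsub>M\<^esub> ev w'" if "w : FC (a 0)" "w' : FC (a 0)" for w w'
    using LinearCombinations.module_hom_add[OF m that] by (simp add: free_gmodule_def)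
  have sm: "ev (%j. r * w j) = r \<odot>\<^bsub>M\<^esub> ev w" if "w : FC (a 0)" for r w
    using module_hom_smult[OF m _ that, of r] by (simp add: free_gmodule_def)
  show lsm: "ev (unemb (pact r v)) = r \<odot>\<^bsub>M\<^esub> ev (unemb v)" if "v : Ftot (a 0)" for r v
    unfolding unemb_pact[OF that] by (rule sm[OF unemb_carrier[OF that]])
  show "ev (unemb v) : component M t" if v: "v : fr (a 0) t" for t v
  proof -
    have F: "v : Ftot (a 0)" using v fr_Ftot by blast
    have "unemb v : component (free_gmodule (a 0)) t" unfolding emb_component using v emb_unemb[OF F] unemb_carrier[OF F] by simp
    then show ?thesis using e unfolding graded_hom_def by blast
  qed
  have un: "unemb ` Ftot (a 0) = FC (a 0)" using unemb_carrier emb_carrier[of "a 0"] unemb_emb[of _ "a 0"] by force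
  show "lin_image (Ftot (a 0)) M (%v. ev (unemb v))"
  proof (rule lin_image.intro)
    show "(%v. ev (unemb v)) ` Ftot (a 0) = carrier M" using sur un by (metis image_image)
    show "ev (unemb (x + y)) = ev (unemb x) \<oplus>\<^bsub>M\<^esub> ev (unemb y)" if xy: "x : Ftot (a 0)" "y : Ftot (a 0)" for x y
    proof -
      have "unemb (x + y) = (%j. unemb x j + unemb y j)" using unemb_add[OF xy] by blast
      then show ?thesis using add[OF unemb_carrier[OF xy(1)] unemb_carrier[OF xy(2)]] by simp
    qed
    have "0 : Ftot (a 0)" by (rule fs.subspace_0[OF subspace_Ftot])
    note z = this
    have "ev (unemb (pact 0 0)) = \<zero>\<^bsub>M\<^esub>"
      unfolding lsm[OF z] using M.smult_l_null[OF funcset_mem[OF module_hom_closed[OF m] unemb_carrier[OF z]]] by (simp add: class_ring_simps)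
    then show "ev (unemb 0) = \<zero>\<^bsub>M\<^esub>" by (simp only: pact_0)
  qed (rule subspace_Ftot)
qed

sublocale pres "a 0" M "%v. ev (unemb v)" by (rule pres_eps)

definition g :: "nat => nat => ('n, 'k) lvec" where
  "g q j = transport (dv q) (dirac (j, 0))"

abbreviation "T q \<equiv> transport (dv q)"

lemma T_gact: "v : Ftot (a (Suc q)) ==> T q v = gact (length (a (Suc q))) (g q) v" unfolding g_def using transport_gact[OF hom] .

lemma T_exact: "T (Suc q) ` Ftot (a (Suc (Suc q))) = {v \<in> Ftot (a (Suc q)). T q v = 0}"
proof -
  have ex: "dv (Suc q) ` FC (a (Suc (Suc q))) = {v \<in> FC (a (Suc q)). dv q v = (%_. 0)}"
    using res unfolding graded_free_resolution_def by blast
  have z: "T q v = 0 \<longleftrightarrow> dv q (unemb v) = (%_. 0)" if v: "v : Ftot (a (Suc q))" for v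
  proof
    assume "T q v = 0"
    then have "dv q (unemb v) = unemb 0" using unemb_transport[OF hom v] by simp
    then show "dv q (unemb v) = (%_. 0)" by (simp add: fun_eq_iff unemb_0)
  qed (simp add: transport_def emb_def fun_eq_iff)
  have em: "emb w : Ftot (a p)" "unemb (emb w) = w" if "w : FC (a p)" for w p
    using emb_carrier[of "a p"] that unemb_emb[of w "a p"] by auto
  show ?thesis
  proof
    show "T (Suc q) ` Ftot (a (Suc (Suc q))) <= {v \<in> Ftot (a (Suc q)). T q v = 0}"
    proof
      fix y assume "y : T (Suc q) ` Ftot (a (Suc (Suc q)))"
      then obtain v where v: "v : Ftot (a (Suc (Suc q)))" "y = T (Suc q) v" by blast
      have y: "y : Ftot (a (Suc q))" unfolding v(2) by (rule transport_Ftot[OF hom v(1)])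
      have "dv (Suc q) (unemb v) : {v \<in> FC (a (Suc q)). dv q v = (%_. 0)}"
        unfolding ex[symmetric] by (intro imageI unemb_carrier v(1))
      then have "T q y = 0" unfolding z[OF y] unfolding v(2) unemb_transport[OF hom v(1)] by blast
      then show "y : {v \<in> Ftot (a (Suc q)). T q v = 0}" using y by blast
    qed
    show "{v \<in> Ftot (a (Suc q)). T q v = 0} <= T (Suc q) ` Ftot (a (Suc (Suc q)))"
    proof
      fix y assume "y : {v \<in> Ftot (a (Suc q)). T q v = 0}"
      then have y: "y : Ftot (a (Suc q))" "T q y = 0" by blast+
      then have "unemb y : dv (Suc q) ` FC (a (Suc (Suc q)))" unfolding ex using z unemb_carrier by blast
      then obtain w where w: "w : FC (a (Suc (Suc q)))" "unemb y = dv (Suc q) w" by blast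
      have "T (Suc q) (emb w) = y" unfolding transport_def em(2)[OF w(1)] w(2)[symmetric] by (rule emb_unemb[OF y(1)])
      then show "y : T (Suc q) ` Ftot (a (Suc (Suc q)))" using em(1)[OF w(1)] by blast
    qed
  qed
qed

lemma T_exact_0: "T 0 ` Ftot (a 1) = {v \<in> Ftot (a 0). ev (unemb v) = \<zero>\<^bsub>M\<^esub>}"
proof -
  have ex: "dv 0 ` FC (a 1) = {v \<in> FC (a 0). ev v = \<zero>\<^bsub>M\<^esub>}"
    using res unfolding graded_free_resolution_def by blast
  have em: "emb w : Ftot (a p)" "unemb (emb w) = w" if "w : FC (a p)" for w p
    using emb_carrier[of "a p"] that unemb_emb[of w "a p"] by auto
  have un: "unemb (T 0 v) = dv 0 (unemb v)" "T 0 v : Ftot (a 0)" if "v : Ftot (a 1)" for v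
    using unemb_transport[OF hom, of v 0] transport_Ftot[OF hom, of v 0] that by simp_all
  show ?thesis
  proof
    show "T 0 ` Ftot (a 1) <= {v \<in> Ftot (a 0). ev (unemb v) = \<zero>\<^bsub>M\<^esub>}"
      using un ex unemb_carrier[of _ "a 1"] by fastforce
    show "{v \<in> Ftot (a 0). ev (unemb v) = \<zero>\<^bsub>M\<^esub>} <= T 0 ` Ftot (a 1)"
    proof
      fix y assume "y : {v \<in> Ftot (a 0). ev (unemb v) = \<zero>\<^bsub>M\<^esub>}"
      then have y: "y : Ftot (a 0)" "ev (unemb y) = \<zero>\<^bsub>M\<^esub>" by blast+
      then have "unemb y : dv 0 ` FC (a 1)" unfolding ex using unemb_carrier by blast
      then obtain w where w: "w : FC (a 1)" "unemb y = dv 0 w" by blast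
      have "T 0 (emb w) = y" unfolding transport_def em(2)[OF w(1)] w(2)[symmetric] by (rule emb_unemb[OF y(1)])
      then show "y : T 0 ` Ftot (a 1)" using em(1)[OF w(1)] by blast
    qed
  qed
qed

lemma fr_image_gact: "gact (length (a (Suc q))) (g q) ` fr (a (Suc q)) t = fr (a q) t Int T q ` Ftot (a (Suc q))"
proof
  have F: "v : Ftot (a q)" if "v : fr (a q) t" for v q using that fr_Ftot by blast
  show "gact (length (a (Suc q))) (g q) ` fr (a (Suc q)) t <= fr (a q) t Int T q ` Ftot (a (Suc q))"
    using T_gact[OF F] transport_fr[OF hom] F by force
  show "fr (a q) t Int T q ` Ftot (a (Suc q)) <= gact (length (a (Suc q))) (g q) ` fr (a (Suc q)) t"
  proof
    fix y assume y: "y : fr (a q) t Int T q ` Ftot (a (Suc q))"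
    then obtain v where v: "v : Ftot (a (Suc q))" "y = T q v" by blast
    have "y = proj (a q) t y" using proj_of_fr[of y "a q" t t] y by simp
    also have "\<dots> = T q (proj (a (Suc q)) t v)" unfolding v(2) by (rule transport_proj[OF hom v(1)])
    also have "\<dots> = gact (length (a (Suc q))) (g q) (proj (a (Suc q)) t v)" by (rule T_gact[OF F[OF proj_fr[OF v(1)]]])
    finally show "y : gact (length (a (Suc q))) (g q) ` fr (a (Suc q)) t" using proj_fr[OF v(1)] by blast
  qed
qed

lemma conc: "conc_res a g ker"
proof
  show "gsub ker" by (rule gsub_ker)
  show "ker t <= fr (a 0) t" for t by (rule ker_fr)
  have F: "v : Ftot (a q)" if "v : fr (a q) t" for v q t using that fr_Ftot by blast
  show "g q j : fr (a q) (a (Suc q) ! j)" if j: "j < length (a (Suc q))" for q j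
  proof -
    have "dirac (j, 0) : fr (a (Suc q)) (a (Suc q) ! j)" using j by (auto simp: fr_iff dirac_def split: if_splits)
    then show ?thesis unfolding g_def by (rule transport_fr[OF hom])
  qed
  show "gact (length (a (Suc 0))) (g 0) ` fr (a (Suc 0)) t = ker t" for t
    unfolding fr_image_gact using T_exact_0 F unfolding ker_def by auto
  show "gact (length (a (Suc (Suc q)))) (g (Suc q)) ` fr (a (Suc (Suc q))) t
      = {v \<in> fr (a (Suc q)) t. gact (length (a (Suc q))) (g q) v = 0}" for q t
    unfolding fr_image_gact T_exact using T_gact[OF F] F by auto
qed

end

subsection \<open>Ext with values in the polynomial ring\<close>

text \<open>The functional sending the \<open>j\<close>-th basis vector to \<open>unemb f j\<close>;
  \<open>hmr\<close> restricts it to the carrier because \<open>Hom_gmodule\<close> consists of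
  extensional functions.\<close>

definition hm :: "int list => ('n::finite, 'k::field) lvec => (nat => ('n, 'k) mpolynomial) => ('n, 'k) mpolynomial" where
  "hm a f w = (\<Sum>j<length a. w j * unemb f j)"

definition hmr :: "int list => ('n::finite, 'k::field) lvec => (nat => ('n, 'k) mpolynomial) => ('n, 'k) mpolynomial" where
  "hmr a f = restrict (hm a f) (FC a)"

abbreviation HomR :: "int list => (('n::finite, 'k::field) mpolynomial, (nat => ('n, 'k) mpolynomial) => ('n, 'k) mpolynomial) gmodule" where
  "HomR a \<equiv> Hom_gmodule (free_gmodule a) ring_gmodule"

lemma hmr_apply: "w : FC a ==> hmr a f w = hm a f w" by (simp add: hmr_def)

lemma hmr_eqI: "(!!w. w : FC a ==> hm a f w = h w) ==> hmr a f = (\<lambda>w\<in>FC a. h w)"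
  unfolding hmr_def by (rule restrict_ext)

lemma hm_e_vec: "j < length a ==> hm a f (e_vec j) = unemb f j"
proof -
  assume j: "j < length a"
  have "hm a f (e_vec j) = (\<Sum>i<length a. if i = j then unemb f j else 0)" unfolding hm_def e_vec_def by (rule sum.cong) auto
  then show ?thesis using j by simp
qed

lemma free_add_closed: "w : FC a ==> w' : FC a ==> (%j. w j + w' j) : FC a"
  and free_smult_closed: "w : FC a ==> (%j. r * w j) : FC a" by (simp_all add: carrier_free)

lemma Hom_carrier_iff:
  "h : carrier (HomR a) \<longleftrightarrow> h : extensional (FC a) \<and>
    (\<forall>w\<in>FC a. \<forall>w'\<in>FC a. h (%j. w j + w' j) = h w + h w') \<and>
    (\<forall>r. \<forall>w\<in>FC a. h (%j. r * w j) = r * h w)"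
proof -
  have 1: "x \<oplus>\<^bsub>free_gmodule a\<^esub> y = (%j. x j + y j)" "r \<odot>\<^bsub>free_gmodule a\<^esub> x = (%j. r * x j)" for x y :: "nat => ('a, 'b) mpolynomial" and r
    by (simp_all add: free_gmodule_def)
  have 2: "carrier ring_gmodule = (UNIV :: ('a, 'b) mpolynomial set)" "p \<oplus>\<^bsub>ring_gmodule\<^esub> q = p + q" "p \<odot>\<^bsub>ring_gmodule\<^esub> q = p * q" for p q :: "('a, 'b) mpolynomial"
    by (simp_all add: ring_gmodule_def)
  have "carrier (HomR a) = LinearCombinations.module_hom class_ring (free_gmodule a) (ring_gmodule :: (('a, 'b) mpolynomial, ('a, 'b) mpolynomial) gmodule) Int extensional (FC a)"
    by (simp add: Hom_gmodule_def)
  then show ?thesis unfolding LinearCombinations.module_hom_def 1 2 by auto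
qed

lemma hm_add2: "hm a f (%j. w j + w' j) = hm a f w + hm a f w'" by (simp add: hm_def distrib_right sum.distrib)

lemma hm_smult2: "hm a f (%j. r * w j) = r * hm a f w" by (simp add: hm_def sum_distrib_left mult.assoc)

lemma hmr_Hom: "hmr a f : carrier (HomR a)" unfolding Hom_carrier_iff
  by (auto simp: hmr_def hm_add2 hm_smult2 free_add_closed free_smult_closed)

lemma Hom_linear:
  assumes h: "h : carrier (HomR a)" and w: "w : FC a"
  shows "h w = (\<Sum>j<length a. w j * h (e_vec j))"
proof -
  have add: "h (%j. w j + w' j) = h w + h w'" if "w : FC a" "w' : FC a" for w w' using h that unfolding Hom_carrier_iff by blast
  have sm: "h (%j. r * w j) = r * h w" if "w : FC a" for r w using h that unfolding Hom_carrier_iff by blast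
  have "h (%i. \<Sum>j\<in>A. w j * e_vec j i) = (\<Sum>j\<in>A. w j * h (e_vec j))" if "finite A" "A <= {..<length a}" for A
    using that
  proof (induction A rule: finite_induct)
    case empty
    have "h (%j. 0 * (%_. 0) j) = 0 * h (%_. 0)" by (rule sm) (simp add: carrier_free)
    then show ?case by simp
  next
    case (insert x A)
    have c: "e_vec j : FC a" if "j : insert x A" for j using that insert.prems by (intro e_vec_carrier) auto
    have "h (%i. w x * e_vec x i + (\<Sum>j\<in>A. w j * e_vec j i)) = h (%i. w x * e_vec x i) + h (%i. \<Sum>j\<in>A. w j * e_vec j i)"
    proof (rule add[of "%i. w x * e_vec x i" "%i. \<Sum>j\<in>A. w j * e_vec j i"])
      show "(%i. w x * e_vec x i) : FC a" by (rule free_smult_closed[OF c]) simp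
      show "(%i. \<Sum>j\<in>A. w j * e_vec j i) : FC a"
        using insert.prems unfolding carrier_free by (auto intro!: sum.neutral simp: e_vec_def)
    qed
    then show ?case using insert sm[OF c[of x]] by simp
  qed
  from this[of "{..<length a}"] show ?thesis using free_decomp[OF w] by simp
qed

lemma Hom_eq_hmr:
  fixes h :: "(nat => ('n::finite, 'k::field) mpolynomial) => ('n, 'k) mpolynomial"
  assumes h: "h : carrier (HomR a)"
  defines "f \<equiv> emb (%j. if j < length a then h (e_vec j) else 0)"
  shows "f : Ftot a" "h = hmr a f" "!!j. j < length a ==> unemb f j = h (e_vec j)"
proof -
  show F: "f : Ftot a" unfolding f_def by (rule emb_Ftot) simp
  have u: "unemb f = (%j. if j < length a then h (e_vec j) else 0)" using F unfolding f_def by (rule unemb_emb)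
  then show "!!j. j < length a ==> unemb f j = h (e_vec j)" by simp
  show "h = hmr a f"
  proof (rule extensionalityI[of _ "FC a"])
    show "h : extensional (FC a)" using h unfolding Hom_carrier_iff by blast
    show "hmr a f : extensional (FC a)" by (simp add: hmr_def)
    show "h w = hmr a f w" if "w : FC a" for w
      unfolding Hom_linear[OF h that] hmr_apply[OF that] hm_def by (rule sum.cong) (simp_all add: u)
  qed
qed

lemma lin_image_Hom: "lin_image (Ftot a) (HomR a) (hmr a :: ('n::finite, 'k::field) lvec => _)"
proof (rule lin_image.intro)
  show "fs.subspace (Ftot a :: ('n, 'k) lvec set)" by (rule subspace_Ftot)
  show "hmr a ` Ftot a = carrier (HomR a)"
  proof
    show "hmr a ` Ftot a <= carrier (HomR a)" using hmr_Hom by blast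
    show "carrier (HomR a) <= hmr a ` Ftot a" using Hom_eq_hmr by blast
  qed
  show "hmr a (x + y) = hmr a x \<oplus>\<^bsub>HomR a\<^esub> hmr a y" if xy: "x : Ftot a" "y : Ftot a" for x y :: "('n, 'k) lvec"
  proof -
    have "hmr a x \<oplus>\<^bsub>HomR a\<^esub> hmr a y = (\<lambda>w\<in>FC a. hmr a x w + hmr a y w)"
      by (simp add: Hom_gmodule_def ring_gmodule_def)
    moreover have "hmr a (x + y) = (\<lambda>w\<in>FC a. hmr a x w + hmr a y w)"
      by (rule hmr_eqI) (simp add: hmr_apply hm_def unemb_add[OF xy] distrib_left sum.distrib)
    ultimately show ?thesis by simp
  qed
  have z1: "hmr a 0 = (\<lambda>w\<in>FC a. 0 :: ('n, 'k) mpolynomial)"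
    by (rule hmr_eqI) (simp add: hm_def unemb_0 del: zero_fun_apply)
  have z2: "\<zero>\<^bsub>HomR a\<^esub> = (\<lambda>w\<in>FC a. 0 :: ('n, 'k) mpolynomial)"
    by (simp add: Hom_gmodule_def ring_gmodule_def)
  show "hmr a (0 :: ('n, 'k) lvec) = \<zero>\<^bsub>HomR a\<^esub>" by (rule trans[OF z1 z2[symmetric]])
qed

lemma hmr_smult:
  assumes "f : Ftot a"
  shows "r \<odot>\<^bsub>HomR a\<^esub> hmr a f = hmr a (pact r f)"
proof -
  have "hmr a (pact r f) = (\<lambda>w\<in>FC a. r * hmr a f w)"
    by (rule hmr_eqI) (simp add: hmr_apply hm_def unemb_pact[OF assms] sum_distrib_left mult.left_commute)
  then show ?thesis by (simp add: Hom_gmodule_def ring_gmodule_def)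
qed

lemma hmr_eq_0:
  assumes f: "f : Ftot a" and z: "hmr a f = \<zero>\<^bsub>HomR a\<^esub>"
  shows "f = 0"
proof -
  have "unemb f j = 0" for j
  proof (cases "j < length a")
    case True
    have "hmr a f (e_vec j) = 0" unfolding z by (simp add: Hom_gmodule_def ring_gmodule_def e_vec_carrier[OF True])
    then show ?thesis using hmr_apply[OF e_vec_carrier[OF True]] hm_e_vec[OF True] by metis
  next
    case False
    then show ?thesis using unemb_outside[OF f] by simp
  qed
  then have "unemb f = (%_. 0)" by blast
  then have "emb (unemb f) = 0" by (simp add: emb_def fun_eq_iff)
  then show ?thesis using emb_unemb[OF f] by simp
qed

lemma hmr_component: "hmr a ` (fr (dual_shifts a) \<mu> :: ('n::finite, 'k::field) lvec set) = component (HomR a) \<mu>"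
proof
  have len: "length (dual_shifts a) = length a" and nth: "!!j. j < length a ==> dual_shifts a ! j = - a ! j"
    by (simp_all add: dual_shifts_def)
  have C: "component (HomR a) \<mu> = {h :: (nat => ('n, 'k) mpolynomial) => ('n, 'k) mpolynomial.
      h : carrier (HomR a) & (\<forall>t. h ` component (free_gmodule a) t <= homogeneous_part (t + \<mu>))}"
    by (simp add: Hom_gmodule_def ring_gmodule_def)
  show "hmr a ` (fr (dual_shifts a) \<mu> :: ('n, 'k) lvec set) <= component (HomR a) \<mu>"
  proof
    fix h assume "h : hmr a ` (fr (dual_shifts a) \<mu> :: ('n, 'k) lvec set)"
    then obtain f :: "('n, 'k) lvec" where f: "f : fr (dual_shifts a) \<mu>" "h = hmr a f" by blast
    have F: "f : Ftot (dual_shifts a)" using f(1) fr_Ftot by blast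
    have u: "unemb f : component (free_gmodule (dual_shifts a)) \<mu>"
      unfolding emb_component using f(1) emb_unemb[OF F] unemb_carrier[OF F] by simp
    have uj: "unemb f j : homogeneous_part (\<mu> + a ! j)" if "j < length a" for j
    proof -
      have "unemb f j : homogeneous_part (\<mu> - dual_shifts a ! j)" using u that by (simp add: free_gmodule_def len)
      then show ?thesis using nth[OF that] by simp
    qed
    have "h w : homogeneous_part (t + \<mu>)" if w: "w : component (free_gmodule a) t" for w t
    proof -
      have wc: "w : FC a" using w emb_component by blast
      have "w j * unemb f j : homogeneous_part (t + \<mu>)" if j: "j < length a" for j
      proof -
        have "w j : homogeneous_part (t - a ! j)" using w j by (simp add: free_gmodule_def)
        from homogeneous_part_mult[OF this uj[OF j]] show ?thesis by (simp add: algebra_simps)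
      qed
      then show ?thesis unfolding f(2) hmr_apply[OF wc] hm_def by (intro homogeneous_part_sum) simp
    qed
    then show "h : component (HomR a) \<mu>" unfolding C using hmr_Hom f(2) by blast
  qed
  show "component (HomR a) \<mu> <= hmr a ` (fr (dual_shifts a) \<mu> :: ('n, 'k) lvec set)"
  proof
    fix h :: "(nat => ('n, 'k) mpolynomial) => ('n, 'k) mpolynomial" assume "h : component (HomR a) \<mu>"
    then have h: "h : carrier (HomR a)" "!!t w. w : component (free_gmodule a) t ==> h w : homogeneous_part (t + \<mu>)"
      unfolding C by blast+
    define f where "f = emb (%j. if j < length a then h (e_vec j) else 0)"
    note f = Hom_eq_hmr[OF h(1), folded f_def]
    have F: "f : Ftot (dual_shifts a)" using f(1) Ftot_cong[OF len] by blast
    have "unemb f : component (free_gmodule (dual_shifts a)) \<mu>"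
    proof -
      have "unemb f j : homogeneous_part (\<mu> - dual_shifts a ! j)" if j: "j < length a" for j
      proof -
        have "e_vec j : component (free_gmodule a) (a ! j)"
          using j by (auto simp: free_gmodule_def e_vec_def homogeneous_part_def mono_degree_def)
        from h(2)[OF this] show ?thesis using f(3)[OF j] nth[OF j] by (simp add: add.commute)
      qed
      then show ?thesis using unemb_outside[OF F] by (simp add: free_gmodule_def len)
    qed
    then have "f : fr (dual_shifts a) \<mu>" unfolding emb_component using emb_unemb[OF F] by simp
    then show "h : hmr a ` fr (dual_shifts a) \<mu>" using f(2) by blast
  qed
qed

text \<open>In coordinates, the transposed map evaluates the functional \<open>f\<close> on each
  column \<open>g j\<close>; the convolution in \<open>tact\<close> is the resulting sum of products
  of polynomials.\<close>

lemma tact_eq_emb: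
  fixes f :: "('n::finite, 'k::field) lvec"
  assumes f: "f : Ftot a" and g: "!!j. j < L ==> g j : Ftot a"
  shows "tact L g f = emb (%j. if j < L then hm a f (unemb (g j)) else 0)"
proof
  fix x :: "nat \<times> ('n => int)"
  obtain j gv where x: "x = (j, gv)" by (cases x)
  show "tact L g f x = emb (%j. if j < L then hm a f (unemb (g j)) else 0) x"
  proof (cases "j < L")
    case False
    then show ?thesis by (simp add: x tact_def emb_def)
  next
    case True
    note gj = g[OF True]
    have supp: "finite {x. g j x ~= 0}" using gj by (simp add: Ftot_iff)
    let ?r = "%i. unemb (g j) i"
    show ?thesis
    proof (cases "0 <= gv")
      case False
      have "g j y * f (fst y, gv - snd y) = 0" for y
      proof (rule ccontr)
        assume "g j y * f (fst y, gv - snd y) ~= 0"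
        then have "0 <= snd y" "0 <= gv - snd y" using gj f unfolding Ftot_iff by (cases y; force)+
        then have "0 <= gv" using add_nonneg_nonneg[of "snd y" "gv - snd y"] by simp
        then show False using False by contradiction
      qed
      then show ?thesis using True False by (simp add: x tact_def emb_def)
    next
      case True2: True
      have term_eq: "lookup (?r i * unemb f i) (mexp gv)
          = (\<Sum>m\<in>keys (?r i). g j (i, iexp m) * f (i, gv - iexp m))" for i
      proof -
        have "lookup (?r i * unemb f i) (mexp gv) = emb (%i'. ?r i * unemb f i') (i, gv)" using True2 by (simp add: emb_def)
        also have "\<dots> = pact (?r i) f (i, gv)" unfolding emb_smult emb_unemb[OF f] ..
        also have "\<dots> = (\<Sum>m\<in>keys (?r i). g j (i, iexp m) * f (i, gv - iexp m))"
          by (simp add: pact_def fun_sum_apply lookup_unemb[OF gj])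
        finally show ?thesis .
      qed
      let ?I = "SIGMA i:{..<length a}. keys (?r i)" and ?e = "%(i, m). (i, iexp m)"
      have "emb (%j. if j < L then hm a f (unemb (g j)) else 0) x = (\<Sum>i<length a. lookup (?r i * unemb f i) (mexp gv))"
        using True True2 by (simp add: x emb_def hm_def lookup_sum)
      also have "\<dots> = (\<Sum>(i, m)\<in>?I. g j (i, iexp m) * f (i, gv - iexp m))" unfolding term_eq by (rule sum.Sigma) auto
      also have "\<dots> = (\<Sum>y\<in>?e ` ?I. g j y * f (fst y, gv - snd y))"
      proof (rule sum.reindex_cong[symmetric, of ?e ?I])
        show "inj_on ?e ?I" by (auto intro!: inj_onI simp: iexp_inj)
      qed auto
      also have "?e ` ?I = {y. g j y ~= 0}"
      proof
        show "?e ` ?I <= {y. g j y ~= 0}" by (auto simp: in_keys_iff lookup_unemb[OF gj])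
        show "{y. g j y ~= 0} <= ?e ` ?I"
        proof
          fix y assume "y : {y. g j y ~= 0}"
          then obtain i av where y: "y = (i, av)" "g j (i, av) ~= 0" by (cases y) auto
          have b: "i < length a" "0 <= av" using gj y(2) unfolding Ftot_iff by blast+
          have "mexp av : keys (?r i)" using y(2) iexp_mexp[OF b(2)] by (simp add: in_keys_iff lookup_unemb[OF gj])
          then show "y : ?e ` ?I" using b iexp_mexp[OF b(2)] y(1) by (intro image_eqI[of _ _ "(i, mexp av)"]) auto
        qed
      qed
      finally have "emb (%j. if j < L then hm a f (unemb (g j)) else 0) x = (\<Sum>y | g j y ~= 0. g j y * f (fst y, gv - snd y))" .
      moreover have "tact L g f x = (\<Sum>y | g j y ~= 0. g j y * f (fst y, gv - snd y))"
        by (simp only: x tact_def prod.case True if_True)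
      ultimately show ?thesis by (simp only:)
    qed
  qed
qed

context gres
begin

abbreviation "tq q \<equiv> tact (length (a (Suc q))) (g q)"

lemma g_Ftot: "j < length (a (Suc q)) ==> g q j : Ftot (a q)" unfolding g_def by (rule transport_Ftot[OF hom dirac_Ftot])

lemma tact_eq: "f : Ftot (a q) ==> tq q f = emb (%j. if j < length (a (Suc q)) then hm (a q) f (unemb (g q j)) else 0)"
  by (rule tact_eq_emb) (use g_Ftot in auto)

lemma tact_Ftot: "f : Ftot (a q) ==> tq q f : Ftot (a (Suc q))" by (simp only: tact_eq) (rule emb_Ftot, simp)

lemma hmr_tact:
  assumes f: "f : Ftot (a q)"
  shows "(\<lambda>v\<in>FC (a (Suc q)). hmr (a q) f (dv q v)) = hmr (a (Suc q)) (tq q f)"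
proof -
  let ?C = "FC (a (Suc q))"
  have u: "unemb (tq q f) j = hm (a q) f (unemb (g q j))" if "j < length (a (Suc q))" for j
    using unemb_emb[of "%j. if j < length (a (Suc q)) then hm (a q) f (unemb (g q j)) else 0" "a (Suc q)"]
      tact_Ftot[OF f] that unfolding tact_eq[OF f] by simp
  have gu: "unemb (g q j) = dv q (e_vec j)" if j: "j < length (a (Suc q))" for j
  proof -
    have "unemb (dirac (j, 0) :: ('n, 'k) lvec) = e_vec j"
      unfolding emb_e_vec[symmetric] by (rule unemb_emb[of _ "a (Suc q)"]) (unfold emb_e_vec, rule dirac_Ftot[OF j])
    then show ?thesis unfolding g_def unemb_transport[OF hom dirac_Ftot[OF j]] by simp
  qed
  have "(\<lambda>v\<in>?C. hm (a q) f (dv q v)) : carrier (HomR (a (Suc q)))" unfolding Hom_carrier_iff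
    by (auto simp: free_add_closed free_smult_closed free_hom_add[OF hom] free_hom_smult[OF hom] hm_add2 hm_smult2)
  note lin = Hom_linear[OF this]
  have "hm (a (Suc q)) (tq q f) v = hmr (a q) f (dv q v)" if v: "v : ?C" for v
  proof -
    have "hm (a q) f (dv q v) = (\<Sum>j<length (a (Suc q)). v j * hm (a q) f (dv q (e_vec j)))"
    proof -
      have "hm (a q) f (dv q v) = (\<lambda>v\<in>?C. hm (a q) f (dv q v)) v" using v by simp
      also have "\<dots> = (\<Sum>j<length (a (Suc q)). v j * (\<lambda>v\<in>?C. hm (a q) f (dv q v)) (e_vec j))" by (rule lin[OF v])
      also have "\<dots> = (\<Sum>j<length (a (Suc q)). v j * hm (a q) f (dv q (e_vec j)))"
        by (rule sum.cong) (simp_all add: e_vec_carrier)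
      finally show ?thesis .
    qed
    also have "\<dots> = hm (a (Suc q)) (tq q f) v" unfolding hm_def[of "a (Suc q)"] by (rule sum.cong) (simp_all add: u gu)
    finally show ?thesis using hmr_apply[OF free_hom_closed[OF hom v]] by simp
  qed
  then show ?thesis by (rule hmr_eqI[symmetric])
qed

lemma tact_tact: "f : Ftot (a q) ==> tq (Suc q) (tq q f) = 0"
proof (rule hmr_eq_0[of _ "a (Suc (Suc q))"])
  assume f: "f : Ftot (a q)"
  show "tq (Suc q) (tq q f) : Ftot (a (Suc (Suc q)))" by (intro tact_Ftot f)
  have dd0: "dv q (dv (Suc q) v) = (%_. 0)" if "v : FC (a (Suc (Suc q)))" for v
  proof -
    have "dv (Suc q) ` FC (a (Suc (Suc q))) = {v \<in> FC (a (Suc q)). dv q v = (%_. 0)}"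
      using res unfolding graded_free_resolution_def by blast
    then show ?thesis using that by blast
  qed
  have "hmr (a (Suc (Suc q))) (tq (Suc q) (tq q f)) = (\<lambda>v\<in>FC (a (Suc (Suc q))). 0)"
    unfolding hmr_tact[OF tact_Ftot[OF f], symmetric] hmr_tact[OF f, symmetric]
  proof (rule restrict_ext)
    fix v :: "nat => ('n, 'k) mpolynomial" assume v: "v : FC (a (Suc (Suc q)))"
    have "dv (Suc q) v : FC (a (Suc q))" by (rule free_hom_closed[OF hom v])
    then show "(\<lambda>v\<in>FC (a (Suc q)). hmr (a q) f (dv q v)) (dv (Suc q) v) = 0"
      using dd0[OF v] by (simp add: hmr_apply carrier_free hm_def)
  qed
  then show "hmr (a (Suc (Suc q))) (tq (Suc q) (tq q f)) = \<zero>\<^bsub>HomR (a (Suc (Suc q)))\<^esub>"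
    by (simp add: Hom_gmodule_def ring_gmodule_def)
qed

definition ExtR :: "nat => (('n, 'k) mpolynomial, ((nat => ('n, 'k) mpolynomial) => ('n, 'k) mpolynomial) set) gmodule" where
  "ExtR q = cohomology (%p. HomR (a p)) (%p h. \<lambda>v\<in>FC (a (Suc p)). h (dv p v)) q"

interpretation cr: conc_res a g ker by (rule conc)

text \<open>\<open>W\<close> holds the coboundaries of all degrees. Within \<open>ExtZ\<close> it
  contains \<open>ExtB\<close>, so the quotient is no larger than \<open>ExtZ\<close> modulo
  \<open>ExtB\<close>, which is enough for an upper bound. The last clause serves the statement on
  the initial degree.\<close>

lemma dim_Ext_le:
  assumes q: "q <= CARD('n)"
  shows "vectorspace.fin_dim class_ring (component_space (ExtR q) \<mu>) \<and>
    int (vectorspace.dim class_ring (component_space (ExtR q) \<mu>)) <= hI (int CARD('n) - int q) (fr (a 0)) ker (- \<mu> - int CARD('n)) \<and>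
    (vectorspace.dim class_ring (component_space (ExtR q) \<mu>) = 0 --> component (ExtR q) \<mu> = {\<zero>\<^bsub>ExtR q\<^esub>})"
proof -
  define D where "D p h = (\<lambda>v\<in>FC (a (Suc p)). h (dv p v))"
    for p and h :: "(nat => ('n, 'k) mpolynomial) => ('n, 'k) mpolynomial"
  have D: "D p (hmr (a p) f) = hmr (a (Suc p)) (tq p f)" if "f : Ftot (a p)" for p f unfolding D_def by (rule hmr_tact[OF that])
  define S where "S = sub_gmodule (HomR (a q)) {x \<in> carrier (HomR (a q)). D q x = \<zero>\<^bsub>HomR (a (Suc q))\<^esub>}"
  define Z where "Z = {f \<in> Ftot (a q). tq q f = 0}"
  define W where "W = (case q of 0 => {0} | Suc q' => tq q' ` Ftot (a q'))"
  note hi = lin_image_Hom[of "a q"]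
  have Dz: "D q (hmr (a q) f) = \<zero>\<^bsub>HomR (a (Suc q))\<^esub> \<longleftrightarrow> tq q f = 0" if f: "f : Ftot (a q)" for f
    unfolding D[OF f] using hmr_eq_0[OF tact_Ftot[OF f]] lin_image.hzero[OF lin_image_Hom, of "a (Suc q)"] by metis
  have ZF: "f : Ftot (a q)" if "f : Z" for f using that by (simp add: Z_def)
  have Wimg: "(case q of 0 => {\<zero>\<^bsub>HomR (a 0)\<^esub>} | Suc q' => D q' ` carrier (HomR (a q'))) = hmr (a q) ` W"
  proof (cases q)
    case 0
    show ?thesis unfolding 0 W_def nat.case by (simp only: image_insert image_empty lin_image.hzero[OF lin_image_Hom])
  next
    case (Suc q')
    have "D q' ` hmr (a q') ` Ftot (a q') = hmr (a q) ` tq q' ` Ftot (a q')"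
      unfolding image_image Suc by (rule image_cong[OF refl D])
    then show ?thesis unfolding lin_image.img[OF lin_image_Hom] by (simp add: Suc W_def)
  qed
  have Zsub: "fs.subspace Z"
  proof -
    have "Z = {f \<in> Ftot (a q). tq q f : {0}}" by (simp add: Z_def)
    then show ?thesis using subspace_vimage[OF flin_tact subspace_Ftot fs.subspace_single_0] by simp
  qed
  have WZ: "W <= Z"
  proof (cases q)
    case 0
    then show ?thesis using fs.subspace_0[OF Zsub] by (simp add: W_def)
  next
    case (Suc q')
    then show ?thesis using tact_Ftot[of _ q'] tact_tact[of _ q'] by (auto simp: W_def Z_def)
  qed
  interpret Q: lin_quot Z S "hmr (a q)" W
  proof (rule lin_quot.intro)
    show "lin_image Z S (hmr (a q))"
    proof (rule lin_image.intro)
      show "fs.subspace Z" by (rule Zsub)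
      have "carrier S = {x \<in> hmr (a q) ` Ftot (a q). D q x = \<zero>\<^bsub>HomR (a (Suc q))\<^esub>}"
        unfolding S_def sub_gmodule_def lin_image.img[OF hi] by simp
      also have "\<dots> = hmr (a q) ` Z" unfolding Z_def using Dz by blast
      finally show "hmr (a q) ` Z = carrier S" by simp
      show "hmr (a q) (x + y) = hmr (a q) x \<oplus>\<^bsub>S\<^esub> hmr (a q) y" if "x : Z" "y : Z" for x y
        using lin_image.hadd[OF hi ZF[OF that(1)] ZF[OF that(2)]] by (simp add: S_def sub_gmodule_def)
      show "hmr (a q) 0 = \<zero>\<^bsub>S\<^esub>" using lin_image.hzero[OF hi] by (simp add: S_def sub_gmodule_def)
    qed
    show "lin_quot_axioms Z S (hmr (a q)) W"
    proof
      show "fs.subspace W" by (cases q) (simp_all add: W_def fs.subspace_single_0 subspace_image[OF flin_tact subspace_Ftot])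
      show "W <= Z" by (rule WZ)
      show "v : W" if "v : Z" "hmr (a q) v = \<zero>\<^bsub>S\<^esub>" for v
      proof -
        have "v = 0" by (rule hmr_eq_0[OF ZF[OF that(1)]]) (use that(2) in \<open>simp add: S_def sub_gmodule_def\<close>)
        then show ?thesis using \<open>fs.subspace W\<close> fs.subspace_0 by blast
      qed
    qed
  qed
  have ext: "ExtR q = quot_gmodule S (hmr (a q) ` W)" unfolding ExtR_def cohomology_def D_def[symmetric] S_def Wimg[symmetric] ..
  let ?V = "component_space (ExtR q) \<mu>"
  have F: "Ftot (dual_shifts (a q)) = (Ftot (a q) :: ('n, 'k) lvec set)" by (rule Ftot_cong) (simp add: dual_shifts_def)
  have EZ: "f : Z" if "f : cr.ExtZ q \<mu>" for f
  proof -
    have f: "f : fr (dual_shifts (a q)) \<mu>" "tq q f = 0" using that by (simp_all add: cr.ExtZ_def)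
    have "f : Ftot (a q)" using subsetD[OF fr_Ftot f(1)] F by simp
    then show ?thesis using f(2) by (simp add: Z_def)
  qed
  have compS: "component S \<mu> = hmr (a q) ` cr.ExtZ q \<mu>"
  proof -
    have "component S \<mu> = {x \<in> hmr (a q) ` fr (dual_shifts (a q)) \<mu>. x : carrier (HomR (a q)) & D q x = \<zero>\<^bsub>HomR (a (Suc q))\<^esub>}"
      unfolding S_def sub_gmodule_def hmr_component by auto
    also have "\<dots> = hmr (a q) ` {f \<in> fr (dual_shifts (a q)) \<mu>. tq q f = 0}"
    proof -
      have "D q (hmr (a q) f) = \<zero>\<^bsub>HomR (a (Suc q))\<^esub> \<longleftrightarrow> tq q f = 0" if "f : fr (dual_shifts (a q)) \<mu>" for f
        by (rule Dz) (use subsetD[OF fr_Ftot that] F in simp)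
      then show ?thesis using hmr_Hom by blast
    qed
    finally show ?thesis unfolding cr.ExtZ_def .
  qed
  have li: "lin_image (cr.ExtZ q \<mu>) ?V Q.Q"
  proof (rule lin_image.intro)
    show "fs.subspace (cr.ExtZ q \<mu>)" by (rule cr.subspace_ExtZ)
    have "carrier ?V = {hmr (a q) ` W +>\<^bsub>S\<^esub> x | x. x : component S \<mu>}"
      by (simp add: component_space_def ext quot_gmodule_def)
    also have "\<dots> = Q.Q ` cr.ExtZ q \<mu>" unfolding compS Q.Q_def by blast
    finally show "Q.Q ` cr.ExtZ q \<mu> = carrier ?V" by simp
    show "Q.Q (x + y) = Q.Q x \<oplus>\<^bsub>?V\<^esub> Q.Q y" if "x : cr.ExtZ q \<mu>" "y : cr.ExtZ q \<mu>" for x y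
      using Q.Q_add[OF EZ EZ, OF that] by (simp add: component_space_def ext quot_gmodule_def)
    show "Q.Q 0 = \<zero>\<^bsub>?V\<^esub>" by (simp add: component_space_def ext quot_gmodule_def Q.Q_0)
  qed
  have sm: "Q.Q (scl c z) = c \<odot>\<^bsub>?V\<^esub> Q.Q z" if z0: "z : cr.ExtZ q \<mu>" for c z
  proof -
    note z = EZ[OF z0]
    have "c \<odot>\<^bsub>?V\<^esub> Q.Q z = (\<Union>x\<in>Q.Q z. hmr (a q) ` W +>\<^bsub>S\<^esub> (pconst c \<odot>\<^bsub>S\<^esub> x))"
      by (simp add: component_space_def ext quot_gmodule_def)
    also have "\<dots> = (\<Union>x\<in>Q.Q z. Q.Q (scl c z))"
    proof (rule SUP_cong[OF refl])
      fix x assume "x : Q.Q z"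
      then obtain w where w: "w : W" "x = hmr (a q) (w + z)" unfolding Q.Q_eq[OF z] by blast
      have wz: "w + z : Z" by (rule fs.subspace_add[OF Zsub Q.W_F[OF w(1)] z])
      have "pconst c \<odot>\<^bsub>S\<^esub> x = hmr (a q) (scl c (w + z))"
        unfolding w(2) scl_pact using hmr_smult[OF ZF[OF wz], of "pconst c"] by (simp add: S_def sub_gmodule_def pconst_def)
      then have "hmr (a q) ` W +>\<^bsub>S\<^esub> (pconst c \<odot>\<^bsub>S\<^esub> x) = Q.Q (scl c (w + z))" by (simp only: Q.Q_def)
      also have "\<dots> = Q.Q (scl c z)"
      proof (rule iffD2[OF Q.Q_eq_iff])
        show "scl c (w + z) : Z" "scl c z : Z" by (intro fs.subspace_scale[OF Zsub] wz z)+
        have "scl c (w + z) - scl c z = scl c w" by (simp add: fun_eq_iff algebra_simps)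
        then show "scl c (w + z) - scl c z : W" using fs.subspace_scale[OF Q.Wsub w(1)] by simp
      qed
      finally show "hmr (a q) ` W +>\<^bsub>S\<^esub> (pconst c \<odot>\<^bsub>S\<^esub> x) = Q.Q (scl c z)" .
    qed
    also have "\<dots> = Q.Q (scl c z)" using fs.subspace_0[OF Q.Wsub] unfolding Q.Q_eq[OF z] by auto
    finally show ?thesis by simp
  qed
  let ?K = "{z \<in> cr.ExtZ q \<mu>. Q.Q z = \<zero>\<^bsub>?V\<^esub>}" and ?h = "hh (int CARD('n) - int q) (fr (a 0)) ker (- \<mu> - int CARD('n))"
  have BW: "cr.ExtB q \<mu> <= W"
  proof (cases q)
    case 0
    then show ?thesis by (simp add: cr.ExtB_def W_def)
  next
    case (Suc q')
    have e: "Ftot (a q') = (Ftot (dual_shifts (a q')) :: ('n, 'k) lvec set)" by (rule Ftot_cong) (simp add: dual_shifts_def)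
    have "fr (dual_shifts (a q')) \<mu> <= (Ftot (a q') :: ('n, 'k) lvec set)" unfolding e by (rule fr_Ftot)
    then show ?thesis unfolding cr.ExtB_def W_def Suc by auto
  qed
  have "cr.ExtB q \<mu> Int cr.ExtZ q \<mu> <= ?K"
    using BW Q.Q_zero_iff[OF EZ] by (auto simp: component_space_def ext quot_gmodule_def)
  have "qdim (cr.ExtZ q \<mu>) ?K <= qdim (cr.ExtZ q \<mu>) (cr.ExtB q \<mu>)"
    by (rule qdim_inj[of "%x. x", OF flinI cr.subspace_ExtZ cr.subspace_ExtB])
      (use \<open>cr.ExtB q \<mu> Int cr.ExtZ q \<mu> <= ?K\<close> in blast)+
  also have "\<dots> <= ?h" by (rule cr.Ext_le_local_cohomology[OF q])
  finally have le: "qdim (cr.ExtZ q \<mu>) ?K <= ?h" .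
  have fin: "?h ~= \<infinity>" by (rule hh_adm_finite[OF adm_ker])
  obtain m where m: "qdim (cr.ExtZ q \<mu>) ?K = enat m" using le fin by (cases "qdim (cr.ExtZ q \<mu>) ?K") auto
  have "vectorspace.fin_dim class_ring ?V & vectorspace.dim class_ring ?V = m" by (rule dim_lin_image[OF li sm m])
  moreover have "int m <= hI (int CARD('n) - int q) (fr (a 0)) ker (- \<mu> - int CARD('n))"
    using eint_mono[OF le fin] m by (simp add: hI_def eint_def)
  moreover have "component (ExtR q) \<mu> = {\<zero>\<^bsub>ExtR q\<^esub>}" if "m = 0"
  proof -
    have K: "?K = cr.ExtZ q \<mu> Int W" using Q.Q_zero_iff[OF EZ] by (auto simp: component_space_def ext quot_gmodule_def)
    have "qdim (cr.ExtZ q \<mu>) (cr.ExtZ q \<mu> Int W) = 0" using m K that by (simp add: zero_enat_def)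
    then have "cr.ExtZ q \<mu> <= ?K" unfolding K using qdim_eq_0_iff[OF fs.subspace_inter[OF cr.subspace_ExtZ Q.Wsub]] by blast
    then have "carrier ?V = {\<zero>\<^bsub>?V\<^esub>}"
      unfolding lin_image.img[OF li, symmetric] using fs.subspace_0[OF cr.subspace_ExtZ[of q \<mu>]] by auto
    then show ?thesis by (simp add: component_space_def)
  qed
  ultimately show ?thesis by simp
qed

end

subsection \<open>Existence of graded free resolutions\<close>

text \<open>Finitely many generators may be replaced by their homogeneous components, whose degrees
  become the shifts.\<close>

lemma exists_pres:
  fixes M :: "(('n::{finite,linorder}, 'k::field) mpolynomial, 'm) gmodule"
  assumes gM: "graded_module M" and fg: "finitely_generated M"
  shows "\<exists>a E. pres a M E"
proof -
  interpret M: graded_module M by (rule gM)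
  obtain A where A: "finite A" "A <= carrier M" "LinearCombinations.module.span class_ring M A = carrier M"
    using fg unfolding finitely_generated_def by blast
  have compM: "component M t <= carrier M" for t using subgroup.subset[OF M.component_subgroup] by simp
  have "\<forall>x. \<exists>f. x : A --> (\<forall>t. f t : component M t) & finite {t. f t ~= \<zero>\<^bsub>M\<^esub>} & x = (\<Oplus>\<^bsub>M\<^esub>t\<in>{t. f t ~= \<zero>\<^bsub>M\<^esub>}. f t)"
  proof
    fix x
    show "\<exists>f. x : A --> (\<forall>t. f t : component M t) & finite {t. f t ~= \<zero>\<^bsub>M\<^esub>} & x = (\<Oplus>\<^bsub>M\<^esub>t\<in>{t. f t ~= \<zero>\<^bsub>M\<^esub>}. f t)"
    proof (cases "x : A")
      case True
      then show ?thesis using ex1_implies_ex[OF M.component_direct_sum[OF subsetD[OF A(2) True]]] by simp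
    qed simp
  qed
  then obtain f where f0: "\<forall>x. x : A --> (\<forall>t. f x t : component M t) & finite {t. f x t ~= \<zero>\<^bsub>M\<^esub>} & x = (\<Oplus>\<^bsub>M\<^esub>t\<in>{t. f x t ~= \<zero>\<^bsub>M\<^esub>}. f x t)"
    by (rule choice[THEN exE])
  then have f: "!!x t. x : A ==> f x t : component M t" "!!x. x : A ==> finite {t. f x t ~= \<zero>\<^bsub>M\<^esub>}"
    "!!x. x : A ==> x = (\<Oplus>\<^bsub>M\<^esub>t\<in>{t. f x t ~= \<zero>\<^bsub>M\<^esub>}. f x t)" by blast+
  \<comment> \<open>The nonzero components of the generators, each paired with its degree.\<close>
  define B where "B = (\<Union>x\<in>A. (%t. (t, f x t)) ` {t. f x t ~= \<zero>\<^bsub>M\<^esub>})"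
  have "finite B" unfolding B_def using A(1) f(2) by blast
  then obtain bs where bs: "set bs = B" using finite_list by blast
  define a where "a = map fst bs"
  define y where "y j = snd (bs ! j)" for j
  have len: "length a = length bs" by (simp add: a_def)
  have y: "y j : component M (a ! j)" if "j < length a" for j
  proof -
    have "bs ! j : B" using that bs len by auto
    then show ?thesis using that f(1) len unfolding B_def a_def y_def by auto
  qed
  have yM: "y j : carrier M" if "j < length a" for j using y[OF that] compM by blast
  define E where "E v = (\<Oplus>\<^bsub>M\<^esub>j\<in>{..<length a}. unemb v j \<odot>\<^bsub>M\<^esub> y j)" for v
  have cl: "r \<odot>\<^bsub>M\<^esub> y j : carrier M" if "j < length a" for r j using M.smult_closed[OF _ yM[OF that]] by simp
  have cl': "(%j. p j \<odot>\<^bsub>M\<^esub> y j) : {..<length a} \<rightarrow> carrier M" for p using cl by auto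
  have E_closed: "E v : carrier M" for v unfolding E_def by (rule M.M.finsum_closed[OF cl'])
  have E_add: "E (v + w) = E v \<oplus>\<^bsub>M\<^esub> E w" if vw: "v : Ftot a" "w : Ftot a" for v w
  proof -
    have "E (v + w) = (\<Oplus>\<^bsub>M\<^esub>j\<in>{..<length a}. unemb v j \<odot>\<^bsub>M\<^esub> y j \<oplus>\<^bsub>M\<^esub> unemb w j \<odot>\<^bsub>M\<^esub> y j)"
      unfolding E_def
    proof (rule M.M.finsum_cong'[OF refl])
      show "(%j. unemb v j \<odot>\<^bsub>M\<^esub> y j \<oplus>\<^bsub>M\<^esub> unemb w j \<odot>\<^bsub>M\<^esub> y j) : {..<length a} \<rightarrow> carrier M" using cl by auto
      show "unemb (v + w) j \<odot>\<^bsub>M\<^esub> y j = unemb v j \<odot>\<^bsub>M\<^esub> y j \<oplus>\<^bsub>M\<^esub> unemb w j \<odot>\<^bsub>M\<^esub> y j" if "j : {..<length a}" for j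
        using that M.smult_l_distr[of "unemb v j" "unemb w j" "y j"] yM by (simp add: unemb_add[OF vw])
    qed
    then show ?thesis unfolding E_def using M.M.finsum_addf[OF cl' cl'] by simp
  qed
  have E_sm: "E (pact r v) = r \<odot>\<^bsub>M\<^esub> E v" if v: "v : Ftot a" for r v
  proof -
    have "E (pact r v) = (\<Oplus>\<^bsub>M\<^esub>j\<in>{..<length a}. r \<odot>\<^bsub>M\<^esub> (unemb v j \<odot>\<^bsub>M\<^esub> y j))"
      unfolding E_def
    proof (rule M.M.finsum_cong'[OF refl])
      show "(%j. r \<odot>\<^bsub>M\<^esub> (unemb v j \<odot>\<^bsub>M\<^esub> y j)) : {..<length a} \<rightarrow> carrier M" using cl by auto
      show "unemb (pact r v) j \<odot>\<^bsub>M\<^esub> y j = r \<odot>\<^bsub>M\<^esub> (unemb v j \<odot>\<^bsub>M\<^esub> y j)" if "j : {..<length a}" for j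
        using that M.smult_assoc1[of r "unemb v j" "y j"] yM by (simp add: unemb_pact[OF v])
    qed
    also have "\<dots> = r \<odot>\<^bsub>M\<^esub> E v"
      unfolding E_def by (rule M.finsum_smult_ldistr[symmetric]) (use cl' in auto)
    finally show ?thesis .
  qed
  have E_0: "E 0 = \<zero>\<^bsub>M\<^esub>"
    using E_sm[OF fs.subspace_0[OF subspace_Ftot], of 0] M.smult_l_null[OF E_closed] by (simp add: class_ring_simps)
  have E_dirac: "E (dirac (j, 0)) = y j" if j: "j < length a" for j
  proof -
    have u: "unemb (dirac (j, 0)) = (e_vec j :: nat => ('n, 'k) mpolynomial)"
      unfolding emb_e_vec[symmetric] by (rule unemb_emb[of _ a]) (unfold emb_e_vec, rule dirac_Ftot[OF j])
    have "E (dirac (j, 0)) = (\<Oplus>\<^bsub>M\<^esub>i\<in>{..<length a}. if j = i then y i else \<zero>\<^bsub>M\<^esub>)"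
      unfolding E_def u
    proof (rule M.M.finsum_cong'[OF refl])
      show "(%i. if j = i then y i else \<zero>\<^bsub>M\<^esub>) : {..<length a} \<rightarrow> carrier M" using yM by auto
      show "e_vec j i \<odot>\<^bsub>M\<^esub> y i = (if j = i then y i else \<zero>\<^bsub>M\<^esub>)" if "i : {..<length a}" for i
        using that M.smult_one[OF yM, of i] M.smult_l_null[OF yM, of i] by (simp add: e_vec_def class_ring_simps)
    qed
    also have "\<dots> = y j" by (rule M.M.finsum_singleton) (use j yM in auto)
    finally show ?thesis .
  qed
  let ?I = "E ` Ftot a"
  have I_sum: "(\<Oplus>\<^bsub>M\<^esub>i\<in>S. h i) : ?I" if "finite S" "!!i. i : S ==> h i : ?I" for S :: "'s set" and h
    using that
  proof (induction S rule: finite_induct)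
    case empty
    show ?case unfolding M.M.finsum_empty E_0[symmetric] by (intro imageI fs.subspace_0[OF subspace_Ftot])
  next
    case (insert i S)
    obtain v w where vw: "v : Ftot a" "h i = E v" "w : Ftot a" "(\<Oplus>\<^bsub>M\<^esub>i\<in>S. h i) = E w" using insert by blast
    have "h j : carrier M" if "j : insert i S" for j using insert.prems[OF that] E_closed by auto
    then have "(\<Oplus>\<^bsub>M\<^esub>i\<in>insert i S. h i) = h i \<oplus>\<^bsub>M\<^esub> (\<Oplus>\<^bsub>M\<^esub>i\<in>S. h i)"
      by (intro M.M.finsum_insert insert.hyps) auto
    then have "(\<Oplus>\<^bsub>M\<^esub>i\<in>insert i S. h i) = E (v + w)" using E_add[OF vw(1,3)] vw(2,4) by simp
    then show ?case using fs.subspace_add[OF subspace_Ftot vw(1,3)] by blast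
  qed
  have AI: "x : ?I" if x: "x : A" for x
  proof -
    have "f x t : ?I" if t: "t : {t. f x t ~= \<zero>\<^bsub>M\<^esub>}" for t
    proof -
      have "(t, f x t) : set bs" unfolding bs B_def using x t by blast
      then obtain j where j: "j < length bs" "bs ! j = (t, f x t)" unfolding in_set_conv_nth by blast
      have "E (dirac (j, 0)) = f x t" using E_dirac[of j] j len by (simp add: y_def)
      then show ?thesis using dirac_Ftot[of j a] j(1) len by (metis imageI)
    qed
    then have "(\<Oplus>\<^bsub>M\<^esub>t\<in>{t. f x t ~= \<zero>\<^bsub>M\<^esub>}. f x t) : ?I" by (rule I_sum[OF f(2)[OF x]])
    then show ?thesis using f(3)[OF x] by simp
  qed
  have "carrier M <= ?I"
  proof
    fix x assume "x : carrier M"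
    then have "x : M.span A" using A(3) by simp
    then obtain c where c: "x = M.lincomb c A" unfolding M.finite_span[OF A(1,2)] by blast
    have "c z \<odot>\<^bsub>M\<^esub> z : ?I" if "z : A" for z
    proof -
      obtain v where v: "v : Ftot a" "z = E v" using AI[OF \<open>z : A\<close>] by blast
      have "c z \<odot>\<^bsub>M\<^esub> z = E (pact (c z) v)" using E_sm[OF v(1), of "c z"] v(2) by simp
      then show ?thesis using pact_Ftot[OF v(1)] by blast
    qed
    then show "x : ?I" unfolding c M.lincomb_def by (rule I_sum[OF A(1)])
  qed
  then have img: "E ` Ftot a = carrier M" using E_closed by blast
  have cp: "E v : component M t" if v: "v : fr a t" for v t
  proof -
    have F: "v : Ftot a" using v fr_Ftot by blast
    have u: "unemb v : component (free_gmodule a) t" unfolding emb_component using v emb_unemb[OF F] unemb_carrier[OF F] by simp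
    have h: "unemb v j \<odot>\<^bsub>M\<^esub> y j : component M t" if j: "j < length a" for j
    proof -
      have "unemb v j : homogeneous_part (t - a ! j)" using u j by (simp add: free_gmodule_def)
      from M.component_smult[OF this y[OF j]] show ?thesis by simp
    qed
    have "(\<Oplus>\<^bsub>M\<^esub>j\<in>S. unemb v j \<odot>\<^bsub>M\<^esub> y j) : component M t" if "finite S" "S <= {..<length a}" for S
      using that
    proof (induction S rule: finite_induct)
      case empty
      show ?case unfolding M.M.finsum_empty using subgroup.one_closed[OF M.component_subgroup[of t]] by simp
    next
      case (insert j S)
      have "(\<Oplus>\<^bsub>M\<^esub>j\<in>insert j S. unemb v j \<odot>\<^bsub>M\<^esub> y j) = unemb v j \<odot>\<^bsub>M\<^esub> y j \<oplus>\<^bsub>M\<^esub> (\<Oplus>\<^bsub>M\<^esub>j\<in>S. unemb v j \<odot>\<^bsub>M\<^esub> y j)"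
        using insert.prems cl by (intro M.M.finsum_insert insert.hyps) auto
      moreover have "unemb v j \<odot>\<^bsub>M\<^esub> y j : component M t" "(\<Oplus>\<^bsub>M\<^esub>j\<in>S. unemb v j \<odot>\<^bsub>M\<^esub> y j) : component M t"
        using h insert by auto
      ultimately show ?case using subgroup.m_closed[OF M.component_subgroup[of t]] by simp
    qed
    from this[of "{..<length a}"] show ?thesis by (simp add: E_def)
  qed
  have "lin_image (Ftot a) M E" by (rule lin_image.intro) (use subspace_Ftot img E_add E_0 in blast)+
  then have "pres a M E" by (rule pres_of_hom[OF gM]) (use E_sm cp in blast)+
  then show ?thesis by blast
qed

context
  fixes b c :: "int list" and g :: "nat => ('n::{finite,linorder}, 'k::field) lvec"
  assumes col: "!!j. j < length c ==> g j : fr b (c ! j)"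
begin

lemma gact_fr: "v : fr c t ==> gact (length c) g v : fr b t"
  by (rule gact_in[OF gsub_fr col]) (use fr_finite_support[OF col] in auto)

lemma gact_sum_proj:
  assumes v: "v : Ftot c"
  shows "\<exists>T. finite T & v = (\<Sum>t\<in>T. proj c t v) & gact (length c) g v = (\<Sum>t\<in>T. gact (length c) g (proj c t v)) & (\<forall>t. t ~: T --> proj c t v = 0)"
proof -
  obtain T where T: "finite T" "v = (\<Sum>t\<in>T. proj c t v)" "!!t. t ~: T ==> proj c t v = 0" using sum_proj[OF v] by metis
  have "gact (length c) g v = (\<Sum>t\<in>T. gact (length c) g (proj c t v))"
    unfolding flin_sum[OF flin_gact, symmetric] by (rule arg_cong[OF T(2)])
  then show ?thesis using T by blast
qed

lemma gact_Ftot: "v : Ftot c ==> gact (length c) g v : Ftot b"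
proof -
  assume v: "v : Ftot c"
  obtain T where "gact (length c) g v = (\<Sum>t\<in>T. gact (length c) g (proj c t v))" using gact_sum_proj[OF v] by blast
  then show ?thesis using fs.subspace_sum[OF subspace_Ftot, of T "%t. gact (length c) g (proj c t v)" b]
    subsetD[OF fr_Ftot gact_fr[OF proj_fr[OF v]]] by simp
qed

lemma gact_proj: "v : Ftot c ==> proj b t (gact (length c) g v) = gact (length c) g (proj c t v)"
proof -
  assume v: "v : Ftot c"
  obtain T where T: "finite T" "gact (length c) g v = (\<Sum>t\<in>T. gact (length c) g (proj c t v))" "!!t. t ~: T ==> proj c t v = 0"
    using gact_sum_proj[OF v] by blast
  have "proj b t (gact (length c) g v) = (\<Sum>s\<in>T. proj b t (gact (length c) g (proj c s v)))"
    unfolding T(2) flin_sum[OF flin_proj] ..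
  also have "\<dots> = (\<Sum>s\<in>T. if s = t then gact (length c) g (proj c t v) else 0)"
    by (rule sum.cong[OF refl]) (simp add: proj_of_fr[OF gact_fr[OF proj_fr[OF v]]])
  also have "\<dots> = gact (length c) g (proj c t v)"
  proof (cases "t : T")
    case True
    then show ?thesis using sum.delta[OF T(1), of t "%_. gact (length c) g (proj c t v)"] by (simp only: if_True)
  next
    case False
    have "(\<Sum>s\<in>T. if s = t then gact (length c) g (proj c t v) else 0) = 0"
      by (rule sum.neutral) (use False in \<open>auto simp del: zero_fun_apply\<close>)
    then show ?thesis unfolding T(3)[OF False] flin_0[OF flin_gact] .
  qed
  finally show ?thesis .
qed

lemma gact_zero_iff: "v : Ftot c ==> gact (length c) g v = 0 \<longleftrightarrow> (\<forall>t. gact (length c) g (proj c t v) = 0)"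
proof
  assume v: "v : Ftot c" and "gact (length c) g v = 0"
  then show "\<forall>t. gact (length c) g (proj c t v) = 0"
    unfolding gact_proj[OF v, symmetric] by (simp only: flin_0[OF flin_proj]) blast
next
  assume v: "v : Ftot c" and z: "\<forall>t. gact (length c) g (proj c t v) = 0"
  obtain T where "gact (length c) g v = (\<Sum>t\<in>T. gact (length c) g (proj c t v))" using gact_sum_proj[OF v] by blast
  then show "gact (length c) g v = 0" using z by (simp only: sum.neutral_const)
qed

text \<open>Passes from images in each degree to the image of the whole module by adding up
  preimages of the finitely many components.\<close>

lemma gact_total:
  assumes U: "!!t. gact (length c) g ` fr c t = U t"
  shows "gact (length c) g ` Ftot c = {v \<in> Ftot b. \<forall>t. proj b t v : U t}"
proof
  show "gact (length c) g ` Ftot c <= {v \<in> Ftot b. \<forall>t. proj b t v : U t}"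
  proof
    fix y assume "y : gact (length c) g ` Ftot c"
    then obtain v where v: "v : Ftot c" "y = gact (length c) g v" by blast
    have "proj b t y : U t" for t unfolding v(2) gact_proj[OF v(1)] U[symmetric] by (intro imageI proj_fr v(1))
    then show "y : {v \<in> Ftot b. \<forall>t. proj b t v : U t}" using gact_Ftot[OF v(1)] v(2) by blast
  qed
  show "{v \<in> Ftot b. \<forall>t. proj b t v : U t} <= gact (length c) g ` Ftot c"
  proof
    fix v assume "v : {v \<in> Ftot b. \<forall>t. proj b t v : U t}"
    then have v: "v : Ftot b" "!!t. proj b t v : gact (length c) g ` fr c t" unfolding U by blast+
    have "\<forall>t. \<exists>w. w : fr c t & proj b t v = gact (length c) g w" using v(2) by blast
    then obtain w where w: "\<forall>t. w t : fr c t & proj b t v = gact (length c) g (w t)" by (rule choice[THEN exE])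
    obtain T where T: "finite T" "v = (\<Sum>t\<in>T. proj b t v)" using sum_proj[OF v(1)] by metis
    have "(\<Sum>t\<in>T. proj b t v) = gact (length c) g (\<Sum>t\<in>T. w t)"
      unfolding flin_sum[OF flin_gact] by (rule sum.cong) (use w in auto)
    then have "v = gact (length c) g (\<Sum>t\<in>T. w t)" using T(2) by simp
    moreover have "(\<Sum>t\<in>T. w t) : Ftot c" by (rule fs.subspace_sum[OF subspace_Ftot]) (use w fr_Ftot in blast)
    ultimately show "v : gact (length c) g ` Ftot c" by blast
  qed
qed

lemma gact_hom: "(%w. unemb (gact (length c) g (emb w))) : graded_hom (free_gmodule c) (free_gmodule b)"
proof -
  have cF: "emb w : Ftot c" if "w : FC c" for w :: "nat => ('n, 'k) mpolynomial" using that emb_carrier by blast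
  let ?h = "%w. unemb (gact (length c) g (emb w))"
  have ops: "x \<oplus>\<^bsub>free_gmodule a\<^esub> y = (%j. x j + y j)" "r \<odot>\<^bsub>free_gmodule a\<^esub> x = (%j. r * x j)" for a r and x y :: "nat => ('n, 'k) mpolynomial"
    by (simp_all add: free_gmodule_def)
  have add: "?h (%j. w j + w' j) = (%j. ?h w j + ?h w' j)" if "w : FC c" "w' : FC c" for w w'
    unfolding emb_add flin_add[OF flin_gact] using unemb_add[OF gact_Ftot[OF cF[OF that(1)]] gact_Ftot[OF cF[OF that(2)]]] by blast
  have sm: "?h (%j. r * w j) = (%j. r * ?h w j)" if "w : FC c" for r w
    unfolding emb_smult eqv_commutes_pact[OF eqv_gact] by (rule unemb_pact[OF gact_Ftot[OF cF[OF that]]])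
  have "?h : LinearCombinations.module_hom class_ring (free_gmodule c) (free_gmodule b)"
    unfolding LinearCombinations.module_hom_def ops using add sm unemb_carrier[OF gact_Ftot[OF cF]] by blast
  moreover have "?h w : component (free_gmodule b) t" if "w : component (free_gmodule c) t" for w t
  proof -
    have "emb w : fr c t" using that emb_component by blast
    from gact_fr[OF this] have f: "gact (length c) g (emb w) : fr b t" .
    then have F: "gact (length c) g (emb w) : Ftot b" using fr_Ftot by blast
    show ?thesis unfolding emb_component emb_unemb[OF F] using f unemb_carrier[OF F] by blast
  qed
  ultimately show ?thesis unfolding graded_hom_def by blast
qed

end

text \<open>\<open>noetherian\<close> is applied to the successive kernels by dependent choice; a
  state records shifts, the kernel still to be covered, and the matrix of the last step.\<close>

lemma exists_resolution:
  fixes M :: "(('n::{finite,linorder}, 'k::field) mpolynomial, 'm) gmodule"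
  assumes "graded_module M" "finitely_generated M"
  shows "\<exists>a dv ev. graded_free_resolution M a dv ev"
proof -
  obtain a0 E where "pres a0 M E" using exists_pres[OF assms] by blast
  then interpret pres a0 M E .
  have imgE: "E ` Ftot a0 = carrier M" by (rule img)
  define good where "good s \<longleftrightarrow> (case s of (b, U, g) => gsub U & (\<forall>t. U t <= fr b t))"
    for s :: "int list \<times> ('n, 'k) fam \<times> (nat => ('n, 'k) lvec)"
  define R where "R s s' \<longleftrightarrow> (case s of (b, U, _) => case s' of (c, U', g) =>
      (\<forall>j<length c. g j : fr b (c ! j)) & (\<forall>t. gact (length c) g ` fr c t = U t) \<and>
      U' = (%t. {v \<in> fr c t. gact (length c) g v = 0}))"
    for s s' :: "int list \<times> ('n, 'k) fam \<times> (nat => ('n, 'k) lvec)"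
  have step: "\<exists>s'. good s' & R s s'" if "good s" for s
  proof -
    obtain b U g0 where s: "s = (b, U, g0)" by (cases s)
    have U: "gsub U" "!!t. U t <= fr b t" using that by (auto simp: good_def s)
    obtain c g where g: "!!j. j < length c ==> g j : U (c ! j)" "!!t. gact (length c) g ` fr c t = U t"
      by (rule noetherian[OF U]) blast
    have "gsub (%t. {v \<in> fr c t. gact (length c) g v : zf (t + 0)})" by (rule gsub_vimage[OF eqv_gact gsub_fr gsub_zf])
    then have "gsub (%t. {v \<in> fr c t. gact (length c) g v = 0})" by (simp add: zf_eq)
    then have "good (c, %t. {v \<in> fr c t. gact (length c) g v = 0}, g)" by (auto simp: good_def)
    moreover have "R s (c, %t. {v \<in> fr c t. gact (length c) g v = 0}, g)" unfolding R_def s prod.case using g U(2) by blast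
    ultimately show ?thesis by blast
  qed
  have "\<exists>s. \<forall>n. (good (s n) & (n = 0 --> s n = (a0, ker, undefined))) & R (s n) (s (Suc n))"
  proof (rule dependent_nat_choice)
    show "\<exists>x. good x & (0 = (0 :: nat) --> x = (a0, ker, undefined))" using gsub_ker ker_fr by (auto simp: good_def)
    show "\<exists>y. (good y & (Suc n = 0 --> y = (a0, ker, undefined))) & R x y" if "good x & (n = 0 --> x = (a0, ker, undefined))" for x n
      using step[of x] that by blast
  qed
  then obtain s where s: "s 0 = (a0, ker, undefined)" "!!n. R (s n) (s (Suc n))" by blast
  define a where "a n = fst (s n)" for n
  define U where "U n = fst (snd (s n))" for n
  define g where "g n = snd (snd (s (Suc n)))" for n
  have s_eq: "s n = (a n, U n, snd (snd (s n)))" for n by (simp add: a_def U_def)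
  have Rn: "R (a n, U n, snd (snd (s n))) (a (Suc n), U (Suc n), g n)" for n
    using s(2)[of n] s_eq[of n] s_eq[of "Suc n"] unfolding g_def by metis
  have col: "!!j. j < length (a (Suc n)) ==> g n j : fr (a n) (a (Suc n) ! j)"
    and img: "!!t. gact (length (a (Suc n))) (g n) ` fr (a (Suc n)) t = U n t"
    and ker': "U (Suc n) = (%t. {v \<in> fr (a (Suc n)) t. gact (length (a (Suc n))) (g n) v = 0})" for n
    using Rn[of n] unfolding R_def prod.case by blast+
  have a0: "a 0 = a0" "U 0 = ker" using s(1) by (simp_all add: a_def U_def)
  define d where "d n = gact (length (a (Suc n))) (g n)" for n
  define dv where "dv n = (%w. unemb (d n (emb w)))" for n
  define ev where "ev = (%w. E (emb w))"
  have em: "emb w : Ftot b" "unemb (emb w) = w" if "w : FC b" for w :: "nat => ('n, 'k) mpolynomial" and b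
    using emb_carrier[of b] that unemb_emb[of w b] by auto
  have tot: "d n ` Ftot (a (Suc n)) = {v \<in> Ftot (a n). \<forall>t. proj (a n) t v : U n t}" for n
    unfolding d_def by (rule gact_total[OF col img])
  have unembF: "unemb ` Ftot b = (FC b :: (nat => ('n, 'k) mpolynomial) set)" for b
    using unemb_carrier[of _ b] em[of _ b] by force
  have dv_img: "dv n ` FC (a (Suc n)) = unemb ` {v \<in> Ftot (a n). \<forall>t. proj (a n) t v : U n t}" for n
  proof -
    have "dv n ` FC (a (Suc n)) = unemb ` d n ` emb ` FC (a (Suc n))" by (simp add: dv_def image_image)
    then show ?thesis unfolding emb_carrier tot .
  qed
  have pull: "unemb ` {v \<in> Ftot b. P v} = {w \<in> FC b. P (emb w)}" for b and P :: "('n, 'k) lvec => bool"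
    using unemb_carrier[of _ b] emb_unemb[of _ b] em[of _ b] by force
  have "graded_free_resolution M a dv ev" unfolding graded_free_resolution_def
  proof (intro conjI allI)
    have ops: "x \<oplus>\<^bsub>free_gmodule b\<^esub> y = (%j. x j + y j)" "r \<odot>\<^bsub>free_gmodule b\<^esub> x = (%j. r * x j)" for b r and x y :: "nat => ('n, 'k) mpolynomial"
      by (simp_all add: free_gmodule_def)
    have "ev : LinearCombinations.module_hom class_ring (free_gmodule (a 0)) M"
    proof -
      have "ev : FC a0 \<rightarrow> carrier M" unfolding ev_def using closed[OF em(1)] by blast
      moreover have "ev (%j. x j + y j) = ev x \<oplus>\<^bsub>M\<^esub> ev y" if "x : FC a0" "y : FC a0" for x y
        unfolding ev_def emb_add by (rule hadd[OF em(1)[OF that(1)] em(1)[OF that(2)]])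
      moreover have "ev (%j. r * x j) = r \<odot>\<^bsub>M\<^esub> ev x" if "x : FC a0" for r x
        unfolding ev_def emb_smult by (rule hsmult[OF em(1)[OF that]])
      ultimately show ?thesis unfolding LinearCombinations.module_hom_def ops a0 by simp
    qed
    moreover have "ev ` component (free_gmodule (a 0)) t <= component M t" for t
      unfolding ev_def a0 hcomp[symmetric] using emb_component by blast
    ultimately show "ev : graded_hom (free_gmodule (a 0)) M" unfolding graded_hom_def by blast
    show "ev ` FC (a 0) = carrier M" unfolding ev_def a0 image_image[of E emb, symmetric] emb_carrier by (rule imgE)
    show "dv p : graded_hom (free_gmodule (a (Suc p))) (free_gmodule (a p))" for p
      unfolding dv_def d_def by (rule gact_hom[OF col])
    have "(\<forall>t. proj (a 0) t v : U 0 t) \<longleftrightarrow> E v = \<zero>\<^bsub>M\<^esub>" if "v : Ftot (a 0)" for v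
      using E_zero_iff_proj[of v] proj_fr[of v] that unfolding a0 ker_def by blast
    then have "{v \<in> Ftot (a 0). \<forall>t. proj (a 0) t v : U 0 t} = {v \<in> Ftot (a 0). E v = \<zero>\<^bsub>M\<^esub>}" by blast
    then show "dv 0 ` FC (a 1) = {v \<in> FC (a 0). ev v = \<zero>\<^bsub>M\<^esub>}"
      using dv_img[of 0] pull[of "a 0" "%v. E v = \<zero>\<^bsub>M\<^esub>"] unfolding ev_def by simp
    show "dv (Suc p) ` FC (a (Suc (Suc p))) = {v \<in> FC (a (Suc p)). dv p v = (%_. 0)}" for p
    proof -
      have "(\<forall>t. proj (a (Suc p)) t v : U (Suc p) t) \<longleftrightarrow> d p v = 0" if "v : Ftot (a (Suc p))" for v
        using gact_zero_iff[OF col that] proj_fr[OF that] unfolding ker' d_def by blast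
      then have "{v \<in> Ftot (a (Suc p)). \<forall>t. proj (a (Suc p)) t v : U (Suc p) t} = {v \<in> Ftot (a (Suc p)). d p v = 0}" by blast
      then have "dv (Suc p) ` FC (a (Suc (Suc p))) = {w \<in> FC (a (Suc p)). d p (emb w) = 0}"
        using dv_img[of "Suc p"] pull[of "a (Suc p)" "%v. d p v = 0"] by simp
      also have "\<dots> = {v \<in> FC (a (Suc p)). dv p v = (%_. 0)}"
      proof -
        have "d p (emb w) = 0 \<longleftrightarrow> dv p w = (%_. 0)" if w: "w : FC (a (Suc p))" for w
        proof
          assume "d p (emb w) = 0"
          then have "dv p w = unemb 0" unfolding dv_def by simp
          then show "dv p w = (%_. 0)" by (simp add: fun_eq_iff unemb_0)
        next
          assume z: "dv p w = (%_. 0)"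
          have "d p (emb w) : Ftot (a p)" unfolding d_def by (rule gact_Ftot[OF col em(1)[OF w]])
          then have "d p (emb w) = emb (dv p w)" unfolding dv_def by (rule emb_unemb[symmetric])
          then show "d p (emb w) = 0" unfolding z by (simp add: emb_def fun_eq_iff)
        qed
        then show ?thesis by blast
      qed
      finally show ?thesis .
    qed
  qed
  then show ?thesis by blast
qed

subsection \<open>Chains of prime ideals\<close>

context
begin

definition pdeg_le :: "nat => (('n::finite \<Rightarrow>\<^sub>0 nat) => 'k::field) set" where
  "pdeg_le s = funs_on {m. mono_degree m <= s}"

text \<open>An ideal as a set of coefficient functions, the form in which \<open>qdim\<close>
  applies.\<close>

definition lk :: "('n, 'k::field) mpolynomial set => (('n \<Rightarrow>\<^sub>0 nat) => 'k) set" where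
  "lk P = lookup ` P"

lemma finite_mono_degree_le: "finite {m :: 'n::finite \<Rightarrow>\<^sub>0 nat. mono_degree m <= s}"
  and card_mono_degree_le: "card {m :: 'n::finite \<Rightarrow>\<^sub>0 nat. mono_degree m <= s} <= (s + 1) ^ CARD('n)"
proof -
  let ?A = "{m :: 'n \<Rightarrow>\<^sub>0 nat. mono_degree m <= s}" and ?B = "(UNIV :: 'n set) \<rightarrow>\<^sub>E {..s}"
  have sub: "lookup ` ?A <= ?B"
  proof
    fix f assume "f : lookup ` ?A"
    then obtain m where m: "mono_degree m <= s" "f = lookup m" by blast
    have "lookup m i <= s" for i using member_le_sum[of i UNIV "lookup m"] m(1) by (simp add: mono_degree_def)
    then show "f : ?B" using m(2) by auto
  qed
  have inj: "inj_on lookup ?A" by (auto intro!: inj_onI simp: poly_mapping_eqI)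
  have fin: "finite ?B" by (intro finite_PiE) auto
  show "finite ?A" by (rule finite_imageD[OF finite_subset[OF sub fin] inj])
  have "card ?A = card (lookup ` ?A)" by (rule card_image[OF inj, symmetric])
  also have "\<dots> <= card ?B" by (rule card_mono[OF fin sub])
  also have "card ?B = (s + 1) ^ CARD('n)" by (simp add: card_PiE)
  finally show "card ?A <= (s + 1) ^ CARD('n)" .
qed

lemma pdeg_le_iff: "f : pdeg_le s \<longleftrightarrow> (\<forall>m. f m ~= 0 --> mono_degree m <= s)"
  unfolding pdeg_le_def funs_on_def by auto

lemma subspace_pdeg_le: "fs.subspace (pdeg_le s :: (('n::finite \<Rightarrow>\<^sub>0 nat) => 'k::field) set)"
proof (rule fs.subspaceI)
  fix x y :: "('n \<Rightarrow>\<^sub>0 nat) => 'k" assume xy: "x : pdeg_le s" "y : pdeg_le s"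
  have "x m ~= 0 | y m ~= 0" if "(x + y) m ~= 0" for m using that by auto
  then show "x + y : pdeg_le s" using xy unfolding pdeg_le_iff by blast
next
  fix c and x :: "('n \<Rightarrow>\<^sub>0 nat) => 'k" assume "x : pdeg_le s"
  then show "scl c x : pdeg_le s" unfolding pdeg_le_iff by (auto simp: scl_def)
qed (simp add: pdeg_le_iff)

lemma lookup_lk_iff: "lookup p : lk P \<longleftrightarrow> p : P"
  unfolding lk_def by (auto simp: poly_mapping_eqI Poly_Mapping.lookup_inject)

lemma pdeg_le_lookup:
  assumes "f : pdeg_le s"
  obtains p where "f = lookup p"
proof -
  have "finite {m. f m ~= 0}" by (rule finite_subset[OF _ finite_mono_degree_le[of s]]) (use assms in \<open>auto simp: pdeg_le_iff\<close>)
  then have "lookup (Poly_Mapping.Abs_poly_mapping f) = f" by simp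
  then show thesis using that by metis
qed

lemma scl_lookup: "scl c (lookup p) = lookup (pconst c * p)"
proof -
  have "lookup (pconst c * p) m = c * lookup p m" for m
  proof (induction p rule: mpoly_induct)
    case (single m' c')
    show ?case by (simp add: pconst_def mult_single lookup_single when_def)
  next
    case (add p q)
    then show ?case by (simp add: distrib_left lookup_add)
  qed simp
  then show ?thesis by (auto simp: scl_def fun_eq_iff)
qed

lemma subspace_lk:
  fixes P :: "('n::finite, 'k::field) mpolynomial set"
  assumes "ideal P class_ring"
  shows "fs.subspace (lk P)"
proof -
  interpret ideal P class_ring by (rule assms)
  show ?thesis
  proof (rule fs.subspaceI)
    have "0 : P" using zero_closed by (simp add: class_ring_simps)
    then show "0 : lk P" unfolding lk_def by (intro image_eqI[of _ _ 0]) (auto simp: fun_eq_iff)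
    show "x + y : lk P" if "x : lk P" "y : lk P" for x y
    proof -
      obtain p q where pq: "p : P" "q : P" "x = lookup p" "y = lookup q" using \<open>x : lk P\<close> \<open>y : lk P\<close> unfolding lk_def by blast
      have "p + q : P" using a_closed[OF pq(1,2)] by (simp add: class_ring_simps)
      moreover have "x + y = lookup (p + q)" unfolding pq by (auto simp: lookup_add fun_eq_iff)
      ultimately show ?thesis unfolding lk_def by blast
    qed
    show "scl c x : lk P" if x: "x : lk P" for c x
    proof -
      obtain p where p: "p : P" "x = lookup p" using x unfolding lk_def by blast
      have "pconst c * p : P" using I_l_closed[OF p(1), of "pconst c"] by (simp add: class_ring_simps)
      then show ?thesis unfolding p(2) scl_lookup lk_def by blast
    qed
  qed
qed

text \<open>The affine Hilbert function: the dimension of polynomials of degree at most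
  \<open>s\<close> modulo \<open>P\<close>.\<close>

definition Hl :: "('n::finite, 'k::field) mpolynomial set => nat => nat" where
  "Hl P s = the_enat (qdim (pdeg_le s) (pdeg_le s Int lk P))"

lemma Hl_le:
  fixes P :: "('n::finite, 'k::field) mpolynomial set"
  shows "qdim (pdeg_le s) (pdeg_le s Int lk P) = enat (Hl P s)" "Hl P s <= (s + 1) ^ CARD('n)"
proof -
  have "qdim (pdeg_le s) (pdeg_le s Int lk P) <= enat (card {m :: 'n \<Rightarrow>\<^sub>0 nat. mono_degree m <= s})"
    unfolding pdeg_le_def by (rule qdim_funs_on_le[OF finite_mono_degree_le])
  also have "\<dots> <= enat ((s + 1) ^ CARD('n))" using card_mono_degree_le by simp
  finally have le: "qdim (pdeg_le s) (pdeg_le s Int lk P) <= enat ((s + 1) ^ CARD('n))" .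
  then show "qdim (pdeg_le s) (pdeg_le s Int lk P) = enat (Hl P s)" unfolding Hl_def by (cases "qdim (pdeg_le s) (pdeg_le s Int lk P)") auto
  then show "Hl P s <= (s + 1) ^ CARD('n)" using le by simp
qed

text \<open>As \<open>P\<close> is prime, multiplication by an element of \<open>Q\<close> outside
  \<open>P\<close> is injective modulo \<open>P\<close>; it embeds degree at most \<open>s\<close>
  of R/P into degree at most \<open>s + e\<close> of Q/P.\<close>

lemma Hl_step:
  fixes P Q :: "('n::finite, 'k::field) mpolynomial set"
  assumes P: "primeideal P class_ring" and Q: "ideal Q class_ring" and PQ: "P <= Q"
    and q: "q : Q" "q ~: P" "\<forall>m\<in>keys q. mono_degree m <= e"
  shows "Hl Q (s + e) + Hl P s <= Hl P (s + e)"
proof -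
  interpret P: primeideal P class_ring by (rule P)
  interpret Q: ideal Q class_ring by (rule Q)
  let ?Z = "pdeg_le (s + e) :: (('n \<Rightarrow>\<^sub>0 nat) => 'k) set"
  note sub = fs.subspace_inter[OF subspace_pdeg_le subspace_lk]
  have lk: "lk P <= lk Q" using PQ by (auto simp: lk_def)
  have "qdim ?Z (?Z Int lk P) = qdim ?Z (?Z Int lk Q) + qdim (?Z Int lk Q) (?Z Int lk P)"
    by (rule qdim_add[OF sub[OF P.is_ideal] sub[OF Q]]) (use lk in auto)
  moreover have "qdim (pdeg_le s) (pdeg_le s Int lk P) <= qdim (?Z Int lk Q) (?Z Int lk P)"
  proof -
    define F where "F f = (\<Sum>m\<in>keys q. (%k. lookup q m * (if \<exists>k'. k = m + k' then f (k - m) else 0)))"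
      for f :: "('n \<Rightarrow>\<^sub>0 nat) => 'k"
    have F: "F (lookup p) = lookup (q * p)" for p
    proof
      fix k
      have s1: "lookup (single m c * p) k = c * (if \<exists>k'. k = m + k' then lookup p (k - m) else 0)" for m c
      proof (induction p rule: mpoly_induct)
        case (single m' c')
        have "(m + m' = k) \<longleftrightarrow> (\<exists>k'. k = m + k') & m' = k - m" by auto
        then show ?case by (auto simp: mult_single lookup_single when_def)
      next
        case (add p1 p2)
        then show ?case by (simp add: distrib_left lookup_add)
      qed simp
      have "q * p = (\<Sum>m\<in>keys q. single m (lookup q m) * p)"
        unfolding sum_distrib_right[symmetric] using sum_single[of q] by simp
      then show "F (lookup p) k = lookup (q * p) k" by (simp add: F_def fun_sum_apply lookup_sum s1)
    qed
    have flin: "flin F"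
    proof (rule flinI)
      show "F (x + y) = F x + F y" for x y
        unfolding F_def sum.distrib[symmetric] by (rule sum.cong) (auto simp: fun_eq_iff distrib_left)
      show "F (scl c x) = scl c (F x)" for c x
        unfolding F_def fs.scale_sum_right by (rule sum.cong) (auto simp: fun_eq_iff scl_def)
    qed
    show ?thesis
    proof (rule qdim_inj[OF flin subspace_pdeg_le sub[OF P.is_ideal]])
      fix z :: "('n \<Rightarrow>\<^sub>0 nat) => 'k" assume z: "z : pdeg_le s"
      obtain p where p: "z = lookup p" using z by (rule pdeg_le_lookup)
      have "q * p : Q" using Q.I_r_closed[OF q(1), of p] by (simp add: class_ring_simps)
      moreover have "lookup (q * p) : ?Z" unfolding pdeg_le_iff
      proof (intro allI impI)
        fix m assume "lookup (q * p) m ~= 0"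
        then have "m : keys (q * p)" by (simp add: in_keys_iff)
        then obtain m1 m2 where m: "m1 : keys q" "m2 : keys p" "m = m1 + m2" using keys_mult[of q p] by auto
        have "mono_degree m = mono_degree m1 + mono_degree m2" unfolding m(3) by (simp add: mono_degree_def lookup_add sum.distrib)
        moreover have "mono_degree m1 <= e" using q(3) m(1) by blast
        moreover have "mono_degree m2 <= s" using z m(2) unfolding p pdeg_le_iff by (simp add: in_keys_iff)
        ultimately show "mono_degree m <= s + e" by simp
      qed
      ultimately show "F z : ?Z Int lk Q" unfolding p F using lookup_lk_iff by blast
      assume "F z : ?Z Int lk P"
      then have "q * p : P" unfolding p F using lookup_lk_iff by blast
      then have "q : P | p : P" using P.I_prime[of q p] by (simp add: class_ring_simps)
      then show "z : pdeg_le s Int lk P" using q(2) z p lookup_lk_iff by blast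
    qed
  qed
  ultimately show ?thesis unfolding Hl_le(1) by (metis Hl_le(1) add_left_mono plus_enat_simps(1) enat_ord_simps(1))
qed

text \<open>Each step down the chain raises the growth order of the affine Hilbert function by one,
  while the polynomial ring itself has growth of order n.\<close>

lemma prime_chain_length:
  fixes P :: "nat => ('n::finite, 'k::field) mpolynomial set"
  assumes prime: "!!i. i <= r ==> primeideal (P i) class_ring" and chain: "!!i. i < r ==> P i \<subset> P (Suc i)"
  shows "r <= CARD('n)"
proof (rule ccontr)
  let ?n = "CARD('n)"
  assume "\<not> r <= ?n"
  then have r: "?n < r" by simp
  have "\<forall>i. \<exists>q. i < r --> q : P (Suc i) & q ~: P i" using chain by blast
  then obtain q where q: "\<forall>i. i < r --> q i : P (Suc i) & q i ~: P i" by (rule choice[THEN exE])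
  \<comment> \<open>One degree bound for all the chosen elements \<open>q i\<close>.\<close>
  define e where "e = Suc (\<Sum>i<r. \<Sum>m\<in>keys (q i). mono_degree m)"
  have e: "mono_degree m <= e" if "i < r" "m : keys (q i)" for i m
  proof -
    have "mono_degree m <= (\<Sum>m\<in>keys (q i). mono_degree m)" by (rule member_le_sum) (use that in auto)
    also have "\<dots> <= (\<Sum>i<r. \<Sum>m\<in>keys (q i). mono_degree m)"
      by (rule member_le_sum[of i "{..<r}" "%i. \<Sum>m\<in>keys (q i). mono_degree m"]) (use that in auto)
    finally show ?thesis by (simp add: e_def)
  qed
  have one: "1 <= Hl (P i) s" if i: "i <= r" for i s
  proof (rule ccontr)
    assume "\<not> 1 <= Hl (P i) s"
    then have "qdim (pdeg_le s) (pdeg_le s Int lk (P i)) = 0" using Hl_le(1)[of s "P i"] by (simp add: zero_enat_def)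
    interpret I: primeideal "P i" class_ring by (rule prime[OF i])
    have "pdeg_le s <= pdeg_le s Int lk (P i)"
      using qdim_eq_0_iff[OF fs.subspace_inter[OF subspace_pdeg_le subspace_lk[OF I.is_ideal]]] \<open>qdim _ _ = 0\<close> by blast
    moreover have "lookup 1 : (pdeg_le s :: (('n \<Rightarrow>\<^sub>0 nat) => 'k) set)"
      unfolding pdeg_le_iff by (auto simp: lookup_one when_def mono_degree_def split: if_splits)
    ultimately have "(1 :: ('n, 'k) mpolynomial) : P i" using lookup_lk_iff by blast
    then have "P i = carrier class_ring" using I.one_imp_carrier by (simp add: class_ring_simps)
    then show False using I.I_notcarr by blast
  qed
  \<comment> \<open>Induction from the largest prime downwards: \<open>Hl_step\<close> supplies the
    recursion that Pascal's rule gives for the binomial coefficients.\<close>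
  have bin: "(k + i) choose i <= Hl (P (r - i)) (k * e)" if "i <= r" for i k using that
  proof (induction i arbitrary: k)
    case 0
    show ?case using one[of r "k * e"] by simp
  next
    case (Suc i)
    note IHi = Suc.IH
    have ir: "r - Suc i < r" "Suc (r - Suc i) = r - i" using Suc.prems by auto
    show ?case
    proof (induction k)
      case 0
      show ?case using one[of "r - Suc i" 0] by simp
    next
      case (Suc k)
      have "Hl (P (r - i)) (k * e + e) + Hl (P (r - Suc i)) (k * e) <= Hl (P (r - Suc i)) (k * e + e)"
      proof (rule Hl_step[of _ _ "q (r - Suc i)"])
        show "primeideal (P (r - Suc i)) class_ring" by (rule prime) simp
        show "ideal (P (r - i)) class_ring" using prime[of "r - i"] primeideal.axioms(1) by fastforce
        show "P (r - Suc i) <= P (r - i)" using chain[OF ir(1)] ir(2) by auto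
        show "q (r - Suc i) : P (r - i)" "q (r - Suc i) ~: P (r - Suc i)" using q[rule_format, OF ir(1)] unfolding ir(2) by auto
        show "\<forall>m\<in>keys (q (r - Suc i)). mono_degree m <= e" using e[OF ir(1)] by blast
      qed
      moreover have "(Suc k + i) choose i <= Hl (P (r - i)) (k * e + e)" using IHi[of "Suc k"] \<open>Suc i <= r\<close> by (simp add: add.commute)
      moreover have "(Suc k + Suc i) choose Suc i = ((k + Suc i) choose Suc i) + ((Suc k + i) choose i)" by simp
      ultimately show ?case using Suc.IH by (simp add: add.commute)
    qed
  qed
  \<comment> \<open>At degree \<open>r * K * e\<close> the lower bound is at least
    \<open>(K + 1) ^ r\<close> and the upper bound at most a constant times
    \<open>(K + 1) ^ n\<close>; for \<open>r > n\<close> this bounds every \<open>K\<close>.\<close>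
  have bound: "K + 1 <= (r * e + 1) ^ ?n" for K :: nat
  proof -
    have "(K + 1) ^ r <= (r * K + r) choose r"
    proof -
      have "(of_nat (r * K + r) / of_nat r :: real) ^ r <= of_nat ((r * K + r) choose r)" by (rule binomial_ge_n_over_k_pow_k) simp
      moreover have "(of_nat (r * K + r) / of_nat r :: real) = of_nat (K + 1)" using r by (simp add: field_simps)
      ultimately have "real ((K + 1) ^ r) <= real ((r * K + r) choose r)" by simp
      then show ?thesis by linarith
    qed
    also have "\<dots> <= Hl (P (r - r)) (r * K * e)" by (rule bin) simp
    also have "\<dots> <= (r * K * e + 1) ^ ?n" by (rule Hl_le(2))
    also have "\<dots> <= ((r * e + 1) * (K + 1)) ^ ?n" by (rule power_mono) (simp_all add: algebra_simps)
    finally have 1: "(K + 1) ^ r <= (r * e + 1) ^ ?n * (K + 1) ^ ?n" by (simp only: power_mult_distrib)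
    have "(K + 1) ^ ?n * (K + 1) <= (K + 1) ^ r" using power_increasing[of "Suc ?n" r "K + 1"] r by (simp add: mult.commute)
    then have "(K + 1) * (K + 1) ^ ?n <= (r * e + 1) ^ ?n * (K + 1) ^ ?n" using 1 by (simp add: mult.commute)
    then show ?thesis by (simp only: mult_le_cancel2) simp
  qed
  from bound[of "(r * e + 1) ^ ?n"] show False by simp
qed

end

lemma krull_dim_le:
  fixes M :: "(('n::finite, 'k::field) mpolynomial, 'm) gmodule"
  assumes "krull_dim M = Fin (int d)"
  shows "d <= CARD('n)"
proof -
  let ?A = "{int r | r. \<exists>P. (\<forall>i\<le>r. primeideal (P i) (class_ring :: ('n, 'k) mpolynomial ring) & annihilator M <= P i) & (\<forall>i<r. P i \<subset> P (Suc i))}"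
  have A: "ext_Sup ?A = Fin (int d)" using assms unfolding krull_dim_def .
  have "x <= int CARD('n)" if x: "x : ?A" for x
  proof -
    obtain r P where "x = int r" "\<forall>i\<le>r. primeideal (P i) (class_ring :: ('n, 'k) mpolynomial ring)" "\<forall>i<r. P i \<subset> P (Suc i)"
      using x by blast
    then show ?thesis using prime_chain_length[of r P] by simp
  qed
  moreover have "?A ~= {}" "int d = Sup ?A" using A unfolding ext_Sup_def by (auto split: if_splits)
  ultimately have "int d <= int CARD('n)" using cSup_least[of ?A "int CARD('n)"] by simp
  then show ?thesis by simp
qed

subsection \<open>The theorem\<close>

lemma rbar_reg_le:
  fixes N :: "(('n::{finite,linorder}, 'k::field) mpolynomial, 'm) gmodule"
  assumes p: "pres a N E"
  shows "reg_le a (pres.ker a N E) (regularity (mod_torsion N)) & regularity (mod_torsion N) ~= Pinf"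
proof -
  interpret pres a N E by (rule p)
  interpret T: pres a "mod_torsion N" tor.Q by (rule pres_mod_torsion)
  have "Fin (int i + t) <= regularity (mod_torsion N)" if "hI (int i) (fr a) (sat a ker) t ~= 0" for i t
  proof -
    have "hh (int i) (fr a) (sat a ker) t ~= 0" using that unfolding hI_def by (metis eint_0)
    then show ?thesis by (rule T.le_regularity[unfolded mod_torsion_ker])
  qed
  then show ?thesis unfolding reg_le_def using T.regularity_not_Pinf by blast
qed

theorem theorem4p2:
  fixes M :: "(('n::{finite,linorder}, 'k::field) mpolynomial, 'm) gmodule"
    and l :: "nat \<Rightarrow> ('n, 'k) mpolynomial"
    and n d :: nat
    and rbar :: "nat \<Rightarrow> int extended"
  assumes "n = CARD('n)" and "n \<ge> 2"
    and "graded_module M" and "finitely_generated M"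
    and "krull_dim M = Fin (int d)" and "d \<ge> 1"
    and "\<forall>j\<in>{1..d}. l j \<in> homogeneous_part 1"
    and "filter_regular M l d"
    and "\<And>j. j \<le> d \<Longrightarrow> rbar j = regularity (mod_torsion (quot_by_seq M l j))"
  shows "\<forall>i. 0 < i \<and> i \<le> d \<longrightarrow>
      indeg (Ext (n - i) M ring_gmodule) \<ge> - rbar (i - 1) - Fin (int n) + 1 \<and>
      (\<forall>\<mu>. vectorspace.fin_dim class_ring (component_space (Ext (n - i) M ring_gmodule) \<mu>) \<and>
        of_nat (vectorspace.dim class_ring (component_space (Ext (n - i) M ring_gmodule) \<mu>)) \<le>
          of_nat (ext_binomial (Fin \<mu> + rbar (i - 1) + Fin (int n) - 1) (i - 1)) *
          ext_poly ((Delta ^^ (i - 1)) (hilbert_poly M)) (rbar i - 1))"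
proof (intro allI impI)
  fix i assume i: "0 < i & i <= d"
  define m where "m = i - 1"
  have im: "i = Suc m" using i by (simp add: m_def)
  \<comment> \<open>Makes \<open>n - i\<close> a true difference, so that n - (n - i) = i
    below.\<close>
  have "d <= n" using krull_dim_le[OF assms(5)] assms(1) by simp
  then have iN: "i <= CARD('n)" using i assms(1) by simp
  have hl: "!!s. s : {1..d} ==> l s : homogeneous_part 1" using assms(7) by blast
  \<comment> \<open>The resolution selected in the definition of \<open>Ext\<close>; its existence
    makes the choice a genuine resolution.\<close>
  define S where "S = (SOME (a, dv). \<exists>ev. graded_free_resolution M a dv ev)"
  obtain a dv where S: "S = (a, dv)" by (cases S)
  have "\<exists>x. case x of (a, dv) => \<exists>ev. graded_free_resolution M a dv ev" using exists_resolution[OF assms(3,4)] by auto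
  then have "case S of (a, dv) => \<exists>ev. graded_free_resolution M a dv ev" unfolding S_def by (rule someI_ex)
  then obtain ev where res: "graded_free_resolution M a dv ev" unfolding S by auto
  interpret gres M a dv ev by (rule gres.intro[OF assms(3) res])
  have Ext: "Ext q M ring_gmodule = ExtR q" for q unfolding Ext_def ExtR_def S_def[symmetric] S by simp
  define ls where "ls = map (%s. pact (l s)) [1..<Suc i]"
  have ls: "length ls = Suc m" "butlast ls = map (%s. pact (l s)) [1..<Suc m]"
    unfolding ls_def im by (simp_all add: butlast_append)
  have freg: "freg (a 0) ls ker" unfolding ls_def by (rule freg_of_filter_regular[OF hl assms(8)]) (use i in auto)
  have reg: "reg_le (a 0) (hseq (a 0) (map (%s. pact (l s)) [1..<Suc j]) ker) (rbar j) & rbar j ~= Pinf" if j: "j <= d" for j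
  proof -
    have "\<exists>Q. pres (a 0) (quot_by_seq M l j) Q & pres.ker (a 0) (quot_by_seq M l j) Q = hseq (a 0) (map (%s. pact (l s)) [1..<Suc j]) ker"
      by (rule seq_pres) (use hl j in auto)
    then obtain Q where Q: "pres (a 0) (quot_by_seq M l j) Q"
      "pres.ker (a 0) (quot_by_seq M l j) Q = hseq (a 0) (map (%s. pact (l s)) [1..<Suc j]) ker" by blast
    show ?thesis using rbar_reg_le[OF Q(1)] unfolding Q(2) assms(9)[OF j] .
  qed
  let ?B = "%\<mu>. ext_binomial (Fin \<mu> + rbar m + Fin (int n) - 1) m" and ?P = "ext_poly ((Delta ^^ m) (hilbert_poly M)) (rbar i - 1)"
  have lcb: "of_int (hI (Suc m) (fr (a 0)) ker t) <= of_nat (ext_binomial (Fin (- t) + rbar m - 1) m) * ?P" for t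
    using local_cohomology_bound[OF ls(1) gsub_ker ker_fr freg, of "rbar m" "rbar i" "hilbert_poly M"]
      reg[of m] reg[of i] i im hilbert_poly_chi unfolding ls(2) ls_def by auto
  let ?V = "%\<mu>. component_space (Ext (n - i) M ring_gmodule) \<mu>"
  have main: "vectorspace.fin_dim class_ring (?V \<mu>) \<and>
      of_nat (vectorspace.dim class_ring (?V \<mu>)) <= of_nat (?B \<mu>) * ?P \<and>
      (vectorspace.dim class_ring (?V \<mu>) = 0 --> component (Ext (n - i) M ring_gmodule) \<mu> = {\<zero>\<^bsub>Ext (n - i) M ring_gmodule\<^esub>})" for \<mu>
  proof -
    have E: "vectorspace.fin_dim class_ring (?V \<mu>) \<and>
        int (vectorspace.dim class_ring (?V \<mu>)) <= hI (int CARD('n) - int (n - i)) (fr (a 0)) ker (- \<mu> - int CARD('n)) \<and>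
        (vectorspace.dim class_ring (?V \<mu>) = 0 --> component (Ext (n - i) M ring_gmodule) \<mu> = {\<zero>\<^bsub>Ext (n - i) M ring_gmodule\<^esub>})"
      unfolding Ext by (rule dim_Ext_le) (simp add: assms(1))
    have "int CARD('n) - int (n - i) = int (Suc m)" using iN assms(1) im by simp
    \<comment> \<open>Duality evaluates H^i in degree t = -\<mu> - n, which turns the upper argument
      r - t - 1 into \<mu> + r + n - 1.\<close>
    moreover have "Fin (- (- \<mu> - int CARD('n))) + rbar m - 1 = Fin \<mu> + rbar m + Fin (int n) - 1"
      using assms(1) by (cases "rbar m") (simp_all add: one_extended_def)
    ultimately have le: "of_int (hI (int CARD('n) - int (n - i)) (fr (a 0)) ker (- \<mu> - int CARD('n))) <= of_nat (?B \<mu>) * ?P"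
      using lcb[of "- \<mu> - int CARD('n)"] by simp
    have "of_nat (vectorspace.dim class_ring (?V \<mu>)) <= (of_int (hI (int CARD('n) - int (n - i)) (fr (a 0)) ker (- \<mu> - int CARD('n))) :: rat)"
      using E by (metis of_int_le_iff of_int_of_nat_eq)
    then show ?thesis using E le by (meson order_trans)
  qed
  \<comment> \<open>Where the binomial coefficient is zero, the dimension bound forces Ext to
    vanish; the statement on the initial degree is derived from this.\<close>
  have zero: "component (Ext (n - i) M ring_gmodule) \<mu> = {\<zero>\<^bsub>Ext (n - i) M ring_gmodule\<^esub>}" if "?B \<mu> = 0" for \<mu>
  proof -
    have "of_nat (vectorspace.dim class_ring (?V \<mu>)) <= (0 :: rat)" using main[of \<mu>] that by simp
    then show ?thesis using main[of \<mu>] by simp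
  qed
  have indeg: "- rbar m - Fin (int n) + 1 <= indeg (Ext (n - i) M ring_gmodule)"
  proof (cases "rbar m")
    case (Fin r)
    \<comment> \<open>Below this degree the upper argument \<mu> + r + n - 1 is negative, hence
      smaller than the lower one.\<close>
    have nz: "- r - int n + 1 <= \<mu>" if "component (Ext (n - i) M ring_gmodule) \<mu> ~= {\<zero>\<^bsub>Ext (n - i) M ring_gmodule\<^esub>}" for \<mu>
    proof (rule ccontr)
      assume "\<not> ?thesis"
      then have "?B \<mu> = 0" unfolding Fin ext_binomial_def by (simp add: one_extended_def)
      then show False using zero that by blast
    qed
    let ?A = "{t. component (Ext (n - i) M ring_gmodule) t ~= {\<zero>\<^bsub>Ext (n - i) M ring_gmodule\<^esub>}}"
    have "bdd_below ?A" by (rule bdd_belowI[of _ "- r - int n + 1"]) (use nz in blast)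
    moreover have "?A ~= {} ==> - r - int n + 1 <= Inf ?A" by (rule cInf_greatest) (use nz in auto)
    ultimately show ?thesis unfolding indeg_def ext_Inf_def Fin by (auto simp: one_extended_def)
  next
    case Minf
    then have "?B \<mu> = 0" for \<mu> by (simp add: ext_binomial_def one_extended_def)
    then have "{t. component (Ext (n - i) M ring_gmodule) t ~= {\<zero>\<^bsub>Ext (n - i) M ring_gmodule\<^esub>}} = {}" using zero by blast
    then show ?thesis unfolding indeg_def ext_Inf_def by simp
  next
    case Pinf
    then show ?thesis using reg[of m] i im by simp
  qed
  show "indeg (Ext (n - i) M ring_gmodule) >= - rbar (i - 1) - Fin (int n) + 1 \<and>
      (\<forall>\<mu>. vectorspace.fin_dim class_ring (component_space (Ext (n - i) M ring_gmodule) \<mu>) \<and>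
        of_nat (vectorspace.dim class_ring (component_space (Ext (n - i) M ring_gmodule) \<mu>)) \<le>
          of_nat (ext_binomial (Fin \<mu> + rbar (i - 1) + Fin (int n) - 1) (i - 1)) *
          ext_poly ((Delta ^^ (i - 1)) (hilbert_poly M)) (rbar i - 1))" using indeg main unfolding m_def by blast
qed

end
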